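(* Let $w\in BV(\Omega)$ with $w_\ell\le w\le w_u$ a.e. in $\Omega$. Let $u\in H_0^1(\Omega)$ solve $$\int_\Omega A\nabla u\cdot\nabla v+\int_\Omega uwv=\int_\Omega fv\quad\text{for all } v\in H^1_0(\Omega)$$ and, for each $h$, let $u_h\in H_0^1(\Omega)$ solve $$\int_\Omega A\nabla u_h\cdot\nabla v+\int_\Omega (P_hu_h)(P_hw)v=\int_\Omega fv\quad\text{for all } v\in H^1_0(\Omega)$$ for the same $w$. Then there exist positive constants $C_{3/2}^a(w)=C_{3/2}^a(n,w_\ell,w_u,f,w,\Omega)$ and $C_{3/2}^b=C_{3/2}^b(n,w_\ell,w_u,f,\Omega)$, independent of $h$ (the operator $A$ and the family of partitions being fixed data), such that for all $h$ $$\|u-u_h\|_{L^2(\Omega)}\le C_{3/2}^a(w)\,d_h^{3/2}+C_{3/2}^b\,d_h^2$$ and $$\|\nabla(u-u_h)\|_{L^2(\Omega,\mathbb{R}^n)}^2\le\beta^{-1}\max\{-w_\ell,w_u\}\,(c_1^{-1}+c_3^{-1})\,\|f\|_{L^2(\Omega)}\bigl(C_{3/2}^a(w)\,d_h^{3/2}+C_{3/2}^b\,d_h^2\bigr).$$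
   Context: $\Omega\subset\mathbb{R}^n$, $n\in\{1,2,3\}$, is a bounded domain with polygonal boundary; functions are real-valued; $f\in L^2(\Omega)$ is fixed. $A=(a_{ij})_{1\le i,j\le n}$ with $a_{ij}\in L^\infty(\Omega)$ and, for some $\beta>0$, $\beta|v|^2\le A(x)v\cdot v$ for all $v\in\mathbb{R}^n$ and a.e. $x\in\Omega$. $c_p>0$ is a Poincaré constant: $\|v\|_{L^2(\Omega)}\le c_p\|\nabla v\|_{L^2(\Omega,\mathbb{R}^n)}$ for $v\in H_0^1(\Omega)$. The real constants $w_\ell,w_u$ satisfy $-\frac{\beta}{c_p^2}<w_\ell<w_u<\frac{\beta}{c_p^2}$, so that both equations have unique solutions. $\{\mathcal{Q}_h\}_h$ is a family of partitions $\mathcal{Q}_h=\{Q_h^1,\dots,Q_h^{N_h}\}$ of $\Omega$ with mesh sizes $h$, satisfying a bounded eccentricity condition: there is $C>0$ such that each cell $Q_h^i$ is contained in a closed ball $B_h^i$ with $\operatorname{meas}B_h^i\le C\operatorname{meas}Q_h^i$. $d_h$ denotes the maximal diameter of the cells of $\mathcal{Q}_h$. $P_h$ is the local averaging operator $P_hg=\sum_{i=1}^{N_h}1_{Q_h^i}\frac{1}{\operatorname{meas}Q_h^i}\int_{Q_h^i}g$ for $g\in L^1(\Omega)$. The constants are $c_1^{-1}:=\dfrac{c_p}{\beta+\min\{c_p^2w_\ell,0\}}$ and $c_3^{-1}:=\dfrac{c_p}{\beta-\max\{-w_\ell,w_u\}c_p^2}$. *)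

theory Defs
  imports "HOL-Analysis.Analysis" "HOL-Library.Disjoint_Sets"
begin

text \<open>
  Elements of function spaces over \<open>\<Omega>\<close> are represented by functions on the whole of
  \<open>real ^ 'n\<close>; only their values almost everywhere on \<open>\<Omega>\<close> matter. All integrals are with
  respect to (the restriction of) Lebesgue measure.
\<close>

subsection \<open>Classical derivatives and test functions\<close>

definition partial_deriv :: "'n::finite \<Rightarrow> (real ^ 'n \<Rightarrow> real) \<Rightarrow> real ^ 'n \<Rightarrow> real" where
  "partial_deriv i \<phi> x = frechet_derivative \<phi> (at x) (axis i 1)"

primrec C_k :: "nat \<Rightarrow> (real ^ 'n::finite \<Rightarrow> real) \<Rightarrow> bool" where
  "C_k 0 = (\<lambda>\<phi>. continuous_on UNIV \<phi>)"
| "C_k (Suc k) = (\<lambda>\<phi>. (\<forall>x. \<phi> differentiable (at x)) \<and> (\<forall>i. C_k k (partial_deriv i \<phi>)))"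

definition compactly_supported_in :: "(real ^ 'n::finite) set \<Rightarrow> (real ^ 'n \<Rightarrow> real) \<Rightarrow> bool" where
  "compactly_supported_in \<Omega> \<phi> \<longleftrightarrow>
     compact (closure {x. \<phi> x \<noteq> 0}) \<and> closure {x. \<phi> x \<noteq> 0} \<subseteq> \<Omega>"

definition test_function :: "(real ^ 'n::finite) set \<Rightarrow> (real ^ 'n \<Rightarrow> real) \<Rightarrow> bool" where
  "test_function \<Omega> \<phi> \<longleftrightarrow> (\<forall>k. C_k k \<phi>) \<and> compactly_supported_in \<Omega> \<phi>"

subsection \<open>Lebesgue and Sobolev spaces\<close>

definition L2 :: "(real ^ 'n::finite) set \<Rightarrow> (real ^ 'n \<Rightarrow> 'b::euclidean_space) set" where
  "L2 \<Omega> = {g. g \<in> borel_measurable (lebesgue_on \<Omega>) \<and>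
              integrable (lebesgue_on \<Omega>) (\<lambda>x. (norm (g x))\<^sup>2)}"

definition L2_norm :: "(real ^ 'n::finite) set \<Rightarrow> (real ^ 'n \<Rightarrow> 'b::euclidean_space) \<Rightarrow> real" where
  "L2_norm \<Omega> g = sqrt (LINT x|lebesgue_on \<Omega>. (norm (g x))\<^sup>2)"

definition L_infinity :: "(real ^ 'n::finite) set \<Rightarrow> (real ^ 'n \<Rightarrow> real) set" where
  "L_infinity \<Omega> = {g. g \<in> borel_measurable (lebesgue_on \<Omega>) \<and>
                      (\<exists>M. AE x in lebesgue_on \<Omega>. \<bar>g x\<bar> \<le> M)}"

definition locally_integrable_on ::
    "(real ^ 'n::finite \<Rightarrow> 'b::euclidean_space) \<Rightarrow> (real ^ 'n) set \<Rightarrow> bool"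
    (infix "locally'_integrable'_on" 50) where
  "g locally_integrable_on \<Omega> \<longleftrightarrow> (\<forall>K. compact K \<and> K \<subseteq> \<Omega> \<longrightarrow> set_integrable lebesgue K g)"

definition is_weak_gradient ::
    "(real ^ 'n::finite) set \<Rightarrow> (real ^ 'n \<Rightarrow> real) \<Rightarrow> (real ^ 'n \<Rightarrow> real ^ 'n) \<Rightarrow> bool" where
  "is_weak_gradient \<Omega> u g \<longleftrightarrow>
     u locally_integrable_on \<Omega> \<and> g locally_integrable_on \<Omega> \<and>
     (\<forall>\<phi>. test_function \<Omega> \<phi> \<longrightarrow>
        (\<forall>i. (LINT x|lebesgue_on \<Omega>. u x * partial_deriv i \<phi> x) =
             - (LINT x|lebesgue_on \<Omega>. g x $ i * \<phi> x)))"

text \<open>The weak gradient is unique up to a null set, so the choice below is immaterial in integrals.\<close>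

definition weak_grad ::
    "(real ^ 'n::finite) set \<Rightarrow> (real ^ 'n \<Rightarrow> real) \<Rightarrow> real ^ 'n \<Rightarrow> real ^ 'n" where
  "weak_grad \<Omega> u = (SOME g. is_weak_gradient \<Omega> u g)"

definition H1 :: "(real ^ 'n::finite) set \<Rightarrow> (real ^ 'n \<Rightarrow> real) set" where
  "H1 \<Omega> = {u \<in> L2 \<Omega>. \<exists>g \<in> L2 \<Omega>. is_weak_gradient \<Omega> u g}"

definition H1_norm :: "(real ^ 'n::finite) set \<Rightarrow> (real ^ 'n \<Rightarrow> real) \<Rightarrow> real" where
  "H1_norm \<Omega> u = sqrt ((L2_norm \<Omega> u)\<^sup>2 + (L2_norm \<Omega> (weak_grad \<Omega> u))\<^sup>2)"

definition H1_0 :: "(real ^ 'n::finite) set \<Rightarrow> (real ^ 'n \<Rightarrow> real) set" where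
  "H1_0 \<Omega> = {u \<in> H1 \<Omega>. \<exists>\<phi>::nat \<Rightarrow> real ^ 'n \<Rightarrow> real.
     (\<forall>k. test_function \<Omega> (\<phi> k)) \<and> (\<lambda>k. H1_norm \<Omega> (\<lambda>x. u x - \<phi> k x)) \<longlonglongrightarrow> 0}"

subsection \<open>Functions of bounded variation\<close>

text \<open>The set whose supremum is the total variation of \<open>w\<close> in \<open>\<Omega>\<close>;
  the test fields range over \<open>C\<^sub>c\<^sup>1(\<Omega>; \<real>\<^sup>n)\<close>.\<close>

definition variation_values :: "(real ^ 'n::finite) set \<Rightarrow> (real ^ 'n \<Rightarrow> real) \<Rightarrow> real set" where
  "variation_values \<Omega> w =
     {LINT x|lebesgue_on \<Omega>. w x * (\<Sum>i\<in>UNIV. partial_deriv i (\<lambda>y. \<Phi> y $ i) x) |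
        \<Phi> :: real ^ 'n \<Rightarrow> real ^ 'n.
        (\<forall>i. C_k 1 (\<lambda>y. \<Phi> y $ i) \<and> compactly_supported_in \<Omega> (\<lambda>y. \<Phi> y $ i)) \<and>
        (\<forall>x. norm (\<Phi> x) \<le> 1)}"

definition BV :: "(real ^ 'n::finite) set \<Rightarrow> (real ^ 'n \<Rightarrow> real) set" where
  "BV \<Omega> = {w. integrable (lebesgue_on \<Omega>) w \<and> bdd_above (variation_values \<Omega> w)}"

subsection \<open>The domain, partitions and local averages\<close>

text \<open>The boundary is a finite union of flat pieces of dimension \<open>n - 1\<close>: end points for
  \<open>n = 1\<close>, line segments for \<open>n = 2\<close>, convex polygons for \<open>n = 3\<close>.\<close>

definition polygonal_boundary :: "(real ^ 'n::finite) set \<Rightarrow> bool" where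
  "polygonal_boundary \<Omega> \<longleftrightarrow>
     (\<exists>\<F>. finite \<F> \<and> (\<forall>P\<in>\<F>. polytope P \<and> aff_dim P = int CARD('n) - 1) \<and>
          frontier \<Omega> = \<Union>\<F>)"

definition bounded_polygonal_domain :: "(real ^ 'n::finite) set \<Rightarrow> bool" where
  "bounded_polygonal_domain \<Omega> \<longleftrightarrow>
     \<Omega> \<noteq> {} \<and> open \<Omega> \<and> connected \<Omega> \<and> bounded \<Omega> \<and> polygonal_boundary \<Omega>"

definition mesh_partition :: "(real ^ 'n::finite) set \<Rightarrow> (real ^ 'n) set set \<Rightarrow> bool" where
  "mesh_partition \<Omega> \<Q> \<longleftrightarrow> finite \<Q> \<and> partition_on \<Omega> \<Q> \<and> (\<forall>Q\<in>\<Q>. Q \<in> sets lebesgue)"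

text \<open>The balls are nondegenerate, so that every cell has positive measure.\<close>

definition bounded_eccentricity :: "real set \<Rightarrow> (real \<Rightarrow> (real ^ 'n::finite) set set) \<Rightarrow> bool" where
  "bounded_eccentricity H \<Q> \<longleftrightarrow>
     (\<exists>C>0. \<forall>h\<in>H. \<forall>Q\<in>\<Q> h. \<exists>x r. r > 0 \<and> Q \<subseteq> cball x r \<and>
        measure lebesgue (cball x r) \<le> C * measure lebesgue Q)"

definition max_diameter :: "(real ^ 'n::finite) set set \<Rightarrow> real" where
  "max_diameter \<Q> = Max (diameter ` \<Q>)"

definition local_avg ::
    "(real ^ 'n::finite) set set \<Rightarrow> (real ^ 'n \<Rightarrow> real) \<Rightarrow> real ^ 'n \<Rightarrow> real" where
  "local_avg \<Q> g x =
     (\<Sum>Q\<in>\<Q>. indicator Q x * (1 / measure lebesgue Q * (LINT y|lebesgue_on Q. g y)))"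

subsection \<open>Coefficients and equations\<close>

definition elliptic_coefficients ::
    "(real ^ 'n::finite) set \<Rightarrow> (real ^ 'n \<Rightarrow> real ^ 'n ^ 'n) \<Rightarrow> real \<Rightarrow> bool" where
  "elliptic_coefficients \<Omega> A \<beta> \<longleftrightarrow>
     (\<forall>i j. (\<lambda>x. A x $ i $ j) \<in> L_infinity \<Omega>) \<and>
     (AE x in lebesgue_on \<Omega>. \<forall>v. \<beta> * (norm v)\<^sup>2 \<le> (A x *v v) \<bullet> v)"

definition poincare_constant :: "(real ^ 'n::finite) set \<Rightarrow> real \<Rightarrow> bool" where
  "poincare_constant \<Omega> c \<longleftrightarrow> (\<forall>v\<in>H1_0 \<Omega>. L2_norm \<Omega> v \<le> c * L2_norm \<Omega> (weak_grad \<Omega> v))"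

definition solves_pde ::
    "(real ^ 'n::finite) set \<Rightarrow> (real ^ 'n \<Rightarrow> real ^ 'n ^ 'n) \<Rightarrow> (real ^ 'n \<Rightarrow> real) \<Rightarrow>
     (real ^ 'n \<Rightarrow> real) \<Rightarrow> (real ^ 'n \<Rightarrow> real) \<Rightarrow> bool" where
  "solves_pde \<Omega> A f w u \<longleftrightarrow> u \<in> H1_0 \<Omega> \<and>
     (\<forall>v\<in>H1_0 \<Omega>.
        (LINT x|lebesgue_on \<Omega>. (A x *v weak_grad \<Omega> u x) \<bullet> weak_grad \<Omega> v x) +
        (LINT x|lebesgue_on \<Omega>. u x * w x * v x) =
        (LINT x|lebesgue_on \<Omega>. f x * v x))"

definition solves_averaged_pde ::
    "(real ^ 'n::finite) set \<Rightarrow> (real ^ 'n \<Rightarrow> real ^ 'n ^ 'n) \<Rightarrow> (real ^ 'n \<Rightarrow> real) \<Rightarrow>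
     (real ^ 'n) set set \<Rightarrow> (real ^ 'n \<Rightarrow> real) \<Rightarrow> (real ^ 'n \<Rightarrow> real) \<Rightarrow> bool" where
  "solves_averaged_pde \<Omega> A f \<Q> w u \<longleftrightarrow> u \<in> H1_0 \<Omega> \<and>
     (\<forall>v\<in>H1_0 \<Omega>.
        (LINT x|lebesgue_on \<Omega>. (A x *v weak_grad \<Omega> u x) \<bullet> weak_grad \<Omega> v x) +
        (LINT x|lebesgue_on \<Omega>. local_avg \<Q> u x * local_avg \<Q> w x * v x) =
        (LINT x|lebesgue_on \<Omega>. f x * v x))"

end

theory Submission
  imports Defs
begin

text \<open>
  The estimate is an energy argument for the error \<open>e = u - u\<^sub>h\<close>; no duality is needed. With \<open>P\<close>
  the averaging operator, testing both equations with \<open>e\<close> and using that \<open>P\<close> is an orthogonal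
  projection gives
  \<open>\<alpha> \<parallel>\<nabla>e\<parallel>\<^sup>2 \<le> \<bar>\<integral>(w - P w) (u e - P (u e))\<bar> + \<bar>\<integral>(P w) (u - P u) (e - P e)\<bar>\<close> with
  \<open>\<alpha> = \<beta> + min (c\<^sub>p\<^sup>2 w\<^sub>l) 0\<close>. The second term is at most a multiple of \<open>d\<^sup>2 \<parallel>\<nabla>u\<parallel> \<parallel>\<nabla>e\<parallel>\<close> and the
  first one at most a multiple of \<open>d powr (3 / 2) \<parallel>\<nabla>e\<parallel>\<close>: since \<open>w\<close> is bounded and of bounded variation,
  \<open>\<parallel>w - P w\<parallel>\<^sup>2\<close> is of order \<open>d\<close>, and \<open>u e\<close> has a gradient in \<open>L2\<close>. The latter holds because \<open>u\<close> is
  bounded (a truncation argument based on the Faber-Krahn inequality) and \<open>\<parallel>e \<nabla>u\<parallel> \<le> C \<parallel>\<nabla>e\<parallel>\<close>, which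
  follows by testing the equation with \<open>u e\<^sup>2\<close>; this is where \<open>n \<le> 3\<close> enters. As the cells are
  not convex in general, the averages on a cell are compared with averages over balls, the functions
  being extended by zero; for \<open>w\<close> this creates a jump across the polygonal boundary, which has finite area.
\<close>

subsection \<open>Functions of class C1\<close>

text \<open>The exponent \<open>3 / 2\<close> is \<open>1 / 2 + 1\<close>. The factor
  \<open>w - P w\<close> has only half an order in \<open>L2\<close>, as a jump of \<open>w\<close>
  spoils a strip of width \<open>d\<close>; a full order has to come from the other factor, the
  product \<open>u e\<close>. There lies the obstacle: \<open>A\<close> is merely measurable and
  bounded, so neither second derivatives of \<open>u\<close> nor higher integrability of
  \<open>\<nabla>u\<close> are at hand. Only the equation itself controls
  \<open>e \<nabla>u\<close>. Inequalities of Sobolev type are all drawn from one device, the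
  average of the norm of the gradient along rays from a point into a ball
  (\<open>ray_average\<close>). It is a mixture of translates of that norm, so Fubini, Jensen and
  translation invariance bound it without any embedding theorem. At one scale it yields Nash's
  inequality and the error of local averages, over all scales the bound for the integral of
  \<open>norm (g x) * (\<phi> x)\<^sup>2\<close>. The constants are chosen before the solutions,
  hence the bounds hold uniformly for all weak solutions with data of norm at most \<open>N\<close>.
  The gradient error itself comes out of order \<open>d powr (3 / 2)\<close>, so its square is of
  higher order than demanded.\<close>

definition grad :: "(real ^ 'n::finite \<Rightarrow> real) \<Rightarrow> real ^ 'n \<Rightarrow> real ^ 'n" where
  "grad \<phi> x = (\<chi> i. partial_deriv i \<phi> x)"

lemma has_derivative_grad:
  fixes \<phi> :: "real ^ 'n::finite \<Rightarrow> real"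
  assumes "\<phi> differentiable (at x)"
  shows "(\<phi> has_derivative (\<lambda>h. grad \<phi> x \<bullet> h)) (at x)"
proof -
  let ?D = "frechet_derivative \<phi> (at x)"
  have D: "(\<phi> has_derivative ?D) (at x)"
    using assms frechet_derivative_works by blast
  then have lin: "linear ?D" by (rule has_derivative_linear)
  have "?D h = grad \<phi> x \<bullet> h" for h
  proof -
    have "?D h = ?D (\<Sum>i\<in>UNIV. h $ i *\<^sub>R axis i 1)"
      by (simp add: basis_expansion scalar_mult_eq_scaleR[symmetric])
    also have "\<dots> = (\<Sum>i\<in>UNIV. h $ i *\<^sub>R ?D (axis i 1))"
      by (simp add: linear_sum[OF lin] linear_cmul[OF lin])
    finally show ?thesis
      by (simp add: grad_def partial_deriv_def inner_vec_def mult.commute)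
  qed
  then have "?D = (\<lambda>h. grad \<phi> x \<bullet> h)" by auto
  then show ?thesis using D by simp
qed

lemma partial_deriv_eq:
  assumes "(\<phi> has_derivative D) (at x)"
  shows "partial_deriv i \<phi> x = D (axis i 1)"
  using frechet_derivative_at[OF assms] by (simp add: partial_deriv_def)

lemma grad_eq:
  assumes "(\<phi> has_derivative (\<lambda>h. G \<bullet> h)) (at x)"
  shows "grad \<phi> x = G"
  by (simp add: vec_eq_iff grad_def partial_deriv_eq[OF assms] inner_axis)

lemma C_k_1_iff:
  "C_k 1 \<phi> \<longleftrightarrow> (\<forall>x. \<phi> differentiable (at x)) \<and> continuous_on UNIV (grad \<phi>)"
proof -
  have "continuous_on UNIV (grad \<phi>) \<longleftrightarrow> (\<forall>i. continuous_on UNIV (partial_deriv i \<phi>))"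
  proof
    assume "continuous_on UNIV (grad \<phi>)"
    then have "continuous_on UNIV (\<lambda>x. grad \<phi> x $ i)" for i by (intro continuous_intros)
    then show "\<forall>i. continuous_on UNIV (partial_deriv i \<phi>)" by (simp add: grad_def eta_contract_eq)
  next
    assume "\<forall>i. continuous_on UNIV (partial_deriv i \<phi>)"
    then have "continuous_on UNIV (\<lambda>x. \<chi> i. partial_deriv i \<phi> x)"
      by (intro continuous_on_vec_lambda) auto
    then show "continuous_on UNIV (grad \<phi>)" by (simp add: grad_def[abs_def])
  qed
  then show ?thesis by simp
qed

lemma C1D:
  assumes "C_k 1 \<phi>"
  shows "(\<phi> has_derivative (\<lambda>h. grad \<phi> x \<bullet> h)) (at x)" "continuous_on UNIV (grad \<phi>)"
    "continuous_on UNIV \<phi>"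
  using assms has_derivative_grad unfolding C_k_1_iff
  by (auto intro!: differentiable_imp_continuous_on simp: differentiable_on_def)

lemma C1I:
  assumes D: "\<And>x. (\<phi> has_derivative (\<lambda>h. G x \<bullet> h)) (at x)" and G: "continuous_on UNIV G"
  shows "C_k 1 \<phi>" "grad \<phi> = G"
proof -
  show *: "grad \<phi> = G" using grad_eq[OF D] by auto
  show "C_k 1 \<phi>" unfolding C_k_1_iff * using D G by (auto simp: differentiable_def)
qed

lemma grad_mult:
  assumes "C_k 1 f" "C_k 1 g"
  shows "C_k 1 (\<lambda>x. f x * g x)" "grad (\<lambda>x. f x * g x) = (\<lambda>x. f x *\<^sub>R grad g x + g x *\<^sub>R grad f x)"
proof -
  have D: "((\<lambda>x. f x * g x) has_derivative (\<lambda>h. (f x *\<^sub>R grad g x + g x *\<^sub>R grad f x) \<bullet> h)) (at x)" for x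
    by (rule has_derivative_eq_rhs[OF has_derivative_mult[OF C1D(1)[OF assms(1)] C1D(1)[OF assms(2)]]])
       (auto simp: inner_simps)
  have c: "continuous_on UNIV (\<lambda>x. f x *\<^sub>R grad g x + g x *\<^sub>R grad f x)"
    using assms[THEN C1D(2)] assms[THEN C1D(3)] by (intro continuous_intros)
  show "C_k 1 (\<lambda>x. f x * g x)" "grad (\<lambda>x. f x * g x) = (\<lambda>x. f x *\<^sub>R grad g x + g x *\<^sub>R grad f x)"
    using C1I[OF D c] by auto
qed

subsection \<open>Smooth functions\<close>

lemma C_k_Suc_imp: "C_k (Suc k) \<phi> \<Longrightarrow> C_k k \<phi>"
proof (induction k arbitrary: \<phi>)
  case 0
  then show ?case using C1D(3) by fastforce
qed auto

lemma C_k_const: "C_k k (\<lambda>x. c)"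
proof (induction k arbitrary: c)
  case (Suc k)
  have "partial_deriv i (\<lambda>x. c) = (\<lambda>x. 0)" for i :: 'a
    by (rule ext, subst partial_deriv_eq[where D="\<lambda>_. 0"]) auto
  then show ?case using Suc by simp
qed simp

lemma C_k_coord: "C_k k (\<lambda>x. x $ j)"
proof (cases k)
  case (Suc m)
  have D: "((\<lambda>x. x $ j) has_derivative (\<lambda>x. x $ j)) (at x)" for x :: "real ^ 'a"
    by (intro bounded_linear_imp_has_derivative bounded_linear_vec_nth)
  then have "partial_deriv i (\<lambda>x. x $ j) = (\<lambda>x. axis i 1 $ j)" for i
    by (intro ext partial_deriv_eq) auto
  moreover have "(\<lambda>x::real^'a. x $ j) differentiable at x" for x using D differentiable_def by blast
  ultimately show ?thesis using Suc by (simp add: C_k_const)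
qed (auto intro: continuous_intros)

lemma C_k_add: "C_k k f \<Longrightarrow> C_k k g \<Longrightarrow> C_k k (\<lambda>x. f x + g x)"
proof (induction k arbitrary: f g)
  case (Suc k)
  have "partial_deriv i (\<lambda>x. f x + g x) = (\<lambda>x. partial_deriv i f x + partial_deriv i g x)" for i
  proof
    fix x
    have "(f has_derivative (\<lambda>h. grad f x \<bullet> h)) (at x)" "(g has_derivative (\<lambda>h. grad g x \<bullet> h)) (at x)"
      using Suc.prems by (auto intro: has_derivative_grad)
    from partial_deriv_eq[OF has_derivative_add[OF this]]
    show "partial_deriv i (\<lambda>x. f x + g x) x = partial_deriv i f x + partial_deriv i g x"
      by (simp add: inner_axis grad_def)
  qed
  with Suc show ?case by (auto intro: derivative_intros)
qed (auto intro: continuous_intros)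

lemma C_k_mult: "C_k k f \<Longrightarrow> C_k k g \<Longrightarrow> C_k k (\<lambda>x. f x * g x)"
proof (induction k arbitrary: f g)
  case (Suc k)
  have "partial_deriv i (\<lambda>x. f x * g x) = (\<lambda>x. f x * partial_deriv i g x + partial_deriv i f x * g x)" for i
  proof
    fix x
    have "(f has_derivative (\<lambda>h. grad f x \<bullet> h)) (at x)" "(g has_derivative (\<lambda>h. grad g x \<bullet> h)) (at x)"
      using Suc.prems by (auto intro: has_derivative_grad)
    from partial_deriv_eq[OF has_derivative_mult[OF this]]
    show "partial_deriv i (\<lambda>x. f x * g x) x = f x * partial_deriv i g x + partial_deriv i f x * g x"
      by (simp add: inner_axis grad_def)
  qed
  moreover have "C_k k f" "C_k k g" using Suc.prems C_k_Suc_imp by blast+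
  ultimately show ?case using Suc by (simp add: C_k_add)
qed (auto intro: continuous_intros)

lemma C_k_prod: "finite I \<Longrightarrow> (\<And>i. i \<in> I \<Longrightarrow> C_k k (f i)) \<Longrightarrow> C_k k (\<lambda>x. \<Prod>i\<in>I. f i x)"
  by (induction I rule: finite_induct) (auto intro: C_k_mult C_k_const)

text \<open>The whole sequence of derivatives is the witness, so that passing to the derivative is a
  shift of the sequence.\<close>

definition smooth_real :: "(real \<Rightarrow> real) \<Rightarrow> bool" where
  "smooth_real F \<longleftrightarrow> (\<exists>D. D 0 = F \<and> (\<forall>m t. (D m has_real_derivative D (Suc m) t) (at t)))"

lemma smooth_real_deriv:
  assumes "smooth_real F"
  obtains F' where "\<And>t. (F has_real_derivative F' t) (at t)" "smooth_real F'"
proof -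
  from assms obtain D where D: "D 0 = F" "\<And>m t. (D m has_real_derivative D (Suc m) t) (at t)"
    unfolding smooth_real_def by auto
  show ?thesis
  proof (rule that)
    show "(F has_real_derivative D 1 t) (at t)" for t using D(2)[of 0 t] D(1) by simp
    show "smooth_real (D 1)" unfolding smooth_real_def
      by (rule exI[of _ "\<lambda>m. D (Suc m)"]) (use D(2) in auto)
  qed
qed

lemma smooth_real_affine:
  assumes "smooth_real F"
  shows "smooth_real (\<lambda>t. a * F (b * t + c))"
proof -
  from assms obtain D where D: "D 0 = F" "\<And>m t. (D m has_real_derivative D (Suc m) t) (at t)"
    unfolding smooth_real_def by auto
  show ?thesis unfolding smooth_real_def
  proof (intro exI[of _ "\<lambda>m t. a * b ^ m * D m (b * t + c)"] conjI allI)
    fix m t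
    show "((\<lambda>t. a * b ^ m * D m (b * t + c)) has_real_derivative a * b ^ Suc m * D (Suc m) (b * t + c)) (at t)"
      by (auto intro!: derivative_eq_intros DERIV_chain2[OF D(2)])
  qed (use D in auto)
qed

lemma grad_compose:
  assumes "\<phi> differentiable (at x)" and "(F has_real_derivative F') (at (\<phi> x))"
  shows "((\<lambda>x. F (\<phi> x)) has_derivative (\<lambda>h. (F' *\<^sub>R grad \<phi> x) \<bullet> h)) (at x)"
  using has_derivative_compose[OF has_derivative_grad[OF assms(1)] assms(2)[unfolded has_field_derivative_def]]
  by (simp add: mult.commute)

text \<open>\<open>F\<close> varies in the induction: a partial derivative of the composition is the
  composition with \<open>F'\<close>, needed to one order less, times a partial derivative of
  \<open>\<phi>\<close>.\<close>

lemma C_k_compose: "C_k k \<phi> \<Longrightarrow> smooth_real F \<Longrightarrow> C_k k (\<lambda>x. F (\<phi> x))"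
proof (induction k arbitrary: \<phi> F)
  case 0
  obtain F' where "\<And>t. (F has_real_derivative F' t) (at t)" using 0 smooth_real_deriv by blast
  then have "continuous_on UNIV F" by (meson DERIV_isCont continuous_at_imp_continuous_on)
  then show ?case using 0 by (auto intro: continuous_on_compose2)
next
  case (Suc k)
  obtain F' where F': "\<And>t. (F has_real_derivative F' t) (at t)" "smooth_real F'" using Suc.prems smooth_real_deriv by blast
  have D: "((\<lambda>x. F (\<phi> x)) has_derivative (\<lambda>h. (F' (\<phi> x) *\<^sub>R grad \<phi> x) \<bullet> h)) (at x)" for x
    using Suc.prems by (intro grad_compose F') auto
  have "partial_deriv i (\<lambda>x. F (\<phi> x)) = (\<lambda>x. F' (\<phi> x) * partial_deriv i \<phi> x)" for i
    by (auto simp: partial_deriv_eq[OF D] inner_axis grad_def)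
  moreover have "C_k k (\<lambda>x. F' (\<phi> x))" using Suc.IH[OF C_k_Suc_imp[OF Suc.prems(1)] F'(2)] .
  moreover have "(\<lambda>x. F (\<phi> x)) differentiable at x" for x using D differentiable_def by blast
  ultimately show ?case using Suc.prems by (simp add: C_k_mult)
qed

text \<open>The classical function that is flat at \<open>0\<close>. It serves in three ways: it
  produces test functions on boxes, it saturates them towards indicator functions, and, being
  bounded with slope in \<open>[0, 1]\<close>, it truncates weak solutions smoothly.\<close>

definition bump :: "real \<Rightarrow> real" where
  "bump t = (if t > 0 then exp (- 1 / t) else 0)"

lemma poly_times_exp_tendsto_0: "((\<lambda>s. poly p s * exp (- s)) \<longlongrightarrow> (0::real)) at_top"
proof -
  have "((\<lambda>s. \<Sum>i\<le>degree p. coeff p i * (s ^ i / exp s)) \<longlongrightarrow> (\<Sum>i\<le>degree p. coeff p i * 0)) at_top"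
    by (intro tendsto_intros tendsto_power_div_exp_0)
  then show ?thesis
    by (simp add: poly_altdef sum_distrib_right exp_minus field_simps sum_divide_distrib)
qed

lemma smooth_real_bump: "smooth_real bump"
proof -
  \<comment> \<open>Differentiating \<open>q (1 / t) * exp (- 1 / t)\<close> gives
    \<open>(1 / t)\<^sup>2 * (q - q') (1 / t) * exp (- 1 / t)\<close>; this is the recursion for the
    polynomials \<open>P m\<close> in \<open>1 / t\<close>.\<close>
  define P where "P m = ((\<lambda>p::real poly. [:0,0,1:] * (p - pderiv p)) ^^ m) 1" for m
  define D where "D m t = (if t > 0 then poly (P m) (1/t) * exp (- 1 / t) else 0)" for m and t::real
  have PS: "P (Suc m) = [:0,0,1:] * (P m - pderiv (P m))" for m by (simp add: P_def)
  have "(D m has_real_derivative D (Suc m) t) (at t)" for m t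
  proof -
    consider "t > 0" | "t < 0" | "t = 0" by linarith
    then show ?thesis
    proof cases
      case 1
      have "((\<lambda>t. poly (P m) (1/t) * exp (- 1 / t)) has_real_derivative D (Suc m) t) (at t)"
        using 1 unfolding D_def PS
        by (auto intro!: derivative_eq_intros DERIV_chain2[OF poly_DERIV] simp: field_simps power2_eq_square)
      then show ?thesis
        by (rule DERIV_cong_ev[THEN iffD1, rotated -1])
           (auto simp: D_def intro: eventually_nhds_in_open[of "{0<..}", THEN eventually_mono] 1)
    next
      case 2
      have "((\<lambda>t. 0) has_real_derivative D (Suc m) t) (at t)" using 2 by (simp add: D_def)
      then show ?thesis
        by (rule DERIV_cong_ev[THEN iffD1, rotated -1])
           (auto simp: D_def 2 intro!: eventually_nhds_in_open[of "{..<0}", THEN eventually_mono])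
    next
      case 3
      \<comment> \<open>With \<open>s = 1 / t\<close> the difference quotient at \<open>0\<close> is
        the polynomial multiplied by \<open>s\<close>, times \<open>exp (- s)\<close>, and still
        tends to \<open>0\<close>.\<close>
      have r: "((\<lambda>t. D m t / t) \<longlongrightarrow> 0) (at_right 0)"
      proof -
        have "((\<lambda>t. poly ([:0,1:] * P m) (inverse t) * exp (- inverse t)) \<longlongrightarrow> 0) (at_right (0::real))"
          by (rule filterlim_compose[OF poly_times_exp_tendsto_0 filterlim_inverse_at_top_right])
        then show ?thesis
          by (rule Lim_transform_eventually)
             (auto simp: eventually_at_right_field D_def field_simps intro!: exI[of _ 1])
      qed
      have l: "((\<lambda>t. D m t / t) \<longlongrightarrow> 0) (at_left 0)"
        by (rule Lim_transform_eventually[OF tendsto_const])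
           (auto simp: eventually_at_left_field D_def intro!: exI[of _ "-1"])
      show ?thesis using r l 3
        by (simp add: DERIV_def D_def[of m 0] D_def[of "Suc m" 0] filterlim_at_split)
    qed
  qed
  moreover have "D 0 = bump" by (auto simp: D_def P_def bump_def)
  ultimately show ?thesis unfolding smooth_real_def by blast
qed

lemma bump_pos_iff: "bump t > 0 \<longleftrightarrow> t > 0" and bump_nonneg: "bump t \<ge> 0" and bump_le_1: "bump t \<le> 1"
  by (auto simp: bump_def)

text \<open>For positive \<open>t\<close> the derivative is \<open>s\<^sup>2 * exp (- s)\<close>
  with \<open>s = 1 / t\<close>. Its range in \<open>[0, 1]\<close> makes the truncation monotone
  and lets the square of the slope be bounded by the slope in the energy argument.\<close>

lemma bump_deriv:
  obtains b where "\<And>t. (bump has_real_derivative b t) (at t)" "\<And>t. 0 \<le> b t" "\<And>t. b t \<le> 1"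
    "continuous_on UNIV b"
proof -
  obtain b where b: "\<And>t. (bump has_real_derivative b t) (at t)" "smooth_real b"
    using smooth_real_deriv[OF smooth_real_bump] by blast
  obtain b' where b': "\<And>t. (b has_real_derivative b' t) (at t)" using smooth_real_deriv[OF b(2)] by blast
  have pos: "b t = exp (-1/t) / t\<^sup>2" if "t > 0" for t
  proof -
    have "((\<lambda>t. exp (-1/t)) has_real_derivative exp (-1/t) / t\<^sup>2) (at t)"
      using that by (auto intro!: derivative_eq_intros simp: power2_eq_square)
    then have "(bump has_real_derivative exp (-1/t) / t\<^sup>2) (at t)"
      by (rule DERIV_cong_ev[THEN iffD1, rotated -1])
         (auto simp: bump_def that intro!: eventually_nhds_in_open[of "{0<..}", THEN eventually_mono])
    then show ?thesis using b(1) DERIV_unique by blast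
  qed
  have neg: "b t = 0" if "t < 0" for t
  proof -
    have "(bump has_real_derivative 0) (at t)"
      by (rule DERIV_cong_ev[THEN iffD1, OF refl _ refl DERIV_const[of 0]])
         (auto simp: bump_def that intro!: eventually_nhds_in_open[of "{..<0}", THEN eventually_mono])
    then show ?thesis using b(1) DERIV_unique by blast
  qed
  have bcont: "isCont b t" for t using b' DERIV_isCont by blast
  \<comment> \<open>The value at \<open>0\<close> follows from the continuity of the derivative and
    its vanishing to the left.\<close>
  have b0: "b 0 = 0"
  proof -
    have "(b \<longlongrightarrow> b 0) (at_left 0)" using bcont[of 0] by (simp add: isCont_def filterlim_at_split)
    moreover have "(b \<longlongrightarrow> 0) (at_left 0)"
      by (rule Lim_transform_eventually[OF tendsto_const])
         (auto simp: eventually_at_left_field neg intro!: exI[of _ "-1"])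
    ultimately show ?thesis using tendsto_unique trivial_limit_at_left_real by blast
  qed
  \<comment> \<open>With \<open>s = 1 / t\<close>:
    \<open>s \<le> (1 + s / 4)\<^sup>2 \<le> exp (s / 2)\<close>, the first because the difference
    is the square of \<open>1 - s / 4\<close>; squaring gives
    \<open>s\<^sup>2 \<le> exp s\<close>.\<close>
  have le1: "exp (-1/t) / t\<^sup>2 \<le> 1" if "t > 0" for t :: real
  proof -
    have "1/t \<le> exp (1/t/2) "
    proof -
      have "1/t/2 + 1 \<le> exp (1/t/2)" using exp_ge_add_one_self[of "1/t/2"] by linarith
      have "exp (1/t/2) = (exp (1/t/4))^2" by (simp add: power2_eq_square flip: exp_add)
      moreover have "1 + 1/t/4 \<le> exp (1/t/4)" by (rule exp_ge_add_one_self)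
      then have "(1 + 1/t/4)^2 \<le> (exp (1/t/4))^2" using that by (intro power_mono) auto
      moreover have "1/t \<le> (1 + 1/t/4)^2"
        using sum_power2_ge_zero[of "1 - 1/t/4" 0] by (simp add: power2_eq_square algebra_simps)
      ultimately show ?thesis by linarith
    qed
    then have "(1/t)^2 \<le> (exp (1/t/2))^2" using that by (intro power_mono) auto
    also have "\<dots> = exp (1/t)" by (simp add: power2_eq_square flip: exp_add)
    finally show ?thesis using that by (simp add: exp_minus field_simps)
  qed
  show ?thesis
  proof (rule that[of b])
    show "0 \<le> b t" "b t \<le> 1" for t using pos neg b0 le1 by (cases t "0::real" rule: linorder_cases; force)+
    show "continuous_on UNIV b" using bcont continuous_at_imp_continuous_on by blast
  qed (use b in auto)
qed

subsection \<open>Square-integrable functions\<close>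

lemma L2D: "g \<in> L2 \<Omega> \<Longrightarrow> g \<in> borel_measurable (lebesgue_on \<Omega>)"
  "g \<in> L2 \<Omega> \<Longrightarrow> integrable (lebesgue_on \<Omega>) (\<lambda>x. (norm (g x))\<^sup>2)"
  by (auto simp: L2_def)

lemma L2_norm_nonneg [simp]: "L2_norm \<Omega> g \<ge> 0"
  by (simp add: L2_norm_def)

lemma L2_norm_sq: "(L2_norm \<Omega> g)\<^sup>2 = (LINT x|lebesgue_on \<Omega>. (norm (g x))\<^sup>2)"
  by (simp add: L2_norm_def)

lemma L2_bound:
  assumes "f \<in> L2 \<Omega>" "g \<in> borel_measurable (lebesgue_on \<Omega>)"
    "AE x in lebesgue_on \<Omega>. norm (g x) \<le> K * norm (f x)"
  shows "g \<in> L2 \<Omega>"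
proof -
  have "integrable (lebesgue_on \<Omega>) (\<lambda>x. (norm (g x))\<^sup>2)"
  proof (rule Bochner_Integration.integrable_bound)
    show "integrable (lebesgue_on \<Omega>) (\<lambda>x. K\<^sup>2 * (norm (f x))\<^sup>2)"
      using L2D(2)[OF assms(1)] by simp
    show "AE x in lebesgue_on \<Omega>. norm ((norm (g x))\<^sup>2) \<le> norm (K\<^sup>2 * (norm (f x))\<^sup>2)"
      using assms(3) by eventually_elim (auto simp flip: power_mult_distrib intro: power_mono)
  qed (use assms in measurable)
  then show ?thesis using assms by (simp add: L2_def)
qed

lemma L2_norm_bound:
  assumes "f \<in> L2 \<Omega>" "g \<in> borel_measurable (lebesgue_on \<Omega>)" "K \<ge> 0"
    "AE x in lebesgue_on \<Omega>. norm (g x) \<le> K * norm (f x)"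
  shows "L2_norm \<Omega> g \<le> K * L2_norm \<Omega> f"
proof -
  have "(LINT x|lebesgue_on \<Omega>. (norm (g x))\<^sup>2) \<le> (LINT x|lebesgue_on \<Omega>. K\<^sup>2 * (norm (f x))\<^sup>2)"
  proof (rule integral_mono_AE)
    show "AE x in lebesgue_on \<Omega>. (norm (g x))\<^sup>2 \<le> K\<^sup>2 * (norm (f x))\<^sup>2"
      using assms(4) by eventually_elim (auto simp flip: power_mult_distrib intro: power_mono)
  qed (intro integrable_mult_right L2D(2)[OF assms(1)] L2D(2)[OF L2_bound[OF assms(1,2,4)]])+
  then have "(L2_norm \<Omega> g)\<^sup>2 \<le> (K * L2_norm \<Omega> f)\<^sup>2"
    using L2_norm_sq[of \<Omega> f] L2_norm_sq[of \<Omega> g] by (simp add: power_mult_distrib)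
  then show ?thesis by (rule power2_le_imp_le) (simp add: assms(3))
qed

lemma L2_cong_AE:
  assumes "f \<in> L2 \<Omega>" "g \<in> borel_measurable (lebesgue_on \<Omega>)" "AE x in lebesgue_on \<Omega>. f x = g x"
  shows "g \<in> L2 \<Omega>"
  by (rule L2_bound[OF assms(1,2), of 1]) (use assms(3) in auto)

lemma L2_norm_cong_AE:
  assumes "f \<in> borel_measurable (lebesgue_on \<Omega>)" "g \<in> borel_measurable (lebesgue_on \<Omega>)"
    "AE x in lebesgue_on \<Omega>. f x = g x"
  shows "L2_norm \<Omega> f = L2_norm \<Omega> g"
proof -
  have "(LINT x|lebesgue_on \<Omega>. (norm (f x))\<^sup>2) = (LINT x|lebesgue_on \<Omega>. (norm (g x))\<^sup>2)"
    by (rule integral_cong_AE) (use assms in auto)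
  then show ?thesis by (simp add: L2_norm_def)
qed

lemma L2_add:
  assumes "f \<in> L2 \<Omega>" "g \<in> L2 \<Omega>"
  shows "(\<lambda>x. f x + g x) \<in> L2 \<Omega>"
proof -
  have [measurable]: "f \<in> borel_measurable (lebesgue_on \<Omega>)" "g \<in> borel_measurable (lebesgue_on \<Omega>)" using assms by (auto dest: L2D)
  have "integrable (lebesgue_on \<Omega>) (\<lambda>x. (norm (f x + g x))\<^sup>2)"
  proof (rule Bochner_Integration.integrable_bound)
    show "integrable (lebesgue_on \<Omega>) (\<lambda>x. 2 * (norm (f x))\<^sup>2 + 2 * (norm (g x))\<^sup>2)"
      using assms[THEN L2D(2)] by auto
    have "(norm (f x + g x))\<^sup>2 \<le> 2 * (norm (f x))\<^sup>2 + 2 * (norm (g x))\<^sup>2" for x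
    proof -
      have "(norm (f x + g x))\<^sup>2 \<le> (norm (f x) + norm (g x))\<^sup>2" by (intro power_mono norm_triangle_ineq) auto
      also have "\<dots> \<le> 2 * (norm (f x))\<^sup>2 + 2 * (norm (g x))\<^sup>2"
        using sum_squares_bound[of "norm (f x)" "norm (g x)"] by (simp add: power2_sum)
      finally show ?thesis .
    qed
    then show "AE x in lebesgue_on \<Omega>. norm ((norm (f x + g x))\<^sup>2) \<le> norm (2 * (norm (f x))\<^sup>2 + 2 * (norm (g x))\<^sup>2)"
      by auto
  qed measurable
  then show ?thesis by (simp add: L2_def)
qed

lemma L2_scaleR: "f \<in> L2 \<Omega> \<Longrightarrow> (\<lambda>x. c *\<^sub>R f x) \<in> L2 \<Omega>"
  by (rule L2_bound[of f _ _ "\<bar>c\<bar>"]) (auto dest: L2D)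

lemma L2_minus: "f \<in> L2 \<Omega> \<Longrightarrow> (\<lambda>x. - f x) \<in> L2 \<Omega>"
  using L2_scaleR[of f \<Omega> "-1"] by simp

lemma L2_norm_minus: "L2_norm \<Omega> (\<lambda>x. - f x) = L2_norm \<Omega> f"
  by (simp add: L2_norm_def)

lemma L2_diff: "f \<in> L2 \<Omega> \<Longrightarrow> g \<in> L2 \<Omega> \<Longrightarrow> (\<lambda>x. f x - g x) \<in> L2 \<Omega>"
  using L2_add[OF _ L2_minus, of f \<Omega> g] by simp

lemma L2_norm_fun: "f \<in> L2 \<Omega> \<Longrightarrow> (\<lambda>x. norm (f x)) \<in> L2 \<Omega>"
  by (rule L2_bound[of f _ _ 1]) (auto dest: L2D)

lemma L2_norm_norm: "L2_norm \<Omega> (\<lambda>x. norm (f x)) = L2_norm \<Omega> f"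
  by (simp add: L2_norm_def)

lemma L2_norm_times_integrable:
  assumes "f \<in> L2 \<Omega>" "g \<in> L2 \<Omega>"
  shows "integrable (lebesgue_on \<Omega>) (\<lambda>x. norm (f x) * norm (g x))"
proof (rule Bochner_Integration.integrable_bound)
  have [measurable]: "f \<in> borel_measurable (lebesgue_on \<Omega>)" "g \<in> borel_measurable (lebesgue_on \<Omega>)" using assms by (auto dest: L2D)
  show "integrable (lebesgue_on \<Omega>) (\<lambda>x. (norm (f x))\<^sup>2 + (norm (g x))\<^sup>2)"
    using assms[THEN L2D(2)] by auto
  have "norm (f x) * norm (g x) \<le> (norm (f x))\<^sup>2 + (norm (g x))\<^sup>2" for x
    using sum_squares_bound[of "norm (f x)" "norm (g x)"]
      mult_nonneg_nonneg[OF norm_ge_zero[of "f x"] norm_ge_zero[of "g x"]] by linarith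
  then show "AE x in lebesgue_on \<Omega>. norm (norm (f x) * norm (g x)) \<le> norm ((norm (f x))\<^sup>2 + (norm (g x))\<^sup>2)"
    by auto
  show "(\<lambda>x. norm (f x) * norm (g x)) \<in> borel_measurable (lebesgue_on \<Omega>)" by measurable
qed

lemma L2_Cauchy_Schwarz:
  assumes "f \<in> L2 \<Omega>" "g \<in> L2 \<Omega>"
  shows "(LINT x|lebesgue_on \<Omega>. norm (f x) * norm (g x)) \<le> L2_norm \<Omega> f * L2_norm \<Omega> g"
proof -
  let ?a = "L2_norm \<Omega> f" and ?b = "L2_norm \<Omega> g"
  \<comment> \<open>Young's inequality is applied with the weights \<open>?a + e\<close> and
    \<open>?b + e\<close> instead of the norms, so that nothing is divided by \<open>0\<close> when
    a norm vanishes; then \<open>e\<close> tends to \<open>0\<close>.\<close>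
  have *: "(LINT x|lebesgue_on \<Omega>. norm (f x) * norm (g x)) \<le> (?a + e) * (?b + e)" if e: "e > 0" for e
  proof -
    define p where "p = ?a + e"
    define q where "q = ?b + e"
    have pq: "p > 0" "q > 0" "?a \<le> p" "?b \<le> q" using e by (auto simp: p_def q_def add_nonneg_pos)
    have "(LINT x|lebesgue_on \<Omega>. norm (f x) * norm (g x)) \<le>
        (LINT x|lebesgue_on \<Omega>. q / (2 * p) * (norm (f x))\<^sup>2 + p / (2 * q) * (norm (g x))\<^sup>2)"
    proof (rule integral_mono)
      fix x
      have "0 \<le> (q * norm (f x) - p * norm (g x))\<^sup>2 / (2 * p * q)" using pq by simp
      also have "\<dots> = q / (2 * p) * (norm (f x))\<^sup>2 + p / (2 * q) * (norm (g x))\<^sup>2 - norm (f x) * norm (g x)"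
        using pq by (simp add: power2_eq_square field_simps)
      finally show "norm (f x) * norm (g x) \<le> q / (2 * p) * (norm (f x))\<^sup>2 + p / (2 * q) * (norm (g x))\<^sup>2" by simp
    qed (intro Bochner_Integration.integrable_add integrable_mult_right L2_norm_times_integrable assms L2D(2))+
    also have "\<dots> = q / (2 * p) * ?a\<^sup>2 + p / (2 * q) * ?b\<^sup>2"
      using assms by (simp add: L2_norm_sq L2D)
    also have "\<dots> \<le> q / (2 * p) * p\<^sup>2 + p / (2 * q) * q\<^sup>2"
      using pq by (intro add_mono mult_left_mono power_mono) auto
    also have "\<dots> = p * q" using pq by (simp add: power2_eq_square field_simps)
    finally show ?thesis by (simp add: p_def q_def)
  qed
  have "((\<lambda>e. (?a + e) * (?b + e)) \<longlongrightarrow> (?a + 0) * (?b + 0)) (at_right 0)"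
    by (intro tendsto_intros)
  then have "(LINT x|lebesgue_on \<Omega>. norm (f x) * norm (g x)) \<le> (?a + 0) * (?b + 0)"
    by (rule tendsto_lowerbound) (use * in \<open>auto simp: eventually_at_right_field intro!: exI[of _ 1]\<close>)
  then show ?thesis by simp
qed

lemma L2_mult_integrable:
  fixes f g :: "real ^ 'n::finite \<Rightarrow> real"
  assumes "f \<in> L2 \<Omega>" "g \<in> L2 \<Omega>"
  shows "integrable (lebesgue_on \<Omega>) (\<lambda>x. f x * g x)"
  by (rule Bochner_Integration.integrable_bound[OF L2_norm_times_integrable[OF assms]])
     (use assms[THEN L2D(1)] in \<open>auto simp: abs_mult\<close>)

lemma L2_inner_integrable:
  assumes "f \<in> L2 \<Omega>" "g \<in> L2 \<Omega>"
  shows "integrable (lebesgue_on \<Omega>) (\<lambda>x. f x \<bullet> g x)"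
  by (rule Bochner_Integration.integrable_bound[OF L2_norm_times_integrable[OF assms]])
     (use assms[THEN L2D(1)] Cauchy_Schwarz_ineq2 in \<open>auto intro!: borel_measurable_inner\<close>)

lemma L2_inner_le:
  assumes "f \<in> L2 \<Omega>" "g \<in> L2 \<Omega>"
  shows "\<bar>LINT x|lebesgue_on \<Omega>. f x \<bullet> g x\<bar> \<le> L2_norm \<Omega> f * L2_norm \<Omega> g"
proof -
  have "\<bar>LINT x|lebesgue_on \<Omega>. f x \<bullet> g x\<bar> \<le> (LINT x|lebesgue_on \<Omega>. \<bar>f x \<bullet> g x\<bar>)"
    by (rule integral_abs_bound)
  also have "\<dots> \<le> (LINT x|lebesgue_on \<Omega>. norm (f x) * norm (g x))"
    using L2_inner_integrable[OF assms] L2_norm_times_integrable[OF assms]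
    by (intro integral_mono Cauchy_Schwarz_ineq2) auto
  finally show ?thesis using L2_Cauchy_Schwarz[OF assms] by linarith
qed

lemma L2_mult_le:
  fixes f g :: "real ^ 'n::finite \<Rightarrow> real"
  assumes "f \<in> L2 \<Omega>" "g \<in> L2 \<Omega>"
  shows "\<bar>LINT x|lebesgue_on \<Omega>. f x * g x\<bar> \<le> L2_norm \<Omega> f * L2_norm \<Omega> g"
  using L2_inner_le[OF assms] by simp

lemma L2_norm_triangle:
  assumes "f \<in> L2 \<Omega>" "g \<in> L2 \<Omega>"
  shows "L2_norm \<Omega> (\<lambda>x. f x + g x) \<le> L2_norm \<Omega> f + L2_norm \<Omega> g"
proof -
  note int = L2D(2)[OF assms(1)] L2D(2)[OF assms(2)] L2_norm_times_integrable[OF assms]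
  have "(L2_norm \<Omega> (\<lambda>x. f x + g x))\<^sup>2 \<le>
    (LINT x|lebesgue_on \<Omega>. (norm (f x))\<^sup>2 + (norm (g x))\<^sup>2 + 2 * (norm (f x) * norm (g x)))"
    unfolding L2_norm_sq
  proof (rule integral_mono)
    fix x
    have "(norm (f x + g x))\<^sup>2 \<le> (norm (f x) + norm (g x))\<^sup>2" by (intro power_mono norm_triangle_ineq) auto
    then show "(norm (f x + g x))\<^sup>2 \<le> (norm (f x))\<^sup>2 + (norm (g x))\<^sup>2 + 2 * (norm (f x) * norm (g x))"
      by (simp add: power2_sum)
  qed (use int L2D(2)[OF L2_add[OF assms]] in auto)
  also have "\<dots> = (L2_norm \<Omega> f)\<^sup>2 + (L2_norm \<Omega> g)\<^sup>2 + 2 * (LINT x|lebesgue_on \<Omega>. norm (f x) * norm (g x))"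
    using int by (simp add: L2_norm_sq)
  also have "\<dots> \<le> (L2_norm \<Omega> f + L2_norm \<Omega> g)\<^sup>2"
    using L2_Cauchy_Schwarz[OF assms] by (simp add: power2_sum)
  finally show ?thesis by (rule power2_le_imp_le) simp
qed

lemma L2_norm_triangle_diff:
  assumes "f \<in> L2 \<Omega>" "g \<in> L2 \<Omega>"
  shows "L2_norm \<Omega> (\<lambda>x. f x - g x) \<le> L2_norm \<Omega> f + L2_norm \<Omega> g"
  using L2_norm_triangle[OF assms(1) L2_minus[OF assms(2)]] by (simp add: L2_norm_minus)

lemma L2_norm_diff_commute: "L2_norm \<Omega> (\<lambda>x. f x - g x) = L2_norm \<Omega> (\<lambda>x. g x - f x)"
  by (simp add: L2_norm_def norm_minus_commute)

lemma L2_norm_eq_0_iff: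
  assumes "f \<in> L2 \<Omega>"
  shows "L2_norm \<Omega> f = 0 \<longleftrightarrow> (AE x in lebesgue_on \<Omega>. f x = 0)"
  using integral_nonneg_eq_0_iff_AE[OF L2D(2)[OF assms]] by (simp add: L2_norm_def)

text \<open>Convergence in the seminorm of \<open>L2\<close>; the limit is only determined almost everywhere.\<close>

definition L2_tendsto ::
    "(real ^ 'n::finite) set \<Rightarrow> (nat \<Rightarrow> real ^ 'n \<Rightarrow> 'b::euclidean_space) \<Rightarrow> (real ^ 'n \<Rightarrow> 'b) \<Rightarrow> bool" where
  "L2_tendsto \<Omega> f g \<longleftrightarrow> g \<in> L2 \<Omega> \<and> (\<forall>k. f k \<in> L2 \<Omega>) \<and> (\<lambda>k. L2_norm \<Omega> (\<lambda>x. f k x - g x)) \<longlonglongrightarrow> 0"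

lemma L2_tendstoI:
  assumes "g \<in> L2 \<Omega>" "\<And>k. f k \<in> L2 \<Omega>" "b \<longlonglongrightarrow> 0" "\<And>k. L2_norm \<Omega> (\<lambda>x. f k x - g x) \<le> b k"
  shows "L2_tendsto \<Omega> f g"
  unfolding L2_tendsto_def
  using assms by (auto intro!: tendsto_sandwich[OF _ _ tendsto_const assms(3)])

lemma L2_tendsto_norm:
  assumes "L2_tendsto \<Omega> f g"
  shows "(\<lambda>k. L2_norm \<Omega> (f k)) \<longlonglongrightarrow> L2_norm \<Omega> g"
proof (rule LIM_zero_cancel, rule Lim_null_comparison)
  have L: "g \<in> L2 \<Omega>" "f k \<in> L2 \<Omega>" for k using assms by (auto simp: L2_tendsto_def)
  show "\<forall>\<^sub>F k in sequentially. norm (L2_norm \<Omega> (f k) - L2_norm \<Omega> g) \<le> L2_norm \<Omega> (\<lambda>x. f k x - g x)"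
  proof (rule always_eventually, rule allI)
    fix k
    show "norm (L2_norm \<Omega> (f k) - L2_norm \<Omega> g) \<le> L2_norm \<Omega> (\<lambda>x. f k x - g x)"
      using L2_norm_triangle[OF L2_diff[OF L(2)[of k] L(1)] L(1)]
        L2_norm_triangle[OF L2_diff[OF L(1) L(2)[of k]] L(2)[of k]]
      by (simp add: L2_norm_diff_commute[of \<Omega> g])
  qed
  show "(\<lambda>k. L2_norm \<Omega> (\<lambda>x. f k x - g x)) \<longlonglongrightarrow> 0" using assms by (simp add: L2_tendsto_def)
qed

lemma L2_tendsto_inner:
  assumes f: "L2_tendsto \<Omega> f f0" and g: "g \<in> L2 \<Omega>"
  shows "(\<lambda>k. LINT x|lebesgue_on \<Omega>. f k x \<bullet> g x) \<longlonglongrightarrow> (LINT x|lebesgue_on \<Omega>. f0 x \<bullet> g x)"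
proof (rule LIM_zero_cancel, rule Lim_null_comparison)
  have L: "f0 \<in> L2 \<Omega>" "f k \<in> L2 \<Omega>" for k using f by (auto simp: L2_tendsto_def)
  show "\<forall>\<^sub>F k in sequentially. norm ((LINT x|lebesgue_on \<Omega>. f k x \<bullet> g x) - (LINT x|lebesgue_on \<Omega>. f0 x \<bullet> g x))
      \<le> L2_norm \<Omega> (\<lambda>x. f k x - f0 x) * L2_norm \<Omega> g"
  proof (rule always_eventually, rule allI)
    fix k
    have "(LINT x|lebesgue_on \<Omega>. f k x \<bullet> g x) - (LINT x|lebesgue_on \<Omega>. f0 x \<bullet> g x) =
      (LINT x|lebesgue_on \<Omega>. (f k x - f0 x) \<bullet> g x)"
      using L g by (simp add: inner_diff_left L2_inner_integrable)
    then show "norm ((LINT x|lebesgue_on \<Omega>. f k x \<bullet> g x) - (LINT x|lebesgue_on \<Omega>. f0 x \<bullet> g x))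
      \<le> L2_norm \<Omega> (\<lambda>x. f k x - f0 x) * L2_norm \<Omega> g"
      using L2_inner_le[OF L2_diff[OF L(2)[of k] L(1)] g] by simp
  qed
  show "(\<lambda>k. L2_norm \<Omega> (\<lambda>x. f k x - f0 x) * L2_norm \<Omega> g) \<longlonglongrightarrow> 0"
    using f by (auto simp: L2_tendsto_def intro!: tendsto_mult_left_zero)
qed

lemma L2_tendsto_add:
  assumes "L2_tendsto \<Omega> f f0" "L2_tendsto \<Omega> g g0"
  shows "L2_tendsto \<Omega> (\<lambda>k x. f k x + g k x) (\<lambda>x. f0 x + g0 x)"
proof (rule L2_tendstoI)
  have L: "f0 \<in> L2 \<Omega>" "f k \<in> L2 \<Omega>" "g0 \<in> L2 \<Omega>" "g k \<in> L2 \<Omega>" for k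
    using assms by (auto simp: L2_tendsto_def)
  then show "(\<lambda>x. f0 x + g0 x) \<in> L2 \<Omega>" "(\<lambda>x. f k x + g k x) \<in> L2 \<Omega>" for k by (auto intro: L2_add)
  show "(\<lambda>k. L2_norm \<Omega> (\<lambda>x. f k x - f0 x) + L2_norm \<Omega> (\<lambda>x. g k x - g0 x)) \<longlonglongrightarrow> 0"
    using assms by (auto simp: L2_tendsto_def intro!: tendsto_add_zero)
  show "L2_norm \<Omega> (\<lambda>x. f k x + g k x - (f0 x + g0 x)) \<le> L2_norm \<Omega> (\<lambda>x. f k x - f0 x) + L2_norm \<Omega> (\<lambda>x. g k x - g0 x)" for k
    using L2_norm_triangle[OF L2_diff[OF L(2)[of k] L(1)] L2_diff[OF L(4)[of k] L(3)]]
    by (simp add: algebra_simps)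
qed

lemma L2_tendsto_mult_bounded:
  fixes b :: "real ^ 'n::finite \<Rightarrow> real"
  assumes f: "L2_tendsto \<Omega> f (f0 :: _ \<Rightarrow> 'b::euclidean_space)" and b: "b \<in> borel_measurable (lebesgue_on \<Omega>)"
    "AE x in lebesgue_on \<Omega>. \<bar>b x\<bar> \<le> K"
  shows "L2_tendsto \<Omega> (\<lambda>k x. b x *\<^sub>R f k x) (\<lambda>x. b x *\<^sub>R f0 x)"
proof (rule L2_tendstoI)
  have L: "f0 \<in> L2 \<Omega>" "f k \<in> L2 \<Omega>" for k using f by (auto simp: L2_tendsto_def)
  have "AE x in lebesgue_on \<Omega>. norm (b x *\<^sub>R h x) \<le> \<bar>K\<bar> * norm (h x)" for h :: "real ^ 'n \<Rightarrow> 'b"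
    using b(2) by eventually_elim (auto intro!: mult_right_mono)
  note * = this
  show "(\<lambda>x. b x *\<^sub>R f0 x) \<in> L2 \<Omega>" "(\<lambda>x. b x *\<^sub>R f k x) \<in> L2 \<Omega>" for k
    using L b(1) L[THEN L2D(1)] by (auto intro!: L2_bound[OF _ _ *])
  show "(\<lambda>k. \<bar>K\<bar> * L2_norm \<Omega> (\<lambda>x. f k x - f0 x)) \<longlonglongrightarrow> 0"
    using f by (auto simp: L2_tendsto_def intro!: tendsto_mult_right_zero)
  show "L2_norm \<Omega> (\<lambda>x. b x *\<^sub>R f k x - b x *\<^sub>R f0 x) \<le> \<bar>K\<bar> * L2_norm \<Omega> (\<lambda>x. f k x - f0 x)" for k
  proof -
    have [measurable]: "f k \<in> borel_measurable (lebesgue_on \<Omega>)" "f0 \<in> borel_measurable (lebesgue_on \<Omega>)"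
      "b \<in> borel_measurable (lebesgue_on \<Omega>)"
      using L[THEN L2D(1)] b(1) by auto
    show ?thesis
      using L2_norm_bound[OF L2_diff[OF L(2)[of k] L(1)] _ _ *] by (simp add: scaleR_diff_right)
  qed
qed

lemma L2_tendsto_minus:
  "L2_tendsto \<Omega> f f0 \<Longrightarrow> L2_tendsto \<Omega> (\<lambda>k x. - f k x) (\<lambda>x. - f0 x)"
  using L2_tendsto_mult_bounded[of \<Omega> f f0 "\<lambda>_. -1" 1] by simp

lemma L2_tendsto_diff:
  assumes "L2_tendsto \<Omega> f f0" "L2_tendsto \<Omega> g g0"
  shows "L2_tendsto \<Omega> (\<lambda>k x. f k x - g k x) (\<lambda>x. f0 x - g0 x)"
  using L2_tendsto_add[OF assms(1) L2_tendsto_minus[OF assms(2)]] by simp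

lemma L2_tendsto_subseq: "L2_tendsto \<Omega> f g \<Longrightarrow> strict_mono r \<Longrightarrow> L2_tendsto \<Omega> (\<lambda>k. f (r k)) g"
  unfolding L2_tendsto_def
  using LIMSEQ_subseq_LIMSEQ[of "\<lambda>k. L2_norm \<Omega> (\<lambda>x. f k x - g x)" 0 r] by (auto simp: o_def)

lemma L2_tendsto_AE_subseq:
  assumes f: "L2_tendsto \<Omega> f g"
  obtains r where "strict_mono r" "AE x in lebesgue_on \<Omega>. (\<lambda>k. f (r k) x) \<longlonglongrightarrow> g x"
proof -
  have L: "g \<in> L2 \<Omega>" "f k \<in> L2 \<Omega>" for k using f by (auto simp: L2_tendsto_def)
  have "(\<lambda>k. (L2_norm \<Omega> (\<lambda>x. f k x - g x))\<^sup>2) \<longlonglongrightarrow> 0\<^sup>2"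
    using f by (intro tendsto_power) (auto simp: L2_tendsto_def)
  then have "(\<lambda>k. LINT x|lebesgue_on \<Omega>. norm ((norm (f k x - g x))\<^sup>2)) \<longlonglongrightarrow> 0"
    by (simp add: L2_norm_sq)
  from tendsto_L1_AE_subseq[OF L2D(2)[OF L2_diff[OF L(2) L(1)]] this]
  obtain r where r: "strict_mono r" "AE x in lebesgue_on \<Omega>. (\<lambda>n. (norm (f (r n) x - g x))\<^sup>2) \<longlonglongrightarrow> 0" by auto
  have "AE x in lebesgue_on \<Omega>. (\<lambda>k. f (r k) x) \<longlonglongrightarrow> g x" using r(2)
  proof eventually_elim
    case (elim x)
    then have "(\<lambda>n. sqrt ((norm (f (r n) x - g x))\<^sup>2)) \<longlonglongrightarrow> sqrt 0" by (rule tendsto_real_sqrt)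
    then show ?case by (simp add: tendsto_norm_zero_iff LIM_zero_iff)
  qed
  then show ?thesis using r(1) that by blast
qed

subsection \<open>Integration by parts\<close>

lemma integrable_continuous_compact_support:
  fixes f :: "'a::euclidean_space \<Rightarrow> 'b::euclidean_space"
  assumes "continuous_on UNIV f" "compact K" "\<And>x. x \<notin> K \<Longrightarrow> f x = 0"
  shows "integrable lborel f"
proof -
  have "integrable lborel (\<lambda>x. indicator K x *\<^sub>R f x)"
    using assms by (intro borel_integrable_compact continuous_on_subset[OF assms(1)]) auto
  moreover have "(\<lambda>x. indicator K x *\<^sub>R f x) = f" using assms(3) by (auto simp: indicator_def)
  ultimately show ?thesis by simp
qed

lemma bounded_continuous_compact_support:
  fixes f :: "'a::euclidean_space \<Rightarrow> 'b::euclidean_space"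
  assumes "continuous_on UNIV f" "compact K" "\<And>x. x \<notin> K \<Longrightarrow> f x = 0"
  obtains B where "B > 0" "\<And>x. norm (f x) \<le> B"
proof -
  have "bounded (f ` K)"
    using assms by (intro compact_imp_bounded compact_continuous_image continuous_on_subset[OF assms(1)]) auto
  then obtain B where B: "\<And>x. x \<in> K \<Longrightarrow> norm (f x) \<le> B" by (auto simp: bounded_iff)
  then have "norm (f x) \<le> max B 1" for x using assms(3)[of x] B[of x] by (cases "x \<in> K") (auto simp: le_max_iff_disj)
  then show ?thesis using that[of "max B 1"] by auto
qed

lemma grad_eq_0_outside:
  fixes f :: "real ^ 'n::finite \<Rightarrow> real"
  assumes "closed K" "\<And>x. x \<notin> K \<Longrightarrow> f x = 0" "x \<notin> K"
  shows "grad f x = 0"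
proof (rule grad_eq)
  have "((\<lambda>x. 0) has_derivative (\<lambda>h. 0 \<bullet> h)) (at x)" by simp
  from has_derivative_transform_within_open[OF this, of "- K" f]
  show "(f has_derivative (\<lambda>h. 0 \<bullet> h)) (at x)" using assms by auto
qed

lemma C1_Lipschitz:
  assumes f: "C_k 1 f" and B: "\<And>x. norm (grad f x) \<le> B"
  shows "\<bar>f x - f y\<bar> \<le> B * norm (x - y)"
proof -
  have "norm (f x - f y) \<le> B * norm (x - y)"
  proof (rule differentiable_bound[of UNIV])
    fix x show "(f has_derivative (\<lambda>h. grad f x \<bullet> h)) (at x within UNIV)" using C1D(1)[OF f] .
    show "onorm (\<lambda>h. grad f x \<bullet> h) \<le> B"
    proof (rule onorm_bound)
      show "0 \<le> B" using B[of x] norm_ge_zero order_trans by blast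
      show "norm (grad f x \<bullet> h) \<le> B * norm h" for h
        using Cauchy_Schwarz_ineq2[of "grad f x" h] mult_right_mono[OF B[of x] norm_ge_zero[of h]] by simp
    qed
  qed auto
  then show ?thesis by simp
qed

text \<open>Translation invariance makes every difference quotient of \<open>f\<close> integrate to
  \<open>0\<close>; the quotients converge to the partial derivative and are dominated by a
  Lipschitz constant on a bounded set.\<close>

lemma integral_partial_deriv_eq_0:
  fixes f :: "real ^ 'n::finite \<Rightarrow> real"
  assumes f: "C_k 1 f" and K: "compact K" "\<And>x. x \<notin> K \<Longrightarrow> f x = 0"
  shows "(LINT x|lborel. partial_deriv i f x) = 0"
proof -
  have gc: "continuous_on UNIV (grad f)" and fc: "continuous_on UNIV f" using C1D[OF f] by auto
  have g0: "grad f x = 0" if "x \<notin> K" for x using grad_eq_0_outside K that compact_imp_closed by blast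
  obtain B where B: "B > 0" "\<And>x. norm (grad f x) \<le> B"
    using bounded_continuous_compact_support[OF gc K(1) g0] by blast
  have fint: "integrable lborel f" by (rule integrable_continuous_compact_support[OF fc K])
  define e where "e k = (1 / real (Suc k)) *\<^sub>R (axis i 1 :: real ^ 'n)" for k
  have ne: "norm (e k) = 1 / real (Suc k)" for k by (simp add: e_def norm_axis_1)
  define a where "a k x = real (Suc k) * (f (e k + x) - f x)" for k x
  \<comment> \<open>All shifts have length at most \<open>1\<close>, so \<open>K\<close> enlarged by
    the unit ball contains the supports of all difference quotients.\<close>
  define S where "S = {x + y |x y. x \<in> K \<and> y \<in> cball (0 :: real ^ 'n) 1}"
  have S: "compact S" unfolding S_def by (intro compact_sums K compact_cball)
  have KS: "x \<in> S" if "x \<in> K \<or> e k + x \<in> K" for x k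
    using that
  proof
    assume "x \<in> K" then show ?thesis unfolding S_def by (intro CollectI exI[of _ x] exI[of _ 0]) auto
  next
    assume "e k + x \<in> K"
    then show ?thesis unfolding S_def
      by (intro CollectI exI[of _ "e k + x"] exI[of _ "- e k"]) (auto simp: ne)
  qed
  have shift: "integrable lborel (\<lambda>x. f (e k + x))" "(LINT x|lborel. f (e k + x)) = (LINT x|lborel. f x)" for k
  proof -
    have m: "(\<lambda>x. e k + x) \<in> lborel \<rightarrow>\<^sub>M borel" and fb: "f \<in> borel_measurable borel"
      using fc borel_measurable_continuous_onI by auto
    show "integrable lborel (\<lambda>x. f (e k + x))"
      using fint integrable_distr_eq[OF m fb] by (simp add: lborel_distr_plus)
    show "(LINT x|lborel. f (e k + x)) = (LINT x|lborel. f x)"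
      using integral_distr[OF m fb] by (simp add: lborel_distr_plus)
  qed
  have z: "(LINT x|lborel. a k x) = 0" for k
    using shift fint by (simp add: a_def)
  have "(\<lambda>k. LINT x|lborel. a k x) \<longlonglongrightarrow> (LINT x|lborel. partial_deriv i f x)"
  proof (rule integral_dominated_convergence[where w="\<lambda>x. B * indicator S x"])
    show "(\<lambda>x. partial_deriv i f x) \<in> borel_measurable lborel"
      using f by (auto intro: borel_measurable_continuous_onI)
    show "a k \<in> borel_measurable lborel" for k
    proof -
      have [measurable]: "f \<in> borel_measurable borel" using fc borel_measurable_continuous_onI by auto
      show ?thesis unfolding a_def by measurable
    qed
    have "integrable lborel (indicator S :: _ \<Rightarrow> real)"
      using emeasure_bounded_finite[OF compact_imp_bounded[OF S]] borel_compact[OF S]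
      by (intro integrable_real_indicator) auto
    then show "integrable lborel (\<lambda>x. B * indicator S x)" by simp
    show "AE x in lborel. norm (a k x) \<le> B * indicator S x" for k
    proof (rule AE_I2)
      fix x
      show "norm (a k x) \<le> B * indicator S x"
      proof (cases "x \<in> S")
        case True
        have "norm (a k x) \<le> real (Suc k) * (B * norm (e k))"
          using C1_Lipschitz[OF f B(2), of "e k + x" x] unfolding a_def norm_mult
          by (intro mult_mono) auto
        then show ?thesis using True by (simp add: ne)
      next
        case False
        then have "f x = 0" "f (e k + x) = 0" using KS K(2) by blast+
        then show ?thesis using False by (simp add: a_def)
      qed
    qed
    show "AE x in lborel. (\<lambda>k. a k x) \<longlonglongrightarrow> partial_deriv i f x"
    proof (rule AE_I2)
      fix x
      have "((\<lambda>t. f (x + t *\<^sub>R axis i 1)) has_derivative (\<lambda>t. grad f x \<bullet> (t *\<^sub>R axis i 1))) (at 0)"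
      proof (rule has_derivative_compose[of "\<lambda>t. x + t *\<^sub>R axis i 1" "\<lambda>t. t *\<^sub>R axis i 1" 0 UNIV f "\<lambda>h. grad f x \<bullet> h"])
        show "((\<lambda>t. x + t *\<^sub>R axis i 1) has_derivative (\<lambda>t. t *\<^sub>R axis i 1)) (at 0)"
          by (auto intro!: derivative_eq_intros)
      qed (use C1D(1)[OF f, of x] in simp)
      then have "((\<lambda>t. f (x + t *\<^sub>R axis i 1)) has_real_derivative partial_deriv i f x) (at 0)"
        by (simp add: has_field_derivative_def inner_axis grad_def o_def mult_commute_abs)
      then have "((\<lambda>t. (f (x + t *\<^sub>R axis i 1) - f x) / t) \<longlongrightarrow> partial_deriv i f x) (at 0)"
        by (simp add: DERIV_def)
      moreover have "filterlim (\<lambda>k. 1 / real (Suc k)) (at 0) sequentially"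
        using LIMSEQ_Suc[OF lim_1_over_n] by (auto simp: filterlim_at)
      ultimately have "(\<lambda>k. (f (x + (1 / real (Suc k)) *\<^sub>R axis i 1) - f x) / (1 / real (Suc k))) \<longlonglongrightarrow> partial_deriv i f x"
        by (rule filterlim_compose)
      then show "(\<lambda>k. a k x) \<longlonglongrightarrow> partial_deriv i f x"
        by (simp add: a_def e_def add.commute mult.commute)
    qed
  qed
  then show ?thesis using z by (simp add: LIMSEQ_const_iff)
qed

text \<open>Passage from integrals over \<open>\<Omega>\<close> to integrals over the whole space,
  where translations act.\<close>

lemma integral_lebesgue_on_eq_lborel:
  fixes f :: "'a::euclidean_space \<Rightarrow> 'b::euclidean_space"
  assumes "\<Omega> \<in> sets lebesgue" "f \<in> borel_measurable borel" "\<And>x. x \<notin> \<Omega> \<Longrightarrow> f x = 0"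
  shows "integral\<^sup>L (lebesgue_on \<Omega>) f = integral\<^sup>L lborel f"
    "integrable (lebesgue_on \<Omega>) f \<longleftrightarrow> integrable lborel f"
proof -
  have "(\<lambda>x. indicator \<Omega> x *\<^sub>R f x) = f" using assms(3) by (auto simp: indicator_def)
  then show "integral\<^sup>L (lebesgue_on \<Omega>) f = integral\<^sup>L lborel f"
    "integrable (lebesgue_on \<Omega>) f \<longleftrightarrow> integrable lborel f"
    using assms by (simp_all add: integral_restrict_space integrable_restrict_space
      integral_completion integrable_completion)
qed

lemma compactly_supported_inE:
  assumes "compactly_supported_in \<Omega> \<phi>"
  obtains K where "compact K" "K \<subseteq> \<Omega>" "\<And>x. x \<notin> K \<Longrightarrow> \<phi> x = 0"
proof
  show "compact (closure {x. \<phi> x \<noteq> 0})" "closure {x. \<phi> x \<noteq> 0} \<subseteq> \<Omega>"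
    using assms by (auto simp: compactly_supported_in_def)
  show "\<phi> x = 0" if "x \<notin> closure {x. \<phi> x \<noteq> 0}" for x
    using that closure_subset[of "{x. \<phi> x \<noteq> 0}"] by auto
qed

lemma compactly_supported_inI:
  assumes "compact K" "K \<subseteq> \<Omega>" "\<And>x. x \<notin> K \<Longrightarrow> \<phi> x = 0"
  shows "compactly_supported_in \<Omega> \<phi>"
proof -
  have "closure {x. \<phi> x \<noteq> 0} \<subseteq> K"
    using assms compact_imp_closed by (intro closure_minimal) auto
  moreover have "compact (closure {x. \<phi> x \<noteq> 0})"
    using bounded_subset[OF compact_imp_bounded[OF assms(1)], of "{x. \<phi> x \<noteq> 0}"] assms(3)
    by (auto simp: compact_closure)
  ultimately show ?thesis using assms(2) by (auto simp: compactly_supported_in_def)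
qed

lemma test_function_C1: "test_function \<Omega> \<phi> \<Longrightarrow> C_k 1 \<phi>"
  by (auto simp: test_function_def simp del: C_k.simps)

text \<open>Compact support of \<open>g\<close> carries over to \<open>f * g\<close>, whose partial
  derivative then integrates to \<open>0\<close>.\<close>

lemma integral_by_parts:
  assumes \<Omega>: "\<Omega> \<in> sets lebesgue" and f: "C_k 1 f" and g: "C_k 1 g" "compactly_supported_in \<Omega> g"
  shows "(LINT x|lebesgue_on \<Omega>. f x * partial_deriv i g x) = - (LINT x|lebesgue_on \<Omega>. partial_deriv i f x * g x)"
proof -
  obtain K where K: "compact K" "K \<subseteq> \<Omega>" "\<And>x. x \<notin> K \<Longrightarrow> g x = 0"
    using compactly_supported_inE[OF g(2)] by metis
  have gg0: "grad g x = 0" if "x \<notin> K" for x using grad_eq_0_outside K(1,3) that compact_imp_closed by blast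
  then have g0: "partial_deriv i g x = 0" if "x \<notin> K" for x using that by (simp add: grad_def vec_eq_iff)
  have c: "continuous_on UNIV f" "continuous_on UNIV g" "continuous_on UNIV (partial_deriv i f)" "continuous_on UNIV (partial_deriv i g)"
    using f g(1) C1D(3)[OF f] C1D(3)[OF g(1)] by auto
  have c1: "continuous_on UNIV (\<lambda>x. f x * partial_deriv i g x)" "continuous_on UNIV (\<lambda>x. partial_deriv i f x * g x)"
    using c by (intro continuous_intros; simp)+
  have "integrable lborel (\<lambda>x. f x * partial_deriv i g x)" "integrable lborel (\<lambda>x. partial_deriv i f x * g x)"
    using c1 K g0 by (auto intro!: integrable_continuous_compact_support[of _ K])
  then have "(LINT x|lborel. f x * partial_deriv i g x) + (LINT x|lborel. partial_deriv i f x * g x)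
     = (LINT x|lborel. f x * partial_deriv i g x + partial_deriv i f x * g x)" by simp
  also have "\<dots> = (LINT x|lborel. partial_deriv i (\<lambda>x. f x * g x) x)"
    using grad_mult(2)[OF f g(1)] by (simp add: grad_def[abs_def] fun_eq_iff vec_eq_iff mult.commute)
  also have "\<dots> = 0"
    using K by (intro integral_partial_deriv_eq_0[OF grad_mult(1)[OF f g(1)] K(1)]) auto
  finally have "(LINT x|lborel. f x * partial_deriv i g x) = - (LINT x|lborel. partial_deriv i f x * g x)" by simp
  moreover have "(LINT x|lebesgue_on \<Omega>. f x * partial_deriv i g x) = (LINT x|lborel. f x * partial_deriv i g x)"
    using K(2) g0 by (intro integral_lebesgue_on_eq_lborel \<Omega> borel_measurable_continuous_onI c1) auto
  moreover have "(LINT x|lebesgue_on \<Omega>. partial_deriv i f x * g x) = (LINT x|lborel. partial_deriv i f x * g x)"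
    using K by (intro integral_lebesgue_on_eq_lborel \<Omega> borel_measurable_continuous_onI c1) auto
  ultimately show ?thesis by simp
qed

subsection \<open>The fundamental lemma of the calculus of variations\<close>

text \<open>Multiplying by a large \<open>j\<close> before applying \<open>bump\<close> pushes every
  positive value to \<open>1\<close> and keeps \<open>0\<close>: a nonnegative function is turned
  into approximations of the indicator of the set where it is positive.\<close>

lemma bump_scaled_tendsto:
  assumes "p > 0"
  shows "(\<lambda>j. bump (real j * p)) \<longlonglongrightarrow> 1"
proof -
  have "(\<lambda>j. exp (- (1 / p) * (1 / real j))) \<longlonglongrightarrow> exp (- (1 / p) * 0)"
    by (intro tendsto_intros lim_1_over_n)
  then have "(\<lambda>j. exp (- (1 / p) * (1 / real j))) \<longlonglongrightarrow> 1" by simp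
  then show ?thesis
    by (rule Lim_transform_eventually)
       (use assms in \<open>auto simp: bump_def field_simps eventually_sequentially intro!: exI[of _ 1]\<close>)
qed

text \<open>The product \<open>p\<close> of one-dimensional bumps is positive exactly on the open
  box. Hence the functions \<open>bump (real j * p x)\<close> are test functions, bounded by
  \<open>1\<close>, that converge to the indicator of the box.\<close>

lemma set_integral_box_eq_0:
  fixes G :: "real ^ 'n::finite \<Rightarrow> real"
  assumes \<Omega>: "\<Omega> \<in> sets lebesgue" and G: "G locally_integrable_on \<Omega>" and ab: "cbox a b \<subseteq> \<Omega>"
    and 0: "\<And>\<phi>. test_function \<Omega> \<phi> \<Longrightarrow> (LINT x|lebesgue_on \<Omega>. G x * \<phi> x) = 0"
  shows "(LINT x|lebesgue. indicator (box a b) x * G x) = 0"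
proof -
  define p where "p x = (\<Prod>i\<in>UNIV. bump (x $ i - a $ i) * bump (b $ i - x $ i))" for x
  define \<phi> where "\<phi> j x = bump (real j * p x)" for j x
  have coord: "C_k k (\<lambda>x::real^'n. c * x $ i + d)" for k c i d
    by (intro C_k_add C_k_mult C_k_const C_k_coord)
  have pk: "C_k k p" for k
    unfolding p_def
  proof (intro C_k_prod C_k_mult C_k_compose[OF _ smooth_real_bump])
    show "C_k k (\<lambda>x. x $ i - a $ i)" "C_k k (\<lambda>x. b $ i - x $ i)" for i
      using coord[of k 1 i "- a $ i"] coord[of k "-1" i "b $ i"] by simp_all
  qed auto
  have \<phi>k: "C_k k (\<phi> j)" for k j
    unfolding \<phi>_def by (intro C_k_compose[OF _ smooth_real_bump] C_k_mult C_k_const pk)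
  have ppos: "p x > 0 \<longleftrightarrow> x \<in> box a b" for x
  proof
    assume "p x > 0"
    then have "p x \<noteq> 0" by simp
    then have "\<forall>i. bump (x $ i - a $ i) * bump (b $ i - x $ i) \<noteq> 0"
      unfolding p_def by simp
    then have "\<forall>i. bump (x $ i - a $ i) > 0 \<and> bump (b $ i - x $ i) > 0"
      by (auto simp: less_le bump_nonneg)
    then show "x \<in> box a b" by (auto simp: mem_box_cart bump_pos_iff)
  next
    assume "x \<in> box a b"
    then show "p x > 0" unfolding p_def
      by (intro prod_pos) (auto simp: mem_box_cart bump_pos_iff intro!: mult_pos_pos)
  qed
  have pnn: "p x \<ge> 0" for x unfolding p_def by (intro prod_nonneg) (auto simp: bump_nonneg)
  have \<phi>0: "\<phi> j x = 0" if "x \<notin> box a b" for j x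
    using that ppos[of x] pnn[of x] by (simp add: \<phi>_def bump_def)
  have sup: "compactly_supported_in \<Omega> (\<phi> j)" for j
  proof (rule compactly_supported_inI[OF compact_cbox ab])
    fix x assume "x \<notin> cbox a b"
    then have "x \<notin> box a b" using box_subset_cbox[of a b] by auto
    then show "\<phi> j x = 0" by (rule \<phi>0)
  qed
  have test: "test_function \<Omega> (\<phi> j)" for j using \<phi>k sup by (auto simp: test_function_def)
  have "set_integrable lebesgue (cbox a b) G" using G ab by (auto simp: locally_integrable_on_def)
  then have "set_integrable lebesgue (box a b) G" by (rule set_integrable_subset) (auto simp: box_subset_cbox)
  then have int: "integrable lebesgue (\<lambda>x. indicator (box a b) x * G x)" by (simp add: set_integrable_def)
  have "(\<lambda>j. LINT x|lebesgue. \<phi> j x * (indicator (box a b) x * G x)) \<longlonglongrightarrow> (LINT x|lebesgue. indicator (box a b) x * G x)"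
  proof (rule integral_dominated_convergence[where w="\<lambda>x. norm (indicator (box a b) x * G x)"])
    have [measurable]: "(\<lambda>x. indicator (box a b) x * G x) \<in> borel_measurable lebesgue" using int by auto
    then show "(\<lambda>x. indicator (box a b) x * G x) \<in> borel_measurable lebesgue" .
    have "continuous_on UNIV (\<phi> j)" for j using \<phi>k[of 0 j] by simp
    then have [measurable]: "\<phi> j \<in> borel_measurable lebesgue" for j
      by (intro measurable_completion) (auto intro: borel_measurable_continuous_onI)
    show "(\<lambda>x. \<phi> j x * (indicator (box a b) x * G x)) \<in> borel_measurable lebesgue" for j by measurable
    show "integrable lebesgue (\<lambda>x. norm (indicator (box a b) x * G x))" using int by (rule integrable_norm)
    show "AE x in lebesgue. norm (\<phi> j x * (indicator (box a b) x * G x)) \<le> norm (indicator (box a b) x * G x)" for j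
    proof (rule AE_I2)
      fix x
      have "\<bar>\<phi> j x\<bar> \<le> 1" by (simp add: \<phi>_def bump_nonneg bump_le_1)
      then show "norm (\<phi> j x * (indicator (box a b) x * G x)) \<le> norm (indicator (box a b) x * G x)"
        unfolding norm_mult by (simp add: mult_left_le_one_le)
    qed
    show "AE x in lebesgue. (\<lambda>j. \<phi> j x * (indicator (box a b) x * G x)) \<longlonglongrightarrow> indicator (box a b) x * G x"
    proof (rule AE_I2)
      fix x
      show "(\<lambda>j. \<phi> j x * (indicator (box a b) x * G x)) \<longlonglongrightarrow> indicator (box a b) x * G x"
      proof (cases "x \<in> box a b")
        case True
        then have "(\<lambda>j. \<phi> j x) \<longlonglongrightarrow> 1" unfolding \<phi>_def by (intro bump_scaled_tendsto) (simp add: ppos)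
        from tendsto_mult_right[OF this, of "indicator (box a b) x * G x"] show ?thesis by simp
      qed auto
    qed
  qed
  moreover have "(LINT x|lebesgue. \<phi> j x * (indicator (box a b) x * G x)) = 0" for j
  proof -
    have "(\<lambda>x. \<phi> j x * (indicator (box a b) x * G x)) = (\<lambda>x. indicator \<Omega> x *\<^sub>R (G x * \<phi> j x))"
      proof
      fix x
      show "\<phi> j x * (indicator (box a b) x * G x) = indicator \<Omega> x *\<^sub>R (G x * \<phi> j x)"
        using \<phi>0[of x j] ab box_subset_cbox[of a b] by (cases "x \<in> box a b") (auto simp: indicator_def subset_iff)
    qed
    then show ?thesis using 0[OF test[of j]] \<Omega> by (simp add: integral_restrict_space)
  qed
  ultimately show ?thesis by (simp add: LIMSEQ_const_iff)
qed

text \<open>Positive and negative part of \<open>g\<close> are the densities of two finite measures.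
  These agree on open boxes, which are stable under intersection and generate the Borel sets, so
  they coincide.\<close>

lemma AE_eq_0_if_box_integrals_0:
  fixes g :: "'a::euclidean_space \<Rightarrow> real"
  assumes g: "integrable lborel g" and 0: "\<And>a b. (LINT x|lborel. indicator (box a b) x * g x) = 0"
  shows "AE x in lborel. g x = 0"
proof -
  have [measurable]: "g \<in> borel_measurable borel" using g by auto
  let ?M1 = "density lborel (\<lambda>x. ennreal (g x))" and ?M2 = "density lborel (\<lambda>x. ennreal (- g x))"
  have fin: "(\<integral>\<^sup>+x. ennreal (g x) \<partial>lborel) \<noteq> \<infinity>"
    using g by (auto simp: real_integrable_def)
  have "?M1 = ?M2"
  proof (rule measure_eqI_generator_eq[where \<Omega>=UNIV and E="range (\<lambda>(a,b). box a b)" and A="\<lambda>n. box (- (real n *\<^sub>R One)) (real n *\<^sub>R One)"])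
    show "Int_stable (range (\<lambda>(a, b). box a b :: 'a set))"
      by (auto simp: Int_stable_def Int_interval box_Int_box)
    show "emeasure ?M1 X = emeasure ?M2 X" if X: "X \<in> range (\<lambda>(a,b). box a b)" for X
    proof -
      from X obtain a b where X: "X = box a b" by auto
      let ?h = "\<lambda>x. indicator X x * g x"
      have h: "integrable lborel ?h" using integrable_real_mult_indicator[OF _ g, of X] unfolding X by (simp add: mult.commute)
      have "enn2real (\<integral>\<^sup>+x. ennreal (?h x) \<partial>lborel) = enn2real (\<integral>\<^sup>+x. ennreal (- ?h x) \<partial>lborel)"
        using 0[of a b] real_lebesgue_integral_def[OF h] by (simp add: X)
      moreover have "ennreal (enn2real (\<integral>\<^sup>+x. ennreal (?h x) \<partial>lborel)) = (\<integral>\<^sup>+x. ennreal (?h x) \<partial>lborel)"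
        "ennreal (enn2real (\<integral>\<^sup>+x. ennreal (- ?h x) \<partial>lborel)) = (\<integral>\<^sup>+x. ennreal (- ?h x) \<partial>lborel)"
        using h unfolding real_integrable_def by (auto intro!: ennreal_enn2real simp: less_top)
      ultimately have "(\<integral>\<^sup>+x. ennreal (?h x) \<partial>lborel) = (\<integral>\<^sup>+x. ennreal (- ?h x) \<partial>lborel)"
        by metis
      moreover have "(\<integral>\<^sup>+x. ennreal (g x) * indicator X x \<partial>lborel) = (\<integral>\<^sup>+x. ennreal (?h x) \<partial>lborel)"
        "(\<integral>\<^sup>+x. ennreal (- g x) * indicator X x \<partial>lborel) = (\<integral>\<^sup>+x. ennreal (- ?h x) \<partial>lborel)"
        by (auto intro!: nn_integral_cong simp: indicator_def)
      ultimately show ?thesis using X by (simp add: emeasure_density)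
    qed
    show "emeasure ?M1 (box (- (real n *\<^sub>R One)) (real n *\<^sub>R One)) \<noteq> \<infinity>" for n
    proof -
      have "emeasure ?M1 (box (- (real n *\<^sub>R One)) (real n *\<^sub>R One)) \<le> emeasure ?M1 UNIV"
        by (intro emeasure_mono) auto
      also have "\<dots> < \<infinity>" using fin by (simp add: emeasure_density less_top)
      finally show ?thesis by simp
    qed
  qed (auto simp: borel_eq_box UN_box_eq_UNIV)
  then have "AE x in lborel. ennreal (g x) = ennreal (- g x)"
    using fin by (subst (asm) finite_density_unique) auto
  \<comment> \<open>\<open>ennreal\<close> cuts negative numbers off at \<open>0\<close>, so the
    equation says that the positive and the negative part of \<open>g x\<close> agree, which forces
    both to vanish.\<close>
  then show ?thesis
  proof eventually_elim
    case (elim x)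
    then show ?case by (cases "g x \<ge> 0") (auto simp: ennreal_neg dest: sym)
  qed
qed

lemma fundamental_lemma:
  fixes G :: "real ^ 'n::finite \<Rightarrow> real"
  assumes \<Omega>: "open \<Omega>" and G: "G locally_integrable_on \<Omega>"
    and 0: "\<And>\<phi>. test_function \<Omega> \<phi> \<Longrightarrow> (LINT x|lebesgue_on \<Omega>. G x * \<phi> x) = 0"
  shows "AE x in lebesgue_on \<Omega>. G x = 0"
proof -
  have \<Omega>l: "\<Omega> \<in> sets lebesgue" using \<Omega> by auto
  have box: "AE x in lebesgue. x \<in> box a b \<longrightarrow> G x = 0" if ab: "cbox a b \<subseteq> \<Omega>" for a b
  proof -
    let ?g = "\<lambda>x. indicator (box a b) x * G x"
    have "set_integrable lebesgue (cbox a b) G" using G ab by (auto simp: locally_integrable_on_def)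
    then have "set_integrable lebesgue (box a b) G" by (rule set_integrable_subset) (auto simp: box_subset_cbox)
    then have int: "integrable lebesgue ?g" by (simp add: set_integrable_def)
    \<comment> \<open>\<open>G\<close> is only Lebesgue measurable, while the comparison of measures
      takes place on Borel sets; hence the passage to a Borel representative.\<close>
    then obtain g' where g': "g' \<in> borel_measurable lborel" "AE x in lborel. ?g x = g' x"
      using completion_ex_borel_measurable_real[of ?g lborel] by auto
    have ae: "AE x in lebesgue. ?g x = g' x" using g'(2) by (rule AE_completion)
    have "integrable lebesgue g'"
      using g'(1) ae by (intro integrable_cong_AE_imp[OF int]) (auto intro: measurable_completion)
    then have i': "integrable lborel g'" using g'(1) by (simp add: integrable_completion)
    have "AE x in lborel. g' x = 0"
    proof (rule AE_eq_0_if_box_integrals_0[OF i'])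
      fix c d
      \<comment> \<open>The boxes of the uniqueness lemma range over the whole space; intersecting
        them with \<open>box a b\<close> brings them into \<open>\<Omega>\<close>.\<close>
      obtain e f where ef: "box c d \<inter> box a b = box e f" by (auto simp: box_Int_box)
      have "(LINT x|lborel. indicator (box c d) x * g' x) = (LINT x|lebesgue. indicator (box c d) x * g' x)"
        using g'(1) by (subst integral_completion) auto
      also have "\<dots> = (LINT x|lebesgue. indicator (box c d) x * ?g x)"
      proof (rule integral_cong_AE)
        have m: "g' \<in> borel_measurable lebesgue" using g'(1) by (auto intro: measurable_completion)
        show "(\<lambda>x. indicator (box c d) x * g' x) \<in> borel_measurable lebesgue"
          by (rule borel_measurable_times[OF borel_measurable_indicator m]) auto
        show "(\<lambda>x. indicator (box c d) x * ?g x) \<in> borel_measurable lebesgue"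
          by (rule borel_measurable_times[OF borel_measurable_indicator borel_measurable_integrable[OF int]]) auto
        show "AE x in lebesgue. indicator (box c d) x * g' x = indicator (box c d) x * ?g x"
          using ae by eventually_elim simp
      qed
      also have "\<dots> = (LINT x|lebesgue. indicator (box e f) x * G x)"
        unfolding ef[symmetric] by (simp add: indicator_inter_arith mult.assoc)
      also have "\<dots> = 0"
      proof (cases "box e f = {}")
        case False
        then have "cbox e f = closure (box e f)" by (simp add: closure_box)
        also have "\<dots> \<subseteq> cbox a b"
          using ef box_subset_cbox[of a b] by (intro closure_minimal) auto
        finally have "cbox e f \<subseteq> cbox a b" .
        then show ?thesis using ab by (intro set_integral_box_eq_0[OF \<Omega>l G _ 0]) auto
      qed simp
      finally show "(LINT x|lborel. indicator (box c d) x * g' x) = 0" .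
    qed
    then have "AE x in lebesgue. g' x = 0" by (rule AE_completion)
    with ae show ?thesis by eventually_elim (auto simp: indicator_def split: if_splits)
  qed
  \<comment> \<open>Countably many closed boxes exhaust \<open>\<Omega>\<close>, and their faces are
    null sets.\<close>
  obtain D where D: "countable D" "D \<subseteq> Pow \<Omega>" "\<And>X. X \<in> D \<Longrightarrow> \<exists>a b. X = cbox a b" "\<Union>D = \<Omega>"
    using open_countable_Union_open_cbox[OF \<Omega>] by metis
  have "AE x in lebesgue. \<forall>X\<in>D. x \<in> X \<longrightarrow> G x = 0"
  proof (subst AE_ball_countable[OF D(1)], rule ballI)
    fix X assume "X \<in> D"
    then obtain a b where X: "X = cbox a b" "cbox a b \<subseteq> \<Omega>" using D by blast
    have "negligible (cbox a b - box a b)" by (rule negligible_frontier_interval)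
    then have "AE x in lebesgue. x \<notin> cbox a b - box a b"
      unfolding negligible_iff_null_sets by (rule AE_not_in)
    with box[OF X(2)] show "AE x in lebesgue. x \<in> X \<longrightarrow> G x = 0"
      unfolding X(1) by eventually_elim auto
  qed
  then have "AE x in lebesgue. x \<in> \<Omega> \<longrightarrow> G x = 0"
    by eventually_elim (use D(4) in blast)
  then show ?thesis using \<Omega>l by (simp add: AE_restrict_space_iff)
qed

subsection \<open>Sobolev functions with zero boundary values\<close>

text \<open>\<open>weak_grad\<close> is an arbitrary choice among functions equal almost everywhere,
  which is awkward in limits and algebraic identities. The gradient is therefore carried along as a
  separate argument; \<open>H10_pair_H1_0\<close> and \<open>H1_0_pair\<close> translate to and from
  \<open>H1_0\<close>.\<close>

definition H10_pair ::
    "(real ^ 'n::finite) set \<Rightarrow> (real ^ 'n \<Rightarrow> real) \<Rightarrow> (real ^ 'n \<Rightarrow> real ^ 'n) \<Rightarrow> bool" where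
  "H10_pair \<Omega> u G \<longleftrightarrow> (\<exists>\<phi>. (\<forall>k. test_function \<Omega> (\<phi> k)) \<and>
     L2_tendsto \<Omega> \<phi> u \<and> L2_tendsto \<Omega> (\<lambda>k. grad (\<phi> k)) G)"

lemma H10_pairD: "H10_pair \<Omega> u G \<Longrightarrow> u \<in> L2 \<Omega>" "H10_pair \<Omega> u G \<Longrightarrow> G \<in> L2 \<Omega>"
  by (auto simp: H10_pair_def L2_tendsto_def)

lemma test_function_diff:
  assumes "test_function \<Omega> \<phi>" "test_function \<Omega> \<psi>"
  shows "test_function \<Omega> (\<lambda>x. \<phi> x - \<psi> x)"
proof -
  obtain K L where KL: "compact K" "K \<subseteq> \<Omega>" "\<And>x. x \<notin> K \<Longrightarrow> \<phi> x = 0" "compact L" "L \<subseteq> \<Omega>" "\<And>x. x \<notin> L \<Longrightarrow> \<psi> x = 0"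
    using assms compactly_supported_inE unfolding test_function_def by metis
  have "C_k k (\<lambda>x. \<phi> x + (-1) * \<psi> x)" for k
    using assms by (intro C_k_add C_k_mult C_k_const) (auto simp: test_function_def)
  moreover have "compactly_supported_in \<Omega> (\<lambda>x. \<phi> x - \<psi> x)"
    using KL by (intro compactly_supported_inI[of "K \<union> L"]) auto
  ultimately show ?thesis by (simp add: test_function_def)
qed

lemma test_function_mult:
  assumes "test_function \<Omega> \<phi>" "test_function \<Omega> \<psi>"
  shows "test_function \<Omega> (\<lambda>x. \<phi> x * \<psi> x)"
proof -
  obtain K where K: "compact K" "K \<subseteq> \<Omega>" "\<And>x. x \<notin> K \<Longrightarrow> \<phi> x = 0"
    using assms compactly_supported_inE unfolding test_function_def by metis
  then have "compactly_supported_in \<Omega> (\<lambda>x. \<phi> x * \<psi> x)"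
    by (intro compactly_supported_inI[OF K(1,2)]) auto
  then show ?thesis using assms by (auto simp: test_function_def intro: C_k_mult)
qed

lemma test_function_compose:
  assumes "test_function \<Omega> \<phi>" "smooth_real F" "F 0 = 0"
  shows "test_function \<Omega> (\<lambda>x. F (\<phi> x))"
proof -
  obtain K where K: "compact K" "K \<subseteq> \<Omega>" "\<And>x. x \<notin> K \<Longrightarrow> \<phi> x = 0"
    using assms compactly_supported_inE unfolding test_function_def by metis
  then have "compactly_supported_in \<Omega> (\<lambda>x. F (\<phi> x))"
    using assms(3) by (intro compactly_supported_inI[OF K(1,2)]) auto
  then show ?thesis using assms by (auto simp: test_function_def intro: C_k_compose)
qed

lemma grad_diff:
  assumes "C_k 1 f" "C_k 1 g"
  shows "grad (\<lambda>x. f x - g x) = (\<lambda>x. grad f x - grad g x)"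
proof
  fix x
  show "grad (\<lambda>x. f x - g x) x = grad f x - grad g x"
    using has_derivative_diff[OF C1D(1)[OF assms(1)] C1D(1)[OF assms(2)]]
    by (intro grad_eq) (simp add: inner_diff_left)
qed

lemma test_function_bounded:
  assumes "test_function \<Omega> \<phi>"
  obtains B where "B > 0" "\<And>x. \<bar>\<phi> x\<bar> \<le> B" "\<And>x. norm (grad \<phi> x) \<le> B"
proof -
  obtain K where K: "compact K" "K \<subseteq> \<Omega>" "\<And>x. x \<notin> K \<Longrightarrow> \<phi> x = 0"
    using assms compactly_supported_inE unfolding test_function_def by metis
  note C1 = test_function_C1[OF assms]
  have g0: "grad \<phi> x = 0" if "x \<notin> K" for x using grad_eq_0_outside[OF compact_imp_closed[OF K(1)] K(3) that] .
  obtain B1 where B1: "B1 > 0" "\<And>x. norm (\<phi> x) \<le> B1" using bounded_continuous_compact_support[OF C1D(3)[OF C1] K(1,3)] by metis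
  obtain B2 where B2: "B2 > 0" "\<And>x. norm (grad \<phi> x) \<le> B2" using bounded_continuous_compact_support[OF C1D(2)[OF C1] K(1) g0] by metis
  show ?thesis
  proof (rule that[of "B1 + B2"])
    show "\<bar>\<phi> x\<bar> \<le> B1 + B2" "norm (grad \<phi> x) \<le> B1 + B2" for x
      using B1(1) B1(2)[of x] B2(1) B2(2)[of x] by auto
  qed (use B1 B2 in auto)
qed

lemma grad_measurable_lebesgue_on:
  assumes "C_k 1 \<phi>"
  shows "\<phi> \<in> borel_measurable (lebesgue_on \<Omega>)" "grad \<phi> \<in> borel_measurable (lebesgue_on \<Omega>)"
  using C1D(2,3)[OF assms]
  by (auto intro!: measurable_restrict_space1 measurable_completion borel_measurable_continuous_onI)

text \<open>Completeness of Lebesgue measure is the reason. It serves to show that the chosen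
  representative \<open>weak_grad\<close> is measurable.\<close>

lemma measurable_lebesgue_on_cong_AE:
  fixes f g :: "real ^ 'n::finite \<Rightarrow> 'b::euclidean_space"
  assumes \<Omega>: "\<Omega> \<in> sets lebesgue" and f: "f \<in> borel_measurable (lebesgue_on \<Omega>)" and ae: "AE x in lebesgue_on \<Omega>. f x = g x"
  shows "g \<in> borel_measurable (lebesgue_on \<Omega>)"
proof -
  have "(\<lambda>x. if x \<in> \<Omega> then f x else 0) \<in> borel_measurable lebesgue"
    using f \<Omega> by (simp add: borel_measurable_if)
  moreover have "AE x in lebesgue. (if x \<in> \<Omega> then f x else 0) = (if x \<in> \<Omega> then g x else 0)"
    using ae \<Omega> by (simp add: AE_restrict_space_iff)
  ultimately have "(\<lambda>x. if x \<in> \<Omega> then g x else 0) \<in> borel_measurable lebesgue"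
    by (rule borel_measurable_AE)
  then show ?thesis using \<Omega> by (simp add: borel_measurable_if)
qed

locale bounded_open =
  fixes \<Omega> :: "(real ^ 'n::finite) set"
  assumes open_\<Omega>: "open \<Omega>" and bounded_\<Omega>: "bounded \<Omega>"
begin

lemma \<Omega>_sets [simp]: "\<Omega> \<in> sets lebesgue"
  using open_\<Omega> by auto

lemma \<Omega>_lmeasurable: "\<Omega> \<in> lmeasurable"
  by (rule bounded_set_imp_lmeasurable[OF bounded_\<Omega> \<Omega>_sets])

sublocale finite_measure "lebesgue_on \<Omega>"
  using \<Omega>_lmeasurable by (rule finite_measure_lebesgue_on)

lemma bounded_in_L2:
  assumes "g \<in> borel_measurable (lebesgue_on \<Omega>)" "AE x in lebesgue_on \<Omega>. norm (g x) \<le> K"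
  shows "g \<in> L2 \<Omega>"
proof -
  have "integrable (lebesgue_on \<Omega>) (\<lambda>x. (norm (g x))\<^sup>2)"
    by (rule integrable_const_bound[of _ "K\<^sup>2"])
       (use assms in \<open>auto elim!: eventually_mono intro!: power_mono\<close>)
  then show ?thesis using assms by (simp add: L2_def)
qed

lemma L2_integrable:
  assumes "g \<in> L2 \<Omega>"
  shows "integrable (lebesgue_on \<Omega>) g"
proof (rule Bochner_Integration.integrable_bound[of _ "\<lambda>x. 1 + (norm (g x))\<^sup>2"])
  show "integrable (lebesgue_on \<Omega>) (\<lambda>x. 1 + (norm (g x))\<^sup>2)" using L2D(2)[OF assms] by simp
  have "t \<le> 1 + t\<^sup>2" for t :: real using sum_power2_ge_zero[of "t - 1/2" 0] by (simp add: power2_eq_square algebra_simps)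
  then show "AE x in lebesgue_on \<Omega>. norm (g x) \<le> norm (1 + (norm (g x))\<^sup>2)" by simp
qed (use L2D(1)[OF assms] in auto)

lemma L2_locally_integrable:
  assumes "g \<in> L2 \<Omega>"
  shows "g locally_integrable_on \<Omega>"
  unfolding locally_integrable_on_def
proof (intro allI impI)
  fix K assume K: "compact K \<and> K \<subseteq> \<Omega>"
  have "set_integrable lebesgue \<Omega> g"
    using L2_integrable[OF assms] by (simp add: set_integrable_def integrable_restrict_space)
  then show "set_integrable lebesgue K g"
    by (rule set_integrable_subset) (use K in \<open>auto intro!: lmeasurable_compact fmeasurableD\<close>)
qed

lemma locally_integrable_times_test:
  fixes g :: "real ^ 'n \<Rightarrow> real"
  assumes g: "g locally_integrable_on \<Omega>" and \<phi>: "test_function \<Omega> \<phi>"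
  shows "integrable (lebesgue_on \<Omega>) (\<lambda>x. g x * \<phi> x)"
proof -
  obtain K where K: "compact K" "K \<subseteq> \<Omega>" "\<And>x. x \<notin> K \<Longrightarrow> \<phi> x = 0"
    using \<phi> compactly_supported_inE unfolding test_function_def by metis
  obtain B where B: "B > 0" "\<And>x. \<bar>\<phi> x\<bar> \<le> B" using test_function_bounded[OF \<phi>] by metis
  have "integrable lebesgue (\<lambda>x. indicator K x *\<^sub>R g x)"
    using g K by (auto simp: locally_integrable_on_def set_integrable_def)
  then have "integrable lebesgue (\<lambda>x. \<phi> x * (indicator K x *\<^sub>R g x))"
  proof (rule Bochner_Integration.integrable_bound[OF integrable_mult_right[of B]])
    show "AE x in lebesgue. norm (\<phi> x * (indicator K x *\<^sub>R g x)) \<le> norm (B * (indicator K x *\<^sub>R g x))"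
      using B by (auto simp: abs_mult intro!: mult_right_mono)
    have "\<phi> \<in> borel_measurable lebesgue" using C1D(3)[OF test_function_C1[OF \<phi>]]
      by (auto intro!: measurable_completion borel_measurable_continuous_onI)
    then show "(\<lambda>x. \<phi> x * (indicator K x *\<^sub>R g x)) \<in> borel_measurable lebesgue"
      by (rule borel_measurable_times[OF _ borel_measurable_integrable]) fact
  qed
  moreover have "(\<lambda>x. \<phi> x * (indicator K x *\<^sub>R g x)) = (\<lambda>x. indicator \<Omega> x *\<^sub>R (g x * \<phi> x))"
  proof
    fix x show "\<phi> x * (indicator K x *\<^sub>R g x) = indicator \<Omega> x *\<^sub>R (g x * \<phi> x)"
      using K(2) K(3)[of x] by (cases "x \<in> K") auto
  qed
  ultimately show ?thesis by (simp add: integrable_restrict_space)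
qed

lemma locally_integrable_component:
  assumes "g locally_integrable_on \<Omega>"
  shows "(\<lambda>x. g x $ i) locally_integrable_on \<Omega>"
  unfolding locally_integrable_on_def set_integrable_def
proof (intro allI impI)
  fix K assume "compact K \<and> K \<subseteq> \<Omega>"
  then have "integrable lebesgue (\<lambda>x. indicator K x *\<^sub>R g x)"
    using assms by (auto simp: locally_integrable_on_def set_integrable_def)
  from integrable_bounded_linear[OF bounded_linear_vec_nth this, of i]
  show "integrable lebesgue (\<lambda>x. indicator K x *\<^sub>R g x $ i)" by simp
qed

lemma weak_gradient_unique:
  assumes g: "is_weak_gradient \<Omega> u g" and g': "is_weak_gradient \<Omega> u g'"
  shows "AE x in lebesgue_on \<Omega>. g x = g' x"
proof -
  have "AE x in lebesgue_on \<Omega>. \<forall>i\<in>UNIV. g x $ i - g' x $ i = 0"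
  proof (subst AE_ball_countable, simp, rule ballI)
    fix i :: 'n
    note loc = locally_integrable_component[of g i] locally_integrable_component[of g' i]
    have gl: "(\<lambda>x. g x $ i) locally_integrable_on \<Omega>" "(\<lambda>x. g' x $ i) locally_integrable_on \<Omega>"
      using g g' loc by (auto simp: is_weak_gradient_def)
    show "AE x in lebesgue_on \<Omega>. g x $ i - g' x $ i = 0"
    proof (rule fundamental_lemma[OF open_\<Omega>])
      show "(\<lambda>x. g x $ i - g' x $ i) locally_integrable_on \<Omega>"
        using gl by (auto simp: locally_integrable_on_def intro: set_integral_diff)
      fix \<phi> assume \<phi>: "test_function \<Omega> \<phi>"
      have "(LINT x|lebesgue_on \<Omega>. g x $ i * \<phi> x) = (LINT x|lebesgue_on \<Omega>. g' x $ i * \<phi> x)"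
        using g g' \<phi> by (auto simp: is_weak_gradient_def)
      then show "(LINT x|lebesgue_on \<Omega>. (g x $ i - g' x $ i) * \<phi> x) = 0"
        using locally_integrable_times_test[OF gl(1) \<phi>] locally_integrable_times_test[OF gl(2) \<phi>]
        by (simp add: left_diff_distrib)
    qed
  qed
  then show ?thesis by eventually_elim (simp add: vec_eq_iff)
qed

lemma weak_grad_AE:
  assumes "is_weak_gradient \<Omega> u g"
  shows "AE x in lebesgue_on \<Omega>. weak_grad \<Omega> u x = g x"
  using weak_gradient_unique[OF someI[of "is_weak_gradient \<Omega> u", OF assms] assms] by (simp add: weak_grad_def)

lemma weak_grad_L2:
  assumes "is_weak_gradient \<Omega> u g" "g \<in> L2 \<Omega>"
  shows "weak_grad \<Omega> u \<in> L2 \<Omega>"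
proof -
  have ae: "AE x in lebesgue_on \<Omega>. g x = weak_grad \<Omega> u x" using weak_grad_AE[OF assms(1)] by eventually_elim simp
  show ?thesis
    using measurable_lebesgue_on_cong_AE[OF \<Omega>_sets L2D(1)[OF assms(2)] ae] L2_cong_AE[OF assms(2) _ ae] by blast
qed

lemma test_function_L2:
  assumes "test_function \<Omega> \<phi>"
  shows "\<phi> \<in> L2 \<Omega>" "grad \<phi> \<in> L2 \<Omega>" "partial_deriv i \<phi> \<in> L2 \<Omega>"
proof -
  obtain B where B: "B > 0" "\<And>x. \<bar>\<phi> x\<bar> \<le> B" "\<And>x. norm (grad \<phi> x) \<le> B" using test_function_bounded[OF assms] by metis
  note m = grad_measurable_lebesgue_on[OF test_function_C1[OF assms], of \<Omega>]
  show "\<phi> \<in> L2 \<Omega>" using B m by (intro bounded_in_L2[of _ B]) auto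
  show g: "grad \<phi> \<in> L2 \<Omega>" using B m by (intro bounded_in_L2[of _ B]) auto
  have p: "partial_deriv i \<phi> = (\<lambda>x. grad \<phi> x $ i)" by (simp add: grad_def)
  have "(\<lambda>x. grad \<phi> x \<bullet> axis i 1) \<in> borel_measurable (lebesgue_on \<Omega>)" using m(2) by (intro borel_measurable_inner) auto
  then show "partial_deriv i \<phi> \<in> L2 \<Omega>"
    unfolding p by (intro L2_bound[OF g, of _ 1]) (auto simp: inner_axis component_le_norm_cart)
qed

lemma test_function_weak_gradient:
  assumes "test_function \<Omega> \<phi>"
  shows "is_weak_gradient \<Omega> \<phi> (grad \<phi>)"
  unfolding is_weak_gradient_def
proof (intro conjI allI impI)
  show "\<phi> locally_integrable_on \<Omega>" "grad \<phi> locally_integrable_on \<Omega>"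
    using test_function_L2[OF assms] by (auto intro: L2_locally_integrable)
  fix \<psi> i assume \<psi>: "test_function \<Omega> \<psi>"
  show "(LINT x|lebesgue_on \<Omega>. \<phi> x * partial_deriv i \<psi> x) = - (LINT x|lebesgue_on \<Omega>. grad \<phi> x $ i * \<psi> x)"
    using integral_by_parts[OF \<Omega>_sets test_function_C1[OF assms] test_function_C1[OF \<psi>]] \<psi>
    by (simp add: grad_def test_function_def)
qed

lemma weak_gradient_diff:
  assumes u: "is_weak_gradient \<Omega> u g" "u \<in> L2 \<Omega>" "g \<in> L2 \<Omega>"
    and v: "is_weak_gradient \<Omega> v h" "v \<in> L2 \<Omega>" "h \<in> L2 \<Omega>"
  shows "is_weak_gradient \<Omega> (\<lambda>x. u x - v x) (\<lambda>x. g x - h x)"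
  unfolding is_weak_gradient_def
proof (intro conjI allI impI)
  show "(\<lambda>x. u x - v x) locally_integrable_on \<Omega>" "(\<lambda>x. g x - h x) locally_integrable_on \<Omega>"
    using u v by (auto intro: L2_locally_integrable L2_diff)
  fix \<phi> i assume \<phi>: "test_function \<Omega> \<phi>"
  have 1: "integrable (lebesgue_on \<Omega>) (\<lambda>x. g x $ i * \<phi> x)" "integrable (lebesgue_on \<Omega>) (\<lambda>x. h x $ i * \<phi> x)"
    using L2_locally_integrable[OF u(3)] L2_locally_integrable[OF v(3)] \<phi>
    by (auto intro!: locally_integrable_times_test locally_integrable_component)
  have 2: "integrable (lebesgue_on \<Omega>) (\<lambda>x. u x * partial_deriv i \<phi> x)" "integrable (lebesgue_on \<Omega>) (\<lambda>x. v x * partial_deriv i \<phi> x)"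
    using u v test_function_L2(3)[OF \<phi>] by (auto intro!: L2_mult_integrable)
  show "(LINT x|lebesgue_on \<Omega>. (u x - v x) * partial_deriv i \<phi> x) = - (LINT x|lebesgue_on \<Omega>. (g x - h x) $ i * \<phi> x)"
    using u(1) v(1) \<phi> 1 2 by (simp add: is_weak_gradient_def left_diff_distrib)
qed

lemma H10_pair_weak_gradient:
  assumes "H10_pair \<Omega> u G"
  shows "is_weak_gradient \<Omega> u G"
  unfolding is_weak_gradient_def
proof (intro conjI allI impI)
  show "u locally_integrable_on \<Omega>" "G locally_integrable_on \<Omega>"
    using H10_pairD[OF assms] by (auto intro: L2_locally_integrable)
  fix \<psi> i assume \<psi>: "test_function \<Omega> \<psi>"
  obtain \<phi> where \<phi>: "\<And>k. test_function \<Omega> (\<phi> k)" "L2_tendsto \<Omega> \<phi> u" "L2_tendsto \<Omega> (\<lambda>k. grad (\<phi> k)) G"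
    using assms by (auto simp: H10_pair_def)
  have "(\<lambda>k. LINT x|lebesgue_on \<Omega>. \<phi> k x \<bullet> partial_deriv i \<psi> x) \<longlonglongrightarrow> (LINT x|lebesgue_on \<Omega>. u x \<bullet> partial_deriv i \<psi> x)"
    by (rule L2_tendsto_inner[OF \<phi>(2) test_function_L2(3)[OF \<psi>]])
  moreover have "(\<lambda>x. \<psi> x *\<^sub>R axis i 1 :: real ^ 'n) \<in> L2 \<Omega>"
    by (rule L2_bound[OF test_function_L2(1)[OF \<psi>], of _ 1])
       (use grad_measurable_lebesgue_on(1)[OF test_function_C1[OF \<psi>]] in \<open>auto simp: norm_axis_1 intro!: borel_measurable_scaleR\<close>)
  from L2_tendsto_inner[OF \<phi>(3) this]
  have "(\<lambda>k. LINT x|lebesgue_on \<Omega>. grad (\<phi> k) x $ i * \<psi> x) \<longlonglongrightarrow> (LINT x|lebesgue_on \<Omega>. G x $ i * \<psi> x)"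
    by (simp add: inner_axis mult.commute)
  then have "(\<lambda>k. - (LINT x|lebesgue_on \<Omega>. grad (\<phi> k) x $ i * \<psi> x)) \<longlonglongrightarrow> - (LINT x|lebesgue_on \<Omega>. G x $ i * \<psi> x)"
    by (rule tendsto_minus)
  moreover have "- (LINT x|lebesgue_on \<Omega>. grad (\<phi> k) x $ i * \<psi> x) = (LINT x|lebesgue_on \<Omega>. \<phi> k x \<bullet> partial_deriv i \<psi> x)" for k
    using test_function_weak_gradient[OF \<phi>(1)[of k]] \<psi> by (simp add: is_weak_gradient_def)
  ultimately show "(LINT x|lebesgue_on \<Omega>. u x * partial_deriv i \<psi> x) = - (LINT x|lebesgue_on \<Omega>. G x $ i * \<psi> x)"
    using LIMSEQ_unique by auto
qed

text \<open>The distance in \<open>H1_0\<close> involves \<open>weak_grad\<close> of the differences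
  \<open>u - \<phi> k\<close>; uniqueness of weak gradients identifies it almost everywhere with
  \<open>G - grad (\<phi> k)\<close>.\<close>

lemma H10_pair_H1_0:
  assumes "H10_pair \<Omega> u G"
  shows "u \<in> H1_0 \<Omega>" "AE x in lebesgue_on \<Omega>. weak_grad \<Omega> u x = G x"
proof -
  note wg = H10_pair_weak_gradient[OF assms] and L = H10_pairD[OF assms]
  show "AE x in lebesgue_on \<Omega>. weak_grad \<Omega> u x = G x" by (rule weak_grad_AE[OF wg])
  obtain \<phi> where \<phi>: "\<And>k. test_function \<Omega> (\<phi> k)" "L2_tendsto \<Omega> \<phi> u" "L2_tendsto \<Omega> (\<lambda>k. grad (\<phi> k)) G"
    using assms by (auto simp: H10_pair_def)
  have eq: "L2_norm \<Omega> (weak_grad \<Omega> (\<lambda>x. u x - \<phi> k x)) = L2_norm \<Omega> (\<lambda>x. G x - grad (\<phi> k) x)" for k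
  proof -
    note t = test_function_L2(1,2)[OF \<phi>(1)[of k]]
    note d = weak_gradient_diff[OF wg L test_function_weak_gradient[OF \<phi>(1)[of k]] t]
    show ?thesis
      using weak_grad_L2[OF d L2_diff[OF L(2) t(2)]] L2_diff[OF L(2) t(2)] weak_grad_AE[OF d]
      by (intro L2_norm_cong_AE) (auto dest: L2D)
  qed
  have "(\<lambda>k. sqrt ((L2_norm \<Omega> (\<lambda>x. \<phi> k x - u x))\<^sup>2 + (L2_norm \<Omega> (\<lambda>x. grad (\<phi> k) x - G x))\<^sup>2)) \<longlonglongrightarrow> sqrt (0\<^sup>2 + 0\<^sup>2)"
    using \<phi>(2,3) by (intro tendsto_intros) (auto simp: L2_tendsto_def)
  then have "(\<lambda>k. H1_norm \<Omega> (\<lambda>x. u x - \<phi> k x)) \<longlonglongrightarrow> 0"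
    by (simp add: H1_norm_def eq L2_norm_diff_commute[of \<Omega> u] L2_norm_diff_commute[of \<Omega> G])
  then show "u \<in> H1_0 \<Omega>" using L wg \<phi>(1) by (auto simp: H1_0_def H1_def)
qed

lemma H1_0_pair:
  assumes "u \<in> H1_0 \<Omega>"
  shows "H10_pair \<Omega> u (weak_grad \<Omega> u)"
proof -
  obtain g where g: "is_weak_gradient \<Omega> u g" "g \<in> L2 \<Omega>" and u: "u \<in> L2 \<Omega>"
    using assms by (auto simp: H1_0_def H1_def)
  obtain \<phi> where \<phi>: "\<And>k. test_function \<Omega> (\<phi> k)" "(\<lambda>k. H1_norm \<Omega> (\<lambda>x. u x - \<phi> k x)) \<longlonglongrightarrow> 0"
    using assms by (auto simp: H1_0_def)
  note G = weak_grad_L2[OF g]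
  have G': "is_weak_gradient \<Omega> u (weak_grad \<Omega> u)"
    unfolding weak_grad_def by (rule someI[of "is_weak_gradient \<Omega> u", OF g(1)])
  have eq: "L2_norm \<Omega> (weak_grad \<Omega> (\<lambda>x. u x - \<phi> k x)) = L2_norm \<Omega> (\<lambda>x. weak_grad \<Omega> u x - grad (\<phi> k) x)" for k
  proof -
    note t = test_function_L2(1,2)[OF \<phi>(1)[of k]]
    note d = weak_gradient_diff[OF G' u G test_function_weak_gradient[OF \<phi>(1)[of k]] t]
    show ?thesis
      using weak_grad_L2[OF d L2_diff[OF G t(2)]] L2_diff[OF G t(2)] weak_grad_AE[OF d]
      by (intro L2_norm_cong_AE) (auto dest: L2D)
  qed
  have le: "L2_norm \<Omega> (\<lambda>x. \<phi> k x - u x) \<le> H1_norm \<Omega> (\<lambda>x. u x - \<phi> k x)"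
    "L2_norm \<Omega> (\<lambda>x. grad (\<phi> k) x - weak_grad \<Omega> u x) \<le> H1_norm \<Omega> (\<lambda>x. u x - \<phi> k x)" for k
    unfolding H1_norm_def eq L2_norm_diff_commute[of \<Omega> u] L2_norm_diff_commute[of \<Omega> "weak_grad \<Omega> u"]
    by (auto intro!: real_le_rsqrt)
  show ?thesis unfolding H10_pair_def
    using \<phi> L2_tendstoI[OF u _ \<phi>(2) le(1)] L2_tendstoI[OF G _ \<phi>(2) le(2)] test_function_L2[OF \<phi>(1)] by blast
qed

lemma H10_pair_diff:
  assumes "H10_pair \<Omega> u G" "H10_pair \<Omega> v H"
  shows "H10_pair \<Omega> (\<lambda>x. u x - v x) (\<lambda>x. G x - H x)"
proof -
  obtain \<phi> where \<phi>: "\<And>k. test_function \<Omega> (\<phi> k)" "L2_tendsto \<Omega> \<phi> u" "L2_tendsto \<Omega> (\<lambda>k. grad (\<phi> k)) G"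
    using assms by (auto simp: H10_pair_def)
  obtain \<psi> where \<psi>: "\<And>k. test_function \<Omega> (\<psi> k)" "L2_tendsto \<Omega> \<psi> v" "L2_tendsto \<Omega> (\<lambda>k. grad (\<psi> k)) H"
    using assms by (auto simp: H10_pair_def)
  have "grad (\<lambda>x. \<phi> k x - \<psi> k x) = (\<lambda>x. grad (\<phi> k) x - grad (\<psi> k) x)" for k
    using \<phi> \<psi> by (intro grad_diff test_function_C1)
  then show ?thesis unfolding H10_pair_def
    using \<phi> \<psi> L2_tendsto_diff[OF \<phi>(2) \<psi>(2)] L2_tendsto_diff[OF \<phi>(3) \<psi>(3)]
    by (intro exI[of _ "\<lambda>k x. \<phi> k x - \<psi> k x"]) (auto intro: test_function_diff)
qed

lemma H10_pair_minus:
  assumes "H10_pair \<Omega> u G"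
  shows "H10_pair \<Omega> (\<lambda>x. - u x) (\<lambda>x. - G x)"
  using H10_pair_diff[OF H10_pair_diff[OF assms assms] assms] by simp

text \<open>The second factor is a test function because a product of two functions with gradients
  in \<open>L2\<close> need not have such a gradient; the product \<open>u e\<close> is reached
  later by approximating \<open>e\<close>.\<close>

lemma H10_pair_mult_test:
  assumes u: "H10_pair \<Omega> u G" and \<psi>: "test_function \<Omega> \<psi>"
  shows "H10_pair \<Omega> (\<lambda>x. u x * \<psi> x) (\<lambda>x. \<psi> x *\<^sub>R G x + u x *\<^sub>R grad \<psi> x)"
proof -
  obtain \<phi> where \<phi>: "\<And>k. test_function \<Omega> (\<phi> k)" "L2_tendsto \<Omega> \<phi> u" "L2_tendsto \<Omega> (\<lambda>k. grad (\<phi> k)) G"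
    using assms by (auto simp: H10_pair_def)
  note L = H10_pairD[OF u] test_function_L2[OF \<phi>(1)]
  obtain B where B: "B > 0" "\<And>x. \<bar>\<psi> x\<bar> \<le> B" "\<And>x. norm (grad \<psi> x) \<le> B" using test_function_bounded[OF \<psi>] by metis
  note m = grad_measurable_lebesgue_on[OF test_function_C1[OF \<psi>], of \<Omega>]
  have 1: "L2_tendsto \<Omega> (\<lambda>k x. \<psi> x *\<^sub>R \<phi> k x) (\<lambda>x. \<psi> x *\<^sub>R u x)" "L2_tendsto \<Omega> (\<lambda>k x. \<psi> x *\<^sub>R grad (\<phi> k) x) (\<lambda>x. \<psi> x *\<^sub>R G x)"
    using L2_tendsto_mult_bounded[OF \<phi>(2) m(1)] L2_tendsto_mult_bounded[OF \<phi>(3) m(1)] B by auto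
  have b: "AE x in lebesgue_on \<Omega>. norm (v x *\<^sub>R grad \<psi> x) \<le> B * norm (v x)" for v
    using B by (auto simp: mult.commute[of B] intro!: mult_left_mono)
  have 2: "L2_tendsto \<Omega> (\<lambda>k x. \<phi> k x *\<^sub>R grad \<psi> x) (\<lambda>x. u x *\<^sub>R grad \<psi> x)"
  proof (rule L2_tendstoI)
    show "(\<lambda>x. u x *\<^sub>R grad \<psi> x) \<in> L2 \<Omega>" using L m by (intro L2_bound[OF L(1) _ b]) (auto dest: L2D)
    show "(\<lambda>x. \<phi> k x *\<^sub>R grad \<psi> x) \<in> L2 \<Omega>" for k
      using L2D(1)[OF L(3)[of k]] m by (intro L2_bound[OF L(3) _ b]) auto
    show "(\<lambda>k. B * L2_norm \<Omega> (\<lambda>x. \<phi> k x - u x)) \<longlonglongrightarrow> 0"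
      using \<phi>(2) by (auto simp: L2_tendsto_def intro!: tendsto_mult_right_zero)
    show "L2_norm \<Omega> (\<lambda>x. \<phi> k x *\<^sub>R grad \<psi> x - u x *\<^sub>R grad \<psi> x) \<le> B * L2_norm \<Omega> (\<lambda>x. \<phi> k x - u x)" for k
      using L2_norm_bound[OF L2_diff[OF L(3)[of k] L(1)] _ _ b] L2D(1)[OF L2_diff[OF L(3)[of k] L(1)]] m B
      by (simp add: scaleR_diff_left[symmetric])
  qed
  have g: "grad (\<lambda>x. \<phi> k x * \<psi> x) = (\<lambda>x. \<psi> x *\<^sub>R grad (\<phi> k) x + \<phi> k x *\<^sub>R grad \<psi> x)" for k
    using grad_mult(2)[OF test_function_C1[OF \<phi>(1)[of k]] test_function_C1[OF \<psi>]] by (simp add: add.commute)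
  show ?thesis unfolding H10_pair_def
    using \<phi>(1) \<psi> 1(1) L2_tendsto_add[OF 1(2) 2]
    by (intro exI[of _ "\<lambda>k x. \<phi> k x * \<psi> x"]) (auto simp: g mult.commute[of "\<psi> _"] intro: test_function_mult)
qed

text \<open>The chain rule for test functions passes to the limit in two pieces:
  \<open>F' (\<phi> k)\<close> times \<open>grad (\<phi> k) - G\<close> is small because
  \<open>F'\<close> is bounded, and \<open>F' (\<phi> k) - F' u\<close> times \<open>G\<close> is
  small by dominated convergence, as \<open>F'\<close> is continuous.\<close>

lemma H10_pair_compose:
  assumes u: "H10_pair \<Omega> u G" and F: "smooth_real F" "F 0 = 0"
    and F': "\<And>t. (F has_real_derivative F' t) (at t)" "\<And>t. \<bar>F' t\<bar> \<le> M" "continuous_on UNIV F'"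
  shows "H10_pair \<Omega> (\<lambda>x. F (u x)) (\<lambda>x. F' (u x) *\<^sub>R G x)"
proof -
  obtain \<phi>0 where \<phi>0: "\<And>k. test_function \<Omega> (\<phi>0 k)" "L2_tendsto \<Omega> \<phi>0 u" "L2_tendsto \<Omega> (\<lambda>k. grad (\<phi>0 k)) G"
    using assms by (auto simp: H10_pair_def)
  \<comment> \<open>Convergence almost everywhere, available along a subsequence, is what makes
    \<open>F' (\<phi> k)\<close> converge.\<close>
  obtain r where r: "strict_mono r" "AE x in lebesgue_on \<Omega>. (\<lambda>k. \<phi>0 (r k) x) \<longlonglongrightarrow> u x"
    using L2_tendsto_AE_subseq[OF \<phi>0(2)] by metis
  define \<phi> where "\<phi> k = \<phi>0 (r k)" for k
  have \<phi>: "\<And>k. test_function \<Omega> (\<phi> k)" "L2_tendsto \<Omega> \<phi> u" "L2_tendsto \<Omega> (\<lambda>k. grad (\<phi> k)) G"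
     "AE x in lebesgue_on \<Omega>. (\<lambda>k. \<phi> k x) \<longlonglongrightarrow> u x"
    using \<phi>0(1) r L2_tendsto_subseq[OF \<phi>0(2) r(1)] L2_tendsto_subseq[OF \<phi>0(3) r(1)] unfolding \<phi>_def by auto
  note L = H10_pairD[OF u] test_function_L2[OF \<phi>(1)]
  have M: "M \<ge> 0" using F'(2)[of 0] by linarith
  have lip: "\<bar>F a - F b\<bar> \<le> M * \<bar>a - b\<bar>" for a b
  proof -
    have "norm (F a - F b) \<le> M * norm (a - b)"
      by (rule field_differentiable_bound[of UNIV F F']) (use F' in auto)
    then show ?thesis by simp
  qed
  have [measurable]: "F \<in> borel_measurable borel" "F' \<in> borel_measurable borel"
    using F'(1,3) by (auto intro!: borel_measurable_continuous_onI continuous_at_imp_continuous_on intro: DERIV_isCont)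
  have um[measurable]: "u \<in> borel_measurable (lebesgue_on \<Omega>)" "G \<in> borel_measurable (lebesgue_on \<Omega>)"
      "\<phi> k \<in> borel_measurable (lebesgue_on \<Omega>)" "grad (\<phi> k) \<in> borel_measurable (lebesgue_on \<Omega>)" for k
    using L by (auto dest: L2D)
  have b: "AE x in lebesgue_on \<Omega>. norm (F' (w x) *\<^sub>R H x) \<le> M * norm (H x)" for w and H :: "real ^ 'n \<Rightarrow> real ^ 'n"
    using F'(2) by (auto intro!: mult_right_mono)
  have bF: "AE x in lebesgue_on \<Omega>. norm (F (w x)) \<le> M * norm (w x)" for w
    using lip[of _ 0] F(2) by auto
  have t1: "L2_tendsto \<Omega> (\<lambda>k x. F (\<phi> k x)) (\<lambda>x. F (u x))"
  proof (rule L2_tendstoI)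
    show "(\<lambda>x. F (u x)) \<in> L2 \<Omega>" by (rule L2_bound[OF L(1) _ bF]) measurable
    show "(\<lambda>x. F (\<phi> k x)) \<in> L2 \<Omega>" for k by (rule L2_bound[OF L(3) _ bF]) measurable
    show "(\<lambda>k. M * L2_norm \<Omega> (\<lambda>x. \<phi> k x - u x)) \<longlonglongrightarrow> 0"
      using \<phi>(2) by (auto simp: L2_tendsto_def intro!: tendsto_mult_right_zero)
    show "L2_norm \<Omega> (\<lambda>x. F (\<phi> k x) - F (u x)) \<le> M * L2_norm \<Omega> (\<lambda>x. \<phi> k x - u x)" for k
      by (rule L2_norm_bound[OF L2_diff[OF L(3)[of k] L(1)] _ M]) (use lip in auto)
  qed
  have t2: "L2_tendsto \<Omega> (\<lambda>k x. F' (\<phi> k x) *\<^sub>R grad (\<phi> k) x - F' (\<phi> k x) *\<^sub>R G x) (\<lambda>x. 0)"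
  proof (rule L2_tendstoI)
    show "(\<lambda>x. 0 :: real ^ 'n) \<in> L2 \<Omega>" by (simp add: L2_def)
    show "(\<lambda>x. F' (\<phi> k x) *\<^sub>R grad (\<phi> k) x - F' (\<phi> k x) *\<^sub>R G x) \<in> L2 \<Omega>" for k
      by (intro L2_diff L2_bound[OF L(4)[of k] _ b] L2_bound[OF L(2) _ b]) measurable
    show "(\<lambda>k. M * L2_norm \<Omega> (\<lambda>x. grad (\<phi> k) x - G x)) \<longlonglongrightarrow> 0"
      using \<phi>(3) by (auto simp: L2_tendsto_def intro!: tendsto_mult_right_zero)
    show "L2_norm \<Omega> (\<lambda>x. F' (\<phi> k x) *\<^sub>R grad (\<phi> k) x - F' (\<phi> k x) *\<^sub>R G x - 0) \<le> M * L2_norm \<Omega> (\<lambda>x. grad (\<phi> k) x - G x)" for k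
      by (rule L2_norm_bound[OF L2_diff[OF L(4)[of k] L(2)] _ M])
         (auto simp: scaleR_diff_right[symmetric] intro!: mult_right_mono F'(2))
  qed
  have t3: "L2_tendsto \<Omega> (\<lambda>k x. F' (\<phi> k x) *\<^sub>R G x) (\<lambda>x. F' (u x) *\<^sub>R G x)"
    unfolding L2_tendsto_def
  proof (intro conjI allI)
    show "(\<lambda>x. F' (u x) *\<^sub>R G x) \<in> L2 \<Omega>" by (intro L2_bound[OF L(2) _ b]) measurable
    show "(\<lambda>x. F' (\<phi> k x) *\<^sub>R G x) \<in> L2 \<Omega>" for k by (intro L2_bound[OF L(2) _ b]) measurable
    have "(\<lambda>k. LINT x|lebesgue_on \<Omega>. (norm (F' (\<phi> k x) *\<^sub>R G x - F' (u x) *\<^sub>R G x))\<^sup>2) \<longlonglongrightarrow> (LINT x|lebesgue_on \<Omega>. 0)"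
    proof (rule integral_dominated_convergence[where w="\<lambda>x. (2 * M)\<^sup>2 * (norm (G x))\<^sup>2"])
      show "integrable (lebesgue_on \<Omega>) (\<lambda>x. (2 * M)\<^sup>2 * (norm (G x))\<^sup>2)" using L2D(2)[OF L(2)] by (rule integrable_mult_right)
      show "AE x in lebesgue_on \<Omega>. (\<lambda>k. (norm (F' (\<phi> k x) *\<^sub>R G x - F' (u x) *\<^sub>R G x))\<^sup>2) \<longlonglongrightarrow> 0"
        using \<phi>(4)
      proof eventually_elim
        case (elim x)
        have "(\<lambda>k. F' (\<phi> k x)) \<longlonglongrightarrow> F' (u x)"
          using F'(3) elim by (auto simp: continuous_on_eq_continuous_at intro: isCont_tendsto_compose)
        then have "(\<lambda>k. (norm (F' (\<phi> k x) *\<^sub>R G x - F' (u x) *\<^sub>R G x))\<^sup>2) \<longlonglongrightarrow> (norm (F' (u x) *\<^sub>R G x - F' (u x) *\<^sub>R G x))\<^sup>2"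
          by (intro tendsto_intros)
        then show ?case by simp
      qed
      show "AE x in lebesgue_on \<Omega>. norm ((norm (F' (\<phi> k x) *\<^sub>R G x - F' (u x) *\<^sub>R G x))\<^sup>2) \<le> (2 * M)\<^sup>2 * (norm (G x))\<^sup>2" for k
      proof (rule AE_I2)
        fix x
        have "\<bar>F' (\<phi> k x) - F' (u x)\<bar> \<le> 2 * M" using F'(2)[of "\<phi> k x"] F'(2)[of "u x"] by linarith
        then have "(\<bar>F' (\<phi> k x) - F' (u x)\<bar> * norm (G x))\<^sup>2 \<le> (2 * M * norm (G x))\<^sup>2"
          by (intro power_mono mult_right_mono) auto
        then show "norm ((norm (F' (\<phi> k x) *\<^sub>R G x - F' (u x) *\<^sub>R G x))\<^sup>2) \<le> (2 * M)\<^sup>2 * (norm (G x))\<^sup>2"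
          by (simp add: scaleR_diff_left[symmetric] power_mult_distrib)
      qed
    qed measurable
    then have "(\<lambda>k. sqrt (LINT x|lebesgue_on \<Omega>. (norm (F' (\<phi> k x) *\<^sub>R G x - F' (u x) *\<^sub>R G x))\<^sup>2)) \<longlonglongrightarrow> sqrt 0"
      by (intro tendsto_real_sqrt) simp
    then show "(\<lambda>k. L2_norm \<Omega> (\<lambda>x. F' (\<phi> k x) *\<^sub>R G x - F' (u x) *\<^sub>R G x)) \<longlonglongrightarrow> 0"
      by (simp add: L2_norm_def)
  qed
  have "grad (\<lambda>x. F (\<phi> k x)) = (\<lambda>x. F' (\<phi> k x) *\<^sub>R grad (\<phi> k) x)" for k
    using test_function_C1[OF \<phi>(1)[of k]] F'(1) by (intro ext grad_eq grad_compose) auto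
  moreover have "L2_tendsto \<Omega> (\<lambda>k x. F' (\<phi> k x) *\<^sub>R grad (\<phi> k) x) (\<lambda>x. F' (u x) *\<^sub>R G x)"
    using L2_tendsto_add[OF t2 t3] by simp
  ultimately show ?thesis unfolding H10_pair_def
    using t1 test_function_compose[OF \<phi>(1) F] by (intro exI[of _ "\<lambda>k x. F (\<phi> k x)"]) auto
qed

end

subsection \<open>Averages of translates\<close>

lemma ennreal_two_mult_le: "2 * a * b \<le> a\<^sup>2 + (b :: ennreal)\<^sup>2"
proof (cases a; cases b)
  fix r s assume rs: "a = ennreal r" "b = ennreal s" "0 \<le> r" "0 \<le> s"
  have "ennreal (2 * r * s) \<le> ennreal (r\<^sup>2 + s\<^sup>2)" by (intro ennreal_leI sum_squares_bound)
  moreover have "ennreal (2 * r * s) = 2 * a * b" using rs by (simp add: ennreal_mult)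
  moreover have "ennreal (r\<^sup>2 + s\<^sup>2) = a\<^sup>2 + b\<^sup>2" using rs by (simp add: ennreal_power)
  ultimately show ?thesis by simp
qed (auto simp: power2_eq_square ennreal_top_mult ennreal_mult_top)

lemma ennreal_add_sq_le: "(a + b)\<^sup>2 \<le> 2 * a\<^sup>2 + 2 * (b :: ennreal)\<^sup>2"
proof -
  have ab: "2 * a * b = a * b + a * b" by (simp add: mult_2 distrib_right)
  have "(a + b)\<^sup>2 = a\<^sup>2 + b\<^sup>2 + 2 * a * b"
    unfolding ab by (simp add: power2_eq_square distrib_left distrib_right ac_simps)
  also have "\<dots> \<le> a\<^sup>2 + b\<^sup>2 + (a\<^sup>2 + b\<^sup>2)" by (intro add_left_mono ennreal_two_mult_le)
  also have "\<dots> = 2 * a\<^sup>2 + 2 * b\<^sup>2" by (simp add: mult_2 algebra_simps)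
  finally show ?thesis .
qed

text \<open>Integrating \<open>2 * c * f x \<le> c\<^sup>2 + (f x)\<^sup>2\<close> with the mean
  \<open>c\<close> of \<open>f\<close> is enough, but cancelling \<open>c\<^sup>2\<close> requires a
  finite mean. If the mean is infinite, \<open>f x \<le> 1 + (f x)\<^sup>2\<close> shows that the
  right-hand side is infinite too.\<close>

lemma nn_integral_sq_le:
  assumes f[measurable]: "f \<in> borel_measurable N" and N: "emeasure N (space N) = 1"
  shows "(\<integral>\<^sup>+x. f x \<partial>N)\<^sup>2 \<le> (\<integral>\<^sup>+x. (f x)\<^sup>2 \<partial>N)"
proof -
  define c where "c = (\<integral>\<^sup>+x. f x \<partial>N)"
  show ?thesis
  proof (cases "c = top")
    case True
    have "f x \<le> 1 + (f x)\<^sup>2" for x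
    proof -
      have "f x \<le> 2 * 1 * f x" by (simp add: mult_2)
      also have "\<dots> \<le> 1\<^sup>2 + (f x)\<^sup>2" by (rule ennreal_two_mult_le)
      finally show ?thesis by simp
    qed
    then have "c \<le> (\<integral>\<^sup>+x. 1 + (f x)\<^sup>2 \<partial>N)" unfolding c_def by (intro nn_integral_mono) auto
    also have "\<dots> = 1 + (\<integral>\<^sup>+x. (f x)\<^sup>2 \<partial>N)" using N by (simp add: nn_integral_add)
    finally have "(\<integral>\<^sup>+x. (f x)\<^sup>2 \<partial>N) = top" using True by (simp add: top_unique)
    then show ?thesis by simp
  next
    case False
    have "c\<^sup>2 + c\<^sup>2 = 2 * c * c" by (simp add: power2_eq_square mult_2 distrib_right)
    also have "\<dots> = (\<integral>\<^sup>+x. 2 * c * f x \<partial>N)"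
      using nn_integral_cmult[OF f, of "2 * c"] by (simp add: c_def)
    also have "\<dots> \<le> (\<integral>\<^sup>+x. c\<^sup>2 + (f x)\<^sup>2 \<partial>N)" by (intro nn_integral_mono ennreal_two_mult_le)
    also have "\<dots> = c\<^sup>2 + (\<integral>\<^sup>+x. (f x)\<^sup>2 \<partial>N)" using N by (simp add: nn_integral_add)
    finally show ?thesis
      using False by (simp add: ennreal_add_left_cancel_le c_def[symmetric] power2_eq_square ennreal_mult_eq_top_iff)
  qed
qed

lemma nn_integral_lborel_translate:
  fixes f :: "'a::euclidean_space \<Rightarrow> ennreal"
  assumes [measurable]: "f \<in> borel_measurable borel"
  shows "(\<integral>\<^sup>+x. f (x + c) \<partial>lborel) = (\<integral>\<^sup>+x. f x \<partial>lborel)"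
proof -
  have "(\<integral>\<^sup>+x. f x \<partial>lborel) = (\<integral>\<^sup>+x. f x \<partial>distr lborel borel ((+) c))" by (simp add: lborel_distr_plus)
  also have "\<dots> = (\<integral>\<^sup>+x. f (c + x) \<partial>lborel)" by (rule nn_integral_distr) auto
  finally show ?thesis by (simp add: add.commute)
qed

text \<open>Averaging over translates is convolution with a probability measure: Fubini and the
  translation invariance of Lebesgue measure preserve the integral, and Jensen's inequality for the
  inner integral gives the contraction in \<open>L2\<close>.\<close>

lemma
  fixes \<psi> :: "'a::euclidean_space \<Rightarrow> ennreal"
  assumes N: "sigma_finite_measure N" "emeasure N (space N) = 1"
    and [measurable]: "s \<in> N \<rightarrow>\<^sub>M borel" "\<psi> \<in> borel_measurable borel"
  shows nn_integral_average_translates: "(\<integral>\<^sup>+x. \<integral>\<^sup>+\<omega>. \<psi> (x + s \<omega>) \<partial>N \<partial>lborel) = (\<integral>\<^sup>+x. \<psi> x \<partial>lborel)"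
    and nn_integral_average_translates_sq: "(\<integral>\<^sup>+x. (\<integral>\<^sup>+\<omega>. \<psi> (x + s \<omega>) \<partial>N)\<^sup>2 \<partial>lborel) \<le> (\<integral>\<^sup>+x. (\<psi> x)\<^sup>2 \<partial>lborel)"
    and borel_measurable_average_translates: "(\<lambda>x. \<integral>\<^sup>+\<omega>. \<psi> (x + s \<omega>) \<partial>N) \<in> borel_measurable borel"
proof -
  interpret N: sigma_finite_measure N by fact
  interpret pair_sigma_finite N lborel ..
  have *: "(\<integral>\<^sup>+x. \<integral>\<^sup>+\<omega>. h (x + s \<omega>) \<partial>N \<partial>lborel) = (\<integral>\<^sup>+x. h x \<partial>lborel)"
    if [measurable]: "h \<in> borel_measurable borel" for h :: "'a \<Rightarrow> ennreal"
  proof -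
    have "(\<integral>\<^sup>+x. \<integral>\<^sup>+\<omega>. h (x + s \<omega>) \<partial>N \<partial>lborel) = (\<integral>\<^sup>+\<omega>. \<integral>\<^sup>+x. h (x + s \<omega>) \<partial>lborel \<partial>N)"
      by (rule Fubini') measurable
    also have "\<dots> = (\<integral>\<^sup>+x. h x \<partial>lborel)" using N(2) by (simp add: nn_integral_lborel_translate)
    finally show ?thesis .
  qed
  show "(\<integral>\<^sup>+x. \<integral>\<^sup>+\<omega>. \<psi> (x + s \<omega>) \<partial>N \<partial>lborel) = (\<integral>\<^sup>+x. \<psi> x \<partial>lborel)" by (rule *) measurable
  have "(\<lambda>x. \<integral>\<^sup>+\<omega>. \<psi> (x + s \<omega>) \<partial>N) \<in> borel_measurable lborel" by measurable
  then show "(\<lambda>x. \<integral>\<^sup>+\<omega>. \<psi> (x + s \<omega>) \<partial>N) \<in> borel_measurable borel" by simp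
  have "(\<integral>\<^sup>+x. (\<integral>\<^sup>+\<omega>. \<psi> (x + s \<omega>) \<partial>N)\<^sup>2 \<partial>lborel) \<le> (\<integral>\<^sup>+x. \<integral>\<^sup>+\<omega>. (\<psi> (x + s \<omega>))\<^sup>2 \<partial>N \<partial>lborel)"
    by (intro nn_integral_mono nn_integral_sq_le N) measurable
  also have "\<dots> = (\<integral>\<^sup>+x. (\<psi> x)\<^sup>2 \<partial>lborel)" by (rule *) measurable
  finally show "(\<integral>\<^sup>+x. (\<integral>\<^sup>+\<omega>. \<psi> (x + s \<omega>) \<partial>N)\<^sup>2 \<partial>lborel) \<le> (\<integral>\<^sup>+x. (\<psi> x)\<^sup>2 \<partial>lborel)" .
qed

section \<open>Averages over balls and along rays\<close>

definition unit_ball_measure :: "'a::euclidean_space measure" where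
  "unit_ball_measure = uniform_measure lborel (ball 0 1)"

definition unit_interval_measure :: "real measure" where
  "unit_interval_measure = uniform_measure lborel {0..1}"

text \<open>The joint law of a point uniform in the unit ball and an independent parameter uniform
  in \<open>[0, 1]\<close>, which selects a position along the ray to that point.\<close>

definition ray_measure :: "('a::euclidean_space \<times> real) measure" where
  "ray_measure = unit_ball_measure \<Otimes>\<^sub>M unit_interval_measure"

lemma sets_unit_measures [simp, measurable_cong]:
  "sets (unit_ball_measure :: 'a::euclidean_space measure) = sets borel"
  "sets unit_interval_measure = sets borel"
  by (auto simp: unit_ball_measure_def unit_interval_measure_def)

lemma sets_ray_measure [simp, measurable_cong]:
  "sets (ray_measure :: ('a::euclidean_space \<times> real) measure) = sets (borel \<Otimes>\<^sub>M borel)"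
  unfolding ray_measure_def by (intro sets_pair_measure_cong) simp_all

lemma emeasure_ball_nontrivial:
  fixes x :: "'a::euclidean_space"
  assumes "r > 0"
  shows "emeasure lborel (ball x r) \<noteq> 0" "emeasure lborel (ball x r) \<noteq> top"
proof -
  have "measure lborel (ball x r) > 0" using content_ball_pos[OF assms] by simp
  then show "emeasure lborel (ball x r) \<noteq> 0" by (auto simp: measure_def)
  show "emeasure lborel (ball x r) \<noteq> top" using emeasure_bounded_finite[OF bounded_ball] by (simp add: less_top)
qed

lemma emeasure_unit_measures:
  "emeasure (unit_ball_measure :: 'a::euclidean_space measure) (space unit_ball_measure) = 1"
  "emeasure unit_interval_measure (space unit_interval_measure) = 1"
proof -
  have "emeasure (unit_ball_measure :: 'a measure) UNIV = 1"
    unfolding unit_ball_measure_def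
    using emeasure_ball_nontrivial[of 1 "0::'a"]
    by (subst emeasure_uniform_measure) (auto simp: ennreal_divide_self less_top)
  then show "emeasure (unit_ball_measure :: 'a measure) (space unit_ball_measure) = 1"
    by (simp add: unit_ball_measure_def)
  have "emeasure unit_interval_measure UNIV = 1"
    unfolding unit_interval_measure_def by (subst emeasure_uniform_measure) auto
  then show "emeasure unit_interval_measure (space unit_interval_measure) = 1"
    by (simp add: unit_interval_measure_def)
qed

lemma sigma_finite_unit_measures:
  "sigma_finite_measure (unit_ball_measure :: 'a::euclidean_space measure)"
  "sigma_finite_measure unit_interval_measure"
  "sigma_finite_measure (ray_measure :: ('a \<times> real) measure)"
proof -
  show 1: "sigma_finite_measure (unit_ball_measure :: 'a measure)"
    using emeasure_unit_measures(1)[where 'a='a] by (intro finite_measure.axioms finite_measureI) simp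
  show 2: "sigma_finite_measure unit_interval_measure"
    using emeasure_unit_measures(2) by (intro finite_measure.axioms finite_measureI) simp
  interpret pair_sigma_finite "unit_ball_measure :: 'a measure" unit_interval_measure
    using 1 2 by (simp add: pair_sigma_finite_def)
  show "sigma_finite_measure (ray_measure :: ('a \<times> real) measure)"
    unfolding ray_measure_def by unfold_locales
qed

lemma nn_integral_ray_measure:
  assumes "f \<in> borel_measurable (borel \<Otimes>\<^sub>M borel)"
  shows "(\<integral>\<^sup>+\<omega>. f \<omega> \<partial>(ray_measure :: ('a::euclidean_space \<times> real) measure)) =
    (\<integral>\<^sup>+y. \<integral>\<^sup>+t. f (y, t) \<partial>unit_interval_measure \<partial>unit_ball_measure)"
proof -
  interpret sigma_finite_measure unit_interval_measure by (rule sigma_finite_unit_measures)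
  have "f \<in> borel_measurable ((unit_ball_measure :: 'a measure) \<Otimes>\<^sub>M unit_interval_measure)"
    using assms by (simp cong: measurable_cong_sets sets_pair_measure_cong)
  then show ?thesis unfolding ray_measure_def by (rule nn_integral_fst[symmetric])
qed

lemma emeasure_ray_measure:
  "emeasure (ray_measure :: ('a::euclidean_space \<times> real) measure) (space ray_measure) = 1"
proof -
  have "(\<integral>\<^sup>+\<omega>. 1 \<partial>(ray_measure :: ('a \<times> real) measure)) = 1"
    by (subst nn_integral_ray_measure) (auto simp: emeasure_unit_measures)
  then show ?thesis by simp
qed

lemma AE_unit_ball_measure: "AE y in unit_ball_measure. norm y < 1"
  unfolding unit_ball_measure_def by (rule AE_uniform_measureI) auto

lemma nn_integral_lborel_affine:
  fixes f :: "'a::euclidean_space \<Rightarrow> ennreal"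
  assumes [measurable]: "f \<in> borel_measurable borel" and R: "R > 0"
  shows "(\<integral>\<^sup>+z. f z \<partial>lborel) = ennreal (R ^ DIM('a)) * (\<integral>\<^sup>+y. f (x + R *\<^sub>R y) \<partial>lborel)"
proof -
  have "(\<integral>\<^sup>+z. f z \<partial>lborel) = (\<integral>\<^sup>+z. f z \<partial>(density (distr lborel borel (\<lambda>y. x + R *\<^sub>R y)) (\<lambda>_. \<bar>R\<bar> ^ DIM('a))))"
    using R by (subst lborel_affine[of R x, symmetric]) auto
  also have "\<dots> = ennreal (R ^ DIM('a)) * (\<integral>\<^sup>+y. f (x + R *\<^sub>R y) \<partial>lborel)"
    using R by (simp add: nn_integral_density nn_integral_distr nn_integral_cmult)
  finally show ?thesis .
qed

lemma emeasure_lborel_ball: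
  fixes x :: "'a::euclidean_space"
  assumes "R > 0"
  shows "emeasure lborel (ball x R) = ennreal (R ^ DIM('a)) * emeasure lborel (ball (0::'a) 1)"
proof -
  have "emeasure lborel (ball x R) = (\<integral>\<^sup>+z. indicator (ball x R) z \<partial>lborel)" by simp
  also have "\<dots> = ennreal (R ^ DIM('a)) * (\<integral>\<^sup>+y. indicator (ball x R) (x + R *\<^sub>R y) \<partial>lborel)"
    by (intro nn_integral_lborel_affine borel_measurable_indicator borel_open open_ball assms)
  also have "(\<lambda>y. indicator (ball x R) (x + R *\<^sub>R y)) = (indicator (ball 0 1) :: 'a \<Rightarrow> ennreal)"
    using assms by (auto simp: indicator_def dist_norm fun_eq_iff)
  finally show ?thesis by simp
qed

lemma nn_integral_unit_ball_measure:
  fixes f :: "'a::euclidean_space \<Rightarrow> ennreal"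
  assumes [measurable]: "f \<in> borel_measurable borel" and R: "R > 0"
  shows "(\<integral>\<^sup>+y. f (x + R *\<^sub>R y) \<partial>unit_ball_measure) =
    (\<integral>\<^sup>+z. f z * indicator (ball x R) z \<partial>lborel) / emeasure lborel (ball x R)"
proof -
  let ?w = "emeasure lborel (ball (0::'a) 1)"
  have [measurable]: "ball x R \<in> sets borel" by (intro borel_open open_ball)
  have "(\<integral>\<^sup>+z. f z * indicator (ball x R) z \<partial>lborel) =
     ennreal (R ^ DIM('a)) * (\<integral>\<^sup>+y. f (x + R *\<^sub>R y) * indicator (ball x R) (x + R *\<^sub>R y) \<partial>lborel)"
    by (rule nn_integral_lborel_affine[OF _ R]) measurable
  also have "(\<lambda>y. f (x + R *\<^sub>R y) * indicator (ball x R) (x + R *\<^sub>R y)) = (\<lambda>y. f (x + R *\<^sub>R y) * indicator (ball 0 1) y)"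
    using R by (auto simp: indicator_def dist_norm fun_eq_iff)
  finally have "(\<integral>\<^sup>+z. f z * indicator (ball x R) z \<partial>lborel) / emeasure lborel (ball x R)
     = (ennreal (R ^ DIM('a)) * (\<integral>\<^sup>+y. f (x + R *\<^sub>R y) * indicator (ball 0 1) y \<partial>lborel)) / (ennreal (R ^ DIM('a)) * ?w)"
    by (simp add: emeasure_lborel_ball[OF R, of x])
  also have "\<dots> = (\<integral>\<^sup>+y. f (x + R *\<^sub>R y) * indicator (ball 0 1) y \<partial>lborel) / ?w"
    using R divide_mult_eq[of "ennreal (R ^ DIM('a))" "(\<integral>\<^sup>+y. f (x + R *\<^sub>R y) * indicator (ball 0 1) y \<partial>lborel)" ?w]
    by (simp add: mult.commute)
  also have "\<dots> = (\<integral>\<^sup>+y. f (x + R *\<^sub>R y) \<partial>unit_ball_measure)"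
    unfolding unit_ball_measure_def
    by (subst nn_integral_uniform_measure) (use emeasure_ball_nontrivial[of 1 "0::'a"] in \<open>auto simp: less_top\<close>)
  finally show ?thesis ..
qed

lemma average_le_nn_integral:
  fixes f :: "'a::euclidean_space \<Rightarrow> ennreal"
  assumes [measurable]: "f \<in> borel_measurable borel" and R: "R > 0"
  shows "(\<integral>\<^sup>+y. f (x + R *\<^sub>R y) \<partial>unit_ball_measure) \<le> (\<integral>\<^sup>+z. f z \<partial>lborel) / (ennreal (R ^ DIM('a)) * emeasure lborel (ball (0::'a) 1))"
  unfolding nn_integral_unit_ball_measure[OF assms] emeasure_lborel_ball[OF R, of x]
  by (intro divide_right_mono_ennreal nn_integral_mono) (auto simp: indicator_def)

text \<open>Comparing with the average over a ball around a nearby centre allows one constant for a whole cell.\<close>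

lemma diff_ball_average_le:
  fixes W :: "'a::euclidean_space \<Rightarrow> real"
  assumes d: "d > 0" and x: "dist x x0 \<le> d"
    and W: "integrable lborel W"
  shows "ennreal \<bar>W x - (LINT z|lborel. indicator (ball x0 d) z * W z) / measure lborel (ball x0 d)\<bar>
    \<le> ennreal (2 ^ DIM('a)) * (\<integral>\<^sup>+y. ennreal \<bar>W (x + (2 * d) *\<^sub>R y) - W x\<bar> \<partial>unit_ball_measure)"
proof -
  let ?B = "ball x0 d" and ?w = "emeasure lborel (ball (0::'a) 1)"
  let ?v = "measure lborel ?B"
  have [measurable]: "W \<in> borel_measurable borel" using W by auto
  have v: "?v > 0" using content_ball_pos[OF d] by simp
  have ev: "emeasure lborel ?B = ennreal ?v"
    using emeasure_ball_nontrivial[OF d, of x0] by (simp add: emeasure_eq_ennreal_measure)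
  have i1: "integrable lborel (\<lambda>z. indicator ?B z * W z)"
    using integrable_real_mult_indicator[OF _ W, of ?B] by (simp add: mult.commute)
  have i2: "integrable lborel (\<lambda>z. indicator ?B z * W x)"
    using emeasure_ball_nontrivial[OF d, of x0] by (auto simp: less_top)
  have "W x - (LINT z|lborel. indicator ?B z * W z) / ?v = (LINT z|lborel. indicator ?B z * (W x - W z)) / ?v"
    using i1 i2 v by (simp add: right_diff_distrib diff_divide_distrib)
  then have "ennreal \<bar>W x - (LINT z|lborel. indicator ?B z * W z) / ?v\<bar>
     = ennreal \<bar>LINT z|lborel. indicator ?B z * (W x - W z)\<bar> / ennreal ?v"
    using v by (simp add: divide_ennreal)
  also have "\<dots> \<le> (\<integral>\<^sup>+z. ennreal \<bar>indicator ?B z * (W x - W z)\<bar> \<partial>lborel) / ennreal ?v"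
  proof (intro divide_right_mono_ennreal)
    have i3: "integrable lborel (\<lambda>z. indicator ?B z * (W x - W z))" using i1 i2 by (simp add: right_diff_distrib)
    show "ennreal \<bar>LINT z|lborel. indicator ?B z * (W x - W z)\<bar> \<le> (\<integral>\<^sup>+z. ennreal \<bar>indicator ?B z * (W x - W z)\<bar> \<partial>lborel)"
      using integral_norm_bound_ennreal[OF i3] by simp
  qed
  \<comment> \<open>The ball is enlarged to the one of radius \<open>2 * d\<close> around
    \<open>x\<close> itself, so that the right-hand side is an average over translates of
    \<open>x\<close> and no longer mentions \<open>x0\<close>. The factor \<open>2 ^ DIM('a)\<close>
    is the ratio of the two volumes.\<close>
  also have "\<dots> \<le> (\<integral>\<^sup>+z. ennreal \<bar>W z - W x\<bar> * indicator (ball x (2 * d)) z \<partial>lborel) / ennreal ?v"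
  proof (intro divide_right_mono_ennreal nn_integral_mono)
    fix z
    have "z \<in> ball x (2 * d)" if "z \<in> ?B"
      using that x dist_triangle[of x z x0] by (auto simp: dist_commute)
    then show "ennreal \<bar>indicator ?B z * (W x - W z)\<bar> \<le> ennreal \<bar>W z - W x\<bar> * indicator (ball x (2 * d)) z"
      by (auto simp: indicator_def abs_minus_commute)
  qed
  also have "\<dots> = ennreal (2 ^ DIM('a)) * ((\<integral>\<^sup>+z. ennreal \<bar>W z - W x\<bar> * indicator (ball x (2 * d)) z \<partial>lborel) / emeasure lborel (ball x (2 * d)))"
  proof -
    define I where "I = (\<integral>\<^sup>+z. ennreal \<bar>W z - W x\<bar> * indicator (ball x (2 * d)) z \<partial>lborel)"
    have "emeasure lborel (ball x (2 * d)) = ennreal ((2 * d) ^ DIM('a)) * ?w"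
      using d by (intro emeasure_lborel_ball) simp
    also have "ennreal ((2 * d) ^ DIM('a)) = ennreal (2 ^ DIM('a)) * ennreal (d ^ DIM('a))"
      using d by (simp only: power_mult_distrib) (rule ennreal_mult, auto)
    also have "ennreal (2 ^ DIM('a)) * ennreal (d ^ DIM('a)) * ?w = ennreal (2 ^ DIM('a)) * ennreal ?v"
      by (simp only: ev[symmetric] emeasure_lborel_ball[OF d, of x0] mult.assoc)
    finally have e: "emeasure lborel (ball x (2 * d)) = ennreal (2 ^ DIM('a)) * ennreal ?v" .
    have "I / ennreal ?v = (I * ennreal (2 ^ DIM('a))) / (ennreal ?v * ennreal (2 ^ DIM('a)))"
      by (rule divide_mult_eq[symmetric]) (auto simp: ennreal_eq_0_iff not_le)
    then show ?thesis
      unfolding e I_def[symmetric] by (simp only: ennreal_times_divide mult.commute)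
  qed
  also have "\<dots> = ennreal (2 ^ DIM('a)) * (\<integral>\<^sup>+y. ennreal \<bar>W (x + (2 * d) *\<^sub>R y) - W x\<bar> \<partial>unit_ball_measure)"
    using d by (subst nn_integral_unit_ball_measure[of "\<lambda>z. ennreal \<bar>W z - W x\<bar>"]) auto
  finally show ?thesis .
qed

text \<open>Fundamental theorem of calculus along the segment; the integral over
  \<open>[0, 1]\<close> is written with \<open>unit_interval_measure\<close> so that it can be
  merged with the average over the ball.\<close>

lemma C1_increment_le:
  fixes \<phi> :: "real ^ 'n::finite \<Rightarrow> real"
  assumes \<phi>: "C_k 1 \<phi>"
  shows "ennreal \<bar>\<phi> (x + y) - \<phi> x\<bar> \<le> ennreal (norm y) * (\<integral>\<^sup>+t. ennreal (norm (grad \<phi> (x + t *\<^sub>R y))) \<partial>unit_interval_measure)"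
proof -
  note c = C1D(2)[OF \<phi>]
  have cc: "continuous_on {0..1} (\<lambda>t. norm (grad \<phi> (x + t *\<^sub>R y)))"
    by (intro continuous_intros continuous_on_compose2[OF c]) auto
  define I where "I = integral {0..1} (\<lambda>t. norm (grad \<phi> (x + t *\<^sub>R y)))"
  have hI: "((\<lambda>t. norm (grad \<phi> (x + t *\<^sub>R y))) has_integral I) {0..1}"
    unfolding I_def by (intro integrable_integral integrable_continuous_real cc)
  have ftc: "((\<lambda>t. grad \<phi> (x + t *\<^sub>R y) \<bullet> y) has_integral \<phi> (x + 1 *\<^sub>R y) - \<phi> (x + 0 *\<^sub>R y)) {0..1}"
  proof (rule fundamental_theorem_of_calculus)
    fix t :: real
    have "((\<lambda>t. \<phi> (x + t *\<^sub>R y)) has_derivative (\<lambda>s. grad \<phi> (x + t *\<^sub>R y) \<bullet> (s *\<^sub>R y))) (at t within {0..1})"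
      by (rule has_derivative_compose[OF _ C1D(1)[OF \<phi>]]) (auto intro!: derivative_eq_intros)
    then show "((\<lambda>t. \<phi> (x + t *\<^sub>R y)) has_vector_derivative grad \<phi> (x + t *\<^sub>R y) \<bullet> y) (at t within {0..1})"
      by (simp add: has_vector_derivative_def)
  qed simp
  have "norm (integral {0..1} (\<lambda>t. grad \<phi> (x + t *\<^sub>R y) \<bullet> y)) \<le> integral {0..1} (\<lambda>t. norm (grad \<phi> (x + t *\<^sub>R y)) * norm y)"
  proof (rule integral_norm_bound_integral)
    show "(\<lambda>t. grad \<phi> (x + t *\<^sub>R y) \<bullet> y) integrable_on {0..1}" using ftc by blast
    show "(\<lambda>t. norm (grad \<phi> (x + t *\<^sub>R y)) * norm y) integrable_on {0..1}"
      by (intro integrable_on_mult_left) (use hI in blast)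
    show "norm (grad \<phi> (x + t *\<^sub>R y) \<bullet> y) \<le> norm (grad \<phi> (x + t *\<^sub>R y)) * norm y" for t
      using Cauchy_Schwarz_ineq2 by simp
  qed
  then have "\<bar>\<phi> (x + y) - \<phi> x\<bar> \<le> norm y * I"
    using integral_unique[OF ftc] by (simp add: I_def mult.commute)
  moreover have "(\<integral>\<^sup>+t. ennreal (norm (grad \<phi> (x + t *\<^sub>R y))) \<partial>unit_interval_measure) = ennreal I"
  proof -
    have [measurable]: "(\<lambda>t. norm (grad \<phi> (x + t *\<^sub>R y))) \<in> borel_measurable borel"
      by (intro borel_measurable_continuous_onI continuous_intros continuous_on_compose2[OF c]) auto
    have "(\<integral>\<^sup>+t. ennreal (norm (grad \<phi> (x + t *\<^sub>R y))) \<partial>unit_interval_measure)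
      = (\<integral>\<^sup>+t. ennreal (norm (grad \<phi> (x + t *\<^sub>R y))) * indicator {0..1} t \<partial>lborel)"
      unfolding unit_interval_measure_def by (subst nn_integral_uniform_measure) (auto simp: divide_ennreal_def)
    also have "\<dots> = (\<integral>\<^sup>+t. ennreal (indicator {0..1} t * norm (grad \<phi> (x + t *\<^sub>R y))) \<partial>lborel)"
      by (intro nn_integral_cong) (auto simp: indicator_def)
    also have "\<dots> = ennreal I" by (rule nn_integral_has_integral_lebesgue[OF _ hI]) auto
    finally show ?thesis .
  qed
  ultimately show ?thesis by (simp add: ennreal_mult'[symmetric] ennreal_leI)
qed

text \<open>The points \<open>x + (a + t * b) *\<^sub>R y\<close> run through the segment between
  the radii \<open>a\<close> and \<open>a + b\<close> in direction \<open>y\<close>. With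
  \<open>a = 0\<close> this controls the deviation of \<open>\<phi> x\<close> from its mean over a
  ball, with \<open>a > 0\<close> the difference of the means at two scales.\<close>

definition ray_average :: "real \<Rightarrow> real \<Rightarrow> (real ^ 'n::finite \<Rightarrow> real) \<Rightarrow> real ^ 'n \<Rightarrow> ennreal" where
  "ray_average a b \<phi> x = (\<integral>\<^sup>+\<omega>. ennreal (norm (grad \<phi> (x + (a + snd \<omega> * b) *\<^sub>R fst \<omega>))) \<partial>ray_measure)"

lemma ray_average:
  assumes \<phi>: "C_k 1 \<phi>"
  shows "ray_average a b \<phi> \<in> borel_measurable borel"
    "(\<integral>\<^sup>+x. ray_average a b \<phi> x \<partial>lborel) = (\<integral>\<^sup>+x. ennreal (norm (grad \<phi> x)) \<partial>lborel)"
    "(\<integral>\<^sup>+x. (ray_average a b \<phi> x)\<^sup>2 \<partial>lborel) \<le> (\<integral>\<^sup>+x. (ennreal (norm (grad \<phi> x)))\<^sup>2 \<partial>lborel)"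
proof -
  have [measurable]: "grad \<phi> \<in> borel_measurable borel" using C1D(2)[OF \<phi>] by (rule borel_measurable_continuous_onI)
  have s: "(\<lambda>\<omega>. (a + snd \<omega> * b) *\<^sub>R fst \<omega>) \<in> (ray_measure :: ((real ^ 'a) \<times> real) measure) \<rightarrow>\<^sub>M borel"
    by measurable
  have \<psi>: "(\<lambda>x. ennreal (norm (grad \<phi> x))) \<in> borel_measurable borel" by measurable
  note l = sigma_finite_unit_measures(3) emeasure_ray_measure s \<psi>
  show "ray_average a b \<phi> \<in> borel_measurable borel"
    "(\<integral>\<^sup>+x. ray_average a b \<phi> x \<partial>lborel) = (\<integral>\<^sup>+x. ennreal (norm (grad \<phi> x)) \<partial>lborel)"
    "(\<integral>\<^sup>+x. (ray_average a b \<phi> x)\<^sup>2 \<partial>lborel) \<le> (\<integral>\<^sup>+x. (ennreal (norm (grad \<phi> x)))\<^sup>2 \<partial>lborel)"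
    unfolding ray_average_def[abs_def]
    using borel_measurable_average_translates[OF l] nn_integral_average_translates[OF l] nn_integral_average_translates_sq[OF l]
    by auto
qed

lemma average_increment_le:
  fixes \<phi> :: "real ^ 'n::finite \<Rightarrow> real"
  assumes \<phi>: "C_k 1 \<phi>" and b: "b \<ge> 0"
  shows "(\<integral>\<^sup>+y. ennreal \<bar>\<phi> (x + (a + b) *\<^sub>R y) - \<phi> (x + a *\<^sub>R y)\<bar> \<partial>unit_ball_measure) \<le> ennreal b * ray_average a b \<phi> x"
proof -
  have [measurable]: "grad \<phi> \<in> borel_measurable borel" using C1D(2)[OF \<phi>] by (rule borel_measurable_continuous_onI)
  have "(\<integral>\<^sup>+y. ennreal \<bar>\<phi> (x + (a + b) *\<^sub>R y) - \<phi> (x + a *\<^sub>R y)\<bar> \<partial>unit_ball_measure) \<le>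
    (\<integral>\<^sup>+y. ennreal b * (\<integral>\<^sup>+t. ennreal (norm (grad \<phi> (x + (a + t * b) *\<^sub>R y))) \<partial>unit_interval_measure) \<partial>unit_ball_measure)"
  proof (rule nn_integral_mono_AE)
    show "AE y in unit_ball_measure. ennreal \<bar>\<phi> (x + (a + b) *\<^sub>R y) - \<phi> (x + a *\<^sub>R y)\<bar> \<le>
       ennreal b * (\<integral>\<^sup>+t. ennreal (norm (grad \<phi> (x + (a + t * b) *\<^sub>R y))) \<partial>unit_interval_measure)"
      using AE_unit_ball_measure
    proof eventually_elim
      case (elim y)
      have "ennreal \<bar>\<phi> ((x + a *\<^sub>R y) + b *\<^sub>R y) - \<phi> (x + a *\<^sub>R y)\<bar> \<le>
          ennreal (norm (b *\<^sub>R y)) * (\<integral>\<^sup>+t. ennreal (norm (grad \<phi> ((x + a *\<^sub>R y) + t *\<^sub>R (b *\<^sub>R y)))) \<partial>unit_interval_measure)"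
        by (rule C1_increment_le[OF \<phi>])
      also have "\<dots> \<le> ennreal b * (\<integral>\<^sup>+t. ennreal (norm (grad \<phi> ((x + a *\<^sub>R y) + t *\<^sub>R (b *\<^sub>R y)))) \<partial>unit_interval_measure)"
        using elim b by (intro mult_right_mono ennreal_leI) (auto intro: mult_left_le)
      finally show ?case by (simp add: scaleR_add_left add.assoc)
    qed
  qed
  also have "\<dots> = ennreal b * (\<integral>\<^sup>+y. \<integral>\<^sup>+t. ennreal (norm (grad \<phi> (x + (a + t * b) *\<^sub>R y))) \<partial>unit_interval_measure \<partial>unit_ball_measure)"
  proof (rule nn_integral_cmult)
    interpret sigma_finite_measure unit_interval_measure by (rule sigma_finite_unit_measures)
    show "(\<lambda>y. \<integral>\<^sup>+t. ennreal (norm (grad \<phi> (x + (a + t * b) *\<^sub>R y))) \<partial>unit_interval_measure) \<in> borel_measurable unit_ball_measure"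
      by measurable
  qed
  also have "\<dots> = ennreal b * ray_average a b \<phi> x"
  proof -
    have "(\<lambda>\<omega>. ennreal (norm (grad \<phi> (x + (a + snd \<omega> * b) *\<^sub>R fst \<omega>)))) \<in> borel_measurable (borel \<Otimes>\<^sub>M borel)"
      by measurable
    from nn_integral_ray_measure[OF this] show ?thesis unfolding ray_average_def by simp
  qed
  finally show ?thesis .
qed

subsection \<open>Nash and form-boundedness inequalities\<close>

text \<open>Jensen's inequality for the geometric distribution with weights
  \<open>(1 / 2) ^ Suc j\<close>, applied to \<open>2 ^ Suc j * X j\<close>, whose mean is the sum
  of the \<open>X j\<close>.\<close>

lemma nn_integral_geometric_sq_le:
  fixes X :: "nat \<Rightarrow> ennreal"
  shows "(\<Sum>j. X j)\<^sup>2 \<le> (\<Sum>j. ennreal (2 ^ Suc j) * (X j)\<^sup>2)"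
proof -
  define p :: "nat \<Rightarrow> real" where "p j = (1 / 2) ^ Suc j" for j
  define N where "N = density (count_space UNIV) (\<lambda>j. ennreal (p j))"
  have sums: "p sums 1" unfolding p_def by (rule power_half_series)
  have p: "p j > 0" for j by (simp add: p_def)
  have int: "(\<integral>\<^sup>+j. f j \<partial>N) = (\<Sum>j. ennreal (p j) * f j)" for f
    unfolding N_def by (subst nn_integral_density) (auto simp: nn_integral_count_space_nat)
  have N1: "emeasure N (space N) = 1"
  proof -
    have "emeasure N (space N) = (\<integral>\<^sup>+j. 1 \<partial>N)" by simp
    also have "\<dots> = (\<Sum>j. ennreal (p j))" by (simp only: int mult_1_right)
    also have "\<dots> = ennreal (suminf p)" using sums p by (intro suminf_ennreal2) (auto simp: sums_iff less_imp_le)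
    finally show ?thesis using sums by (simp add: sums_iff)
  qed
  have c: "ennreal (p j) * ennreal (2 ^ Suc j) = 1" for j
    by (subst ennreal_mult[symmetric]) (auto simp: p_def power_divide)
  have "(\<Sum>j. X j) = (\<integral>\<^sup>+j. ennreal (2 ^ Suc j) * X j \<partial>N)"
    unfolding int by (simp only: mult.assoc[symmetric] c mult_1_left)
  then have "(\<Sum>j. X j)\<^sup>2 \<le> (\<integral>\<^sup>+j. (ennreal (2 ^ Suc j) * X j)\<^sup>2 \<partial>N)"
    using nn_integral_sq_le[OF _ N1, of "\<lambda>j. ennreal (2 ^ Suc j) * X j"] by (simp add: N_def)
  also have "\<dots> = (\<Sum>j. ennreal (2 ^ Suc j) * (X j)\<^sup>2)"
  proof -
    have "ennreal (p j) * (ennreal (2 ^ Suc j) * X j)\<^sup>2 = ennreal (2 ^ Suc j) * (X j)\<^sup>2" for j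
    proof -
      have "ennreal (p j) * (ennreal (2 ^ Suc j) * X j)\<^sup>2 =
        (ennreal (p j) * ennreal (2 ^ Suc j)) * (ennreal (2 ^ Suc j) * (X j)\<^sup>2)"
        by (simp only: power2_eq_square ac_simps)
      then show ?thesis by (simp only: c mult_1_left)
    qed
    then show ?thesis unfolding int by (simp only:)
  qed
  finally show ?thesis .
qed

section \<open>Integrals over the domain and over the whole space\<close>

lemma nn_integral_lebesgue_on_le_lborel:
  "(\<integral>\<^sup>+x. f x \<partial>lebesgue_on \<Omega>) \<le> (\<integral>\<^sup>+x. f x \<partial>lborel)" if "\<Omega> \<in> sets lebesgue" for \<Omega> :: "'a::euclidean_space set"
proof -
  have "(\<integral>\<^sup>+x. f x \<partial>lebesgue_on \<Omega>) = (\<integral>\<^sup>+x. f x * indicator \<Omega> x \<partial>lebesgue)"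
    using that by (simp add: nn_integral_restrict_space)
  also have "\<dots> \<le> (\<integral>\<^sup>+x. f x \<partial>lebesgue)" by (intro nn_integral_mono) (auto simp: indicator_def)
  finally show ?thesis by (simp add: nn_integral_completion)
qed

lemma measurable_lborel_lebesgue_on:
  "f \<in> borel_measurable borel \<Longrightarrow> f \<in> borel_measurable (lebesgue_on \<Omega>)"
  by (intro measurable_restrict_space1 measurable_completion) simp

lemma L2_norm_le_nn_integral:
  assumes "g \<in> L2 \<Omega>" "(\<integral>\<^sup>+x. (ennreal (norm (g x)))\<^sup>2 \<partial>lebesgue_on \<Omega>) \<le> ennreal (K\<^sup>2)" "K \<ge> 0"
  shows "L2_norm \<Omega> g \<le> K"
proof -
  have "ennreal ((L2_norm \<Omega> g)\<^sup>2) = (\<integral>\<^sup>+x. ennreal ((norm (g x))\<^sup>2) \<partial>lebesgue_on \<Omega>)"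
    unfolding L2_norm_sq by (intro nn_integral_eq_integral[symmetric] L2D(2) assms) auto
  also have "\<dots> \<le> ennreal (K\<^sup>2)" using assms(2) by (simp add: ennreal_power)
  finally have "(L2_norm \<Omega> g)\<^sup>2 \<le> K\<^sup>2" by (simp add: ennreal_le_iff)
  then show ?thesis using assms(3) by (rule power2_le_imp_le)
qed

lemma L2_norm_nn_integral:
  assumes "g \<in> L2 \<Omega>"
  shows "(\<integral>\<^sup>+x. (ennreal (norm (g x)))\<^sup>2 \<partial>lebesgue_on \<Omega>) = ennreal ((L2_norm \<Omega> g)\<^sup>2)"
  unfolding L2_norm_sq
  using nn_integral_eq_integral[OF L2D(2)[OF assms]] by (simp add: ennreal_power)

lemma L2_norm_sq_nn_integral_lborel:
  fixes f :: "real ^ 'n::finite \<Rightarrow> 'b::euclidean_space"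
  assumes "\<Omega> \<in> sets lebesgue" "continuous_on UNIV f" "compact K" "K \<subseteq> \<Omega>" "\<And>x. x \<notin> K \<Longrightarrow> f x = 0"
  shows "(\<integral>\<^sup>+x. (ennreal (norm (f x)))\<^sup>2 \<partial>lborel) = ennreal ((L2_norm \<Omega> f)\<^sup>2)"
    "(\<integral>\<^sup>+x. ennreal (norm (f x)) \<partial>lborel) = ennreal (LINT x|lebesgue_on \<Omega>. norm (f x))"
proof -
  have c: "continuous_on UNIV (\<lambda>x. (norm (f x))\<^sup>2)" "continuous_on UNIV (\<lambda>x. norm (f x))"
    using assms(2) by (intro continuous_intros; simp)+
  have i: "integrable lborel (\<lambda>x. (norm (f x))\<^sup>2)" "integrable lborel (\<lambda>x. norm (f x))"
    using integrable_continuous_compact_support[OF c(1) assms(3)] integrable_continuous_compact_support[OF c(2) assms(3)] assms(5) by auto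
  have "(LINT x|lebesgue_on \<Omega>. (norm (f x))\<^sup>2) = (LINT x|lborel. (norm (f x))\<^sup>2)"
    "(LINT x|lebesgue_on \<Omega>. norm (f x)) = (LINT x|lborel. norm (f x))"
    using assms(4,5) by (auto intro!: integral_lebesgue_on_eq_lborel(1)[OF assms(1)] borel_measurable_continuous_onI[OF c(1)]
        borel_measurable_continuous_onI[OF c(2)] simp: subset_eq)
  then show "(\<integral>\<^sup>+x. (ennreal (norm (f x)))\<^sup>2 \<partial>lborel) = ennreal ((L2_norm \<Omega> f)\<^sup>2)"
    "(\<integral>\<^sup>+x. ennreal (norm (f x)) \<partial>lborel) = ennreal (LINT x|lebesgue_on \<Omega>. norm (f x))"
    using nn_integral_eq_integral[OF i(1)] nn_integral_eq_integral[OF i(2)]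
    by (auto simp: L2_norm_sq ennreal_power)
qed

lemma test_function_nn_integrals:
  assumes "\<Omega> \<in> sets lebesgue" "test_function \<Omega> \<phi>"
  shows "(\<integral>\<^sup>+x. (ennreal \<bar>\<phi> x\<bar>)\<^sup>2 \<partial>lborel) = ennreal ((L2_norm \<Omega> \<phi>)\<^sup>2)"
    "(\<integral>\<^sup>+x. ennreal \<bar>\<phi> x\<bar> \<partial>lborel) = ennreal (LINT x|lebesgue_on \<Omega>. \<bar>\<phi> x\<bar>)"
    "(\<integral>\<^sup>+x. (ennreal (norm (grad \<phi> x)))\<^sup>2 \<partial>lborel) = ennreal ((L2_norm \<Omega> (grad \<phi>))\<^sup>2)"
proof -
  obtain K where K: "compact K" "K \<subseteq> \<Omega>" "\<And>x. x \<notin> K \<Longrightarrow> \<phi> x = 0"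
    using assms(2) compactly_supported_inE unfolding test_function_def by metis
  note C1 = test_function_C1[OF assms(2)]
  have g0: "grad \<phi> x = 0" if "x \<notin> K" for x using grad_eq_0_outside[OF compact_imp_closed[OF K(1)] K(3) that] .
  show "(\<integral>\<^sup>+x. (ennreal \<bar>\<phi> x\<bar>)\<^sup>2 \<partial>lborel) = ennreal ((L2_norm \<Omega> \<phi>)\<^sup>2)"
    "(\<integral>\<^sup>+x. ennreal \<bar>\<phi> x\<bar> \<partial>lborel) = ennreal (LINT x|lebesgue_on \<Omega>. \<bar>\<phi> x\<bar>)"
    "(\<integral>\<^sup>+x. (ennreal (norm (grad \<phi> x)))\<^sup>2 \<partial>lborel) = ennreal ((L2_norm \<Omega> (grad \<phi>))\<^sup>2)"
    using L2_norm_sq_nn_integral_lborel[OF assms(1) C1D(3)[OF C1] K] L2_norm_sq_nn_integral_lborel(1)[OF assms(1) C1D(2)[OF C1] K(1,2) g0]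
    by auto
qed

definition unit_ball_volume :: "'n::finite itself \<Rightarrow> real" where
  "unit_ball_volume _ = measure lborel (ball (0 :: real ^ 'n) 1)"

lemma unit_ball_volume:
  "unit_ball_volume TYPE('n::finite) > 0"
  "emeasure lborel (ball (0 :: real ^ 'n) 1) = ennreal (unit_ball_volume TYPE('n))"
proof -
  show "unit_ball_volume TYPE('n) > 0"
    using content_ball_pos[of 1 "0 :: real ^ 'n"] by (simp add: unit_ball_volume_def)
  show "emeasure lborel (ball (0 :: real ^ 'n) 1) = ennreal (unit_ball_volume TYPE('n))"
    using emeasure_ball_nontrivial[of 1 "0 :: real ^ 'n"] by (simp add: emeasure_eq_ennreal_measure unit_ball_volume_def)
qed

lemma abs_average_le:
  fixes \<phi> :: "real ^ 'n::finite \<Rightarrow> real"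
  assumes \<phi>: "C_k 1 \<phi>" and r: "r > 0"
  shows "ennreal \<bar>\<phi> x\<bar> \<le> ennreal r * ray_average 0 r \<phi> x + (\<integral>\<^sup>+y. ennreal \<bar>\<phi> (x + r *\<^sub>R y)\<bar> \<partial>unit_ball_measure)"
proof -
  have [measurable]: "\<phi> \<in> borel_measurable borel" using C1D(3)[OF \<phi>] by (rule borel_measurable_continuous_onI)
  have "ennreal \<bar>\<phi> x\<bar> = (\<integral>\<^sup>+y. ennreal \<bar>\<phi> x\<bar> \<partial>(unit_ball_measure :: (real ^ 'n) measure))"
    by (simp only: nn_integral_const emeasure_unit_measures mult_1_right)
  also have "\<dots> \<le> (\<integral>\<^sup>+y. ennreal \<bar>\<phi> (x + (0 + r) *\<^sub>R y) - \<phi> (x + 0 *\<^sub>R y)\<bar> + ennreal \<bar>\<phi> (x + r *\<^sub>R y)\<bar> \<partial>unit_ball_measure)"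
    by (intro nn_integral_mono) (auto simp: ennreal_plus[symmetric] simp del: ennreal_plus intro!: ennreal_leI)
  also have "\<dots> = (\<integral>\<^sup>+y. ennreal \<bar>\<phi> (x + (0 + r) *\<^sub>R y) - \<phi> (x + 0 *\<^sub>R y)\<bar> \<partial>unit_ball_measure) + (\<integral>\<^sup>+y. ennreal \<bar>\<phi> (x + r *\<^sub>R y)\<bar> \<partial>unit_ball_measure)"
    by (rule nn_integral_add) measurable
  also have "\<dots> \<le> ennreal r * ray_average 0 r \<phi> x + (\<integral>\<^sup>+y. ennreal \<bar>\<phi> (x + r *\<^sub>R y)\<bar> \<partial>unit_ball_measure)"
    using r by (intro add_right_mono average_increment_le[OF \<phi>]) auto
  finally show ?thesis .
qed

text \<open>\<open>\<phi>\<close> is compared with its mean over a ball of radius \<open>r\<close>.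
  The means \<open>T x\<close> of \<open>\<bar>\<phi>\<bar>\<close> are bounded both uniformly, by
  the integral \<open>I\<close> over the volume of the ball, and in \<open>L1\<close>, by
  \<open>I\<close>; the product of the two bounds controls \<open>T\<close> in
  \<open>L2\<close>.\<close>

lemma Nash_test_function:
  fixes \<phi> :: "real ^ 'n::finite \<Rightarrow> real"
  assumes \<Omega>: "\<Omega> \<in> sets lebesgue" and \<phi>: "test_function \<Omega> \<phi>" and r: "r > 0"
  shows "(L2_norm \<Omega> \<phi>)\<^sup>2 \<le> 2 * r\<^sup>2 * (L2_norm \<Omega> (grad \<phi>))\<^sup>2
    + 2 / (r ^ CARD('n) * unit_ball_volume TYPE('n)) * (LINT x|lebesgue_on \<Omega>. \<bar>\<phi> x\<bar>)\<^sup>2"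
proof -
  note C1 = test_function_C1[OF \<phi>] and ni = test_function_nn_integrals[OF \<Omega> \<phi>]
  let ?v = "r ^ CARD('n) * unit_ball_volume TYPE('n)"
  have v: "?v > 0" using r unit_ball_volume(1)[where 'n='n] by simp
  define I where "I = (LINT x|lebesgue_on \<Omega>. \<bar>\<phi> x\<bar>)"
  have I: "I \<ge> 0" by (simp add: I_def)
  have [measurable]: "\<phi> \<in> borel_measurable borel" using C1D(3)[OF C1] by (rule borel_measurable_continuous_onI)
  define T where "T x = (\<integral>\<^sup>+y. ennreal \<bar>\<phi> (x + r *\<^sub>R y)\<bar> \<partial>unit_ball_measure)" for x
  note l = sigma_finite_unit_measures(1)[where 'a="real ^ 'n"] emeasure_unit_measures(1)[where 'a="real ^ 'n"]
  have Tm[measurable]: "T \<in> borel_measurable borel" and Tint: "(\<integral>\<^sup>+x. T x \<partial>lborel) = ennreal I"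
    unfolding T_def[abs_def]
    using borel_measurable_average_translates[OF l, of "\<lambda>y. r *\<^sub>R y" "\<lambda>x. ennreal \<bar>\<phi> x\<bar>"]
      nn_integral_average_translates[OF l, of "\<lambda>y. r *\<^sub>R y" "\<lambda>x. ennreal \<bar>\<phi> x\<bar>"] by (auto simp: ni I_def)
  have Tle: "T x \<le> ennreal (I / ?v)" for x
  proof -
    have "T x \<le> ennreal I / (ennreal (r ^ CARD('n)) * ennreal (unit_ball_volume TYPE('n)))"
      using average_le_nn_integral[of "\<lambda>x. ennreal \<bar>\<phi> x\<bar>" r x] r by (simp add: T_def ni I_def unit_ball_volume)
    also have "\<dots> = ennreal (I / ?v)"
      using r v I unit_ball_volume(1)[where 'n='n] by (simp add: ennreal_mult[symmetric] divide_ennreal)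
    finally show ?thesis .
  qed
  note ra = ray_average[OF C1, of 0 r]
  note [measurable] = ra(1)
  have "ennreal ((L2_norm \<Omega> \<phi>)\<^sup>2) \<le> (\<integral>\<^sup>+x. 2 * (ennreal r)\<^sup>2 * (ray_average 0 r \<phi> x)\<^sup>2 + 2 * ennreal (I / ?v) * T x \<partial>lborel)"
    unfolding ni(1)[symmetric]
  proof (rule nn_integral_mono)
    fix x
    have "(ennreal \<bar>\<phi> x\<bar>)\<^sup>2 \<le> (ennreal r * ray_average 0 r \<phi> x + T x)\<^sup>2"
      unfolding T_def by (intro power_mono abs_average_le[OF C1 r]) auto
    also have "\<dots> \<le> 2 * (ennreal r * ray_average 0 r \<phi> x)\<^sup>2 + 2 * (T x)\<^sup>2" by (rule ennreal_add_sq_le)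
    also have "\<dots> \<le> 2 * (ennreal r * ray_average 0 r \<phi> x)\<^sup>2 + 2 * (ennreal (I / ?v) * T x)"
      unfolding power2_eq_square[of "T x"] by (intro add_left_mono mult_left_mono mult_right_mono Tle) auto
    finally show "(ennreal \<bar>\<phi> x\<bar>)\<^sup>2 \<le> 2 * (ennreal r)\<^sup>2 * (ray_average 0 r \<phi> x)\<^sup>2 + 2 * ennreal (I / ?v) * T x"
      by (simp only: power_mult_distrib mult.assoc)
  qed
  also have "\<dots> = 2 * (ennreal r)\<^sup>2 * (\<integral>\<^sup>+x. (ray_average 0 r \<phi> x)\<^sup>2 \<partial>lborel) + 2 * ennreal (I / ?v) * (\<integral>\<^sup>+x. T x \<partial>lborel)"
    by (simp add: nn_integral_add nn_integral_cmult)
  also have "\<dots> \<le> 2 * (ennreal r)\<^sup>2 * ennreal ((L2_norm \<Omega> (grad \<phi>))\<^sup>2) + 2 * ennreal (I / ?v) * ennreal I"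
    unfolding Tint ni(3)[symmetric] by (intro add_right_mono mult_left_mono ra) auto
  also have "\<dots> = ennreal (2 * r\<^sup>2 * (L2_norm \<Omega> (grad \<phi>))\<^sup>2 + 2 * (I / ?v) * I)"
  proof -
    have a: "2 * (ennreal r)\<^sup>2 * ennreal X = ennreal (2 * r\<^sup>2 * X)" if "X \<ge> 0" for X
      using r that by (simp add: ennreal_mult ennreal_power)
    have b: "2 * ennreal X * ennreal I = ennreal (2 * X * I)" if "X \<ge> 0" for X
      using I that by (simp add: ennreal_mult)
    have y: "I / ?v \<ge> 0" using v I by simp
    show ?thesis
      unfolding a[OF zero_le_power2] b[OF y]
      using r y I by (intro ennreal_plus[symmetric] mult_nonneg_nonneg) auto
  qed
  finally have "(L2_norm \<Omega> \<phi>)\<^sup>2 \<le> 2 * r\<^sup>2 * (L2_norm \<Omega> (grad \<phi>))\<^sup>2 + 2 * (I / ?v) * I"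
    using r v I by (subst (asm) ennreal_le_iff) (auto intro!: add_nonneg_nonneg mult_nonneg_nonneg divide_nonneg_pos)
  then show ?thesis by (simp add: I_def power2_eq_square)
qed

context bounded_open
begin

lemma Nash:
  assumes u: "H10_pair \<Omega> u G" and r: "r > 0"
  shows "(L2_norm \<Omega> u)\<^sup>2 \<le> 2 * r\<^sup>2 * (L2_norm \<Omega> G)\<^sup>2
    + 2 / (r ^ CARD('n) * unit_ball_volume TYPE('n)) * (LINT x|lebesgue_on \<Omega>. \<bar>u x\<bar>)\<^sup>2"
proof -
  obtain \<phi> where \<phi>: "\<And>k. test_function \<Omega> (\<phi> k)" "L2_tendsto \<Omega> \<phi> u" "L2_tendsto \<Omega> (\<lambda>k. grad (\<phi> k)) G"
    using u by (auto simp: H10_pair_def)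
  note L = H10_pairD[OF u] test_function_L2[OF \<phi>(1)]
  have "L2_tendsto \<Omega> (\<lambda>k x. \<bar>\<phi> k x\<bar>) (\<lambda>x. \<bar>u x\<bar>)"
  proof (rule L2_tendstoI)
    show "(\<lambda>x. \<bar>u x\<bar>) \<in> L2 \<Omega>" "(\<lambda>x. \<bar>\<phi> k x\<bar>) \<in> L2 \<Omega>" for k
      using L2_norm_fun[OF L(1)] L2_norm_fun[OF L(3)] by auto
    show "(\<lambda>k. 1 * L2_norm \<Omega> (\<lambda>x. \<phi> k x - u x)) \<longlonglongrightarrow> 0" using \<phi>(2) by (simp add: L2_tendsto_def)
    show "L2_norm \<Omega> (\<lambda>x. \<bar>\<phi> k x\<bar> - \<bar>u x\<bar>) \<le> 1 * L2_norm \<Omega> (\<lambda>x. \<phi> k x - u x)" for k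
      using L2D(1)[OF L(1)] L2D(1)[OF L(3)[of k]] by (intro L2_norm_bound L2_diff L) auto
  qed
  moreover have "(\<lambda>x. 1 :: real) \<in> L2 \<Omega>" by (intro bounded_in_L2[of _ 1]) auto
  ultimately have "(\<lambda>k. LINT x|lebesgue_on \<Omega>. \<bar>\<phi> k x\<bar> \<bullet> 1) \<longlonglongrightarrow> (LINT x|lebesgue_on \<Omega>. \<bar>u x\<bar> \<bullet> 1)"
    by (rule L2_tendsto_inner)
  then have 1: "(\<lambda>k. LINT x|lebesgue_on \<Omega>. \<bar>\<phi> k x\<bar>) \<longlonglongrightarrow> (LINT x|lebesgue_on \<Omega>. \<bar>u x\<bar>)" by simp
  show ?thesis
  proof (rule LIMSEQ_le)
    show "(\<lambda>k. (L2_norm \<Omega> (\<phi> k))\<^sup>2) \<longlonglongrightarrow> (L2_norm \<Omega> u)\<^sup>2"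
      by (intro tendsto_intros L2_tendsto_norm \<phi>)
    show "(\<lambda>k. 2 * r\<^sup>2 * (L2_norm \<Omega> (grad (\<phi> k)))\<^sup>2
      + 2 / (r ^ CARD('n) * unit_ball_volume TYPE('n)) * (LINT x|lebesgue_on \<Omega>. \<bar>\<phi> k x\<bar>)\<^sup>2) \<longlonglongrightarrow>
      2 * r\<^sup>2 * (L2_norm \<Omega> G)\<^sup>2 + 2 / (r ^ CARD('n) * unit_ball_volume TYPE('n)) * (LINT x|lebesgue_on \<Omega>. \<bar>u x\<bar>)\<^sup>2"
      by (intro tendsto_intros L2_tendsto_norm \<phi> 1)
    show "\<exists>N. \<forall>k\<ge>N. (L2_norm \<Omega> (\<phi> k))\<^sup>2 \<le> 2 * r\<^sup>2 * (L2_norm \<Omega> (grad (\<phi> k)))\<^sup>2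
      + 2 / (r ^ CARD('n) * unit_ball_volume TYPE('n)) * (LINT x|lebesgue_on \<Omega>. \<bar>\<phi> k x\<bar>)\<^sup>2"
      using Nash_test_function[OF \<Omega>_sets \<phi>(1) r] by blast
  qed
qed

text \<open>Nash's inequality with the radius adapted to the measure of the support gives a Faber-Krahn inequality.\<close>

lemma Faber_Krahn:
  assumes u: "H10_pair \<Omega> u G" and r: "r > 0"
    and E: "E \<in> sets (lebesgue_on \<Omega>)" "AE x in lebesgue_on \<Omega>. x \<notin> E \<longrightarrow> u x = 0"
    and m: "4 * measure (lebesgue_on \<Omega>) E \<le> r ^ CARD('n) * unit_ball_volume TYPE('n)"
  shows "L2_norm \<Omega> u \<le> 2 * r * L2_norm \<Omega> G"
proof -
  let ?v = "r ^ CARD('n) * unit_ball_volume TYPE('n)" and ?m = "measure (lebesgue_on \<Omega>) E"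
  have v: "?v > 0" using r unit_ball_volume(1)[where 'n='n] by simp
  note L = H10_pairD[OF u]
  have iL: "(indicator E :: _ \<Rightarrow> real) \<in> L2 \<Omega>"
    using E(1) by (intro bounded_in_L2[of _ 1]) (auto simp: indicator_def)
  have "(L2_norm \<Omega> (indicator E :: _ \<Rightarrow> real))\<^sup>2 = ?m"
  proof -
    have "(\<lambda>x. (norm (indicator E x :: real))\<^sup>2) = indicator E" by (auto simp: indicator_def)
    then show ?thesis unfolding L2_norm_sq using E(1) sets.sets_into_space[OF E(1)] by (simp add: Int_absorb2)
  qed
  then have iN: "L2_norm \<Omega> (indicator E :: _ \<Rightarrow> real) = sqrt ?m" by (simp add: real_sqrt_unique)
  have "(LINT x|lebesgue_on \<Omega>. \<bar>u x\<bar>) = (LINT x|lebesgue_on \<Omega>. indicator E x * \<bar>u x\<bar>)"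
  proof (rule integral_cong_AE)
    show "AE x in lebesgue_on \<Omega>. \<bar>u x\<bar> = indicator E x * \<bar>u x\<bar>"
      using E(2) by eventually_elim (auto simp: indicator_def)
  qed (use L2D(1)[OF L(1)] E in auto)
  also have "\<dots> \<le> \<bar>LINT x|lebesgue_on \<Omega>. indicator E x * \<bar>u x\<bar>\<bar>" by simp
  also have "\<dots> \<le> sqrt ?m * L2_norm \<Omega> u"
    using L2_mult_le[OF iL L2_norm_fun[OF L(1)]] L2_norm_norm[of \<Omega> u] by (simp add: iN)
  finally have "(LINT x|lebesgue_on \<Omega>. \<bar>u x\<bar>)\<^sup>2 \<le> (sqrt ?m * L2_norm \<Omega> u)\<^sup>2"
    by (intro power_mono) auto
  then have "(LINT x|lebesgue_on \<Omega>. \<bar>u x\<bar>)\<^sup>2 \<le> ?m * (L2_norm \<Omega> u)\<^sup>2"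
    by (simp add: power_mult_distrib)
  \<comment> \<open>Hypothesis \<open>m\<close> makes the \<open>L1\<close> term of Nash's
    inequality at most half of the left-hand side, which absorbs it.\<close>
  then have "2 / ?v * (LINT x|lebesgue_on \<Omega>. \<bar>u x\<bar>)\<^sup>2 \<le> 2 / ?v * (?m * (L2_norm \<Omega> u)\<^sup>2)"
    using v by (intro mult_left_mono) auto
  also have "\<dots> = (4 * ?m) / ?v * ((L2_norm \<Omega> u)\<^sup>2 / 2)" by simp
  also have "\<dots> \<le> 1 * ((L2_norm \<Omega> u)\<^sup>2 / 2)"
    using m v by (intro mult_right_mono) (auto simp: divide_le_eq_1)
  finally have "(L2_norm \<Omega> u)\<^sup>2 \<le> 2 * r\<^sup>2 * (L2_norm \<Omega> G)\<^sup>2 + (L2_norm \<Omega> u)\<^sup>2 / 2"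
    using Nash[OF u r] by simp
  then have "(L2_norm \<Omega> u)\<^sup>2 \<le> (2 * r * L2_norm \<Omega> G)\<^sup>2" by (simp add: power_mult_distrib)
  then show ?thesis by (rule power2_le_imp_le) (use r in simp)
qed

end

text \<open>For a fixed position \<open>t\<close> on the rays the mean over \<open>y\<close> is one
  over a ball of radius \<open>a + t * b\<close>, hence at least \<open>a\<close>, and is bounded by
  the whole integral divided by the volume of the smallest such ball. This is a pointwise bound, in
  contrast to the \<open>L2\<close> bound valid for every \<open>a\<close>.\<close>

lemma ray_average_sq_le:
  fixes \<phi> :: "real ^ 'n::finite \<Rightarrow> real"
  assumes \<Omega>: "\<Omega> \<in> sets lebesgue" and \<phi>: "test_function \<Omega> \<phi>" and a: "a > 0" "b \<ge> 0"
  shows "(ray_average a b \<phi> x)\<^sup>2 \<le> ennreal ((L2_norm \<Omega> (grad \<phi>))\<^sup>2 / (a ^ CARD('n) * unit_ball_volume TYPE('n)))"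
proof -
  note C1 = test_function_C1[OF \<phi>] and ni = test_function_nn_integrals[OF \<Omega> \<phi>]
  let ?\<mu> = "unit_ball_measure :: (real ^ 'n) measure"
  have [measurable]: "grad \<phi> \<in> borel_measurable borel" using C1D(2)[OF C1] by (rule borel_measurable_continuous_onI)
  interpret pair_sigma_finite ?\<mu> unit_interval_measure
    using sigma_finite_unit_measures by (simp add: pair_sigma_finite_def)
  have m: "(\<lambda>\<omega>. (ennreal (norm (grad \<phi> (x + (a + snd \<omega> * b) *\<^sub>R fst \<omega>))))\<^sup>2) \<in> borel_measurable (borel \<Otimes>\<^sub>M borel)"
    by measurable
  have "(ray_average a b \<phi> x)\<^sup>2 \<le> (\<integral>\<^sup>+\<omega>. (ennreal (norm (grad \<phi> (x + (a + snd \<omega> * b) *\<^sub>R fst \<omega>))))\<^sup>2 \<partial>ray_measure)"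
    unfolding ray_average_def by (intro nn_integral_sq_le emeasure_ray_measure) measurable
  also have "\<dots> = (\<integral>\<^sup>+y. \<integral>\<^sup>+t. (ennreal (norm (grad \<phi> (x + (a + t * b) *\<^sub>R y))))\<^sup>2 \<partial>unit_interval_measure \<partial>?\<mu>)"
    using nn_integral_ray_measure[OF m] by simp
  also have "\<dots> = (\<integral>\<^sup>+t. \<integral>\<^sup>+y. (ennreal (norm (grad \<phi> (x + (a + t * b) *\<^sub>R y))))\<^sup>2 \<partial>?\<mu> \<partial>unit_interval_measure)"
    by (rule Fubini'[symmetric]) measurable
  also have "\<dots> \<le> (\<integral>\<^sup>+t. ennreal ((L2_norm \<Omega> (grad \<phi>))\<^sup>2 / (a ^ CARD('n) * unit_ball_volume TYPE('n))) \<partial>unit_interval_measure)"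
  proof (rule nn_integral_mono_AE)
    have "AE t in unit_interval_measure. 0 \<le> t"
      unfolding unit_interval_measure_def by (rule AE_uniform_measureI) auto
    then show "AE t in unit_interval_measure. (\<integral>\<^sup>+y. (ennreal (norm (grad \<phi> (x + (a + t * b) *\<^sub>R y))))\<^sup>2 \<partial>?\<mu>)
       \<le> ennreal ((L2_norm \<Omega> (grad \<phi>))\<^sup>2 / (a ^ CARD('n) * unit_ball_volume TYPE('n)))"
    proof eventually_elim
      case (elim t)
      let ?R = "a + t * b" and ?w = "unit_ball_volume TYPE('n)"
      have R: "?R > 0" "a \<le> ?R" using a elim by (auto intro: add_pos_nonneg)
      have w: "?w > 0" by (rule unit_ball_volume)
      have "(\<integral>\<^sup>+y. (ennreal (norm (grad \<phi> (x + ?R *\<^sub>R y))))\<^sup>2 \<partial>?\<mu>)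
        \<le> ennreal ((L2_norm \<Omega> (grad \<phi>))\<^sup>2) / (ennreal (?R ^ CARD('n)) * ennreal ?w)"
        using average_le_nn_integral[of "\<lambda>x. (ennreal (norm (grad \<phi> x)))\<^sup>2" ?R x] R(1)
        unfolding ni(3) unit_ball_volume(2) by simp
      also have "\<dots> = ennreal ((L2_norm \<Omega> (grad \<phi>))\<^sup>2 / (?R ^ CARD('n) * ?w))"
      proof -
        have "ennreal (?R ^ CARD('n)) * ennreal ?w = ennreal (?R ^ CARD('n) * ?w)"
          using R w by (intro ennreal_mult[symmetric]) auto
        then show ?thesis using R w by (simp only:) (rule divide_ennreal, auto)
      qed
      also have "\<dots> \<le> ennreal ((L2_norm \<Omega> (grad \<phi>))\<^sup>2 / (a ^ CARD('n) * ?w))"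
        using R w a by (intro ennreal_leI divide_left_mono mult_right_mono power_mono mult_pos_pos) auto
      finally show ?case .
    qed
  qed
  also have "\<dots> = ennreal ((L2_norm \<Omega> (grad \<phi>))\<^sup>2 / (a ^ CARD('n) * unit_ball_volume TYPE('n)))"
    by (simp only: nn_integral_const emeasure_unit_measures mult_1_right)
  finally show ?thesis .
qed

text \<open>Where \<open>g\<close> is at most \<open>s / l\<close>, the second term suffices;
  elsewhere \<open>X\<^sup>2 \<le> s \<le> l * g\<close>, and the first term does.\<close>

lemma ennreal_mult_sq_le:
  fixes g X :: ennreal
  assumes "X\<^sup>2 \<le> ennreal s" "l > 0" "s \<ge> 0"
  shows "g * X\<^sup>2 \<le> ennreal l * g\<^sup>2 + ennreal (s / l) * X\<^sup>2"
proof (cases "g \<le> ennreal (s / l)")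
  case True
  then have "g * X\<^sup>2 \<le> ennreal (s / l) * X\<^sup>2" by (rule mult_right_mono) simp
  then show ?thesis by (rule order_trans) simp
next
  case False
  have "ennreal s = ennreal l * ennreal (s / l)" using assms by (subst ennreal_mult[symmetric]) auto
  moreover have "ennreal (s / l) \<le> g" using False linear by blast
  ultimately have "X\<^sup>2 \<le> ennreal l * g"
    using assms(1) mult_left_mono[of "ennreal (s / l)" g "ennreal l"] by simp
  then have "g * X\<^sup>2 \<le> g * (ennreal l * g)" by (rule mult_left_mono) simp
  also have "\<dots> = ennreal l * g\<^sup>2" by (simp only: power2_eq_square ac_simps)
  finally show ?thesis by (rule order_trans) simp
qed

context bounded_open
begin

text \<open>Replaces Hoelder's inequality with an \<open>L4\<close> norm of \<open>X\<close>: a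
  uniform bound and an \<open>L2\<close> bound enter through their product, and the free parameter
  \<open>l\<close> balances the two terms.\<close>

lemma weighted_nn_integral_le:
  fixes X :: "real ^ 'n \<Rightarrow> ennreal"
  assumes g: "g \<in> L2 \<Omega>" and X[measurable]: "X \<in> borel_measurable borel"
    and s: "\<And>x. (X x)\<^sup>2 \<le> ennreal s" and q: "(\<integral>\<^sup>+x. (X x)\<^sup>2 \<partial>lborel) \<le> ennreal q"
    and pos: "l > 0" "s \<ge> 0" "q \<ge> 0"
  shows "(\<integral>\<^sup>+x. ennreal (norm (g x)) * (X x)\<^sup>2 \<partial>lebesgue_on \<Omega>) \<le> ennreal (l * (L2_norm \<Omega> g)\<^sup>2 + s / l * q)"
proof -
  have [measurable]: "g \<in> borel_measurable (lebesgue_on \<Omega>)" "X \<in> borel_measurable (lebesgue_on \<Omega>)"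
    using L2D(1)[OF g] measurable_lborel_lebesgue_on[OF X] by auto
  have "(\<integral>\<^sup>+x. ennreal (norm (g x)) * (X x)\<^sup>2 \<partial>lebesgue_on \<Omega>)
    \<le> (\<integral>\<^sup>+x. ennreal l * (ennreal (norm (g x)))\<^sup>2 + ennreal (s / l) * (X x)\<^sup>2 \<partial>lebesgue_on \<Omega>)"
    by (intro nn_integral_mono ennreal_mult_sq_le s pos)
  also have "\<dots> = ennreal l * (\<integral>\<^sup>+x. (ennreal (norm (g x)))\<^sup>2 \<partial>lebesgue_on \<Omega>) + ennreal (s / l) * (\<integral>\<^sup>+x. (X x)\<^sup>2 \<partial>lebesgue_on \<Omega>)"
    by (simp add: nn_integral_add nn_integral_cmult)
  also have "\<dots> \<le> ennreal l * ennreal ((L2_norm \<Omega> g)\<^sup>2) + ennreal (s / l) * ennreal q"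
    unfolding L2_norm_nn_integral[OF g]
    by (intro add_left_mono mult_left_mono order_trans[OF nn_integral_lebesgue_on_le_lborel[OF \<Omega>_sets] q]) auto
  also have "\<dots> = ennreal (l * (L2_norm \<Omega> g)\<^sup>2 + s / l * q)"
    using pos by (simp only: ennreal_plus ennreal_mult zero_le_power2 divide_nonneg_pos less_imp_le mult_nonneg_nonneg)
  finally show ?thesis .
qed

text \<open>The telescoping sum runs over averages at the scales \<open>16 ^ (- j)\<close>; the increments are
  bounded uniformly and in \<open>L2\<close>, and the product of the two bounds decays geometrically
  since the dimension is at most three.\<close>

lemma form_bounded_test_function:
  assumes n: "CARD('n) \<le> 3" and g: "g \<in> L2 \<Omega>" and \<phi>: "test_function \<Omega> \<phi>"
    and A: "A > 0" "(L2_norm \<Omega> \<phi>)\<^sup>2 \<le> A" "(L2_norm \<Omega> (grad \<phi>))\<^sup>2 \<le> A"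
  shows "(LINT x|lebesgue_on \<Omega>. norm (g x) * (\<phi> x)\<^sup>2) \<le> 4 * A * ((L2_norm \<Omega> g)\<^sup>2 + 65536 / unit_ball_volume TYPE('n))"
proof -
  note C1 = test_function_C1[OF \<phi>] and ni = test_function_nn_integrals[OF \<Omega>_sets \<phi>]
  let ?\<mu> = "unit_ball_measure :: (real ^ 'n) measure"
  let ?w = "unit_ball_volume TYPE('n)"
  have w: "?w > 0" by (rule unit_ball_volume)
  obtain M where M: "M > 0" "\<And>x. \<bar>\<phi> x\<bar> \<le> M" "\<And>x. norm (grad \<phi> x) \<le> M" using test_function_bounded[OF \<phi>] by metis
  have [measurable]: "\<phi> \<in> borel_measurable borel" using C1D(3)[OF C1] by (rule borel_measurable_continuous_onI)
  interpret \<mu>: finite_measure ?\<mu>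
    using emeasure_unit_measures(1)[where 'a="real ^ 'n"] by (intro finite_measureI) simp
  define r where "r j = (1 / 16 :: real) ^ j" for j
  have r: "r j > 0" "r j \<le> 1" "r (Suc j) = r j / 16" for j by (auto simp: r_def power_le_one)
  define T where "T j x = (LINT y|?\<mu>. \<phi> (x + r j *\<^sub>R y))" for j x
  have Tint: "integrable ?\<mu> (\<lambda>y. \<phi> (x + c *\<^sub>R y))" for x c
    using M by (intro \<mu>.integrable_const_bound[of _ M]) auto
  have prob: "measure ?\<mu> (space ?\<mu>) = 1" using emeasure_unit_measures(1)[where 'a="real ^ 'n"] by (simp add: measure_def)
  define b where "b j = r j - r (Suc j)" for j
  have b: "b j \<ge> 0" "b j \<le> r j" "r (Suc j) + b j = r j" for j using r[of j] by (auto simp: b_def)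
  \<comment> \<open>\<open>X 0\<close> is the absolute value of the mean at scale \<open>1\<close>;
    \<open>X (Suc j)\<close> dominates the change of the mean from scale \<open>r j\<close> to scale
    \<open>r (Suc j)\<close>. Telescoping gives
    \<open>\<bar>\<phi> x\<bar> \<le> (\<Sum>j. X j x)\<close>.\<close>
  define X where "X j x = (case j of 0 \<Rightarrow> ennreal \<bar>T 0 x\<bar> | Suc j \<Rightarrow> ennreal (b j) * ray_average (r (Suc j)) (b j) \<phi> x)" for j x
  have diff: "ennreal \<bar>T (Suc j) x - T j x\<bar> \<le> X (Suc j) x" for j x
  proof -
    have i: "integrable ?\<mu> (\<lambda>y. \<phi> (x + r (Suc j) *\<^sub>R y) - \<phi> (x + r j *\<^sub>R y))" by (intro Bochner_Integration.integrable_diff Tint)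
    have "T (Suc j) x - T j x = (LINT y|?\<mu>. \<phi> (x + r (Suc j) *\<^sub>R y) - \<phi> (x + r j *\<^sub>R y))"
      unfolding T_def by (rule Bochner_Integration.integral_diff[symmetric]) (rule Tint)+
    then have "ennreal \<bar>T (Suc j) x - T j x\<bar> \<le> (\<integral>\<^sup>+y. ennreal \<bar>\<phi> (x + r (Suc j) *\<^sub>R y) - \<phi> (x + r j *\<^sub>R y)\<bar> \<partial>?\<mu>)"
      using integral_norm_bound_ennreal[OF i] by simp
    also have "\<dots> = (\<integral>\<^sup>+y. ennreal \<bar>\<phi> (x + (r (Suc j) + b j) *\<^sub>R y) - \<phi> (x + r (Suc j) *\<^sub>R y)\<bar> \<partial>?\<mu>)"
      by (simp only: b abs_minus_commute)
    also have "\<dots> \<le> ennreal (b j) * ray_average (r (Suc j)) (b j) \<phi> x"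
      using b by (intro average_increment_le[OF C1]) auto
    finally show ?thesis by (simp add: X_def)
  qed
  have part: "ennreal \<bar>T J x\<bar> \<le> (\<Sum>j\<le>J. X j x)" for J x
  proof (induction J)
    case 0 show ?case by (simp add: X_def)
  next
    case (Suc J)
    have "ennreal \<bar>T (Suc J) x\<bar> \<le> ennreal (\<bar>T J x\<bar> + \<bar>T (Suc J) x - T J x\<bar>)" by (intro ennreal_leI) linarith
    also have "\<dots> \<le> (\<Sum>j\<le>J. X j x) + X (Suc J) x" using Suc diff[of J x] by (simp add: ennreal_plus add_mono)
    finally show ?case by simp
  qed
  have limT: "(\<lambda>J. T J x) \<longlonglongrightarrow> \<phi> x" for x
  proof (rule LIM_zero_cancel, rule Lim_null_comparison)
    show "\<forall>\<^sub>F J in sequentially. norm (T J x - \<phi> x) \<le> M * r J"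
    proof (rule always_eventually, rule allI)
      fix J
      have "T J x - \<phi> x = (LINT y|?\<mu>. \<phi> (x + r J *\<^sub>R y) - \<phi> x)"
        using Tint[of x "r J"] prob by (simp add: T_def)
      also have "norm (LINT y|?\<mu>. \<phi> (x + r J *\<^sub>R y) - \<phi> x) \<le> (LINT y|?\<mu>. norm (\<phi> (x + r J *\<^sub>R y) - \<phi> x))"
        by (rule integral_norm_bound)
      also have "\<dots> \<le> (LINT y|?\<mu>. M * r J)"
      proof (rule integral_mono_AE)
        show "integrable ?\<mu> (\<lambda>y. norm (\<phi> (x + r J *\<^sub>R y) - \<phi> x))" using Tint by (intro integrable_norm) simp
        show "AE y in ?\<mu>. norm (\<phi> (x + r J *\<^sub>R y) - \<phi> x) \<le> M * r J"
          using AE_unit_ball_measure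
        proof eventually_elim
          case (elim y)
          have "\<bar>\<phi> (x + r J *\<^sub>R y) - \<phi> x\<bar> \<le> M * norm (r J *\<^sub>R y)"
            using C1_Lipschitz[OF C1 M(3), of "x + r J *\<^sub>R y" x] by simp
          also have "\<dots> \<le> M * r J" using elim r(1)[of J] M(1) by (intro mult_left_mono) (auto intro: mult_left_le)
          finally show ?case by simp
        qed
      qed auto
      also have "\<dots> = M * r J" using prob by simp
      finally show "norm (T J x - \<phi> x) \<le> M * r J" .
    qed
    have "r \<longlonglongrightarrow> 0" unfolding r_def by (intro LIMSEQ_realpow_zero) auto
    then show "(\<lambda>J. M * r J) \<longlonglongrightarrow> 0" by (rule tendsto_mult_right_zero)
  qed
  have le: "ennreal \<bar>\<phi> x\<bar> \<le> (\<Sum>j. X j x)" for x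
  proof (rule LIMSEQ_le_const2)
    show "(\<lambda>J. ennreal \<bar>T J x\<bar>) \<longlonglongrightarrow> ennreal \<bar>\<phi> x\<bar>" by (intro tendsto_ennrealI tendsto_rabs limT)
    have "(\<Sum>j\<le>J. X j x) \<le> (\<Sum>j. X j x)" for J by (intro sum_le_suminf) auto
    then show "\<exists>N. \<forall>J\<ge>N. ennreal \<bar>T J x\<bar> \<le> (\<Sum>j. X j x)" using part order_trans by blast
  qed
  note l = sigma_finite_unit_measures(1)[where 'a="real ^ 'n"] emeasure_unit_measures(1)[where 'a="real ^ 'n"]
  have X0: "X 0 x \<le> (\<integral>\<^sup>+y. ennreal \<bar>\<phi> (x + 1 *\<^sub>R y)\<bar> \<partial>?\<mu>)" for x
    using integral_norm_bound_ennreal[OF Tint[of x "1"]] by (simp add: X_def T_def r_def)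
  have Xm[measurable]: "X j \<in> borel_measurable borel" for j
  proof (cases j)
    case 0
    have "(\<lambda>x. T 0 x) \<in> borel_measurable borel"
      unfolding T_def by (rule \<mu>.borel_measurable_lebesgue_integral) measurable
    moreover have "X 0 = (\<lambda>x. ennreal \<bar>T 0 x\<bar>)" by (simp add: X_def fun_eq_iff)
    ultimately show ?thesis using 0 by simp
  next
    case (Suc i)
    moreover have "X (Suc i) = (\<lambda>x. ennreal (b i) * ray_average (r (Suc i)) (b i) \<phi> x)" by (simp add: X_def fun_eq_iff)
    ultimately show ?thesis using ray_average(1)[OF C1] by simp
  qed
  define t where "t = (L2_norm \<Omega> g)\<^sup>2 + 65536 / ?w"
  have t: "t \<ge> 0" using w by (simp add: t_def)
  have bnd: "(\<integral>\<^sup>+x. ennreal (norm (g x)) * (X j x)\<^sup>2 \<partial>lebesgue_on \<Omega>) \<le> ennreal ((1 / 4) ^ j * A * t)" for j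
  proof (cases j)
    case 0
    have T2: "(X 0 x)\<^sup>2 \<le> (\<integral>\<^sup>+y. (ennreal \<bar>\<phi> (x + 1 *\<^sub>R y)\<bar>)\<^sup>2 \<partial>?\<mu>)" for x
    proof -
      have "(X 0 x)\<^sup>2 \<le> (\<integral>\<^sup>+y. ennreal \<bar>\<phi> (x + 1 *\<^sub>R y)\<bar> \<partial>?\<mu>)\<^sup>2" using X0 by (intro power_mono) auto
      also have "\<dots> \<le> (\<integral>\<^sup>+y. (ennreal \<bar>\<phi> (x + 1 *\<^sub>R y)\<bar>)\<^sup>2 \<partial>?\<mu>)" by (intro nn_integral_sq_le l) measurable
      finally show ?thesis .
    qed
    have "(X 0 x)\<^sup>2 \<le> ennreal (A / ?w)" for x
    proof -
      note T2
      also have "(\<integral>\<^sup>+y. (ennreal \<bar>\<phi> (x + 1 *\<^sub>R y)\<bar>)\<^sup>2 \<partial>?\<mu>) \<le> ennreal ((L2_norm \<Omega> \<phi>)\<^sup>2) / (ennreal (1 ^ CARD('n)) * ennreal ?w)"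
        using average_le_nn_integral[of "\<lambda>x. (ennreal \<bar>\<phi> x\<bar>)\<^sup>2" 1 x] unfolding ni unit_ball_volume(2) by simp
      also have "\<dots> = ennreal ((L2_norm \<Omega> \<phi>)\<^sup>2 / ?w)" using w divide_ennreal[OF zero_le_power2 w] by simp
      also have "\<dots> \<le> ennreal (A / ?w)" using A w by (intro ennreal_leI divide_right_mono) auto
      finally show ?thesis .
    qed
    moreover have "(\<integral>\<^sup>+x. (X 0 x)\<^sup>2 \<partial>lborel) \<le> ennreal A"
    proof -
      have "(\<integral>\<^sup>+x. (X 0 x)\<^sup>2 \<partial>lborel) \<le> (\<integral>\<^sup>+x. \<integral>\<^sup>+y. (ennreal \<bar>\<phi> (x + 1 *\<^sub>R y)\<bar>)\<^sup>2 \<partial>?\<mu> \<partial>lborel)"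
        by (intro nn_integral_mono T2)
      also have "\<dots> = ennreal ((L2_norm \<Omega> \<phi>)\<^sup>2)"
        using nn_integral_average_translates[OF l, of "\<lambda>y. y" "\<lambda>x. (ennreal \<bar>\<phi> x\<bar>)\<^sup>2"] by (simp add: ni[simplified])
      also have "\<dots> \<le> ennreal A" using A by (intro ennreal_leI)
      finally show ?thesis .
    qed
    ultimately have "(\<integral>\<^sup>+x. ennreal (norm (g x)) * (X 0 x)\<^sup>2 \<partial>lebesgue_on \<Omega>) \<le> ennreal (A * (L2_norm \<Omega> g)\<^sup>2 + (A / ?w) / A * A)"
      using A w by (intro weighted_nn_integral_le[OF g Xm]) auto
    also have "\<dots> \<le> ennreal ((1 / 4) ^ 0 * A * t)"
      using A w by (intro ennreal_leI) (auto simp: t_def distrib_left divide_right_mono)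
    finally show ?thesis using 0 by simp
  next
    case (Suc i)
    have rs: "r (Suc i) > 0" "b i \<le> 16 * r (Suc i)" "r (Suc i) \<le> 1" using r[of i] r[of "Suc i"] b(2)[of i] by auto
    \<comment> \<open>\<open>256\<close> is the square of the ratio \<open>16\<close> of consecutive
      scales. It enters both the uniform and the \<open>L2\<close> bound, whence
      \<open>65536 = 256\<^sup>2\<close>.\<close>
    have b2: "(b i)\<^sup>2 \<le> 256 * (r (Suc i))\<^sup>2" using power_mono[OF rs(2) b(1), of 2] by (simp add: power_mult_distrib)
    have s: "(X (Suc i) x)\<^sup>2 \<le> ennreal (256 * A / (r (Suc i) * ?w))" for x
    proof -
      have "(X (Suc i) x)\<^sup>2 = (ennreal (b i))\<^sup>2 * (ray_average (r (Suc i)) (b i) \<phi> x)\<^sup>2" by (simp add: X_def power_mult_distrib)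
      also have "\<dots> \<le> (ennreal (b i))\<^sup>2 * ennreal ((L2_norm \<Omega> (grad \<phi>))\<^sup>2 / (r (Suc i) ^ CARD('n) * ?w))"
        using rs b by (intro mult_left_mono ray_average_sq_le[OF \<Omega>_sets \<phi>]) auto
      also have "\<dots> = ennreal ((b i)\<^sup>2 * ((L2_norm \<Omega> (grad \<phi>))\<^sup>2 / (r (Suc i) ^ CARD('n) * ?w)))"
        unfolding ennreal_power[OF b(1)] using rs w
        by (intro ennreal_mult[symmetric] divide_nonneg_pos mult_pos_pos zero_less_power zero_le_power2)
      \<comment> \<open>The radius is at most \<open>1\<close>, so the exponent
        \<open>CARD('n)\<close> may be raised to \<open>3\<close>. One negative power of the radius
        remains in the uniform bound, against two positive ones in the \<open>L2\<close>
        bound.\<close>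
      also have "\<dots> \<le> ennreal (256 * (r (Suc i))\<^sup>2 * (A / (r (Suc i) ^ 3 * ?w)))"
        using b2 A rs w n by (intro ennreal_leI mult_mono frac_le mult_right_mono power_decreasing mult_pos_pos divide_nonneg_pos) auto
      also have "256 * (r (Suc i))\<^sup>2 * (A / (r (Suc i) ^ 3 * ?w)) = 256 * A / (r (Suc i) * ?w)"
        using rs w by (simp add: field_simps power2_eq_square power3_eq_cube)
      finally show ?thesis .
    qed
    have q: "(\<integral>\<^sup>+x. (X (Suc i) x)\<^sup>2 \<partial>lborel) \<le> ennreal (256 * (r (Suc i))\<^sup>2 * A)"
    proof -
      have [measurable]: "ray_average (r (Suc i)) (b i) \<phi> \<in> borel_measurable borel" by (rule ray_average[OF C1])
      have "(\<integral>\<^sup>+x. (X (Suc i) x)\<^sup>2 \<partial>lborel) = (ennreal (b i))\<^sup>2 * (\<integral>\<^sup>+x. (ray_average (r (Suc i)) (b i) \<phi> x)\<^sup>2 \<partial>lborel)"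
        by (simp add: X_def power_mult_distrib nn_integral_cmult)
      also have "\<dots> \<le> (ennreal (b i))\<^sup>2 * ennreal ((L2_norm \<Omega> (grad \<phi>))\<^sup>2)"
        unfolding ni(3)[symmetric] by (intro mult_left_mono ray_average[OF C1]) auto
      also have "\<dots> = ennreal ((b i)\<^sup>2 * (L2_norm \<Omega> (grad \<phi>))\<^sup>2)" unfolding ennreal_power[OF b(1)]
        by (intro ennreal_mult[symmetric] zero_le_power2)
      also have "\<dots> \<le> ennreal (256 * (r (Suc i))\<^sup>2 * A)" using b2 A by (intro ennreal_leI mult_mono) auto
      finally show ?thesis .
    qed
    \<comment> \<open>The product of the two bounds is of order
      \<open>r (Suc i) = (1 / 16) ^ Suc i\<close>; dividing it by a weight of order
      \<open>(1 / 4) ^ Suc i\<close> leaves the same power, so both terms decay alike.\<close>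
    let ?l = "(1 / 4) ^ Suc i * A"
    have "(\<integral>\<^sup>+x. ennreal (norm (g x)) * (X (Suc i) x)\<^sup>2 \<partial>lebesgue_on \<Omega>)
      \<le> ennreal (?l * (L2_norm \<Omega> g)\<^sup>2 + (256 * A / (r (Suc i) * ?w)) / ?l * (256 * (r (Suc i))\<^sup>2 * A))"
      using A rs w by (intro weighted_nn_integral_le[OF g Xm s q] mult_pos_pos) auto
    also have "(256 * A / (r (Suc i) * ?w)) / ?l * (256 * (r (Suc i))\<^sup>2 * A) = 65536 / ?w * A * (r (Suc i) / (1 / 4) ^ Suc i)"
      using A rs w by (simp add: field_simps power2_eq_square)
    also have "r (Suc i) / (1 / 4) ^ Suc i = (1 / 4) ^ Suc i"
      unfolding r_def power_divide[symmetric] by simp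
    also have "?l * (L2_norm \<Omega> g)\<^sup>2 + 65536 / ?w * A * (1 / 4) ^ Suc i = (1 / 4) ^ Suc i * A * t"
      by (simp add: t_def algebra_simps)
    finally show ?thesis using Suc by simp
  qed
  have gm[measurable]: "g \<in> borel_measurable (lebesgue_on \<Omega>)" using L2D(1)[OF g] .
  have [measurable]: "X j \<in> borel_measurable (lebesgue_on \<Omega>)" for j using measurable_lborel_lebesgue_on[OF Xm] .
  have "(\<integral>\<^sup>+x. ennreal (norm (g x) * (\<phi> x)\<^sup>2) \<partial>lebesgue_on \<Omega>)
    \<le> (\<integral>\<^sup>+x. (\<Sum>j. ennreal (2 ^ Suc j) * (ennreal (norm (g x)) * (X j x)\<^sup>2)) \<partial>lebesgue_on \<Omega>)"
  proof (rule nn_integral_mono)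
    fix x
    have "ennreal (norm (g x) * (\<phi> x)\<^sup>2) = ennreal (norm (g x)) * (ennreal \<bar>\<phi> x\<bar>)\<^sup>2"
      by (simp add: ennreal_mult ennreal_power)
    also have "\<dots> \<le> ennreal (norm (g x)) * (\<Sum>j. ennreal (2 ^ Suc j) * (X j x)\<^sup>2)"
      by (intro mult_left_mono order_trans[OF power_mono[OF le] nn_integral_geometric_sq_le]) auto
    also have "\<dots> = (\<Sum>j. ennreal (2 ^ Suc j) * (ennreal (norm (g x)) * (X j x)\<^sup>2))"
      by (simp only: ennreal_suminf_cmult[symmetric] mult.left_commute)
    finally show "ennreal (norm (g x) * (\<phi> x)\<^sup>2) \<le> (\<Sum>j. ennreal (2 ^ Suc j) * (ennreal (norm (g x)) * (X j x)\<^sup>2))" .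
  qed
  also have "\<dots> = (\<Sum>j. ennreal (2 ^ Suc j) * (\<integral>\<^sup>+x. ennreal (norm (g x)) * (X j x)\<^sup>2 \<partial>lebesgue_on \<Omega>))"
  proof -
    have mm: "(\<lambda>x. ennreal (norm (g x)) * (X j x)\<^sup>2) \<in> borel_measurable (lebesgue_on \<Omega>)" for j
      by measurable
    have "(\<integral>\<^sup>+x. (\<Sum>j. ennreal (2 ^ Suc j) * (ennreal (norm (g x)) * (X j x)\<^sup>2)) \<partial>lebesgue_on \<Omega>) =
      (\<Sum>j. \<integral>\<^sup>+x. ennreal (2 ^ Suc j) * (ennreal (norm (g x)) * (X j x)\<^sup>2) \<partial>lebesgue_on \<Omega>)"
      by (rule nn_integral_suminf) (use mm in measurable)
    then show ?thesis by (simp only: nn_integral_cmult[OF mm])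
  qed
  \<comment> \<open>Squaring the telescoping sum costs \<open>2 ^ Suc j\<close>, which the decay
    \<open>(1 / 4) ^ j\<close> more than compensates; the remaining geometric series accounts for
    the factor \<open>4\<close>.\<close>
  also have "\<dots> \<le> (\<Sum>j. ennreal (2 * A * t * (1 / 2) ^ j))"
  proof (rule suminf_le)
    fix j
    have "ennreal (2 ^ Suc j) * (\<integral>\<^sup>+x. ennreal (norm (g x)) * (X j x)\<^sup>2 \<partial>lebesgue_on \<Omega>) \<le> ennreal (2 ^ Suc j) * ennreal ((1 / 4) ^ j * A * t)"
      by (intro mult_left_mono bnd) auto
    also have "\<dots> = ennreal (2 ^ Suc j * ((1 / 4) ^ j * A * t))"
      using A t by (intro ennreal_mult[symmetric]) auto
    also have "2 ^ Suc j * ((1 / 4) ^ j * A * t) = 2 * A * t * (1 / 2) ^ j"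
    proof -
      have "(2::real) ^ j * (1 / 4) ^ j = (1 / 2) ^ j" by (simp add: power_mult_distrib[symmetric])
      then show ?thesis by (simp add: mult.assoc[symmetric])
    qed
    finally show "ennreal (2 ^ Suc j) * (\<integral>\<^sup>+x. ennreal (norm (g x)) * (X j x)\<^sup>2 \<partial>lebesgue_on \<Omega>) \<le> ennreal (2 * A * t * (1 / 2) ^ j)" .
  qed auto
  also have "\<dots> = ennreal (\<Sum>j. 2 * A * t * (1 / 2) ^ j)"
    using A t by (intro suminf_ennreal2 summable_mult summable_geometric) auto
  also have "(\<Sum>j. 2 * A * t * (1 / 2) ^ j) = 4 * A * t"
    by (subst suminf_mult) (auto simp: suminf_geometric)
  finally have "(\<integral>\<^sup>+x. ennreal (norm (g x) * (\<phi> x)\<^sup>2) \<partial>lebesgue_on \<Omega>) \<le> ennreal (4 * A * t)" .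
  moreover have "(LINT x|lebesgue_on \<Omega>. norm (g x) * (\<phi> x)\<^sup>2) \<le> 4 * A * t"
    if "(\<integral>\<^sup>+x. ennreal (norm (g x) * (\<phi> x)\<^sup>2) \<partial>lebesgue_on \<Omega>) \<le> ennreal (4 * A * t)"
  proof -
    have "\<phi> \<in> borel_measurable (lebesgue_on \<Omega>)" by (rule measurable_lborel_lebesgue_on) measurable
    then have [measurable]: "(\<lambda>x. norm (g x) * (\<phi> x)\<^sup>2) \<in> borel_measurable (lebesgue_on \<Omega>)" by measurable
    have "(LINT x|lebesgue_on \<Omega>. norm (g x) * (\<phi> x)\<^sup>2) = enn2real (\<integral>\<^sup>+x. ennreal (norm (g x) * (\<phi> x)\<^sup>2) \<partial>lebesgue_on \<Omega>)"
      by (intro integral_eq_nn_integral) auto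
    also have "\<dots> \<le> 4 * A * t" using that A t by (intro enn2real_leI) auto
    finally show ?thesis .
  qed
  ultimately show ?thesis by (simp add: t_def)
qed

end

subsection \<open>Boundedness of weak solutions\<close>

context bounded_open
begin

lemma matrix_vector_measurable:
  fixes A :: "real ^ 'n \<Rightarrow> real ^ 'n ^ 'n"
  assumes "\<And>i j. (\<lambda>x. A x $ i $ j) \<in> borel_measurable (lebesgue_on \<Omega>)"
    and "G \<in> borel_measurable (lebesgue_on \<Omega>)"
  shows "(\<lambda>x. A x *v G x) \<in> borel_measurable (lebesgue_on \<Omega>)"
proof (subst borel_measurable_euclidean_space, rule ballI)
  fix b :: "real ^ 'n" assume "b \<in> Basis"
  then obtain i where b: "b = axis i 1" by (auto simp: Basis_vec_def)
  have "(\<lambda>x. G x \<bullet> axis j 1) \<in> borel_measurable (lebesgue_on \<Omega>)" for j using assms(2) by (intro borel_measurable_inner) auto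
  then have "(\<lambda>x. \<Sum>j\<in>UNIV. A x $ i $ j * G x $ j) \<in> borel_measurable (lebesgue_on \<Omega>)"
    using assms(1) by (intro borel_measurable_sum borel_measurable_times) (auto simp: inner_axis)
  then show "(\<lambda>x. (A x *v G x) \<bullet> b) \<in> borel_measurable (lebesgue_on \<Omega>)"
    by (simp add: b inner_axis matrix_vector_mult_def)
qed

lemma elliptic_coefficients_bounded:
  assumes "elliptic_coefficients \<Omega> A \<beta>"
  obtains L where "L \<ge> 0" "AE x in lebesgue_on \<Omega>. \<forall>v. norm (A x *v v) \<le> L * norm v"
proof -
  have "\<forall>i j. \<exists>M. AE x in lebesgue_on \<Omega>. \<bar>A x $ i $ j\<bar> \<le> M"
    using assms by (auto simp: elliptic_coefficients_def L_infinity_def)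
  then obtain M where M: "\<And>i j. AE x in lebesgue_on \<Omega>. \<bar>A x $ i $ j\<bar> \<le> M i j" by metis
  have ae: "AE x in lebesgue_on \<Omega>. \<forall>i\<in>UNIV. \<forall>j\<in>UNIV. \<bar>A x $ i $ j\<bar> \<le> M i j"
    using M by (simp add: AE_ball_countable AE_all_countable)
  show ?thesis
  proof (rule that[of "\<Sum>i\<in>UNIV. \<Sum>j\<in>UNIV. \<bar>M i j\<bar>"])
    show "0 \<le> (\<Sum>i\<in>UNIV. \<Sum>j\<in>UNIV. \<bar>M i j\<bar>)" by (intro sum_nonneg) auto
    show "AE x in lebesgue_on \<Omega>. \<forall>v. norm (A x *v v) \<le> (\<Sum>i\<in>UNIV. \<Sum>j\<in>UNIV. \<bar>M i j\<bar>) * norm v"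
      using ae
    proof eventually_elim
      case (elim x)
      show ?case
      proof
        fix v :: "real ^ 'n"
        have "norm (A x *v v) \<le> (\<Sum>i\<in>UNIV. \<bar>(A x *v v) $ i\<bar>)" by (rule norm_le_l1_cart)
        also have "\<dots> \<le> (\<Sum>i\<in>UNIV. \<Sum>j\<in>UNIV. \<bar>M i j\<bar> * norm v)"
        proof (rule sum_mono)
          fix i
          have "\<bar>(A x *v v) $ i\<bar> \<le> (\<Sum>j\<in>UNIV. \<bar>A x $ i $ j * v $ j\<bar>)"
            by (simp add: matrix_vector_mult_def sum_abs)
          also have "\<dots> \<le> (\<Sum>j\<in>UNIV. \<bar>M i j\<bar> * norm v)"
          proof (rule sum_mono)
            fix j
            have "\<bar>A x $ i $ j\<bar> \<le> M i j" using elim by blast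
            then have "\<bar>A x $ i $ j\<bar> \<le> \<bar>M i j\<bar>" by linarith
            then show "\<bar>A x $ i $ j * v $ j\<bar> \<le> \<bar>M i j\<bar> * norm v"
              unfolding abs_mult by (intro mult_mono component_le_norm_cart) auto
          qed
          finally show "\<bar>(A x *v v) $ i\<bar> \<le> (\<Sum>j\<in>UNIV. \<bar>M i j\<bar> * norm v)" .
        qed
        finally show "norm (A x *v v) \<le> (\<Sum>i\<in>UNIV. \<Sum>j\<in>UNIV. \<bar>M i j\<bar>) * norm v"
          by (simp add: sum_distrib_right)
      qed
    qed
  qed
qed

lemma elliptic_L2:
  assumes "elliptic_coefficients \<Omega> A \<beta>" "G \<in> L2 \<Omega>"
  shows "(\<lambda>x. A x *v G x) \<in> L2 \<Omega>"
proof -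
  obtain L where L: "L \<ge> 0" "AE x in lebesgue_on \<Omega>. \<forall>v. norm (A x *v v) \<le> L * norm v"
    by (rule elliptic_coefficients_bounded[OF assms(1)])
  show ?thesis
  proof (rule L2_bound[OF assms(2), of _ L])
    show "(\<lambda>x. A x *v G x) \<in> borel_measurable (lebesgue_on \<Omega>)"
    proof (rule matrix_vector_measurable[OF _ L2D(1)[OF assms(2)]])
      show "(\<lambda>x. A x $ i $ j) \<in> borel_measurable (lebesgue_on \<Omega>)" for i j
        using assms(1) by (auto simp: elliptic_coefficients_def L_infinity_def)
    qed
    show "AE x in lebesgue_on \<Omega>. norm (A x *v G x) \<le> L * norm (G x)" using L(2) by eventually_elim auto
  qed
qed

lemma elliptic_coercive:
  assumes "elliptic_coefficients \<Omega> A \<beta>" "G \<in> L2 \<Omega>"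
  shows "\<beta> * (L2_norm \<Omega> G)\<^sup>2 \<le> (LINT x|lebesgue_on \<Omega>. (A x *v G x) \<bullet> G x)"
proof -
  have "\<beta> * (L2_norm \<Omega> G)\<^sup>2 = (LINT x|lebesgue_on \<Omega>. \<beta> * (norm (G x))\<^sup>2)" by (simp add: L2_norm_sq)
  also have "\<dots> \<le> (LINT x|lebesgue_on \<Omega>. (A x *v G x) \<bullet> G x)"
  proof (rule integral_mono_AE)
    show "integrable (lebesgue_on \<Omega>) (\<lambda>x. \<beta> * (norm (G x))\<^sup>2)" using L2D(2)[OF assms(2)] by (rule integrable_mult_right)
    show "integrable (lebesgue_on \<Omega>) (\<lambda>x. (A x *v G x) \<bullet> G x)" by (intro L2_inner_integrable elliptic_L2[OF assms] assms)
    have "AE x in lebesgue_on \<Omega>. \<forall>v. \<beta> * (norm v)\<^sup>2 \<le> (A x *v v) \<bullet> v"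
      using assms(1) by (simp add: elliptic_coefficients_def)
    then show "AE x in lebesgue_on \<Omega>. \<beta> * (norm (G x))\<^sup>2 \<le> (A x *v G x) \<bullet> G x" by eventually_elim auto
  qed
  finally show ?thesis .
qed

text \<open>The term of order zero is part of the data \<open>g\<close>, so that the boundedness
  argument sees only the elliptic part and the norm of \<open>g\<close>. Later \<open>g\<close> is
  \<open>f - w u\<close>.\<close>

definition weak_solution ::
    "(real ^ 'n \<Rightarrow> real ^ 'n ^ 'n) \<Rightarrow> (real ^ 'n \<Rightarrow> real) \<Rightarrow> (real ^ 'n \<Rightarrow> real ^ 'n) \<Rightarrow> (real ^ 'n \<Rightarrow> real) \<Rightarrow> bool" where
  "weak_solution A u G g \<longleftrightarrow> H10_pair \<Omega> u G \<and> g \<in> L2 \<Omega> \<and>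
     (\<forall>v H. H10_pair \<Omega> v H \<longrightarrow>
        (LINT x|lebesgue_on \<Omega>. (A x *v G x) \<bullet> H x) = (LINT x|lebesgue_on \<Omega>. g x * v x))"

lemma weak_solution_minus:
  assumes "weak_solution A u G g"
  shows "weak_solution A (\<lambda>x. - u x) (\<lambda>x. - G x) (\<lambda>x. - g x)"
proof -
  have "A x *v (- v) = - (A x *v v)" for x v using linear_neg[OF matrix_vector_mul_linear, of "A x" v] by simp
  then show ?thesis using assms by (auto simp: weak_solution_def H10_pair_minus L2_minus)
qed

text \<open>One step of De Giorgi's iteration. Testing with the truncation \<open>v\<close> of
  \<open>u\<close> above level \<open>k\<close> gives \<open>\<beta> \<parallel>H\<parallel>\<^sup>2
  \<le> N \<parallel>v\<parallel>\<close>; Faber-Krahn gives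
  \<open>\<parallel>v\<parallel> \<le> 2 r \<parallel>H\<parallel>\<close>, since \<open>v\<close>
  lives where \<open>u\<close> exceeds \<open>k\<close>. Together they bound
  \<open>\<parallel>v\<parallel>\<close> by \<open>4 r\<^sup>2 N / \<beta>\<close>, and Chebyshev's
  inequality bounds the next level set.\<close>

lemma truncated_solution_bound:
  assumes A: "elliptic_coefficients \<Omega> A \<beta>" and \<beta>: "\<beta> > 0" and u: "weak_solution A u G g"
    and g: "L2_norm \<Omega> g \<le> N" and s: "s > 0" and k: "k \<ge> 0" and r: "r > 0"
    and m: "4 * measure (lebesgue_on \<Omega>) {x \<in> \<Omega>. k < u x} \<le> r ^ CARD('n) * unit_ball_volume TYPE('n)"
  shows "measure (lebesgue_on \<Omega>) {x \<in> \<Omega>. k + s < u x} \<le> (4 * exp 1 * N * r\<^sup>2 / (\<beta> * s))\<^sup>2"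
proof -
  have uG: "H10_pair \<Omega> u G" and gL: "g \<in> L2 \<Omega>"
    and eq: "\<And>v H. H10_pair \<Omega> v H \<Longrightarrow> (LINT x|lebesgue_on \<Omega>. (A x *v G x) \<bullet> H x) = (LINT x|lebesgue_on \<Omega>. g x * v x)"
    using u by (auto simp: weak_solution_def)
  note L = H10_pairD[OF uG]
  have [measurable]: "u \<in> borel_measurable (lebesgue_on \<Omega>)" "G \<in> borel_measurable (lebesgue_on \<Omega>)" using L by (auto dest: L2D)
  have lev[measurable]: "{x \<in> \<Omega>. c < u x} \<in> sets (lebesgue_on \<Omega>)" for c
  proof -
    have "{x \<in> space (lebesgue_on \<Omega>). c < u x} \<in> sets (lebesgue_on \<Omega>)" by measurable
    then show ?thesis by simp
  qed
  obtain b where b: "\<And>t. (bump has_real_derivative b t) (at t)" "\<And>t. 0 \<le> b t" "\<And>t. b t \<le> 1"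
    "continuous_on UNIV b" using bump_deriv by metis
  \<comment> \<open>\<open>F\<close> vanishes up to level \<open>k\<close>; scaling value and
    argument by the same \<open>s\<close> keeps its slope in \<open>[0, 1]\<close>.\<close>
  define F where "F t = s * bump ((1 / s) * t + (- k / s))" for t
  define F' where "F' t = b ((1 / s) * t + (- k / s))" for t
  have F0: "F 0 = 0" using divide_nonneg_pos[OF k s] by (simp add: F_def bump_def not_less)
  have Fs: "smooth_real F" unfolding F_def[abs_def] by (rule smooth_real_affine[OF smooth_real_bump])
  have FD: "(F has_real_derivative F' t) (at t)" for t
    unfolding F_def F'_def using s by (auto intro!: derivative_eq_intros DERIV_chain2[OF b(1)])
  have F'c: "continuous_on UNIV F'" unfolding F'_def
    by (intro continuous_on_compose2[OF b(4)] continuous_intros) auto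
  have F'b: "0 \<le> F' t" "F' t \<le> 1" "\<bar>F' t\<bar> \<le> 1" for t using b by (auto simp: F'_def)
  define v where "v = (\<lambda>x. F (u x))"
  define H where "H = (\<lambda>x. F' (u x) *\<^sub>R G x)"
  have vH: "H10_pair \<Omega> v H" unfolding v_def H_def by (rule H10_pair_compose[OF uG Fs F0 FD F'b(3) F'c])
  note LH = H10_pairD[OF vH]
  have "\<beta> * (L2_norm \<Omega> H)\<^sup>2 = (LINT x|lebesgue_on \<Omega>. \<beta> * (norm (H x))\<^sup>2)" by (simp add: L2_norm_sq)
  also have "\<dots> \<le> (LINT x|lebesgue_on \<Omega>. (A x *v G x) \<bullet> H x)"
  proof (rule integral_mono_AE)
    show "integrable (lebesgue_on \<Omega>) (\<lambda>x. \<beta> * (norm (H x))\<^sup>2)" using L2D(2)[OF LH(2)] by (rule integrable_mult_right)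
    show "integrable (lebesgue_on \<Omega>) (\<lambda>x. (A x *v G x) \<bullet> H x)" by (intro L2_inner_integrable elliptic_L2[OF A] L LH)
    have "AE x in lebesgue_on \<Omega>. \<forall>v. \<beta> * (norm v)\<^sup>2 \<le> (A x *v v) \<bullet> v"
      using A by (simp add: elliptic_coefficients_def)
    then show "AE x in lebesgue_on \<Omega>. \<beta> * (norm (H x))\<^sup>2 \<le> (A x *v G x) \<bullet> H x"
    proof eventually_elim
      case (elim x)
      \<comment> \<open>The left-hand side of the goal carries two factors \<open>F'\<close>, the
        right-hand side only one; a slope in \<open>[0, 1]\<close> bridges the gap.\<close>
      have "(F' (u x))\<^sup>2 \<le> F' (u x)" using F'b[of "u x"] by (simp add: power2_eq_square mult_left_le)
      then have "\<beta> * (norm (H x))\<^sup>2 \<le> F' (u x) * (\<beta> * (norm (G x))\<^sup>2)"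
        using \<beta> by (simp add: H_def power_mult_distrib mult.left_commute mult_right_mono)
      also have "\<dots> \<le> F' (u x) * ((A x *v G x) \<bullet> G x)" using F'b elim by (intro mult_left_mono) auto
      finally show ?case by (simp add: H_def)
    qed
  qed
  also have "\<dots> = (LINT x|lebesgue_on \<Omega>. g x * v x)" by (rule eq[OF vH])
  also have "\<dots> \<le> L2_norm \<Omega> g * L2_norm \<Omega> v" using L2_mult_le[OF gL LH(1)] by linarith
  also have "\<dots> \<le> N * L2_norm \<Omega> v" using g by (intro mult_right_mono) auto
  finally have 1: "\<beta> * (L2_norm \<Omega> H)\<^sup>2 \<le> N * L2_norm \<Omega> v" .
  have "L2_norm \<Omega> v \<le> 2 * r * L2_norm \<Omega> H"
  proof (rule Faber_Krahn[OF vH r lev[of k] _ m], rule AE_I2, rule impI)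
    fix x assume "x \<in> space (lebesgue_on \<Omega>)" "x \<notin> {x \<in> \<Omega>. k < u x}"
    then have "u x \<le> k" by auto
    then have "(1 / s) * u x + (- k / s) \<le> 0" using s by (simp add: field_simps)
    then show "v x = 0" by (simp add: v_def F_def bump_def)
  qed
  then have "(L2_norm \<Omega> v)\<^sup>2 \<le> (2 * r * L2_norm \<Omega> H)\<^sup>2" by (intro power_mono) auto
  also have "\<dots> = 4 * r\<^sup>2 / \<beta> * (\<beta> * (L2_norm \<Omega> H)\<^sup>2)" using \<beta> by (simp add: power_mult_distrib)
  also have "\<dots> \<le> 4 * r\<^sup>2 / \<beta> * (N * L2_norm \<Omega> v)" using 1 \<beta> by (intro mult_left_mono) auto
  finally have "L2_norm \<Omega> v * L2_norm \<Omega> v \<le> (4 * r\<^sup>2 * N / \<beta>) * L2_norm \<Omega> v" by (simp add: power2_eq_square)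
  moreover have N: "N \<ge> 0" using g L2_norm_nonneg order_trans by blast
  ultimately have v: "L2_norm \<Omega> v \<le> 4 * r\<^sup>2 * N / \<beta>"
    using \<beta> mult_right_le_imp_le[of "L2_norm \<Omega> v" "L2_norm \<Omega> v" "4 * r\<^sup>2 * N / \<beta>"] L2_norm_nonneg[of \<Omega> v]
    by (cases "L2_norm \<Omega> v = 0") (simp, linarith)
  let ?E = "{x \<in> \<Omega>. k + s < u x}"
  \<comment> \<open>Chebyshev: above level \<open>k + s\<close> the argument of \<open>bump\<close>
    is at least \<open>1\<close>, where \<open>bump\<close> is at least
    \<open>exp (- 1)\<close>.\<close>
  have "(s / exp 1)\<^sup>2 * measure (lebesgue_on \<Omega>) ?E = (LINT x|lebesgue_on \<Omega>. (s / exp 1)\<^sup>2 * indicator ?E x)"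
  proof -
    have "?E \<inter> \<Omega> = ?E" by auto
    then show ?thesis using lev[of "k + s"] by simp
  qed
  also have "\<dots> \<le> (LINT x|lebesgue_on \<Omega>. (norm (v x))\<^sup>2)"
  proof (rule integral_mono)
    show "integrable (lebesgue_on \<Omega>) (\<lambda>x. (s / exp 1)\<^sup>2 * indicator ?E x)"
      using lev[of "k + s"] by (intro integrable_mult_right integrable_real_indicator) (auto simp: less_top[symmetric])
    show "integrable (lebesgue_on \<Omega>) (\<lambda>x. (norm (v x))\<^sup>2)" by (rule L2D[OF LH(1)])
    fix x
    show "(s / exp 1)\<^sup>2 * indicator ?E x \<le> (norm (v x))\<^sup>2"
    proof (cases "x \<in> ?E")
      case True
      define t where "t = (1 / s) * u x + (- k / s)"
      have t: "t \<ge> 1" using True s by (simp add: t_def field_simps)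
      then have "exp (- 1) \<le> bump t" by (simp add: bump_def)
      then have "s * exp (- 1) \<le> v x" using s unfolding v_def F_def t_def[symmetric] by (intro mult_left_mono) auto
      then have "(s * exp (- 1))\<^sup>2 \<le> (norm (v x))\<^sup>2" using s by (intro power_mono) auto
      then show ?thesis using True by (simp add: exp_minus field_simps)
    qed simp
  qed
  also have "\<dots> = (L2_norm \<Omega> v)\<^sup>2" by (simp add: L2_norm_sq)
  also have "\<dots> \<le> (4 * r\<^sup>2 * N / \<beta>)\<^sup>2" using v by (intro power_mono) auto
  finally have "measure (lebesgue_on \<Omega>) ?E \<le> (4 * r\<^sup>2 * N / \<beta>)\<^sup>2 / (s / exp 1)\<^sup>2"
    using s by (simp add: pos_le_divide_eq mult.commute)
  also have "\<dots> = (4 * exp 1 * N * r\<^sup>2 / (\<beta> * s))\<^sup>2"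
    unfolding power_divide[symmetric] using s \<beta> by (simp add: field_simps)
  finally show ?thesis .
qed

text \<open>De Giorgi's iteration over the levels \<open>S * (1 - (1 / 2) ^ j)\<close>. A level set
  of measure at most \<open>c ^ 3\<close> admits a radius proportional to \<open>c\<close>, as the
  dimension is at most three; the next measure is then of order \<open>c ^ 4\<close>. This gain of a
  power beats the factor \<open>4\<close> by which \<open>1 / s\<^sup>2\<close> grows in each
  step.\<close>

lemma weak_solution_upper_bound:
  assumes n: "CARD('n) \<le> 3" and A: "elliptic_coefficients \<Omega> A \<beta>" and \<beta>: "\<beta> > 0"
  shows "\<exists>M. \<forall>u G g. weak_solution A u G g \<longrightarrow> L2_norm \<Omega> g \<le> N \<longrightarrow> (AE x in lebesgue_on \<Omega>. u x \<le> M)"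
proof -
  let ?w = "unit_ball_volume TYPE('n)" and ?m = "measure (lebesgue_on \<Omega>)"
  have w: "?w > 0" by (rule unit_ball_volume)
  define V where "V = max 1 (?m \<Omega>)"
  have V: "V \<ge> 1" "?m \<Omega> \<le> V" by (auto simp: V_def)
  \<comment> \<open>The ratio of the radius to \<open>c\<close>: it makes
    \<open>4 * c ^ 3 \<le> (\<rho> * c) ^ CARD('n) * ?w\<close>, where the powers of
    \<open>c\<close> missing in low dimension are bounded by \<open>V\<^sup>2\<close>.\<close>
  define \<rho> where "\<rho> = max 1 (4 * V\<^sup>2 / ?w)"
  have \<rho>: "\<rho> \<ge> 1" "4 * V\<^sup>2 / ?w \<le> \<rho>" by (auto simp: \<rho>_def)
  define D where "D = (4 * exp 1 * N * \<rho>\<^sup>2 / \<beta>)\<^sup>2"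
  \<comment> \<open>With \<open>s = S * (1 / 2) ^ Suc j\<close> and
    \<open>c = V * (1 / 4) ^ j\<close> the step closes if
    \<open>4 * D * V ^ 4 / S\<^sup>2 \<le> V ^ 3 / 64\<close>, that is
    \<open>256 * D * V \<le> S\<^sup>2\<close>. The summand \<open>1\<close> ensures
    \<open>S \<le> S\<^sup>2\<close>.\<close>
  define S where "S = 256 * D * V + 1"
  have D: "D \<ge> 0" by (simp add: D_def)
  have S: "S \<ge> 1" using D V by (simp add: S_def)
  have SS: "256 * D * V \<le> S\<^sup>2"
  proof -
    have "256 * D * V \<le> S" by (simp add: S_def)
    also have "S \<le> S\<^sup>2" using S by (simp add: power2_eq_square)
    finally show ?thesis .
  qed
  have "AE x in lebesgue_on \<Omega>. u x \<le> S" if u: "weak_solution A u G g" and g: "L2_norm \<Omega> g \<le> N" for u G g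
  proof -
    have [measurable]: "u \<in> borel_measurable (lebesgue_on \<Omega>)"
      using u by (auto simp: weak_solution_def dest!: H10_pairD(1) L2D(1))
    have lev: "{x \<in> \<Omega>. c < u x} \<in> sets (lebesgue_on \<Omega>)" for c
    proof -
      have "{x \<in> space (lebesgue_on \<Omega>). c < u x} \<in> sets (lebesgue_on \<Omega>)" by measurable
      then show ?thesis by simp
    qed
    define a where "a k = ?m {x \<in> \<Omega>. k < u x}" for k
    have step: "a (k + s) \<le> D / s\<^sup>2 * c ^ 4" if "a k \<le> c ^ 3" "0 < c" "c \<le> V" "s > 0" "k \<ge> 0" for k s c
    proof -
      have "4 * c ^ 3 \<le> (\<rho> * c) ^ CARD('n) * ?w"
      proof -
        have "c ^ (3 - CARD('n)) \<le> V ^ (3 - CARD('n))" using that by (intro power_mono) auto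
        also have "\<dots> \<le> V\<^sup>2"
        proof (intro power_increasing V)
          show "3 - CARD('n) \<le> 2" using zero_less_card_finite[where 'a='n] by linarith
        qed
        also have "V\<^sup>2 \<le> \<rho> * ?w / 4" using \<rho>(2) w by (simp add: field_simps)
        also have "\<rho> * ?w / 4 \<le> \<rho> ^ CARD('n) * ?w / 4"
          using \<rho> w power_increasing[of 1 "CARD('n)" \<rho>] by (intro divide_right_mono mult_right_mono) (auto simp: Suc_le_eq)
        finally have "c ^ (3 - CARD('n)) * c ^ CARD('n) \<le> \<rho> ^ CARD('n) * ?w / 4 * c ^ CARD('n)"
          using that by (intro mult_right_mono) auto
        then show ?thesis using n by (simp add: power_add[symmetric] power_mult_distrib field_simps)
      qed
      then have m: "4 * ?m {x \<in> \<Omega>. k < u x} \<le> (\<rho> * c) ^ CARD('n) * ?w" using that(1) by (simp add: a_def)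
      have "a (k + s) \<le> (4 * exp 1 * N * (\<rho> * c)\<^sup>2 / (\<beta> * s))\<^sup>2"
        unfolding a_def using that \<rho> by (intro truncated_solution_bound[OF A \<beta> u g _ _ _ m]) auto
      also have "\<dots> = D / s\<^sup>2 * c ^ 4"
        by (simp add: D_def power_mult_distrib power_divide power_mult[symmetric])
      finally show ?thesis .
    qed
    have iter: "a (S * (1 - (1 / 2) ^ j)) \<le> (V * (1 / 4) ^ j) ^ 3" for j
    proof (induction j)
      case 0
      have "a 0 \<le> ?m \<Omega>" unfolding a_def by (intro finite_measure_mono) auto
      also have "\<dots> \<le> V ^ 3" using V power_increasing[of 1 3 V] by simp
      finally show ?case by simp
    next
      case (Suc j)
      let ?k = "S * (1 - (1 / 2) ^ j)" and ?s = "S * (1 / 2) ^ Suc j" and ?c = "V * (1 / 4) ^ j"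
      have k: "?k \<ge> 0" using S by (simp add: power_le_one)
      have cV: "?c \<le> V" using V by (simp add: mult_left_le power_le_one)
      have "S * (1 - (1 / 2) ^ Suc j) = ?k + ?s" by (simp add: algebra_simps)
      then have "a (S * (1 - (1 / 2) ^ Suc j)) \<le> D / ?s\<^sup>2 * ?c ^ 4"
        using step[OF Suc.IH _ cV _ k, of ?s] V S by simp
      also have "\<dots> = (4 * D * V ^ 4 / S\<^sup>2) * (1 / 64) ^ j"
      proof -
        have "((1 / 2 :: real) ^ j)\<^sup>2 = ((1 / 2)\<^sup>2) ^ j" by (simp only: power_mult[symmetric] mult.commute)
        also have "(1 / 2 :: real)\<^sup>2 = 1 / 4" by (simp add: power2_eq_square)
        finally have h: "((1 / 2 :: real) ^ j)\<^sup>2 = (1 / 4) ^ j" .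
        have "?s\<^sup>2 = S\<^sup>2 * (((1 / 2) ^ j)\<^sup>2 / 4)" by (simp add: power2_eq_square)
        then have 1: "?s\<^sup>2 = S\<^sup>2 * ((1 / 4) ^ j / 4)" by (simp only: h)
        have "((1 / 4 :: real) ^ j) ^ 4 = ((1 / 4) ^ 4) ^ j" by (simp only: power_mult[symmetric] mult.commute)
        also have "(1 / 4 :: real) ^ 4 = 1 / 64 * (1 / 4)" by (simp add: power4_eq_xxxx)
        finally have 2: "?c ^ 4 = V ^ 4 * ((1 / 64) ^ j * (1 / 4) ^ j)"
          by (simp only: power_mult_distrib)
        show ?thesis unfolding 1 2 using S by (simp add: field_simps)
      qed
      also have "\<dots> \<le> (V ^ 3 / 64) * (1 / 64) ^ j"
      proof (intro mult_right_mono)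
        have "256 * D * V * V ^ 3 \<le> S\<^sup>2 * V ^ 3" using SS V by (intro mult_right_mono) auto
        then show "4 * D * V ^ 4 / S\<^sup>2 \<le> V ^ 3 / 64" using S by (simp add: field_simps power4_eq_xxxx power3_eq_cube)
      qed simp
      also have "\<dots> = (V * (1 / 4) ^ Suc j) ^ 3"
      proof -
        have "((1 / 4 :: real) ^ j) ^ 3 = ((1 / 4) ^ 3) ^ j" by (simp only: power_mult[symmetric] mult.commute)
        also have "(1 / 4 :: real) ^ 3 = 1 / 64" by (simp add: power3_eq_cube)
        finally have "((1 / 4 :: real) ^ j) ^ 3 = (1 / 64) ^ j" .
        moreover have "(V * (1 / 4) ^ Suc j) ^ 3 = V ^ 3 / 64 * ((1 / 4) ^ j) ^ 3" by (simp add: power3_eq_cube)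
        ultimately show ?thesis by (simp only:)
      qed
      finally show ?case .
    qed
    have "a S \<le> (V * (1 / 4) ^ j) ^ 3" for j
    proof -
      have "a S \<le> a (S * (1 - (1 / 2) ^ j))"
        unfolding a_def
      proof (intro finite_measure_mono lev subsetI)
        fix x assume "x \<in> {x \<in> \<Omega>. S < u x}"
        moreover have "S * (1 - (1 / 2) ^ j) \<le> S" using S by (intro mult_left_le) auto
        ultimately show "x \<in> {x \<in> \<Omega>. S * (1 - (1 / 2) ^ j) < u x}" by auto
      qed
      then show ?thesis using iter order_trans by blast
    qed
    moreover have "(\<lambda>j. (V * (1 / 4) ^ j) ^ 3) \<longlonglongrightarrow> (V * 0) ^ 3"
      by (intro tendsto_intros LIMSEQ_realpow_zero) auto
    ultimately have "a S \<le> 0" using LIMSEQ_le_const[of "\<lambda>j. (V * (1 / 4) ^ j) ^ 3" 0 "a S"] by simp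
    then have "?m {x \<in> \<Omega>. S < u x} = 0" using measure_nonneg[of "lebesgue_on \<Omega>"] by (simp add: a_def order_antisym)
    then have "{x \<in> \<Omega>. S < u x} \<in> null_sets (lebesgue_on \<Omega>)"
      using lev by (auto simp: emeasure_eq_measure)
    from AE_not_in[OF this] AE_space[of "lebesgue_on \<Omega>"] show ?thesis
      by eventually_elim auto
  qed
  then show ?thesis by blast
qed

lemma weak_solution_bounded:
  assumes n: "CARD('n) \<le> 3" and A: "elliptic_coefficients \<Omega> A \<beta>" and \<beta>: "\<beta> > 0"
  obtains M where "M \<ge> 0" "\<And>u G g. weak_solution A u G g \<Longrightarrow> L2_norm \<Omega> g \<le> N \<Longrightarrow> AE x in lebesgue_on \<Omega>. \<bar>u x\<bar> \<le> M"
proof -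
  obtain M where M: "\<And>u G g. weak_solution A u G g \<Longrightarrow> L2_norm \<Omega> g \<le> N \<Longrightarrow> AE x in lebesgue_on \<Omega>. u x \<le> M"
    using weak_solution_upper_bound[OF n A \<beta>, of N] by blast
  show ?thesis
  proof (rule that[of "\<bar>M\<bar>"])
    fix u G g assume *: "weak_solution A u G g" "L2_norm \<Omega> g \<le> N"
    have "AE x in lebesgue_on \<Omega>. - u x \<le> M"
      using M[OF weak_solution_minus[OF *(1)]] *(2) by (simp add: L2_norm_minus)
    with M[OF *] show "AE x in lebesgue_on \<Omega>. \<bar>u x\<bar> \<le> \<bar>M\<bar>" by eventually_elim linarith
  qed simp
qed

text \<open>Testing the equation with \<open>u \<phi>\<^sup>2\<close> controls \<open>\<phi> \<nabla>u\<close> although neither factor is bounded in \<open>L4\<close>.\<close>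

lemma product_gradient_bound:
  assumes n: "CARD('n) \<le> 3" and A: "elliptic_coefficients \<Omega> A \<beta>" and \<beta>: "\<beta> > 0"
  obtains C where "C \<ge> 0" "\<And>u G g \<phi> K. weak_solution A u G g \<Longrightarrow> L2_norm \<Omega> g \<le> N \<Longrightarrow>
    (AE x in lebesgue_on \<Omega>. \<bar>u x\<bar> \<le> M) \<Longrightarrow> test_function \<Omega> \<phi> \<Longrightarrow> K > 0 \<Longrightarrow>
    (L2_norm \<Omega> \<phi>)\<^sup>2 \<le> K \<Longrightarrow> (L2_norm \<Omega> (grad \<phi>))\<^sup>2 \<le> K \<Longrightarrow>
    (L2_norm \<Omega> (\<lambda>x. \<phi> x *\<^sub>R G x))\<^sup>2 \<le> C * K"
proof -
  obtain L where L: "L \<ge> 0" "AE x in lebesgue_on \<Omega>. \<forall>v. norm (A x *v v) \<le> L * norm v"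
    by (rule elliptic_coefficients_bounded[OF A])
  let ?w = "unit_ball_volume TYPE('n)"
  have w: "?w > 0" by (rule unit_ball_volume)
  define C where "C = 2 / \<beta> * (\<bar>M\<bar> * (4 * (N\<^sup>2 + 65536 / ?w)) + 2 * (\<bar>M\<bar> * L)\<^sup>2 / \<beta>)"
  have "C \<ge> 0" using \<beta> w by (auto simp: C_def intro!: mult_nonneg_nonneg add_nonneg_nonneg divide_nonneg_pos)
  moreover have "(L2_norm \<Omega> (\<lambda>x. \<phi> x *\<^sub>R G x))\<^sup>2 \<le> C * K"
    if u: "weak_solution A u G g" and g: "L2_norm \<Omega> g \<le> N" and M: "AE x in lebesgue_on \<Omega>. \<bar>u x\<bar> \<le> M"
      and \<phi>: "test_function \<Omega> \<phi>" and K: "K > 0" "(L2_norm \<Omega> \<phi>)\<^sup>2 \<le> K" "(L2_norm \<Omega> (grad \<phi>))\<^sup>2 \<le> K" for u G g \<phi> K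
  proof -
    have uG: "H10_pair \<Omega> u G" and gL: "g \<in> L2 \<Omega>"
      and eq: "\<And>v H. H10_pair \<Omega> v H \<Longrightarrow> (LINT x|lebesgue_on \<Omega>. (A x *v G x) \<bullet> H x) = (LINT x|lebesgue_on \<Omega>. g x * v x)"
      using u by (auto simp: weak_solution_def)
    note Lu = H10_pairD[OF uG]
    have N: "N \<ge> 0" using g L2_norm_nonneg order_trans by blast
    note AG = elliptic_L2[OF A Lu(2)] and C1 = test_function_C1[OF \<phi>] and L\<phi> = test_function_L2[OF \<phi>]
    obtain B where B: "B > 0" "\<And>x. \<bar>\<phi> x\<bar> \<le> B" "\<And>x. norm (grad \<phi> x) \<le> B" using test_function_bounded[OF \<phi>] by metis
    have [measurable]: "u \<in> borel_measurable (lebesgue_on \<Omega>)" "G \<in> borel_measurable (lebesgue_on \<Omega>)"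
       "\<phi> \<in> borel_measurable (lebesgue_on \<Omega>)" "grad \<phi> \<in> borel_measurable (lebesgue_on \<Omega>)"
       "(\<lambda>x. A x *v G x) \<in> borel_measurable (lebesgue_on \<Omega>)" "g \<in> borel_measurable (lebesgue_on \<Omega>)"
      using Lu AG L\<phi> gL by (auto dest: L2D)
    have g2: "grad (\<lambda>x. \<phi> x * \<phi> x) = (\<lambda>x. (2 * \<phi> x) *\<^sub>R grad \<phi> x)"
      using grad_mult(2)[OF C1 C1] by (simp add: scaleR_2[symmetric] scaleR_scaleR[symmetric] del: scaleR_scaleR)
    note tp = H10_pair_mult_test[OF uG test_function_mult[OF \<phi> \<phi>], unfolded g2]
    define X where "X = (\<lambda>x. \<phi> x *\<^sub>R G x)"
    have XL: "X \<in> L2 \<Omega>" unfolding X_def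
      by (rule L2_bound[OF Lu(2), of _ B]) (use B in \<open>auto intro!: mult_right_mono\<close>)
    define Y where "Y = (\<lambda>x. u x *\<^sub>R grad \<phi> x)"
    have Yle: "AE x in lebesgue_on \<Omega>. norm (Y x) \<le> \<bar>M\<bar> * norm (grad \<phi> x)"
      using M by eventually_elim (auto simp: Y_def intro!: mult_right_mono)
    have YL: "Y \<in> L2 \<Omega>" by (rule L2_bound[OF L\<phi>(2) _ Yle]) (simp add: Y_def)
    have YN: "L2_norm \<Omega> Y \<le> \<bar>M\<bar> * L2_norm \<Omega> (grad \<phi>)" by (rule L2_norm_bound[OF L\<phi>(2) _ _ Yle]) (simp_all add: Y_def)
    define Z where "Z = (\<lambda>x. A x *v X x)"
    have ZL: "Z \<in> L2 \<Omega>" unfolding Z_def by (rule elliptic_L2[OF A XL])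
    have ZN: "L2_norm \<Omega> Z \<le> L * L2_norm \<Omega> X"
      by (rule L2_norm_bound[OF XL L2D(1)[OF ZL] L(1)]) (use L(2) in \<open>auto simp: Z_def\<close>)
    have Zeq: "Z x = \<phi> x *\<^sub>R (A x *v G x)" for x by (simp add: Z_def X_def matrix_vector_mult_scaleR)
    \<comment> \<open>The gradient of \<open>u \<phi>\<^sup>2\<close> is
      \<open>\<phi>\<^sup>2 G + 2 u \<phi> \<nabla>\<phi>\<close>; moving one factor
      \<open>\<phi>\<close> to the side of the coefficients yields the products of \<open>Z\<close>
      with \<open>X\<close> and with \<open>2 Y\<close>.\<close>
    have "(LINT x|lebesgue_on \<Omega>. Z x \<bullet> X x) + 2 * (LINT x|lebesgue_on \<Omega>. Z x \<bullet> Y x) = (LINT x|lebesgue_on \<Omega>. Z x \<bullet> X x + 2 * (Z x \<bullet> Y x))"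
      using L2_inner_integrable[OF ZL XL] L2_inner_integrable[OF ZL YL] by simp
    also have "\<dots> = (LINT x|lebesgue_on \<Omega>. (A x *v G x) \<bullet> ((\<phi> x * \<phi> x) *\<^sub>R G x + u x *\<^sub>R (2 * \<phi> x) *\<^sub>R grad \<phi> x))"
      by (rule Bochner_Integration.integral_cong) (auto simp: Zeq X_def Y_def inner_simps)
    also have "\<dots> = (LINT x|lebesgue_on \<Omega>. g x * (u x * (\<phi> x * \<phi> x)))" by (rule eq[OF tp])
    also have "\<dots> \<le> (LINT x|lebesgue_on \<Omega>. \<bar>M\<bar> * (norm (g x) * (\<phi> x)\<^sup>2))"
    proof (rule integral_mono_AE)
      have "(\<lambda>x. \<phi> x * \<phi> x) \<in> L2 \<Omega>" using test_function_L2(1)[OF test_function_mult[OF \<phi> \<phi>]] .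
      from L2_mult_integrable[OF L2_norm_fun[OF gL] this]
      show "integrable (lebesgue_on \<Omega>) (\<lambda>x. \<bar>M\<bar> * (norm (g x) * (\<phi> x)\<^sup>2))" by (simp add: power2_eq_square)
      show "integrable (lebesgue_on \<Omega>) (\<lambda>x. g x * (u x * (\<phi> x * \<phi> x)))"
        by (rule L2_mult_integrable[OF gL H10_pairD(1)[OF tp]])
      show "AE x in lebesgue_on \<Omega>. g x * (u x * (\<phi> x * \<phi> x)) \<le> \<bar>M\<bar> * (norm (g x) * (\<phi> x)\<^sup>2)"
        using M
      proof eventually_elim
        case (elim x)
        have "g x * (u x * (\<phi> x * \<phi> x)) \<le> \<bar>g x * (u x * (\<phi> x * \<phi> x))\<bar>" by simp
        also have "\<dots> = \<bar>u x\<bar> * (\<bar>g x\<bar> * (\<phi> x)\<^sup>2)" by (simp add: abs_mult power2_eq_square)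
        also have "\<dots> \<le> \<bar>M\<bar> * (\<bar>g x\<bar> * (\<phi> x)\<^sup>2)" using elim by (intro mult_right_mono) auto
        finally show ?case by simp
      qed
    qed
    \<comment> \<open>Here the form bound for \<open>g\<close> replaces an estimate of
      \<open>\<phi>\<close> in \<open>L4\<close>.\<close>
    also have "\<dots> \<le> \<bar>M\<bar> * (4 * K * (N\<^sup>2 + 65536 / ?w))"
    proof -
      have "(LINT x|lebesgue_on \<Omega>. norm (g x) * (\<phi> x)\<^sup>2) \<le> 4 * K * ((L2_norm \<Omega> g)\<^sup>2 + 65536 / ?w)"
        by (rule form_bounded_test_function[OF n gL \<phi> K])
      also have "\<dots> \<le> 4 * K * (N\<^sup>2 + 65536 / ?w)" using g K by (intro mult_left_mono add_right_mono power_mono) auto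
      finally show ?thesis by (simp add: mult_left_mono)
    qed
    finally have 1: "(LINT x|lebesgue_on \<Omega>. Z x \<bullet> X x) \<le> \<bar>M\<bar> * (4 * K * (N\<^sup>2 + 65536 / ?w)) - 2 * (LINT x|lebesgue_on \<Omega>. Z x \<bullet> Y x)"
      by simp
    have 2: "\<beta> * (L2_norm \<Omega> X)\<^sup>2 \<le> (LINT x|lebesgue_on \<Omega>. Z x \<bullet> X x)"
      unfolding Z_def by (rule elliptic_coercive[OF A XL])
    have 3: "- 2 * (LINT x|lebesgue_on \<Omega>. Z x \<bullet> Y x) \<le> 2 * (L * L2_norm \<Omega> X * (\<bar>M\<bar> * sqrt K))"
    proof -
      have "L2_norm \<Omega> (grad \<phi>) \<le> sqrt K" using K(3) by (rule real_le_rsqrt)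
      then have "L2_norm \<Omega> Y \<le> \<bar>M\<bar> * sqrt K" using YN by (meson abs_ge_zero mult_left_mono order_trans)
      then have "L2_norm \<Omega> Z * L2_norm \<Omega> Y \<le> L * L2_norm \<Omega> X * (\<bar>M\<bar> * sqrt K)"
        using ZN L(1) by (intro mult_mono) auto
      moreover have "- (LINT x|lebesgue_on \<Omega>. Z x \<bullet> Y x) \<le> L2_norm \<Omega> Z * L2_norm \<Omega> Y"
        using L2_inner_le[OF ZL YL] by linarith
      ultimately show ?thesis by linarith
    qed
    \<comment> \<open>Young's inequality with the weight for which half of the coercive term absorbs
      \<open>X\<close>; it is the expansion of a square with the coefficients \<open>\<beta>\<close>
      and \<open>2 \<bar>M\<bar> L\<close>.\<close>
    have 4: "2 * (L * L2_norm \<Omega> X * (\<bar>M\<bar> * sqrt K)) \<le> \<beta> / 2 * (L2_norm \<Omega> X)\<^sup>2 + 2 * (\<bar>M\<bar> * L)\<^sup>2 / \<beta> * K"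
    proof -
      have "0 \<le> (\<beta> * L2_norm \<Omega> X - 2 * (\<bar>M\<bar> * L) * sqrt K)\<^sup>2 / (2 * \<beta>)" using \<beta> by simp
      also have "\<dots> = (\<beta>\<^sup>2 * (L2_norm \<Omega> X)\<^sup>2 + 4 * (\<bar>M\<bar> * L)\<^sup>2 * K - 4 * \<beta> * (L * L2_norm \<Omega> X * (\<bar>M\<bar> * sqrt K))) / (2 * \<beta>)"
        using K by (simp add: power2_diff power_mult_distrib algebra_simps)
      also have "\<dots> = \<beta> / 2 * (L2_norm \<Omega> X)\<^sup>2 + 2 * (\<bar>M\<bar> * L)\<^sup>2 / \<beta> * K - 2 * (L * L2_norm \<Omega> X * (\<bar>M\<bar> * sqrt K))"
        using \<beta> by (simp add: field_simps power2_eq_square)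
      finally show ?thesis by simp
    qed
    have "\<beta> / 2 * (L2_norm \<Omega> X)\<^sup>2 = \<beta> * (L2_norm \<Omega> X)\<^sup>2 - \<beta> / 2 * (L2_norm \<Omega> X)\<^sup>2" by simp
    then have "\<beta> / 2 * (L2_norm \<Omega> X)\<^sup>2 \<le> \<bar>M\<bar> * (4 * K * (N\<^sup>2 + 65536 / ?w)) + 2 * (\<bar>M\<bar> * L)\<^sup>2 / \<beta> * K"
      using 1 2 3 4 by linarith
    then have "2 / \<beta> * (\<beta> / 2 * (L2_norm \<Omega> X)\<^sup>2) \<le> 2 / \<beta> * (\<bar>M\<bar> * (4 * K * (N\<^sup>2 + 65536 / ?w)) + 2 * (\<bar>M\<bar> * L)\<^sup>2 / \<beta> * K)"
      using \<beta> by (intro mult_left_mono) auto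
    also have "\<dots> = C * K" by (simp add: C_def algebra_simps)
    finally show ?thesis using \<beta> by (simp add: X_def)
  qed
  ultimately show ?thesis using that by blast
qed

end

subsection \<open>Local averages\<close>

definition piecewise_const :: "'a set set \<Rightarrow> ('a set \<Rightarrow> real) \<Rightarrow> 'a \<Rightarrow> real" where
  "piecewise_const \<Q> c x = (\<Sum>Q\<in>\<Q>. indicator Q x * c Q)"

text \<open>Positive measure of the cells makes the averages reproduce piecewise constant functions;
  on a null cell the division by zero would yield the average \<open>0\<close>.\<close>

locale mesh = bounded_open +
  fixes \<Q> :: "(real ^ 'a) set set"
  assumes partition: "mesh_partition \<Omega> \<Q>"
    and cell_pos: "\<And>Q. Q \<in> \<Q> \<Longrightarrow> measure lebesgue Q > 0"
begin

lemma finite_\<Q> [simp]: "finite \<Q>"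
  using partition by (simp add: mesh_partition_def)

lemma cell_subset: "Q \<in> \<Q> \<Longrightarrow> Q \<subseteq> \<Omega>" and cell_sets [measurable]: "Q \<in> \<Q> \<Longrightarrow> Q \<in> sets lebesgue"
  and Union_cells: "\<Union>\<Q> = \<Omega>" and cell_nonempty: "Q \<in> \<Q> \<Longrightarrow> Q \<noteq> {}"
  using partition by (auto simp: mesh_partition_def partition_on_def)

lemma cell_sets_\<Omega>: "Q \<in> \<Q> \<Longrightarrow> Q \<in> sets (lebesgue_on \<Omega>)"
  using cell_sets cell_subset by (auto simp: sets_restrict_space_iff)

lemma measure_cell: "Q \<in> \<Q> \<Longrightarrow> measure (lebesgue_on \<Omega>) Q = measure lebesgue Q"
  using cell_subset[of Q] by (intro measure_restrict_space) auto

lemma cell_disjoint: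
  assumes "Q \<in> \<Q>" "R \<in> \<Q>" "x \<in> Q" "x \<in> R"
  shows "Q = R"
proof -
  have "disjoint \<Q>" using partition by (simp add: mesh_partition_def partition_on_def)
  from disjointD[OF this assms(1,2)] assms(3,4) show ?thesis by blast
qed

lemma piecewise_const_eq:
  assumes "Q \<in> \<Q>" "x \<in> Q"
  shows "piecewise_const \<Q> c x = c Q"
proof -
  have "piecewise_const \<Q> c x = (\<Sum>R\<in>\<Q>. if R = Q then c R else 0)"
    unfolding piecewise_const_def
  proof (rule sum.cong[OF refl])
    fix R assume R: "R \<in> \<Q>"
    show "indicator R x * c R = (if R = Q then c R else 0)"
    proof (cases "x \<in> R")
      case True
      then have "R = Q" by (rule cell_disjoint[OF R assms(1) _ assms(2)])
      then show ?thesis using assms(2) by simp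
    next
      case False
      then have "R \<noteq> Q" using assms(2) by blast
      then show ?thesis using False by simp
    qed
  qed
  also have "\<dots> = c Q" by (simp only: sum.delta[OF finite_\<Q>] assms(1) if_True)
  finally show ?thesis .
qed

lemma piecewise_const_cases:
  assumes "x \<in> \<Omega>"
  obtains Q where "Q \<in> \<Q>" "x \<in> Q" "\<And>c. piecewise_const \<Q> c x = c Q"
proof -
  from assms obtain Q where "Q \<in> \<Q>" "x \<in> Q" using Union_cells by auto
  then show ?thesis using that[of Q] piecewise_const_eq[of Q x] by simp
qed

definition cell_avg :: "(real ^ 'a \<Rightarrow> real) \<Rightarrow> (real ^ 'a) set \<Rightarrow> real" where
  "cell_avg g Q = 1 / measure lebesgue Q * (LINT y|lebesgue_on Q. g y)"

lemma local_avg_eq: "local_avg \<Q> g = piecewise_const \<Q> (cell_avg g)"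
  by (simp add: fun_eq_iff local_avg_def piecewise_const_def cell_avg_def)

lemma integral_cell:
  fixes g :: "real ^ 'a \<Rightarrow> real"
  assumes "Q \<in> \<Q>"
  shows "(LINT y|lebesgue_on Q. g y) = (LINT y|lebesgue_on \<Omega>. indicator Q y * g y)"
proof -
  have "(\<lambda>y. indicator \<Omega> y *\<^sub>R (indicator Q y * g y)) = (\<lambda>y. indicator Q y *\<^sub>R g y)"
    using cell_subset[OF assms] by (auto simp: indicator_def fun_eq_iff)
  then show ?thesis using cell_sets[OF assms] by (simp add: integral_restrict_space)
qed

lemma integrable_cell:
  fixes g :: "real ^ 'a \<Rightarrow> real"
  assumes "integrable (lebesgue_on \<Omega>) g" "Q \<in> \<Q>"
  shows "integrable (lebesgue_on \<Omega>) (\<lambda>y. indicator Q y * g y)"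
  using integrable_real_mult_indicator[OF cell_sets_\<Omega>[OF assms(2)] assms(1)] by (simp add: mult.commute)

lemma integral_cell_avg:
  "Q \<in> \<Q> \<Longrightarrow> (LINT y|lebesgue_on \<Omega>. indicator Q y * g y) = measure lebesgue Q * cell_avg g Q"
  using cell_pos[of Q] by (simp add: cell_avg_def integral_cell)

lemma piecewise_const_measurable [measurable]: "piecewise_const \<Q> c \<in> borel_measurable (lebesgue_on \<Omega>)"
  unfolding piecewise_const_def[abs_def]
  by (intro borel_measurable_sum borel_measurable_times borel_measurable_const borel_measurable_indicator cell_sets_\<Omega>)

lemma piecewise_const_bounded: "\<bar>piecewise_const \<Q> c x\<bar> \<le> (\<Sum>Q\<in>\<Q>. \<bar>c Q\<bar>)"
proof -
  have "\<bar>piecewise_const \<Q> c x\<bar> \<le> (\<Sum>Q\<in>\<Q>. \<bar>indicator Q x * c Q\<bar>)" unfolding piecewise_const_def by (rule sum_abs)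
  also have "\<dots> \<le> (\<Sum>Q\<in>\<Q>. \<bar>c Q\<bar>)" by (intro sum_mono) (auto simp: indicator_def)
  finally show ?thesis .
qed

lemma piecewise_const_L2: "piecewise_const \<Q> c \<in> L2 \<Omega>"
  by (rule bounded_in_L2[of _ "\<Sum>Q\<in>\<Q>. \<bar>c Q\<bar>"]) (auto simp: piecewise_const_bounded)

lemma piecewise_const_diff: "piecewise_const \<Q> c x - piecewise_const \<Q> d x = piecewise_const \<Q> (\<lambda>Q. c Q - d Q) x"
  by (simp add: piecewise_const_def sum_subtractf right_diff_distrib)

lemma piecewise_const_mult:
  assumes "x \<in> \<Omega>"
  shows "piecewise_const \<Q> c x * piecewise_const \<Q> d x = piecewise_const \<Q> (\<lambda>Q. c Q * d Q) x"
  by (rule piecewise_const_cases[OF assms]) simp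

lemma integral_piecewise_const_mult:
  assumes "integrable (lebesgue_on \<Omega>) g"
  shows "(LINT x|lebesgue_on \<Omega>. piecewise_const \<Q> c x * g x) = (\<Sum>Q\<in>\<Q>. c Q * (measure lebesgue Q * cell_avg g Q))"
proof -
  have "(LINT x|lebesgue_on \<Omega>. piecewise_const \<Q> c x * g x) = (LINT x|lebesgue_on \<Omega>. (\<Sum>Q\<in>\<Q>. c Q * (indicator Q x * g x)))"
  proof -
    have "piecewise_const \<Q> c x * g x = (\<Sum>Q\<in>\<Q>. c Q * (indicator Q x * g x))" for x
      unfolding piecewise_const_def sum_distrib_right by (rule sum.cong) (simp_all only: mult_ac)
    then show ?thesis by simp
  qed
  also have "\<dots> = (\<Sum>Q\<in>\<Q>. LINT x|lebesgue_on \<Omega>. c Q * (indicator Q x * g x))"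
    by (intro Bochner_Integration.integral_sum integrable_mult_right integrable_cell assms)
  finally show ?thesis by (simp add: integral_cell_avg)
qed

lemma cell_avg_piecewise_const:
  assumes "Q \<in> \<Q>"
  shows "cell_avg (piecewise_const \<Q> d) Q = d Q"
proof -
  have "measure lebesgue Q * cell_avg (piecewise_const \<Q> d) Q = (LINT y|lebesgue_on \<Omega>. indicator Q y * piecewise_const \<Q> d y)"
    using assms by (simp add: integral_cell_avg)
  also have "\<dots> = (LINT y|lebesgue_on \<Omega>. d Q * indicator Q y)"
    using piecewise_const_eq[OF assms] by (intro Bochner_Integration.integral_cong) (auto simp: indicator_def)
  also have "\<dots> = measure lebesgue Q * d Q"
    using cell_sets_\<Omega>[OF assms] cell_subset[OF assms] by (simp add: measure_cell[OF assms] Int_absorb2)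
  finally show ?thesis using cell_pos[OF assms] by simp
qed

lemma local_avg_L2: "local_avg \<Q> g \<in> L2 \<Omega>"
  by (simp add: local_avg_eq piecewise_const_L2)

lemma local_avg_orthogonal:
  assumes "g \<in> L2 \<Omega>"
  shows "(LINT x|lebesgue_on \<Omega>. piecewise_const \<Q> c x * (g x - local_avg \<Q> g x)) = 0"
proof -
  note i = L2_integrable[OF assms] L2_integrable[OF piecewise_const_L2]
  have "(LINT x|lebesgue_on \<Omega>. piecewise_const \<Q> c x * (g x - local_avg \<Q> g x)) =
    (LINT x|lebesgue_on \<Omega>. piecewise_const \<Q> c x * g x) - (LINT x|lebesgue_on \<Omega>. piecewise_const \<Q> c x * local_avg \<Q> g x)"
    using L2_mult_integrable[OF piecewise_const_L2 assms] L2_mult_integrable[OF piecewise_const_L2 local_avg_L2]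
    by (simp add: right_diff_distrib)
  also have "\<dots> = 0"
    unfolding local_avg_eq integral_piecewise_const_mult[OF i(1)] integral_piecewise_const_mult[OF i(2)]
    by (simp add: cell_avg_piecewise_const)
  finally show ?thesis .
qed

lemma local_avg_Pythagoras:
  assumes g: "g \<in> L2 \<Omega>"
  shows "(L2_norm \<Omega> (\<lambda>x. g x - piecewise_const \<Q> c x))\<^sup>2 =
    (L2_norm \<Omega> (\<lambda>x. g x - local_avg \<Q> g x))\<^sup>2 + (L2_norm \<Omega> (\<lambda>x. local_avg \<Q> g x - piecewise_const \<Q> c x))\<^sup>2"
proof -
  let ?a = "\<lambda>x. g x - local_avg \<Q> g x" and ?b = "\<lambda>x. local_avg \<Q> g x - piecewise_const \<Q> c x"
  have ab: "?a \<in> L2 \<Omega>" "?b \<in> L2 \<Omega>" by (intro L2_diff g local_avg_L2 piecewise_const_L2)+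
  have "(LINT x|lebesgue_on \<Omega>. ?b x * ?a x) = 0"
    using local_avg_orthogonal[OF g] by (simp add: local_avg_eq piecewise_const_diff)
  moreover have "(LINT x|lebesgue_on \<Omega>. (g x - piecewise_const \<Q> c x)\<^sup>2) =
     (LINT x|lebesgue_on \<Omega>. (?a x)\<^sup>2 + (?b x)\<^sup>2 + 2 * (?b x * ?a x))"
    by (intro Bochner_Integration.integral_cong) (auto simp: power2_eq_square algebra_simps)
  ultimately show ?thesis
    using L2D(2)[OF ab(1)] L2D(2)[OF ab(2)] L2_mult_integrable[OF ab(2,1)] by (simp add: L2_norm_sq)
qed

text \<open>By Pythagoras. It spares any direct estimate of the averages over the cells: it suffices
  to find one good piecewise constant function, with values chosen at convenience.\<close>

lemma local_avg_best_approx: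
  assumes "g \<in> L2 \<Omega>"
  shows "L2_norm \<Omega> (\<lambda>x. g x - local_avg \<Q> g x) \<le> L2_norm \<Omega> (\<lambda>x. g x - piecewise_const \<Q> c x)"
  by (rule power2_le_imp_le) (simp_all add: local_avg_Pythagoras[OF assms, of c])

lemma local_avg_contraction:
  assumes "g \<in> L2 \<Omega>"
  shows "L2_norm \<Omega> (\<lambda>x. g x - local_avg \<Q> g x) \<le> L2_norm \<Omega> g" "L2_norm \<Omega> (local_avg \<Q> g) \<le> L2_norm \<Omega> g"
proof -
  have 0: "piecewise_const \<Q> (\<lambda>_. 0) = (\<lambda>x. 0)" by (simp add: piecewise_const_def fun_eq_iff)
  show "L2_norm \<Omega> (\<lambda>x. g x - local_avg \<Q> g x) \<le> L2_norm \<Omega> g" "L2_norm \<Omega> (local_avg \<Q> g) \<le> L2_norm \<Omega> g"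
    using local_avg_Pythagoras[OF assms, of "\<lambda>_. 0"] by (simp_all add: 0 power2_le_imp_le[OF _ L2_norm_nonneg])
qed

lemma local_avg_diff:
  assumes "f \<in> L2 \<Omega>" "g \<in> L2 \<Omega>"
  shows "local_avg \<Q> (\<lambda>x. f x - g x) x = local_avg \<Q> f x - local_avg \<Q> g x"
proof -
  have "cell_avg (\<lambda>x. f x - g x) Q = cell_avg f Q - cell_avg g Q" if "Q \<in> \<Q>" for Q
    using integrable_cell[OF L2_integrable[OF assms(1)] that] integrable_cell[OF L2_integrable[OF assms(2)] that]
    by (simp add: cell_avg_def integral_cell[OF that] right_diff_distrib diff_divide_distrib)
  then show ?thesis
    unfolding local_avg_eq piecewise_const_diff by (simp add: piecewise_const_def cong: sum.cong)
qed

lemma local_avg_bounds: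
  assumes g: "g \<in> L2 \<Omega>" and ae: "AE x in lebesgue_on \<Omega>. l \<le> g x \<and> g x \<le> b" and x: "x \<in> \<Omega>"
  shows "l \<le> local_avg \<Q> g x \<and> local_avg \<Q> g x \<le> b"
proof -
  obtain Q where Q: "Q \<in> \<Q>" "\<And>c. piecewise_const \<Q> c x = c Q" using piecewise_const_cases[OF x] by metis
  have i: "integrable (lebesgue_on \<Omega>) (\<lambda>y. indicator Q y * t)" for t :: real
    using integrable_cell[OF _ Q(1), of "\<lambda>_. t"] by simp
  have c: "(LINT y|lebesgue_on \<Omega>. indicator Q y * t) = measure lebesgue Q * t" for t
    using cell_sets_\<Omega>[OF Q(1)] cell_subset[OF Q(1)] by (simp add: measure_cell[OF Q(1)] Int_absorb2)
  have ael: "AE y in lebesgue_on \<Omega>. indicator Q y * l \<le> indicator Q y * g y"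
    and aeb: "AE y in lebesgue_on \<Omega>. indicator Q y * g y \<le> indicator Q y * b"
    using ae by (eventually_elim, auto simp: indicator_def)+
  have "(LINT y|lebesgue_on \<Omega>. indicator Q y * l) \<le> (LINT y|lebesgue_on \<Omega>. indicator Q y * g y)"
    by (intro integral_mono_AE i integrable_cell[OF L2_integrable[OF g] Q(1)] ael)
  moreover have "(LINT y|lebesgue_on \<Omega>. indicator Q y * g y) \<le> (LINT y|lebesgue_on \<Omega>. indicator Q y * b)"
    by (intro integral_mono_AE i integrable_cell[OF L2_integrable[OF g] Q(1)] aeb)
  ultimately show ?thesis
    using cell_pos[OF Q(1)] unfolding c integral_cell_avg[OF Q(1)] local_avg_eq Q(2) by simp
qed

lemma cell_diameter:
  assumes "Q \<in> \<Q>"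
  shows "diameter Q \<le> max_diameter \<Q>" "x \<in> Q \<Longrightarrow> y \<in> Q \<Longrightarrow> dist x y \<le> max_diameter \<Q>"
proof -
  show d: "diameter Q \<le> max_diameter \<Q>" unfolding max_diameter_def using assms by (intro Max_ge) auto
  have "bounded Q" using bounded_subset[OF bounded_\<Omega> cell_subset[OF assms]] .
  then show "dist x y \<le> max_diameter \<Q>" if "x \<in> Q" "y \<in> Q"
    using diameter_bounded_bound[OF _ that] d by force
qed

text \<open>The value on a cell is the mean of \<open>W\<close> over a ball of radius
  \<open>d\<close> around an arbitrarily chosen point of the cell. Every point of the cell is within
  \<open>d\<close> of that centre, so the deviation is bounded by mean increments around the point
  itself, whatever the shape of the cell.\<close>

lemma piecewise_const_approx:
  fixes W :: "real ^ 'a \<Rightarrow> real"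
  assumes W: "integrable lborel W" and d: "d > 0" "max_diameter \<Q> \<le> d" and M: "\<And>x. \<bar>W x\<bar> \<le> M"
  obtains c where "\<And>Q. \<bar>c Q\<bar> \<le> M" "\<And>x. x \<in> \<Omega> \<Longrightarrow> ennreal \<bar>W x - piecewise_const \<Q> c x\<bar>
    \<le> ennreal (2 ^ CARD('a)) * (\<integral>\<^sup>+y. ennreal \<bar>W (x + (2 * d) *\<^sub>R y) - W x\<bar> \<partial>unit_ball_measure)"
proof -
  define p where "p Q = (SOME x. x \<in> Q)" for Q :: "(real ^ 'a) set"
  have p: "p Q \<in> Q" if "Q \<in> \<Q>" for Q
    using cell_nonempty[OF that] unfolding p_def by (simp add: some_in_eq)
  define c where "c Q = (LINT z|lborel. indicator (ball (p Q) d) z * W z) / measure lborel (ball (p Q) d)" for Q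
  show ?thesis
  proof (rule that[of c])
    fix Q
    let ?B = "ball (p Q) d"
    have v: "measure lborel ?B > 0" using content_ball_pos[OF d(1), of "p Q"] by simp
    have f: "emeasure lborel ?B < \<infinity>" using emeasure_ball_nontrivial[OF d(1), of "p Q"] by (simp add: less_top)
    have "\<bar>LINT z|lborel. indicator ?B z * W z\<bar> \<le> (LINT z|lborel. \<bar>indicator ?B z * W z\<bar>)" by (rule integral_abs_bound)
    also have "\<dots> \<le> (LINT z|lborel. M * indicator ?B z)"
    proof (rule integral_mono)
      show "integrable lborel (\<lambda>z. \<bar>indicator ?B z * W z\<bar>)"
        using integrable_real_mult_indicator[OF _ W, of ?B] by (intro integrable_abs) (simp add: mult.commute)
      show "integrable lborel (\<lambda>z. M * indicator ?B z)" using f by (intro integrable_mult_right integrable_real_indicator) auto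
    qed (use M in \<open>auto simp: indicator_def\<close>)
    also have "\<dots> = M * measure lborel ?B" using f by simp
    finally show "\<bar>c Q\<bar> \<le> M" using v by (simp add: c_def divide_le_eq)
  next
    fix x assume "x \<in> \<Omega>"
    then obtain Q where Q: "Q \<in> \<Q>" "x \<in> Q" "\<And>c. piecewise_const \<Q> c x = c Q" using piecewise_const_cases by metis
    have "dist x (p Q) \<le> d" using cell_diameter(2)[OF Q(1,2) p[OF Q(1)]] d(2) by simp
    from diff_ball_average_le[OF d(1) this W]
    show "ennreal \<bar>W x - piecewise_const \<Q> c x\<bar>
      \<le> ennreal (2 ^ CARD('a)) * (\<integral>\<^sup>+y. ennreal \<bar>W (x + (2 * d) *\<^sub>R y) - W x\<bar> \<partial>unit_ball_measure)"
      by (simp add: Q(3) c_def)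
  qed
qed

text \<open>Takes the place of a Poincare inequality on each cell, for which irregular cells offer
  no uniform constant. A test function is of class C1 on the whole space, so the balls may leave
  \<open>\<Omega>\<close>.\<close>

lemma local_avg_error_test_function:
  assumes \<phi>: "test_function \<Omega> \<phi>" and d: "d > 0" "max_diameter \<Q> \<le> d"
  shows "L2_norm \<Omega> (\<lambda>x. \<phi> x - local_avg \<Q> \<phi> x) \<le> 2 ^ CARD('a) * (2 * d) * L2_norm \<Omega> (grad \<phi>)"
proof -
  note C1 = test_function_C1[OF \<phi>]
  obtain B where B: "B > 0" "\<And>x. \<bar>\<phi> x\<bar> \<le> B" "\<And>x. norm (grad \<phi> x) \<le> B" using test_function_bounded[OF \<phi>] by metis
  obtain K where K: "compact K" "K \<subseteq> \<Omega>" "\<And>x. x \<notin> K \<Longrightarrow> \<phi> x = 0"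
    using \<phi> compactly_supported_inE unfolding test_function_def by metis
  have int: "integrable lborel \<phi>" by (rule integrable_continuous_compact_support[OF C1D(3)[OF C1] K(1,3)])
  obtain c where c: "\<And>x. x \<in> \<Omega> \<Longrightarrow> ennreal \<bar>\<phi> x - piecewise_const \<Q> c x\<bar>
    \<le> ennreal (2 ^ CARD('a)) * (\<integral>\<^sup>+y. ennreal \<bar>\<phi> (x + (2 * d) *\<^sub>R y) - \<phi> x\<bar> \<partial>unit_ball_measure)"
    using piecewise_const_approx[OF int d B(2)] by metis
  let ?k = "2 ^ CARD('a) * (2 * d)"
  have le: "ennreal \<bar>\<phi> x - piecewise_const \<Q> c x\<bar> \<le> ennreal ?k * ray_average 0 (2 * d) \<phi> x" if "x \<in> \<Omega>" for x
  proof -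
    note c[OF that]
    also have "ennreal (2 ^ CARD('a)) * (\<integral>\<^sup>+y. ennreal \<bar>\<phi> (x + (2 * d) *\<^sub>R y) - \<phi> x\<bar> \<partial>unit_ball_measure)
      \<le> ennreal (2 ^ CARD('a)) * (ennreal (2 * d) * ray_average 0 (2 * d) \<phi> x)"
      using average_increment_le[OF C1, of "2 * d" x 0] d by (intro mult_left_mono) auto
    also have "\<dots> = ennreal ?k * ray_average 0 (2 * d) \<phi> x"
      using d by (subst ennreal_mult) (auto simp: mult.assoc)
    finally show ?thesis .
  qed
  have "L2_norm \<Omega> (\<lambda>x. \<phi> x - piecewise_const \<Q> c x) \<le> ?k * L2_norm \<Omega> (grad \<phi>)"
  proof (rule L2_norm_le_nn_integral)
    show "(\<lambda>x. \<phi> x - piecewise_const \<Q> c x) \<in> L2 \<Omega>" by (intro L2_diff test_function_L2[OF \<phi>] piecewise_const_L2)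
    have [measurable]: "ray_average 0 (2 * d) \<phi> \<in> borel_measurable borel" by (rule ray_average[OF C1])
    have "(\<integral>\<^sup>+x. (ennreal (norm (\<phi> x - piecewise_const \<Q> c x)))\<^sup>2 \<partial>lebesgue_on \<Omega>)
      \<le> (\<integral>\<^sup>+x. (ennreal ?k * ray_average 0 (2 * d) \<phi> x)\<^sup>2 \<partial>lebesgue_on \<Omega>)"
      using le by (intro nn_integral_mono power_mono) auto
    also have "\<dots> \<le> (\<integral>\<^sup>+x. (ennreal ?k * ray_average 0 (2 * d) \<phi> x)\<^sup>2 \<partial>lborel)"
      by (rule nn_integral_lebesgue_on_le_lborel) simp
    also have "\<dots> = (ennreal ?k)\<^sup>2 * (\<integral>\<^sup>+x. (ray_average 0 (2 * d) \<phi> x)\<^sup>2 \<partial>lborel)"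
      by (simp only: power_mult_distrib) (rule nn_integral_cmult, measurable)
    also have "\<dots> \<le> (ennreal ?k)\<^sup>2 * (\<integral>\<^sup>+x. (ennreal (norm (grad \<phi> x)))\<^sup>2 \<partial>lborel)"
      by (intro mult_left_mono ray_average[OF C1]) auto
    also have "\<dots> = ennreal (?k\<^sup>2) * ennreal ((L2_norm \<Omega> (grad \<phi>))\<^sup>2)"
      unfolding test_function_nn_integrals(3)[OF \<Omega>_sets \<phi>] using d by (subst ennreal_power) auto
    also have "\<dots> = ennreal ((?k * L2_norm \<Omega> (grad \<phi>))\<^sup>2)"
      unfolding power_mult_distrib[of ?k] by (intro ennreal_mult[symmetric] zero_le_power2)
    finally show "(\<integral>\<^sup>+x. (ennreal (norm (\<phi> x - piecewise_const \<Q> c x)))\<^sup>2 \<partial>lebesgue_on \<Omega>) \<le> ennreal ((?k * L2_norm \<Omega> (grad \<phi>))\<^sup>2)" .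
    show "0 \<le> ?k * L2_norm \<Omega> (grad \<phi>)" using d by simp
  qed
  then show ?thesis using local_avg_best_approx[OF test_function_L2(1)[OF \<phi>], of c] by linarith
qed

text \<open>The operator \<open>u \<mapsto> u - P u\<close> is a contraction of \<open>L2\<close>,
  so the estimate survives the approximation by test functions.\<close>

lemma local_avg_error:
  assumes u: "H10_pair \<Omega> u G" and d: "d > 0" "max_diameter \<Q> \<le> d"
  shows "L2_norm \<Omega> (\<lambda>x. u x - local_avg \<Q> u x) \<le> 2 ^ CARD('a) * (2 * d) * L2_norm \<Omega> G"
proof -
  obtain \<phi> where \<phi>: "\<And>k. test_function \<Omega> (\<phi> k)" "L2_tendsto \<Omega> \<phi> u" "L2_tendsto \<Omega> (\<lambda>k. grad (\<phi> k)) G"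
    using u by (auto simp: H10_pair_def)
  note Lu = H10_pairD(1)[OF u] and L\<phi> = test_function_L2(1)[OF \<phi>(1)]
  let ?k = "2 ^ CARD('a) * (2 * d)"
  have le: "L2_norm \<Omega> (\<lambda>x. u x - local_avg \<Q> u x) \<le> ?k * L2_norm \<Omega> (grad (\<phi> k)) + L2_norm \<Omega> (\<lambda>x. \<phi> k x - u x)" for k
  proof -
    have "(\<lambda>x. u x - local_avg \<Q> u x) =
      (\<lambda>x. (\<phi> k x - local_avg \<Q> (\<phi> k) x) - ((\<phi> k x - u x) - local_avg \<Q> (\<lambda>x. \<phi> k x - u x) x))"
      using local_avg_diff[OF L\<phi> Lu] by auto
    then have "L2_norm \<Omega> (\<lambda>x. u x - local_avg \<Q> u x) \<le> L2_norm \<Omega> (\<lambda>x. \<phi> k x - local_avg \<Q> (\<phi> k) x)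
      + L2_norm \<Omega> (\<lambda>x. (\<phi> k x - u x) - local_avg \<Q> (\<lambda>x. \<phi> k x - u x) x)"
      by (simp only:) (intro L2_norm_triangle_diff L2_diff L\<phi> Lu local_avg_L2)
    also have "\<dots> \<le> ?k * L2_norm \<Omega> (grad (\<phi> k)) + L2_norm \<Omega> (\<lambda>x. \<phi> k x - u x)"
      by (intro add_mono local_avg_error_test_function[OF \<phi>(1) d] local_avg_contraction(1) L2_diff L\<phi> Lu)
    finally show ?thesis .
  qed
  have "(\<lambda>k. ?k * L2_norm \<Omega> (grad (\<phi> k)) + L2_norm \<Omega> (\<lambda>x. \<phi> k x - u x)) \<longlonglongrightarrow> ?k * L2_norm \<Omega> G + 0"
    using \<phi>(2) by (intro tendsto_intros L2_tendsto_norm \<phi>) (simp add: L2_tendsto_def)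
  then show ?thesis using LIMSEQ_le_const[of _ "?k * L2_norm \<Omega> G" "L2_norm \<Omega> (\<lambda>x. u x - local_avg \<Q> u x)"] le by auto
qed

end

subsection \<open>Cut-off functions near a polygonal boundary\<close>

text \<open>Translates of the slab by multiples of \<open>3 * e\<close> in the normal direction are
  disjoint, as its thickness is \<open>2 * e\<close>. About \<open>R / (3 * e)\<close> of them fit
  into the ball of radius \<open>2 * R\<close>, so each has at most the corresponding share of its
  volume.\<close>

lemma measure_slab_le:
  fixes a :: "'a::euclidean_space"
  assumes a: "norm a = 1" and R: "R > 0" and e: "e > 0"
  shows "measure lebesgue (ball 0 R \<inter> {x. \<bar>a \<bullet> x - b\<bar> \<le> e}) \<le> 3 * measure lebesgue (ball (0::'a) (2 * R)) / R * e"
proof -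
  define S where "S = ball 0 R \<inter> {x. \<bar>a \<bullet> x - b\<bar> \<le> e}"
  define J where "J = nat \<lfloor>R / (3 * e)\<rfloor>"
  have J: "real J \<le> R / (3 * e)" "R / (3 * e) \<le> real J + 1" using R e by (auto simp: J_def)
  have "closed {x. \<bar>a \<bullet> x - b\<bar> \<le> e}" by (intro closed_Collect_le continuous_intros)
  then have "S \<in> sets borel" unfolding S_def by auto
  then have Sl: "S \<in> lmeasurable"
    by (intro bounded_set_imp_lmeasurable) (auto simp: S_def intro: bounded_subset[OF bounded_ball])
  define T where "T j = (+) ((3 * e * real j) *\<^sub>R a) ` S" for j :: nat
  have Tl: "T j \<in> lmeasurable" for j unfolding T_def using Sl by (rule measurable_translation)
  have aa: "a \<bullet> a = 1" using a by (simp add: dot_square_norm)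
  have Tval: "\<bar>a \<bullet> z - b - 3 * e * real j\<bar> \<le> e" if "z \<in> T j" for z j
    using that by (auto simp: T_def S_def inner_add_right aa)
  have dis: "disjoint_family_on T {..J}"
    unfolding disjoint_family_on_def
  proof (intro ballI impI)
    fix i j :: nat assume "i \<noteq> j"
    show "T i \<inter> T j = {}"
    proof (rule equals0I)
      fix z assume "z \<in> T i \<inter> T j"
      then have "\<bar>3 * e * real i - 3 * e * real j\<bar> \<le> 2 * e" using Tval[of z i] Tval[of z j] by auto
      then have "3 * e * \<bar>real i - real j\<bar> \<le> 2 * e" using e by (simp add: right_diff_distrib[symmetric] abs_mult)
      moreover have "\<bar>real i - real j\<bar> \<ge> 1" using \<open>i \<noteq> j\<close> by linarith
      then have "3 * e * 1 \<le> 3 * e * \<bar>real i - real j\<bar>" using e by (intro mult_left_mono) auto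
      ultimately show False using e by linarith
    qed
  qed
  have "(real J + 1) * measure lebesgue S = (\<Sum>j\<le>J. measure lebesgue (T j))"
  proof -
    have "measure lebesgue (T j) = measure lebesgue S" for j unfolding T_def by (rule measure_translation)
    then show ?thesis by (simp add: algebra_simps)
  qed
  also have "\<dots> = measure lebesgue (\<Union>j\<le>J. T j)"
    using fmeasurableD[OF Tl] fmeasurableD2[OF Tl]
    by (intro measure_finite_Union[symmetric] dis) (auto simp del: emeasure_completion)
  also have "\<dots> \<le> measure lebesgue (ball (0::'a) (2 * R))"
  proof (rule measure_mono_fmeasurable)
    show "(\<Union>j\<le>J. T j) \<subseteq> ball 0 (2 * R)"
    proof
      fix z assume "z \<in> (\<Union>j\<le>J. T j)"
      then obtain j x where j: "j \<le> J" "x \<in> S" "z = (3 * e * real j) *\<^sub>R a + x" by (auto simp: T_def)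
      have "3 * e * real j \<le> 3 * e * real J" using j e by (intro mult_left_mono) auto
      also have "\<dots> \<le> R" using J(1) e by (simp add: field_simps)
      finally have "norm ((3 * e * real j) *\<^sub>R a) \<le> R" using e a by simp
      moreover have "norm x < R" using j(2) by (simp add: S_def)
      ultimately show "z \<in> ball 0 (2 * R)" using norm_triangle_ineq[of "(3 * e * real j) *\<^sub>R a" x] by (simp add: j(3))
    qed
    show "(\<Union>j\<le>J. T j) \<in> sets lebesgue" using Tl by (intro sets.finite_UN) (auto simp: fmeasurable_def)
  qed simp
  finally have "(R / (3 * e)) * measure lebesgue S \<le> measure lebesgue (ball (0::'a) (2 * R))"
    using mult_right_mono[OF J(2) measure_nonneg[of lebesgue S]] by linarith
  then show ?thesis using R e by (simp add: S_def field_simps)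
qed

text \<open>The square makes the positive part differentiable with the continuous derivative
  \<open>2 * max 0 v\<close>; this matches the test fields of the variation, which are of class
  C1.\<close>

definition pos_sq :: "real \<Rightarrow> real" where "pos_sq v = (max 0 v)\<^sup>2"

lemma pos_sq_deriv: "(pos_sq has_real_derivative 2 * max 0 v) (at v)"
proof -
  have "(pos_sq has_derivative (\<lambda>h. (2 * max 0 v) * h)) (at v)"
  proof (rule has_derivativeI_sandwich[where e=1 and H="\<lambda>y. \<bar>y - v\<bar>"])
    show "bounded_linear (\<lambda>h. (2 * max 0 v) * h)" by (rule bounded_linear_mult_right)
    have ineq: "\<bar>pos_sq y - pos_sq v - (2 * max 0 v) * (y - v)\<bar> \<le> \<bar>y - v\<bar> * \<bar>y - v\<bar>" for y
    proof -
      consider "v \<ge> 0" "y \<ge> 0" | "v < 0" "y < 0" | "v \<ge> 0" "y < 0" | "v < 0" "y \<ge> 0" by linarith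
      then show ?thesis
      proof cases
        case 1
        then have "pos_sq y - pos_sq v - (2 * max 0 v) * (y - v) = (y - v) * (y - v)"
          by (simp add: pos_sq_def power2_eq_square algebra_simps)
        then show ?thesis by (simp add: abs_mult)
      next
        case 2
        then show ?thesis by (simp add: pos_sq_def)
      next
        case 3
        then have eq: "pos_sq y - pos_sq v - (2 * max 0 v) * (y - v) = v * v - 2 * v * y"
          by (simp add: pos_sq_def power2_eq_square algebra_simps)
        have "v * y \<le> 0" using 3 by (simp add: mult_le_0_iff)
        then have "0 \<le> v * v - 2 * v * y" using zero_le_square[of v] by linarith
        moreover have "v * v - 2 * v * y \<le> (v - y) * (v - y)" using zero_le_square[of y] by (simp add: algebra_simps)
        moreover have "(y - v) * (y - v) = (v - y) * (v - y)" by (simp add: algebra_simps)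
        ultimately show ?thesis unfolding eq abs_mult_self_eq by simp
      next
        case 4
        then have eq: "pos_sq y - pos_sq v - (2 * max 0 v) * (y - v) = y * y"
          by (simp add: pos_sq_def power2_eq_square)
        have "y * y \<le> (y - v) * (y - v)" using 4 by (intro mult_mono) auto
        then show ?thesis unfolding eq by (simp add: abs_mult[symmetric])
      qed
    qed
    show "norm (pos_sq y - pos_sq v - (2 * max 0 v) * (y - v)) / norm (y - v) \<le> \<bar>y - v\<bar>" if "y \<noteq> v" "dist y v < 1" for y
      using ineq[of y] that by (simp add: divide_le_eq)
    show "((\<lambda>y. \<bar>y - v\<bar>) \<longlongrightarrow> 0) (at v)"
      by (intro tendsto_rabs_zero) (simp add: LIM_zero)
  qed simp
  then show ?thesis by (simp add: has_field_derivative_def)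
qed

lemma pos_sq_props: "pos_sq v \<ge> 0" "v \<le> 0 \<Longrightarrow> pos_sq v = 0" "v \<ge> 1 \<Longrightarrow> pos_sq v \<ge> 1" "v \<le> 1 \<Longrightarrow> pos_sq v \<le> 1"
  by (auto simp: pos_sq_def max_def power_le_one)

text \<open>Working with \<open>(t / e)\<^sup>2\<close> avoids the absolute value: the inner
  \<open>pos_sq\<close> is \<open>0\<close> for \<open>\<bar>t\<bar> \<le> e\<close> and at least
  \<open>1\<close> for \<open>\<bar>t\<bar> \<ge> 2 * e\<close>, and the outer one joins these
  regimes to a C1 transition from \<open>0\<close> to \<open>1\<close>.\<close>

definition cutoff :: "real \<Rightarrow> real \<Rightarrow> real" where
  "cutoff e t = 1 - pos_sq (1 - pos_sq ((t / e)\<^sup>2 - 1))"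

lemma cutoff_props:
  assumes "e > 0"
  shows "0 \<le> cutoff e t" "cutoff e t \<le> 1" "\<bar>t\<bar> \<le> e \<Longrightarrow> cutoff e t = 0" "2 * e \<le> \<bar>t\<bar> \<Longrightarrow> cutoff e t = 1"
proof -
  have "pos_sq (1 - pos_sq ((t / e)\<^sup>2 - 1)) \<le> 1" using pos_sq_props(1)[of "(t / e)\<^sup>2 - 1"] by (intro pos_sq_props(4)) auto
  then show "0 \<le> cutoff e t" by (simp add: cutoff_def)
  show "cutoff e t \<le> 1" using pos_sq_props(1) by (simp add: cutoff_def)
  show "cutoff e t = 0" if "\<bar>t\<bar> \<le> e"
  proof -
    have "(\<bar>t\<bar> / e)\<^sup>2 \<le> 1\<^sup>2" using that assms by (intro power_mono) auto
    then have "(t / e)\<^sup>2 - 1 \<le> 0" by (simp add: power_divide)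
    then show ?thesis by (simp add: cutoff_def pos_sq_props(2)) (simp add: pos_sq_def)
  qed
  show "cutoff e t = 1" if "2 * e \<le> \<bar>t\<bar>"
  proof -
    have "2\<^sup>2 \<le> (\<bar>t\<bar> / e)\<^sup>2" using that assms by (intro power_mono) (auto simp: field_simps)
    then have "(t / e)\<^sup>2 - 1 \<ge> 1" by (simp add: power_divide)
    then have "1 - pos_sq ((t / e)\<^sup>2 - 1) \<le> 0" using pos_sq_props(3) by simp
    then show ?thesis by (simp add: cutoff_def pos_sq_props(2))
  qed
qed

definition cutoff_deriv :: "real \<Rightarrow> real \<Rightarrow> real" where
  "cutoff_deriv e t = 2 * max 0 (1 - pos_sq ((t / e)\<^sup>2 - 1)) * (2 * max 0 ((t / e)\<^sup>2 - 1)) * (2 * t / e\<^sup>2)"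

lemma cutoff_deriv:
  assumes "e > 0"
  shows "(cutoff e has_real_derivative cutoff_deriv e t) (at t)" "continuous_on UNIV (cutoff_deriv e)"
    "2 * e \<le> \<bar>t\<bar> \<Longrightarrow> cutoff_deriv e t = 0" "\<bar>cutoff_deriv e t\<bar> \<le> 16 / e"
proof -
  have 1: "((\<lambda>t. (t / e)\<^sup>2 - 1) has_real_derivative 2 * t / e\<^sup>2) (at t)"
    using assms by (auto intro!: derivative_eq_intros simp: power2_eq_square)
  have 2: "((\<lambda>t. 1 - pos_sq ((t / e)\<^sup>2 - 1)) has_real_derivative - (2 * max 0 ((t / e)\<^sup>2 - 1) * (2 * t / e\<^sup>2))) (at t)"
    using DERIV_chain2[OF pos_sq_deriv 1] by (auto intro!: derivative_eq_intros)
  show "(cutoff e has_real_derivative cutoff_deriv e t) (at t)"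
    unfolding cutoff_def[abs_def] cutoff_deriv_def
    by (rule derivative_eq_intros DERIV_chain2[OF pos_sq_deriv 2] refl)+ simp
  show "continuous_on UNIV (cutoff_deriv e)"
    unfolding cutoff_deriv_def[abs_def] pos_sq_def using assms by (intro continuous_intros) auto
  show z: "cutoff_deriv e t = 0" if "2 * e \<le> \<bar>t\<bar>" for t
  proof -
    have "2\<^sup>2 \<le> (\<bar>t\<bar> / e)\<^sup>2" using that assms by (intro power_mono) (auto simp: field_simps)
    then have "(t / e)\<^sup>2 - 1 \<ge> 1" by (simp add: power_divide)
    then have "1 - pos_sq ((t / e)\<^sup>2 - 1) \<le> 0" using pos_sq_props(3) by simp
    then show ?thesis by (simp add: cutoff_deriv_def)
  qed
  show "\<bar>cutoff_deriv e t\<bar> \<le> 16 / e"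
  proof (cases "(t / e)\<^sup>2 - 1 \<ge> 1")
    case True
    then have "1 - pos_sq ((t / e)\<^sup>2 - 1) \<le> 0" using pos_sq_props(3) by simp
    then show ?thesis using assms by (simp add: cutoff_deriv_def)
  next
    case False
    show ?thesis
    proof (cases "2 * e \<le> \<bar>t\<bar>")
      case True then show ?thesis using z assms by simp
    next
      case t: False
      \<comment> \<open>In the transition zone the two derivatives of \<open>pos_sq\<close>
        contribute at most \<open>2\<close> each and the inner derivative
        \<open>2 * t / e\<^sup>2\<close> at most \<open>4 / e\<close>, in total
        \<open>16 / e\<close>.\<close>
      let ?x = "max 0 (1 - pos_sq ((t / e)\<^sup>2 - 1))" and ?y = "max 0 ((t / e)\<^sup>2 - 1)"
      have "0 \<le> ?x" "?x \<le> 1" "0 \<le> ?y" "?y \<le> 1" using False pos_sq_props(1) by auto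
      then have xy: "2 * ?x * (2 * ?y) \<le> 4" "0 \<le> 2 * ?x * (2 * ?y)" using mult_mono[of ?x 1 ?y 1] by auto
      have "\<bar>2 * t / e\<^sup>2\<bar> = 2 * \<bar>t\<bar> / e\<^sup>2" using assms by (simp add: abs_mult)
      also have "\<dots> \<le> 2 * (2 * e) / e\<^sup>2" using t by (intro divide_right_mono) auto
      also have "\<dots> = 4 / e" using assms by (simp add: power2_eq_square)
      finally have "\<bar>2 * t / e\<^sup>2\<bar> \<le> 4 / e" .
      then have "(2 * ?x * (2 * ?y)) * \<bar>2 * t / e\<^sup>2\<bar> \<le> 4 * (4 / e)" using xy by (intro mult_mono) auto
      moreover have "\<bar>cutoff_deriv e t\<bar> = (2 * ?x * (2 * ?y)) * \<bar>2 * t / e\<^sup>2\<bar>"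
        unfolding cutoff_deriv_def abs_mult using xy(2) by (simp add: abs_mult)
      ultimately show ?thesis by simp
    qed
  qed
qed

text \<open>The whole hyperplanes containing the faces are cut out, not only the faces. This keeps
  the function a plain product, and a slab around a hyperplane still has measure of order
  \<open>e\<close> inside a bounded set.\<close>

definition hyperplane_cutoff :: "((real ^ 'n::finite) \<times> real) set \<Rightarrow> real \<Rightarrow> real ^ 'n \<Rightarrow> real" where
  "hyperplane_cutoff F e x = (\<Prod>(a, b)\<in>F. cutoff e (a \<bullet> x - b))"

lemma cutoff_inner_C1:
  assumes "e > 0"
  shows "C_k 1 (\<lambda>x::real^'n::finite. cutoff e (a \<bullet> x - b))"
    "grad (\<lambda>x. cutoff e (a \<bullet> x - b)) x = cutoff_deriv e (a \<bullet> x - b) *\<^sub>R a"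
proof -
  have D: "((\<lambda>x. cutoff e (a \<bullet> x - b)) has_derivative (\<lambda>h. (cutoff_deriv e (a \<bullet> x - b) *\<^sub>R a) \<bullet> h)) (at x)" for x
  proof -
    have "((\<lambda>x. a \<bullet> x - b) has_derivative (\<lambda>h. a \<bullet> h)) (at x)" by (auto intro!: derivative_eq_intros)
    from has_derivative_compose[OF this cutoff_deriv(1)[OF assms, unfolded has_field_derivative_def]]
    show ?thesis by simp
  qed
  have c: "continuous_on UNIV (\<lambda>x. cutoff_deriv e (a \<bullet> x - b) *\<^sub>R a)"
    by (intro continuous_intros continuous_on_compose2[OF cutoff_deriv(2)[OF assms]]) auto
  show "C_k 1 (\<lambda>x. cutoff e (a \<bullet> x - b))" "grad (\<lambda>x. cutoff e (a \<bullet> x - b)) x = cutoff_deriv e (a \<bullet> x - b) *\<^sub>R a"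
    using C1I[OF D c] by auto
qed

lemma hyperplane_cutoff_props:
  assumes "e > 0" "finite F"
  shows "C_k 1 (hyperplane_cutoff F e)" "0 \<le> hyperplane_cutoff F e x" "hyperplane_cutoff F e x \<le> 1"
    "(a, b) \<in> F \<Longrightarrow> \<bar>a \<bullet> x - b\<bar> \<le> e \<Longrightarrow> hyperplane_cutoff F e x = 0"
    "(\<And>a b. (a, b) \<in> F \<Longrightarrow> 2 * e \<le> \<bar>a \<bullet> x - b\<bar>) \<Longrightarrow> hyperplane_cutoff F e x = 1"
proof -
  have "C_k 1 (\<lambda>x. \<Prod>p\<in>F. cutoff e (fst p \<bullet> x - snd p))"
    by (intro C_k_prod assms cutoff_inner_C1)
  then show "C_k 1 (hyperplane_cutoff F e)" by (simp add: hyperplane_cutoff_def[abs_def] case_prod_unfold)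
  show "0 \<le> hyperplane_cutoff F e x" "hyperplane_cutoff F e x \<le> 1"
    unfolding hyperplane_cutoff_def case_prod_unfold using cutoff_props[OF assms(1)]
    by (auto intro!: prod_nonneg prod_le_1)
  show "hyperplane_cutoff F e x = 0" if "(a, b) \<in> F" "\<bar>a \<bullet> x - b\<bar> \<le> e"
    unfolding hyperplane_cutoff_def using that cutoff_props(3)[OF assms(1)] assms(2) by (intro prod_zero bexI[of _ "(a, b)"]) auto
  show "hyperplane_cutoff F e x = 1" if "\<And>a b. (a, b) \<in> F \<Longrightarrow> 2 * e \<le> \<bar>a \<bullet> x - b\<bar>"
    unfolding hyperplane_cutoff_def using that cutoff_props(4)[OF assms(1)] by (intro prod.neutral) auto
qed

text \<open>All factors lie in \<open>[0, 1]\<close>, so the product rule bounds the gradient by the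
  sum of the gradients of the factors.\<close>

lemma hyperplane_cutoff_grad_le:
  assumes "e > 0" "finite F" "\<And>a b. (a, b) \<in> F \<Longrightarrow> norm a = 1"
  shows "norm (grad (hyperplane_cutoff F e) x) \<le> (\<Sum>(a, b)\<in>F. 16 / e * indicator {x. \<bar>a \<bullet> x - b\<bar> \<le> 2 * e} x)"
  using assms(2,3)
proof (induction F)
  case empty
  have "grad (\<lambda>x::real^'a. 1) x = 0" by (rule grad_eq) simp
  then show ?case by (simp add: hyperplane_cutoff_def[abs_def])
next
  case (insert p F)
  obtain a b where p: "p = (a, b)" by (cases p)
  have a: "norm a = 1" using insert.prems p by auto
  let ?f = "\<lambda>x. cutoff e (a \<bullet> x - b)"
  have eq: "hyperplane_cutoff (insert p F) e = (\<lambda>x. ?f x * hyperplane_cutoff F e x)"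
    using insert.hyps by (simp add: hyperplane_cutoff_def fun_eq_iff p)
  note h = hyperplane_cutoff_props[OF assms(1) insert.hyps(1)]
  have "norm (grad (hyperplane_cutoff (insert p F) e) x) = norm (?f x *\<^sub>R grad (hyperplane_cutoff F e) x + hyperplane_cutoff F e x *\<^sub>R grad ?f x)"
    unfolding eq grad_mult(2)[OF cutoff_inner_C1(1)[OF assms(1)] h(1)] ..
  also have "\<dots> \<le> ?f x * norm (grad (hyperplane_cutoff F e) x) + hyperplane_cutoff F e x * \<bar>cutoff_deriv e (a \<bullet> x - b)\<bar>"
    using norm_triangle_ineq[of "?f x *\<^sub>R grad (hyperplane_cutoff F e) x" "hyperplane_cutoff F e x *\<^sub>R grad ?f x"]
      cutoff_props(1)[OF assms(1)] h(2)[of x] by (simp add: cutoff_inner_C1(2)[OF assms(1)] a abs_mult)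
  also have "\<dots> \<le> norm (grad (hyperplane_cutoff F e) x) + \<bar>cutoff_deriv e (a \<bullet> x - b)\<bar>"
    using cutoff_props[OF assms(1), of "a \<bullet> x - b"] h(2,3)[of x] by (intro add_mono mult_left_le_one_le) auto
  also have "\<dots> \<le> (\<Sum>(a, b)\<in>F. 16 / e * indicator {x. \<bar>a \<bullet> x - b\<bar> \<le> 2 * e} x) + 16 / e * indicator {x. \<bar>a \<bullet> x - b\<bar> \<le> 2 * e} x"
  proof (rule add_mono)
    show "norm (grad (hyperplane_cutoff F e) x) \<le> (\<Sum>(a, b)\<in>F. 16 / e * indicator {x. \<bar>a \<bullet> x - b\<bar> \<le> 2 * e} x)"
      using insert by auto
    show "\<bar>cutoff_deriv e (a \<bullet> x - b)\<bar> \<le> 16 / e * indicator {x. \<bar>a \<bullet> x - b\<bar> \<le> 2 * e} x"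
      using cutoff_deriv(3,4)[OF assms(1), of "a \<bullet> x - b"] by (cases "\<bar>a \<bullet> x - b\<bar> \<le> 2 * e") auto
  qed
  finally show ?case using insert.hyps by (simp add: p add.commute)
qed

lemma polygonal_boundary_hyperplanes:
  fixes \<Omega> :: "(real ^ 'n::finite) set"
  assumes "polygonal_boundary \<Omega>"
  obtains F :: "((real ^ 'n) \<times> real) set" where "finite F" "\<And>a b. (a, b) \<in> F \<Longrightarrow> norm a = 1"
    "\<And>x. x \<in> frontier \<Omega> \<Longrightarrow> \<exists>(a, b)\<in>F. a \<bullet> x = b"
proof -
  obtain \<F> where \<F>: "finite \<F>" "\<And>P. P \<in> \<F> \<Longrightarrow> aff_dim P = int CARD('n) - 1" "frontier \<Omega> = \<Union>\<F>"
    using assms by (auto simp: polygonal_boundary_def)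
  have "\<exists>p. norm (fst p) = 1 \<and> P \<subseteq> {x. fst p \<bullet> x = snd p}" if "P \<in> \<F>" for P
  proof -
    have "aff_dim P < DIM(real ^ 'n)" using \<F>(2)[OF that] by simp
    then obtain a b where ab: "a \<noteq> 0" "P \<subseteq> {x. a \<bullet> x = b}" by (rule aff_lowdim_subset_hyperplane)
    then show ?thesis
      by (intro exI[of _ "(a /\<^sub>R norm a, b / norm a)"]) (auto simp: divide_inverse mult.commute)
  qed
  then obtain p where p: "\<And>P. P \<in> \<F> \<Longrightarrow> norm (fst (p P)) = 1 \<and> P \<subseteq> {x. fst (p P) \<bullet> x = snd (p P)}" by metis
  show ?thesis
  proof (rule that[of "p ` \<F>"])
    show "finite (p ` \<F>)" using \<F>(1) by simp
    show "norm a = 1" if "(a, b) \<in> p ` \<F>" for a b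
    proof -
      from that obtain P where "P \<in> \<F>" "(a, b) = p P" by (rule imageE)
      then show ?thesis using p[of P] by (metis fst_conv)
    qed
    show "\<exists>(a, b)\<in>p ` \<F>. a \<bullet> x = b" if "x \<in> frontier \<Omega>" for x
    proof -
      from that have "x \<in> \<Union>\<F>" using \<F>(3) by simp
      then obtain P where "P \<in> \<F>" "x \<in> P" by blast
      then show ?thesis using p[of P] by (intro bexI[of _ "p P"]) auto
    qed
  qed
qed

subsection \<open>Translation estimate for functions of bounded variation\<close>

text \<open>A cut-off product need not vanish outside \<open>\<Omega>\<close>, as compact support in
  \<open>\<Omega>\<close> demands. It may be set to \<open>0\<close> there because within
  \<open>\<Omega>\<close> it already vanishes off a closed subset.\<close>

lemma C1_extend_by_zero:
  fixes g :: "real ^ 'n::finite \<Rightarrow> real"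
  assumes g: "C_k 1 g" and \<Omega>: "open \<Omega>" and K: "closed K" "K \<subseteq> \<Omega>" "\<And>x. x \<in> \<Omega> - K \<Longrightarrow> g x = 0"
  shows "C_k 1 (\<lambda>x. if x \<in> \<Omega> then g x else 0)"
    "grad (\<lambda>x. if x \<in> \<Omega> then g x else 0) = (\<lambda>x. if x \<in> \<Omega> then grad g x else 0)"
proof -
  let ?f = "\<lambda>x. if x \<in> \<Omega> then g x else 0" and ?G = "\<lambda>x. if x \<in> \<Omega> then grad g x else 0"
  have g0: "grad g x = 0" if "x \<in> \<Omega> - K" for x
  proof (rule grad_eq)
    have "((\<lambda>x. 0) has_derivative (\<lambda>h. 0 \<bullet> h)) (at x)" by simp
    from has_derivative_transform_within_open[OF this, of "\<Omega> - K" g]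
    show "(g has_derivative (\<lambda>h. 0 \<bullet> h)) (at x)" using that \<Omega> K by auto
  qed
  have D: "(?f has_derivative (\<lambda>h. ?G x \<bullet> h)) (at x)" for x
  proof (cases "x \<in> \<Omega>")
    case True
    from has_derivative_transform_within_open[OF C1D(1)[OF g, of x] \<Omega> True, of ?f]
    show ?thesis using True by auto
  next
    case False
    have "((\<lambda>x. 0) has_derivative (\<lambda>h. 0 \<bullet> h)) (at x)" by simp
    then have "(?f has_derivative (\<lambda>h. 0 \<bullet> h)) (at x)"
    proof (rule has_derivative_transform_within_open)
      show "open (- K)" "x \<in> - K" using False K by auto
      show "0 = ?f z" if "z \<in> - K" for z using that K(3)[of z] by auto
    qed
    then show ?thesis using False by simp
  qed
  have "continuous_on (\<Omega> \<union> - K) ?G"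
  proof (rule continuous_on_open_Un[OF \<Omega>])
    show "open (- K)" using K by auto
    have "continuous_on \<Omega> (grad g)" using C1D(2)[OF g] by (rule continuous_on_subset) auto
    then show "continuous_on \<Omega> ?G" by (rule continuous_on_cong[THEN iffD1, rotated -1]) auto
    have "continuous_on (- K) (\<lambda>x. 0 :: real ^ 'n)" by (rule continuous_on_const)
    then show "continuous_on (- K) ?G" by (rule continuous_on_cong[THEN iffD1, rotated -1]) (use g0 in auto)
  qed
  moreover have "\<Omega> \<union> - K = UNIV" using K by auto
  ultimately have c: "continuous_on UNIV ?G" by simp
  show "C_k 1 ?f" "grad ?f = ?G" using C1I[OF D c] by auto
qed

context bounded_open
begin

text \<open>A bounded scalar function times a fixed unit vector is an admissible test field, and its
  divergence is the directional derivative.\<close>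

lemma variation_bound:
  assumes w: "w \<in> BV \<Omega>"
  obtains V where "V \<ge> 0" "\<And>f y. C_k 1 f \<Longrightarrow> compactly_supported_in \<Omega> f \<Longrightarrow> (\<And>x. \<bar>f x\<bar> \<le> 1) \<Longrightarrow>
    (LINT x|lebesgue_on \<Omega>. w x * (grad f x \<bullet> y)) \<le> V * norm y"
proof -
  define V where "V = Sup (variation_values \<Omega> w)"
  have bdd: "bdd_above (variation_values \<Omega> w)" using w by (simp add: BV_def)
  have unit: "(LINT x|lebesgue_on \<Omega>. w x * (grad f x \<bullet> y)) \<le> V"
    if f: "C_k 1 f" "compactly_supported_in \<Omega> f" "\<And>x. \<bar>f x\<bar> \<le> 1" and y: "norm y \<le> 1" for f and y :: "real ^ 'n"
  proof -
    define \<Phi> where "\<Phi> x = f x *\<^sub>R y" for x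
    have comp: "(\<lambda>x. \<Phi> x $ i) = (\<lambda>x. f x * y $ i)" for i by (simp add: \<Phi>_def)
    have C1: "C_k 1 (\<lambda>x. \<Phi> x $ i)" for i unfolding comp by (intro C_k_mult f C_k_const)
    obtain K where K: "compact K" "K \<subseteq> \<Omega>" "\<And>x. x \<notin> K \<Longrightarrow> f x = 0" using compactly_supported_inE[OF f(2)] by metis
    have sup: "compactly_supported_in \<Omega> (\<lambda>x. \<Phi> x $ i)" for i
      unfolding comp using K by (intro compactly_supported_inI[OF K(1,2)]) auto
    have nm: "norm (\<Phi> x) \<le> 1" for x using f(3)[of x] y by (simp add: \<Phi>_def mult_le_one)
    have "partial_deriv i (\<lambda>x. \<Phi> x $ i) x = grad f x $ i * y $ i" for i x
    proof -
      have "((\<lambda>x. f x * y $ i) has_derivative (\<lambda>h. (grad f x \<bullet> h) * y $ i)) (at x)"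
        by (intro has_derivative_mult_left C1D f)
      from partial_deriv_eq[OF this, of i] show ?thesis unfolding comp by (simp add: inner_axis)
    qed
    then have "(\<Sum>i\<in>UNIV. partial_deriv i (\<lambda>x. \<Phi> x $ i) x) = grad f x \<bullet> y" for x by (simp add: inner_vec_def)
    then have "(LINT x|lebesgue_on \<Omega>. w x * (grad f x \<bullet> y)) \<in> variation_values \<Omega> w"
      unfolding variation_values_def using C1 sup nm by (intro CollectI exI[of _ \<Phi>]) (simp del: C_k.simps)
    then show ?thesis unfolding V_def using bdd by (rule cSup_upper)
  qed
  have z: "C_k 1 (\<lambda>x. 0)" "compactly_supported_in \<Omega> (\<lambda>x. 0)"
    by (auto intro: C_k_const compactly_supported_inI[of "{}"] simp del: C_k.simps)
  show ?thesis
  proof (rule that[of V])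
    show "V \<ge> 0" using unit[OF z, of 0] by simp
    fix f and y :: "real ^ 'n" assume f: "C_k 1 f" "compactly_supported_in \<Omega> f" "\<And>x. \<bar>f x\<bar> \<le> 1"
    show "(LINT x|lebesgue_on \<Omega>. w x * (grad f x \<bullet> y)) \<le> V * norm y"
    proof (cases "y = 0")
      case False
      have "norm y * (LINT x|lebesgue_on \<Omega>. w x * (grad f x \<bullet> (y /\<^sub>R norm y))) \<le> norm y * V"
        using False by (intro mult_left_mono unit f) auto
      moreover have "norm y * (LINT x|lebesgue_on \<Omega>. w x * (grad f x \<bullet> (y /\<^sub>R norm y))) = (LINT x|lebesgue_on \<Omega>. w x * (grad f x \<bullet> y))"
      proof -
        have "w x * (grad f x \<bullet> (y /\<^sub>R norm y)) = w x * (grad f x \<bullet> y) / norm y" for x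
          by (simp add: divide_inverse)
        then show ?thesis using False by simp
      qed
      ultimately show ?thesis by (simp add: mult.commute)
    qed simp
  qed
qed

text \<open>Across the boundary \<open>w\<close> may jump, which costs at most \<open>M\<close> times the area of the boundary.\<close>

lemma BV_directional_bound:
  assumes w: "w \<in> BV \<Omega>" and M: "AE x in lebesgue_on \<Omega>. \<bar>w x\<bar> \<le> M" "M \<ge> 0" and poly: "polygonal_boundary \<Omega>"
  obtains K where "K \<ge> 0" "\<And>\<sigma> y B. C_k 1 \<sigma> \<Longrightarrow> (\<And>x. \<bar>\<sigma> x\<bar> \<le> 1) \<Longrightarrow> (\<And>x. norm (grad \<sigma> x) \<le> B) \<Longrightarrow>
    (LINT x|lebesgue_on \<Omega>. w x * (grad \<sigma> x \<bullet> y)) \<le> K * norm y"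
proof -
  obtain F :: "((real ^ 'n) \<times> real) set" where F: "finite F" "\<And>a b. (a, b) \<in> F \<Longrightarrow> norm a = 1"
    "\<And>x. x \<in> frontier \<Omega> \<Longrightarrow> \<exists>(a, b)\<in>F. a \<bullet> x = b"
    using polygonal_boundary_hyperplanes[OF poly] by blast
  obtain V where V: "V \<ge> 0" "\<And>f y. C_k 1 f \<Longrightarrow> compactly_supported_in \<Omega> f \<Longrightarrow> (\<And>x. \<bar>f x\<bar> \<le> 1) \<Longrightarrow>
    (LINT x|lebesgue_on \<Omega>. w x * (grad f x \<bullet> y)) \<le> V * norm y"
    using variation_bound[OF w] by blast
  obtain R where R: "R > 0" "\<Omega> \<subseteq> ball 0 R"
    using bounded_subset_ballD[OF bounded_\<Omega>, of 0] by blast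
  define C where "C = 3 * measure lebesgue (ball (0::real^'n) (2 * R)) / R"
  have C: "C \<ge> 0" using R by (simp add: C_def)
  \<comment> \<open>Per hyperplane: the gradient of the cut-off is at most \<open>16 / e\<close> on
    a slab of half-width \<open>2 * e\<close>, whose measure in \<open>\<Omega>\<close> is at most
    \<open>C * (2 * e)\<close>. The width cancels and \<open>32 * C\<close> remains.\<close>
  define K where "K = V + M * (32 * C * card F)"
  have "K \<ge> 0" using V(1) M(2) C by (simp add: K_def)
  moreover have "(LINT x|lebesgue_on \<Omega>. w x * (grad \<sigma> x \<bullet> y)) \<le> K * norm y"
    if \<sigma>: "C_k 1 \<sigma>" "\<And>x. \<bar>\<sigma> x\<bar> \<le> 1" "\<And>x. norm (grad \<sigma> x) \<le> B" for \<sigma> y B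
  proof -
    have wi: "integrable (lebesgue_on \<Omega>) w" using w by (simp add: BV_def)
    then have wm[measurable]: "w \<in> borel_measurable (lebesgue_on \<Omega>)" by auto
    note \<sigma>m[measurable] = grad_measurable_lebesgue_on[OF \<sigma>(1), of \<Omega>]
    have B: "B \<ge> 0" using \<sigma>(3)[of 0] norm_ge_zero order_trans by blast
    define \<eta> where "\<eta> e = hyperplane_cutoff F e" for e
    have bound: "(LINT x|lebesgue_on \<Omega>. \<eta> e x * (w x * (grad \<sigma> x \<bullet> y))) \<le> K * norm y" if e: "e > 0" for e
    proof -
      note h = hyperplane_cutoff_props[OF e F(1), folded \<eta>_def]
      note hm[measurable] = grad_measurable_lebesgue_on[OF h(1), of \<Omega>]
      have g: "C_k 1 (\<lambda>x. \<eta> e x * \<sigma> x)" "grad (\<lambda>x. \<eta> e x * \<sigma> x) = (\<lambda>x. \<eta> e x *\<^sub>R grad \<sigma> x + \<sigma> x *\<^sub>R grad (\<eta> e) x)"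
        using grad_mult[OF h(1) \<sigma>(1)] by auto
      \<comment> \<open>\<open>T\<close> keeps distance \<open>e\<close> from all hyperplanes, hence
        off the frontier: it is a compact subset of \<open>\<Omega>\<close>, and within
        \<open>\<Omega>\<close> the cut-off vanishes off \<open>T\<close>.\<close>
      define T where "T = closure \<Omega> \<inter> (\<Inter>(a, b)\<in>F. {x. e \<le> \<bar>a \<bullet> x - b\<bar>})"
      have "closed {x. e \<le> \<bar>a \<bullet> x - b\<bar>}" for a b by (intro closed_Collect_le continuous_intros)
      then have Tc: "closed T" unfolding T_def by (intro closed_Int closed_INT) auto
      have Tcomp: "compact T" using Tc bounded_\<Omega> unfolding T_def
        by (auto simp: compact_eq_bounded_closed intro: bounded_subset[of "closure \<Omega>"])
      have T\<Omega>: "T \<subseteq> \<Omega>"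
      proof
        fix x assume x: "x \<in> T"
        show "x \<in> \<Omega>"
        proof (rule ccontr)
          assume "x \<notin> \<Omega>"
          then have "x \<in> frontier \<Omega>" using x open_\<Omega> by (auto simp: frontier_def T_def interior_open)
          then obtain a b where ab: "(a, b) \<in> F" "a \<bullet> x = b" using F(3) by blast
          then have "e \<le> \<bar>a \<bullet> x - b\<bar>" using x by (auto simp: T_def)
          then show False using ab e by simp
        qed
      qed
      have out: "\<eta> e x * \<sigma> x = 0" if x: "x \<in> \<Omega> - T" for x
      proof -
        have "x \<in> closure \<Omega>" using x closure_subset by auto
        then obtain a b where "(a, b) \<in> F" "\<not> e \<le> \<bar>a \<bullet> x - b\<bar>" using x by (auto simp: T_def)
        then show ?thesis using h(4)[of a b x] by simp
      qed
      let ?f = "\<lambda>x. if x \<in> \<Omega> then \<eta> e x * \<sigma> x else 0"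
      note f = C1_extend_by_zero[OF g(1) open_\<Omega> Tc T\<Omega> out]
      have fs: "compactly_supported_in \<Omega> ?f" using out by (intro compactly_supported_inI[OF Tcomp T\<Omega>]) auto
      have fb: "\<bar>?f x\<bar> \<le> 1" for x using h(2,3)[of x] \<sigma>(2)[of x] by (auto simp: abs_mult intro: mult_le_one)
      have le: "(LINT x|lebesgue_on \<Omega>. w x * (grad ?f x \<bullet> y)) \<le> V * norm y" by (rule V(2)[OF f(1) fs fb])
      have fg: "grad ?f x = (if x \<in> \<Omega> then \<eta> e x *\<^sub>R grad \<sigma> x + \<sigma> x *\<^sub>R grad (\<eta> e) x else 0)" for x
        using fun_cong[OF f(2), of x] fun_cong[OF g(2), of x] by simp
      \<comment> \<open>The product rule leaves, besides the wanted integrand, a boundary layer term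
        that contains the gradient of the cut-off.\<close>
      have eq: "(LINT x|lebesgue_on \<Omega>. w x * (grad ?f x \<bullet> y)) =
        (LINT x|lebesgue_on \<Omega>. \<eta> e x * (w x * (grad \<sigma> x \<bullet> y)) + w x * \<sigma> x * (grad (\<eta> e) x \<bullet> y))"
        unfolding fg by (rule Bochner_Integration.integral_cong) (auto simp: inner_simps algebra_simps)
      have wg: "\<bar>w x * (grad \<sigma> x \<bullet> y)\<bar> \<le> \<bar>w x\<bar> * (B * norm y)" for x
        unfolding abs_mult using Cauchy_Schwarz_ineq2[of "grad \<sigma> x" y] \<sigma>(3)[of x]
        by (intro mult_left_mono order_trans[OF Cauchy_Schwarz_ineq2] mult_right_mono) auto
      have i1: "integrable (lebesgue_on \<Omega>) (\<lambda>x. \<eta> e x * (w x * (grad \<sigma> x \<bullet> y)))"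
      proof (rule Bochner_Integration.integrable_bound)
        show "integrable (lebesgue_on \<Omega>) (\<lambda>x. \<bar>w x\<bar> * (B * norm y))" using wi by (intro integrable_mult_left integrable_abs)
        show "AE x in lebesgue_on \<Omega>. norm (\<eta> e x * (w x * (grad \<sigma> x \<bullet> y))) \<le> norm (\<bar>w x\<bar> * (B * norm y))"
        proof (rule AE_I2)
          fix x
          have "norm (\<eta> e x * (w x * (grad \<sigma> x \<bullet> y))) \<le> 1 * (\<bar>w x\<bar> * (B * norm y))"
            unfolding norm_mult[of "\<eta> e x"] using wg[of x] h(2,3)[of x] by (intro mult_mono) auto
          then show "norm (\<eta> e x * (w x * (grad \<sigma> x \<bullet> y))) \<le> norm (\<bar>w x\<bar> * (B * norm y))" using B by simp
        qed
      qed measurable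
      define S where "S p = {x. \<bar>fst p \<bullet> x - snd p\<bar> \<le> 2 * e}" for p :: "(real ^ 'n) \<times> real"
      have Sm: "S p \<in> sets lebesgue" for p
      proof -
        have "closed (S p)" unfolding S_def by (intro closed_Collect_le continuous_intros)
        then show ?thesis by auto
      qed
      define b where "b x = M * norm y * (\<Sum>p\<in>F. 16 / e * indicator (S p) x)" for x
      have gb: "norm (grad (\<eta> e) x) \<le> (\<Sum>p\<in>F. 16 / e * indicator (S p) x)" for x
        using hyperplane_cutoff_grad_le[OF e F(1) F(2), where x=x] unfolding \<eta>_def S_def case_prod_unfold .
      have bi: "integrable (lebesgue_on \<Omega>) (\<lambda>x. indicator (S p) x :: real)" for p
      proof (rule integrable_const_bound[of _ 1])
        show "(\<lambda>x. indicator (S p) x :: real) \<in> borel_measurable (lebesgue_on \<Omega>)"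
          by (intro measurable_restrict_space1 borel_measurable_indicator Sm)
      qed (simp add: indicator_def)
      have wb: "AE x in lebesgue_on \<Omega>. norm (w x * \<sigma> x * (grad (\<eta> e) x \<bullet> y)) \<le> b x"
        using M(1)
      proof eventually_elim
        case (elim x)
        have "norm (w x * \<sigma> x * (grad (\<eta> e) x \<bullet> y)) = \<bar>w x\<bar> * \<bar>\<sigma> x\<bar> * \<bar>grad (\<eta> e) x \<bullet> y\<bar>" by (simp add: abs_mult)
        also have "\<dots> \<le> M * 1 * ((\<Sum>p\<in>F. 16 / e * indicator (S p) x) * norm y)"
          using elim \<sigma>(2)[of x] M(2) by (intro mult_mono order_trans[OF Cauchy_Schwarz_ineq2] mult_right_mono gb) auto
        finally show ?case by (simp add: b_def mult_ac)
      qed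
      have bint: "integrable (lebesgue_on \<Omega>) b" unfolding b_def
        by (intro integrable_mult_right Bochner_Integration.integrable_sum bi)
      have i2: "integrable (lebesgue_on \<Omega>) (\<lambda>x. w x * \<sigma> x * (grad (\<eta> e) x \<bullet> y))"
        by (rule Bochner_Integration.integrable_bound[OF bint])
           (use wb in \<open>auto elim!: eventually_mono intro!: borel_measurable_times borel_measurable_inner hm \<sigma>m wm\<close>)
      have "- (LINT x|lebesgue_on \<Omega>. w x * \<sigma> x * (grad (\<eta> e) x \<bullet> y)) \<le> (LINT x|lebesgue_on \<Omega>. norm (w x * \<sigma> x * (grad (\<eta> e) x \<bullet> y)))"
        using integral_norm_bound[of "lebesgue_on \<Omega>" "\<lambda>x. w x * \<sigma> x * (grad (\<eta> e) x \<bullet> y)"]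
        unfolding real_norm_def by linarith
      also have "\<dots> \<le> (LINT x|lebesgue_on \<Omega>. b x)" by (intro integral_mono_AE integrable_norm i2 bint wb)
      also have "\<dots> = M * norm y * (\<Sum>p\<in>F. 16 / e * measure (lebesgue_on \<Omega>) (S p \<inter> \<Omega>))"
        unfolding b_def using bi by (simp add: Bochner_Integration.integral_sum)
      also have "\<dots> \<le> M * norm y * (\<Sum>p\<in>F. 32 * C)"
      proof (intro mult_left_mono sum_mono)
        fix p assume p: "p \<in> F"
        have "measure (lebesgue_on \<Omega>) (S p \<inter> \<Omega>) = measure lebesgue (S p \<inter> \<Omega>)"
          by (intro measure_restrict_space) auto
        also have "\<dots> \<le> measure lebesgue (ball 0 R \<inter> {x. \<bar>fst p \<bullet> x - snd p\<bar> \<le> 2 * e})"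
        proof (rule measure_mono_fmeasurable)
          show "ball 0 R \<inter> {x. \<bar>fst p \<bullet> x - snd p\<bar> \<le> 2 * e} \<in> lmeasurable"
            using Sm[of p] unfolding S_def by (intro bounded_set_imp_lmeasurable bounded_Int) auto
        qed (use R Sm in \<open>auto simp: S_def\<close>)
        also have "\<dots> \<le> C * (2 * e)"
          unfolding C_def using F(2)[of "fst p" "snd p"] p R e by (intro measure_slab_le) auto
        finally have "16 / e * measure (lebesgue_on \<Omega>) (S p \<inter> \<Omega>) \<le> 16 / e * (C * (2 * e))"
          using e by (intro mult_left_mono) auto
        then show "16 / e * measure (lebesgue_on \<Omega>) (S p \<inter> \<Omega>) \<le> 32 * C" using e by simp
      qed (use M(2) in auto)
      finally have i3: "- (LINT x|lebesgue_on \<Omega>. w x * \<sigma> x * (grad (\<eta> e) x \<bullet> y)) \<le> M * norm y * (card F * (32 * C))" by simp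
      show ?thesis using le i3 unfolding eq Bochner_Integration.integral_add[OF i1 i2]
        by (simp add: K_def algebra_simps)
    qed
    \<comment> \<open>The cut-offs tend to \<open>1\<close> off the hyperplanes, which are null
      sets, so the bound, uniform in \<open>e\<close>, passes to the limit.\<close>
    have "(\<lambda>k. LINT x|lebesgue_on \<Omega>. \<eta> (1 / real (Suc k)) x * (w x * (grad \<sigma> x \<bullet> y))) \<longlonglongrightarrow> (LINT x|lebesgue_on \<Omega>. w x * (grad \<sigma> x \<bullet> y))"
    proof (rule integral_dominated_convergence[where w="\<lambda>x. \<bar>w x\<bar> * (B * norm y)"])
      show "(\<lambda>x. w x * (grad \<sigma> x \<bullet> y)) \<in> borel_measurable (lebesgue_on \<Omega>)" by measurable
      show "(\<lambda>x. \<eta> (1 / real (Suc k)) x * (w x * (grad \<sigma> x \<bullet> y))) \<in> borel_measurable (lebesgue_on \<Omega>)" for k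
      proof -
        have "1 / real (Suc k) > 0" by simp
        note [measurable] = grad_measurable_lebesgue_on(1)[OF hyperplane_cutoff_props(1)[OF this F(1), folded \<eta>_def], of \<Omega>]
        show ?thesis by measurable
      qed
      show "integrable (lebesgue_on \<Omega>) (\<lambda>x. \<bar>w x\<bar> * (B * norm y))" using wi by (intro integrable_mult_left integrable_abs)
      show "AE x in lebesgue_on \<Omega>. norm (\<eta> (1 / real (Suc k)) x * (w x * (grad \<sigma> x \<bullet> y))) \<le> \<bar>w x\<bar> * (B * norm y)" for k
      proof (rule AE_I2)
        fix x
        have k: "1 / real (Suc k) > 0" by simp
        note h = hyperplane_cutoff_props(2,3)[OF k F(1), of x, folded \<eta>_def]
        have "\<bar>w x * (grad \<sigma> x \<bullet> y)\<bar> \<le> \<bar>w x\<bar> * (B * norm y)"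
          unfolding abs_mult using \<sigma>(3)[of x]
          by (intro mult_left_mono order_trans[OF Cauchy_Schwarz_ineq2] mult_right_mono) auto
        then have "norm (\<eta> (1 / real (Suc k)) x * (w x * (grad \<sigma> x \<bullet> y))) \<le> 1 * (\<bar>w x\<bar> * (B * norm y))"
          unfolding norm_mult[of "\<eta> (1 / real (Suc k)) x"] using h by (intro mult_mono) auto
        then show "norm (\<eta> (1 / real (Suc k)) x * (w x * (grad \<sigma> x \<bullet> y))) \<le> \<bar>w x\<bar> * (B * norm y)" by simp
      qed
      have "negligible {x. a \<bullet> x = b}" if "(a, b) \<in> F" for a b
        using F(2)[OF that] by (intro negligible_hyperplane) auto
      then have "negligible (\<Union>(a, b)\<in>F. {x. a \<bullet> x = b})"
        using F(1) by (intro negligible_Union) auto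
      then have "AE x in lebesgue. x \<notin> (\<Union>(a, b)\<in>F. {x. a \<bullet> x = b})"
        unfolding negligible_iff_null_sets by (rule AE_not_in)
      then have "AE x in lebesgue_on \<Omega>. x \<notin> (\<Union>(a, b)\<in>F. {x. a \<bullet> x = b})"
        by (subst AE_restrict_space_iff) (auto elim: eventually_mono)
      then show "AE x in lebesgue_on \<Omega>. (\<lambda>k. \<eta> (1 / real (Suc k)) x * (w x * (grad \<sigma> x \<bullet> y))) \<longlonglongrightarrow> w x * (grad \<sigma> x \<bullet> y)"
      proof eventually_elim
        case (elim x)
        have "\<forall>p\<in>F. \<forall>\<^sub>F k in sequentially. 2 * (1 / real (Suc k)) \<le> \<bar>fst p \<bullet> x - snd p\<bar>"
        proof
          fix p assume "p \<in> F"
          then have pos: "0 < \<bar>fst p \<bullet> x - snd p\<bar>" using elim by (auto simp: case_prod_unfold)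
          have "(\<lambda>k. 2 * (1 / real (Suc k))) \<longlonglongrightarrow> 2 * 0" by (intro tendsto_intros LIMSEQ_Suc[OF lim_1_over_n])
          then have "\<forall>\<^sub>F k in sequentially. 2 * (1 / real (Suc k)) < \<bar>fst p \<bullet> x - snd p\<bar>"
            by (rule order_tendstoD) (use pos in simp)
          then show "\<forall>\<^sub>F k in sequentially. 2 * (1 / real (Suc k)) \<le> \<bar>fst p \<bullet> x - snd p\<bar>"
            by (rule eventually_mono) auto
        qed
        then have "\<forall>\<^sub>F k in sequentially. \<forall>p\<in>F. 2 * (1 / real (Suc k)) \<le> \<bar>fst p \<bullet> x - snd p\<bar>"
          using F(1) by (simp add: eventually_ball_finite_distrib)
        then have "\<forall>\<^sub>F k in sequentially. \<eta> (1 / real (Suc k)) x * (w x * (grad \<sigma> x \<bullet> y)) = w x * (grad \<sigma> x \<bullet> y)"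
        proof eventually_elim
          case (elim k)
          have "\<eta> (1 / real (Suc k)) x = 1"
            unfolding \<eta>_def using elim by (intro hyperplane_cutoff_props(5) F(1)) fastforce+
          then show ?case by simp
        qed
        then show ?case by (rule tendsto_eventually)
      qed
    qed
    then show ?thesis
      by (rule LIMSEQ_le_const2) (use bound in auto)
  qed
  ultimately show ?thesis using that by blast
qed

end

section \<open>From directional bounds to the modulus of continuity in L1\<close>

lemma real_polynomial_function_C1:
  fixes p :: "real ^ 'n::finite \<Rightarrow> real"
  assumes "real_polynomial_function p"
  shows "C_k 1 p"
  using assms
proof induction
  case (linear f)
  have D: "(f has_derivative (\<lambda>h. (\<chi> i. f (axis i 1)) \<bullet> h)) (at x)" for x
  proof -
    have "f h = (\<chi> i. f (axis i 1)) \<bullet> h" for h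
    proof -
      have lin: "linear f" using linear by (rule bounded_linear.linear)
      have "f h = f (\<Sum>i\<in>UNIV. h $ i *\<^sub>R axis i 1)"
        by (simp add: basis_expansion scalar_mult_eq_scaleR[symmetric])
      also have "\<dots> = (\<Sum>i\<in>UNIV. h $ i *\<^sub>R f (axis i 1))"
        by (simp add: linear_sum[OF lin] linear_cmul[OF lin])
      finally show ?thesis by (simp add: inner_vec_def mult.commute)
    qed
    then have "f = (\<lambda>h. (\<chi> i. f (axis i 1)) \<bullet> h)" by (rule ext)
    with bounded_linear_imp_has_derivative[OF linear] show ?thesis by (rule has_derivative_eq_rhs)
  qed
  show ?case by (rule C1I(1)[OF D]) (rule continuous_on_const)
next
  case (const c) show ?case by (rule C_k_const)
next
  case (add f g) then show ?case by (intro C_k_add)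
next
  case (mult f g) then show ?case by (intro C_k_mult)
qed

text \<open>Serves as a factor, vanishing outside the ball of radius \<open>R\<close>, that gives
  polynomials compact support.\<close>

lemma pos_sq_radial_C1:
  fixes R :: real
  shows "C_k 1 (\<lambda>x::real^'n::finite. pos_sq (1 - (x \<bullet> x) / R\<^sup>2))"
proof (rule C1I(1))
  fix x :: "real ^ 'n"
  have "((\<lambda>x. 1 - (x \<bullet> x) / R\<^sup>2) has_derivative (\<lambda>h. - ((x \<bullet> h + h \<bullet> x) / R\<^sup>2))) (at x)"
    by (auto intro!: derivative_eq_intros simp: divide_inverse)
  from has_derivative_compose[OF this pos_sq_deriv[unfolded has_field_derivative_def]]
  show "((\<lambda>x. pos_sq (1 - (x \<bullet> x) / R\<^sup>2)) has_derivative
      (\<lambda>h. ((2 * max 0 (1 - (x \<bullet> x) / R\<^sup>2)) * (- 2 / R\<^sup>2)) *\<^sub>R x \<bullet> h)) (at x)"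
    by (simp add: inner_commute mult.assoc)
next
  show "continuous_on UNIV (\<lambda>x::real^'n. ((2 * max 0 (1 - (x \<bullet> x) / R\<^sup>2)) * (- 2 / R\<^sup>2)) *\<^sub>R x)"
    unfolding divide_inverse by (intro continuous_intros)
qed

lemma C1_translate:
  assumes "C_k 1 \<sigma>"
  shows "C_k 1 (\<lambda>x. \<sigma> (x - c))" "grad (\<lambda>x. \<sigma> (x - c)) = (\<lambda>x. grad \<sigma> (x - c))"
proof -
  have D: "((\<lambda>x. \<sigma> (x - c)) has_derivative (\<lambda>h. grad \<sigma> (x - c) \<bullet> h)) (at x)" for x
    by (rule has_derivative_compose[OF _ C1D(1)[OF assms]]) (auto intro!: derivative_eq_intros)
  have c: "continuous_on UNIV (\<lambda>x. grad \<sigma> (x - c))"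
    by (intro continuous_on_compose2[OF C1D(2)[OF assms]] continuous_intros) auto
  show "C_k 1 (\<lambda>x. \<sigma> (x - c))" "grad (\<lambda>x. \<sigma> (x - c)) = (\<lambda>x. grad \<sigma> (x - c))" using C1I[OF D c] by auto
qed

text \<open>\<open>W\<close> is merely integrable, so the translation acts on
  \<open>\<sigma>\<close> and is differentiated there; \<open>B\<close> provides the dominating
  function.\<close>

lemma integral_translate_C1_deriv:
  fixes W \<sigma> :: "real ^ 'n::finite \<Rightarrow> real"
  assumes W: "integrable lborel W" and \<sigma>: "C_k 1 \<sigma>" "\<And>x. \<bar>\<sigma> x\<bar> \<le> 1" "\<And>x. norm (grad \<sigma> x) \<le> B"
  shows "((\<lambda>t. LINT x|lborel. W x * \<sigma> (x - t *\<^sub>R y)) has_real_derivative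
    (LINT x|lborel. W x * (grad \<sigma> (x - t *\<^sub>R y) \<bullet> (- y)))) (at t)"
proof -
  let ?E = "\<lambda>t. LINT x|lborel. W x * \<sigma> (x - t *\<^sub>R y)"
  have [measurable]: "W \<in> borel_measurable borel" "\<sigma> \<in> borel_measurable borel" "grad \<sigma> \<in> borel_measurable borel"
    using W C1D(2,3)[OF \<sigma>(1)] by (auto intro: borel_measurable_continuous_onI)
  have Wi: "integrable lborel (\<lambda>x. W x * \<sigma> (x - t *\<^sub>R y))" for t
  proof (rule Bochner_Integration.integrable_bound[OF W])
    show "AE x in lborel. norm (W x * \<sigma> (x - t *\<^sub>R y)) \<le> norm (W x)"
      using \<sigma>(2) by (auto simp: abs_mult intro!: mult_left_le)
  qed measurable
  have "((\<lambda>h. (?E (t + h) - ?E t) / h) \<longlongrightarrow> (LINT x|lborel. W x * (grad \<sigma> (x - t *\<^sub>R y) \<bullet> (- y)))) (at 0)"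
    unfolding tendsto_at_iff_sequentially
  proof (intro allI impI)
    fix X :: "nat \<Rightarrow> real" assume X: "\<forall>i. X i \<in> UNIV - {0}" "X \<longlonglongrightarrow> 0"
    define q where "q i x = (\<sigma> (x - (t + X i) *\<^sub>R y) - \<sigma> (x - t *\<^sub>R y)) / X i" for i x
    have eq: "((\<lambda>h. (?E (t + h) - ?E t) / h) \<circ> X) i = (LINT x|lborel. W x * q i x)" for i
    proof -
      have "?E (t + X i) - ?E t = (LINT x|lborel. W x * \<sigma> (x - (t + X i) *\<^sub>R y) - W x * \<sigma> (x - t *\<^sub>R y))"
        using Wi by simp
      then have "((\<lambda>h. (?E (t + h) - ?E t) / h) \<circ> X) i = (LINT x|lborel. (W x * \<sigma> (x - (t + X i) *\<^sub>R y) - W x * \<sigma> (x - t *\<^sub>R y)) / X i)"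
        by (simp only: o_def integral_divide_zero)
      then show ?thesis by (simp only: q_def right_diff_distrib[symmetric] times_divide_eq_right)
    qed
    have "(\<lambda>i. LINT x|lborel. W x * q i x) \<longlonglongrightarrow> (LINT x|lborel. W x * (grad \<sigma> (x - t *\<^sub>R y) \<bullet> (- y)))"
    proof (rule integral_dominated_convergence[where w="\<lambda>x. \<bar>W x\<bar> * (B * norm y)"])
      show "(\<lambda>x. W x * (grad \<sigma> (x - t *\<^sub>R y) \<bullet> (- y))) \<in> borel_measurable lborel" by measurable
      show "(\<lambda>x. W x * q i x) \<in> borel_measurable lborel" for i unfolding q_def by measurable
      show "integrable lborel (\<lambda>x. \<bar>W x\<bar> * (B * norm y))" using W by (intro integrable_mult_left integrable_abs)
      show "AE x in lborel. norm (W x * q i x) \<le> \<bar>W x\<bar> * (B * norm y)" for i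
      proof (rule AE_I2)
        fix x
        have Xi: "X i \<noteq> 0" using X(1) by auto
        have "\<bar>\<sigma> (x - (t + X i) *\<^sub>R y) - \<sigma> (x - t *\<^sub>R y)\<bar> \<le> B * norm ((x - (t + X i) *\<^sub>R y) - (x - t *\<^sub>R y))"
          by (rule C1_Lipschitz[OF \<sigma>(1,3)])
        also have "(x - (t + X i) *\<^sub>R y) - (x - t *\<^sub>R y) = - (X i *\<^sub>R y)" by (simp add: algebra_simps)
        finally have "\<bar>q i x\<bar> \<le> B * norm y" using Xi by (simp add: q_def divide_le_eq mult_ac)
        then show "norm (W x * q i x) \<le> \<bar>W x\<bar> * (B * norm y)" by (simp add: abs_mult mult_left_mono)
      qed
      show "AE x in lborel. (\<lambda>i. W x * q i x) \<longlonglongrightarrow> W x * (grad \<sigma> (x - t *\<^sub>R y) \<bullet> (- y))"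
      proof (rule AE_I2)
        fix x
        have "((\<lambda>s. \<sigma> (x - s *\<^sub>R y)) has_derivative (\<lambda>h. grad \<sigma> (x - t *\<^sub>R y) \<bullet> (- (h *\<^sub>R y)))) (at t)"
          by (rule has_derivative_compose[OF _ C1D(1)[OF \<sigma>(1)]]) (auto intro!: derivative_eq_intros)
        moreover have "(\<lambda>h. grad \<sigma> (x - t *\<^sub>R y) \<bullet> (- (h *\<^sub>R y))) = (*) (grad \<sigma> (x - t *\<^sub>R y) \<bullet> (- y))"
          by (auto simp: fun_eq_iff)
        ultimately have "((\<lambda>s. \<sigma> (x - s *\<^sub>R y)) has_real_derivative (grad \<sigma> (x - t *\<^sub>R y) \<bullet> (- y))) (at t)"
          by (simp only: has_field_derivative_def)
        then have "((\<lambda>h. (\<sigma> (x - (t + h) *\<^sub>R y) - \<sigma> (x - t *\<^sub>R y)) / h) \<longlongrightarrow> grad \<sigma> (x - t *\<^sub>R y) \<bullet> (- y)) (at 0)"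
          by (simp add: DERIV_def)
        then have "(\<lambda>i. q i x) \<longlonglongrightarrow> grad \<sigma> (x - t *\<^sub>R y) \<bullet> (- y)"
          unfolding tendsto_at_iff_sequentially using X by (auto simp: q_def o_def)
        then show "(\<lambda>i. W x * q i x) \<longlonglongrightarrow> W x * (grad \<sigma> (x - t *\<^sub>R y) \<bullet> (- y))" by (rule tendsto_mult_left)
      qed
    qed
    then show "((\<lambda>h. (?E (t + h) - ?E t) / h) \<circ> X) \<longlonglongrightarrow> (LINT x|lborel. W x * (grad \<sigma> (x - t *\<^sub>R y) \<bullet> (- y)))"
      using eq by (simp add: fun_eq_iff[symmetric] o_def)
  qed
  then show ?thesis by (simp only: DERIV_def)
qed

lemma lborel_translate:
  fixes f :: "'a::euclidean_space \<Rightarrow> real"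
  assumes [measurable]: "f \<in> borel_measurable borel"
  shows "(LINT x|lborel. f (x + c)) = (LINT x|lborel. f x)" "integrable lborel (\<lambda>x. f (x + c)) \<longleftrightarrow> integrable lborel f"
proof -
  have m: "(\<lambda>x. c + x) \<in> lborel \<rightarrow>\<^sub>M borel" by simp
  show "(LINT x|lborel. f (x + c)) = (LINT x|lborel. f x)"
    using integral_distr[OF m assms] unfolding lborel_distr_plus[of c] by (simp add: add.commute)
  show "integrable lborel (\<lambda>x. f (x + c)) \<longleftrightarrow> integrable lborel f"
    using integrable_distr_eq[OF m assms] unfolding lborel_distr_plus[of c] by (simp add: add.commute)
qed

text \<open>Duality between \<open>L1\<close> and bounded functions. Against a test function the
  increment of \<open>W\<close> is \<open>E 1 - E 0\<close>, and the mean value theorem turns it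
  into one integral of \<open>W\<close> against a directional derivative, which \<open>bound\<close>
  controls. Letting the test functions approach the sign of the increment produces the norm.\<close>

lemma L1_translation_le:
  fixes W :: "real ^ 'n::finite \<Rightarrow> real"
  assumes W: "integrable lborel W" and K: "K \<ge> 0"
    and bound: "\<And>\<sigma> y B. C_k 1 \<sigma> \<Longrightarrow> (\<And>x. \<bar>\<sigma> x\<bar> \<le> 1) \<Longrightarrow> (\<And>x. norm (grad \<sigma> x) \<le> B) \<Longrightarrow>
      (LINT x|lborel. W x * (grad \<sigma> x \<bullet> y)) \<le> K * norm y"
  shows "(\<integral>\<^sup>+x. ennreal \<bar>W (x + y) - W x\<bar> \<partial>lborel) \<le> ennreal (K * norm y)"
proof -
  have Wm[measurable]: "W \<in> borel_measurable borel" using W by auto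
  define D where "D x = W (x + y) - W x" for x
  have Di: "integrable lborel D" unfolding D_def using W lborel_translate(2)[OF Wm] by (intro Bochner_Integration.integrable_diff) auto
  then have Dm[measurable]: "D \<in> borel_measurable borel" by auto
  have test: "(LINT x|lborel. D x * \<sigma> x) \<le> K * norm y"
    if \<sigma>: "C_k 1 \<sigma>" "\<And>x. \<bar>\<sigma> x\<bar> \<le> 1" "\<And>x. norm (grad \<sigma> x) \<le> B" for \<sigma> B
  proof -
    have [measurable]: "\<sigma> \<in> borel_measurable borel" using C1D(3)[OF \<sigma>(1)] by (auto intro: borel_measurable_continuous_onI)
    define E where "E t = (LINT x|lborel. W x * \<sigma> (x - t *\<^sub>R y))" for t
    define E' where "E' t = (LINT x|lborel. W x * (grad \<sigma> (x - t *\<^sub>R y) \<bullet> (- y)))" for t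
    have "(E has_real_derivative E' t) (at t)" for t
      unfolding E_def E'_def by (rule integral_translate_C1_deriv[OF W \<sigma>])
    then obtain z where "E 1 - E 0 = (1 - 0) * E' z" using MVT2[of 0 1 E E'] by auto
    moreover have "E' z \<le> K * norm (- y)"
      unfolding E'_def using bound[OF C1_translate(1)[OF \<sigma>(1)], of "z *\<^sub>R y" B "- y"] \<sigma>
      by (simp add: C1_translate(2)[OF \<sigma>(1)] del: C_k.simps)
    moreover have "E 1 - E 0 = (LINT x|lborel. D x * \<sigma> x)"
    proof -
      have b: "AE x in lborel. norm (V x * \<sigma> x) \<le> norm (V x)" for V :: "real ^ 'n \<Rightarrow> real"
        using \<sigma>(2) by (auto simp: abs_mult intro!: mult_left_le)
      have "E 1 = (LINT x|lborel. W (x + y) * \<sigma> x)"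
        unfolding E_def using lborel_translate(1)[of "\<lambda>x. W x * \<sigma> (x - 1 *\<^sub>R y)" y] by simp
      moreover have "integrable lborel (\<lambda>x. W (x + y) * \<sigma> x)"
        using W lborel_translate(2)[OF Wm, of y] by (intro Bochner_Integration.integrable_bound[OF _ _ b]) auto
      moreover have "integrable lborel (\<lambda>x. W x * \<sigma> x)"
        using W by (intro Bochner_Integration.integrable_bound[OF _ _ b]) auto
      ultimately show ?thesis by (simp add: E_def D_def left_diff_distrib)
    qed
    ultimately show ?thesis by simp
  qed
  \<comment> \<open>The sign is measurable only. It is approximated almost everywhere by continuous
    functions, which are cut to \<open>[-1, 1]\<close>, replaced by polynomials on growing balls,
    and multiplied by a radial cut-off.\<close>
  have "(\<lambda>x. sgn (D x)) \<in> borel_measurable borel" by measurable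
  then have "(\<lambda>x. sgn (D x)) \<in> borel_measurable lebesgue" by (intro measurable_completion) simp
  then have "(\<lambda>x. sgn (D x)) measurable_on UNIV" by (intro lebesgue_measurable_imp_measurable_on) auto
  then obtain N g where N: "negligible N" and gc: "\<And>n. continuous_on UNIV (g n)"
    and glim: "\<And>x. x \<notin> N \<Longrightarrow> (\<lambda>n. g n x) \<longlonglongrightarrow> sgn (D x)"
    unfolding measurable_on_def by auto
  define c where "c n x = max (-1) (min 1 (g n x))" for n x
  have "\<exists>p. real_polynomial_function p \<and> (\<forall>x\<in>cball 0 (real (Suc n)). \<bar>c n x - p x\<bar> < 1 / real (Suc n))" for n
  proof -
    have "continuous_on (cball 0 (real (Suc n))) (c n)"
      unfolding c_def[abs_def] by (intro continuous_intros continuous_on_subset[OF gc]) auto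
    then obtain p where "real_polynomial_function p" "\<And>x. x \<in> cball 0 (real (Suc n)) \<Longrightarrow> \<bar>c n x - p x\<bar> < 1 / real (Suc n)"
      using Stone_Weierstrass_real_polynomial_function[of "cball 0 (real (Suc n))" "c n" "1 / real (Suc n)"] by auto
    then show ?thesis by blast
  qed
  then obtain p where p: "\<And>n. real_polynomial_function (p n)"
    "\<And>n x. x \<in> cball 0 (real (Suc n)) \<Longrightarrow> \<bar>c n x - p n x\<bar> < 1 / real (Suc n)" by metis
  \<comment> \<open>A polynomial is uncontrolled outside its ball, hence the radial factor; inside
    it may exceed \<open>1\<close> by \<open>1 / real (Suc n)\<close>, hence the division.\<close>
  define \<sigma> where "\<sigma> n x = pos_sq (1 - (x \<bullet> x) / (real (Suc n))\<^sup>2) * (p n x * (1 / (1 + 1 / real (Suc n))))" for n x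
  have \<sigma>C: "C_k 1 (\<sigma> n)" for n
    unfolding \<sigma>_def[abs_def] by (intro C_k_mult pos_sq_radial_C1 real_polynomial_function_C1 p C_k_const)
  have \<sigma>0: "\<sigma> n x = 0" if "x \<notin> cball 0 (real (Suc n))" for n x
  proof -
    have "(real (Suc n))\<^sup>2 \<le> (norm x)\<^sup>2" using that by (intro power_mono) auto
    then have "1 \<le> (x \<bullet> x) / (real (Suc n))\<^sup>2" by (simp add: dot_square_norm)
    then show ?thesis by (simp add: \<sigma>_def pos_sq_props(2))
  qed
  have \<sigma>1: "\<bar>\<sigma> n x\<bar> \<le> 1" for n x
  proof (cases "x \<in> cball 0 (real (Suc n))")
    case True
    have "\<bar>p n x\<bar> \<le> 1 + 1 / real (Suc n)" using p(2)[OF True] by (auto simp: c_def abs_if split: if_splits)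
    then have "\<bar>p n x * (1 / (1 + 1 / real (Suc n)))\<bar> \<le> 1" unfolding abs_mult by (simp add: field_simps)
    moreover have "pos_sq (1 - (x \<bullet> x) / (real (Suc n))\<^sup>2) \<le> 1" by (intro pos_sq_props) simp
    ultimately have "pos_sq (1 - (x \<bullet> x) / (real (Suc n))\<^sup>2) * \<bar>p n x * (1 / (1 + 1 / real (Suc n)))\<bar> \<le> 1"
      using pos_sq_props(1) by (intro mult_le_one) auto
    then show ?thesis unfolding \<sigma>_def abs_mult[of "pos_sq _"] abs_of_nonneg[OF pos_sq_props(1)] .
  qed (simp add: \<sigma>0)
  have le: "(LINT x|lborel. D x * \<sigma> n x) \<le> K * norm y" for n
  proof -
    have g0: "grad (\<sigma> n) x = 0" if "x \<notin> cball 0 (real (Suc n))" for x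
      by (rule grad_eq_0_outside[OF closed_cball _ that]) (rule \<sigma>0)
    obtain B where "\<And>x. norm (grad (\<sigma> n) x) \<le> B"
      using bounded_continuous_compact_support[OF C1D(2)[OF \<sigma>C] compact_cball g0] by blast
    then show ?thesis by (rule test[OF \<sigma>C \<sigma>1])
  qed
  have "(\<lambda>n. LINT x|lborel. D x * \<sigma> n x) \<longlonglongrightarrow> (LINT x|lborel. D x * sgn (D x))"
  proof (rule integral_dominated_convergence[where w="\<lambda>x. \<bar>D x\<bar>"])
    have [measurable]: "\<sigma> n \<in> borel_measurable borel" for n using C1D(3)[OF \<sigma>C] by (auto intro: borel_measurable_continuous_onI)
    show "(\<lambda>x. D x * \<sigma> n x) \<in> borel_measurable lborel" for n by measurable
    show "(\<lambda>x. D x * sgn (D x)) \<in> borel_measurable lborel" by measurable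
    show "integrable lborel (\<lambda>x. \<bar>D x\<bar>)" using Di by (rule integrable_abs)
    show "AE x in lborel. norm (D x * \<sigma> n x) \<le> \<bar>D x\<bar>" for n using \<sigma>1 by (auto simp: abs_mult intro!: mult_left_le)
    have "AE x in lebesgue. x \<notin> N" using N unfolding negligible_iff_null_sets by (rule AE_not_in)
    then have "AE x in lborel. x \<notin> N" by (simp add: AE_completion_iff)
    then show "AE x in lborel. (\<lambda>n. D x * \<sigma> n x) \<longlonglongrightarrow> D x * sgn (D x)"
    proof eventually_elim
      case (elim x)
      have "(\<lambda>n. c n x) \<longlonglongrightarrow> max (-1) (min 1 (sgn (D x)))"
        unfolding c_def by (intro tendsto_intros glim elim)
      then have "(\<lambda>n. c n x) \<longlonglongrightarrow> sgn (D x)" by (simp add: sgn_if split: if_splits)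
      moreover have "(\<lambda>n. p n x - c n x) \<longlonglongrightarrow> 0"
      proof (rule Lim_null_comparison)
        obtain n0 where "norm x \<le> real n0" using real_arch_simple by blast
        then have "norm (p n x - c n x) \<le> 1 / real (Suc n)" if "n \<ge> n0" for n
          using p(2)[of x n] that by (auto simp: abs_minus_commute)
        then show "\<forall>\<^sub>F n in sequentially. norm (p n x - c n x) \<le> 1 / real (Suc n)"
          unfolding eventually_sequentially by blast
        show "(\<lambda>n. 1 / real (Suc n)) \<longlonglongrightarrow> 0" by (rule LIMSEQ_Suc[OF lim_1_over_n])
      qed
      ultimately have pl: "(\<lambda>n. p n x) \<longlonglongrightarrow> sgn (D x)" using tendsto_add[of "\<lambda>n. p n x - c n x" 0 sequentially "\<lambda>n. c n x"] by simp
      have "(\<lambda>n. (max 0 (1 - (x \<bullet> x) * (1 / real (Suc n))\<^sup>2))\<^sup>2 * (p n x * (1 / (1 + 1 / real (Suc n)))))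
        \<longlonglongrightarrow> (max 0 (1 - (x \<bullet> x) * 0\<^sup>2))\<^sup>2 * (sgn (D x) * (1 / (1 + 0)))"
        by (intro tendsto_intros pl LIMSEQ_Suc[OF lim_1_over_n]) simp
      then have "(\<lambda>n. \<sigma> n x) \<longlonglongrightarrow> sgn (D x)" by (simp add: \<sigma>_def pos_sq_def power_divide)
      then show ?case by (rule tendsto_mult_left)
    qed
  qed
  then have "(LINT x|lborel. D x * sgn (D x)) \<le> K * norm y" by (rule LIMSEQ_le_const2) (use le in auto)
  then have 1: "(LINT x|lborel. \<bar>D x\<bar>) \<le> K * norm y" by (simp add: mult_sgn_abs mult.commute[of _ "sgn _"] abs_sgn)
  have "(\<integral>\<^sup>+x. ennreal \<bar>D x\<bar> \<partial>lborel) = ennreal (LINT x|lborel. \<bar>D x\<bar>)"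
    using Di by (intro nn_integral_eq_integral integrable_abs) auto
  then show ?thesis using 1 by (simp add: D_def ennreal_leI)
qed

context bounded_open
begin

text \<open>The modulus of continuity in \<open>L1\<close> of \<open>w\<close>, extended by
  \<open>0\<close>, is linear in \<open>d\<close>. As \<open>w\<close> and the approximating
  constants are bounded by \<open>M\<close>, the square of their difference is at most
  \<open>2 * M\<close> times its absolute value, so the squared \<open>L2\<close> error is of the
  same order \<open>d\<close>.\<close>

lemma BV_local_avg_error:
  assumes w: "w \<in> BV \<Omega>" and M: "AE x in lebesgue_on \<Omega>. \<bar>w x\<bar> \<le> M" "M \<ge> 0" and poly: "polygonal_boundary \<Omega>"
  obtains C where "C \<ge> 0" "\<And>\<Q> d. mesh \<Omega> \<Q> \<Longrightarrow> d > 0 \<Longrightarrow> max_diameter \<Q> \<le> d \<Longrightarrow>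
    (L2_norm \<Omega> (\<lambda>x. w x - local_avg \<Q> w x))\<^sup>2 \<le> C * d"
proof -
  obtain K where K: "K \<ge> 0" and Kb: "\<And>\<sigma> y B. C_k 1 \<sigma> \<Longrightarrow> (\<And>x. \<bar>\<sigma> x\<bar> \<le> 1) \<Longrightarrow> (\<And>x. norm (grad \<sigma> x) \<le> B) \<Longrightarrow>
    (LINT x|lebesgue_on \<Omega>. w x * (grad \<sigma> x \<bullet> y)) \<le> K * norm y"
    using BV_directional_bound[OF w M poly] by blast
  have wm[measurable]: "w \<in> borel_measurable (lebesgue_on \<Omega>)" using w by (auto simp: BV_def)
  have wL: "w \<in> L2 \<Omega>" using M(1) by (intro bounded_in_L2[OF wm, of M]) simp
  have "(\<lambda>x. if x \<in> \<Omega> then w x else 0) \<in> borel_measurable (completion lborel)"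
    using wm by (simp add: borel_measurable_if)
  from completion_ex_borel_measurable_real[OF this]
  obtain W0 where W0[measurable]: "W0 \<in> borel_measurable borel" and "AE x in lborel. (if x \<in> \<Omega> then w x else 0) = W0 x" by auto
  then have "AE x in lebesgue. (if x \<in> \<Omega> then w x else 0) = W0 x" by (simp add: AE_completion_iff)
  then have "AE x in lebesgue. x \<in> \<Omega> \<longrightarrow> w x = W0 x" by eventually_elim auto
  then have W0w: "AE x in lebesgue_on \<Omega>. w x = W0 x" by (simp add: AE_restrict_space_iff)
  \<comment> \<open>Truncation and extension by zero turn the Borel representative into a function
    bounded by \<open>M\<close> everywhere, not only almost everywhere, as
    \<open>piecewise_const_approx\<close> demands.\<close>
  define W where "W x = indicator \<Omega> x * max (- M) (min M (W0 x))" for x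
  have [measurable]: "\<Omega> \<in> sets borel" using open_\<Omega> by simp
  have Wm[measurable]: "W \<in> borel_measurable borel" unfolding W_def by measurable
  have W\<Omega>: "W x = 0" if "x \<notin> \<Omega>" for x using that by (simp add: W_def)
  have WM: "\<bar>W x\<bar> \<le> M" for x using M(2) by (auto simp: W_def indicator_def abs_if)
  have Ww: "AE x in lebesgue_on \<Omega>. W x = w x"
    using W0w M(1) AE_space[of "lebesgue_on \<Omega>"] by eventually_elim (auto simp: W_def)
  have Wi: "integrable lborel W"
    using integral_lebesgue_on_eq_lborel(2)[OF \<Omega>_sets Wm W\<Omega>] WM
    by (auto intro!: integrable_const_bound[of _ M] measurable_lborel_lebesgue_on)
  have bound: "(LINT x|lborel. W x * (grad \<sigma> x \<bullet> y)) \<le> K * norm y"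
    if \<sigma>: "C_k 1 \<sigma>" "\<And>x. \<bar>\<sigma> x\<bar> \<le> 1" "\<And>x. norm (grad \<sigma> x) \<le> B" for \<sigma> y B
  proof -
    have [measurable]: "grad \<sigma> \<in> borel_measurable borel" using C1D(2)[OF \<sigma>(1)] by (rule borel_measurable_continuous_onI)
    have m: "(\<lambda>x. W x * (grad \<sigma> x \<bullet> y)) \<in> borel_measurable borel" by measurable
    note [measurable] = grad_measurable_lebesgue_on[OF \<sigma>(1), of \<Omega>]
    have "(LINT x|lborel. W x * (grad \<sigma> x \<bullet> y)) = (LINT x|lebesgue_on \<Omega>. W x * (grad \<sigma> x \<bullet> y))"
      using W\<Omega> by (intro integral_lebesgue_on_eq_lborel(1)[OF \<Omega>_sets m, symmetric]) simp
    also have "\<dots> = (LINT x|lebesgue_on \<Omega>. w x * (grad \<sigma> x \<bullet> y))"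
    proof (rule integral_cong_AE)
      show "(\<lambda>x. W x * (grad \<sigma> x \<bullet> y)) \<in> borel_measurable (lebesgue_on \<Omega>)" by (rule measurable_lborel_lebesgue_on[OF m])
      show "AE x in lebesgue_on \<Omega>. W x * (grad \<sigma> x \<bullet> y) = w x * (grad \<sigma> x \<bullet> y)" using Ww by eventually_elim simp
    qed measurable
    also have "\<dots> \<le> K * norm y" by (rule Kb[OF \<sigma>])
    finally show ?thesis .
  qed
  \<comment> \<open>\<open>2 * M\<close> comes from squaring, \<open>2 ^ CARD('n)\<close> from the
    comparison of balls, and \<open>K * 2\<close> from translations of length at most
    \<open>2 * d\<close>.\<close>
  define C where "C = 2 * M * (2 ^ CARD('n) * (K * 2))"
  have C: "C \<ge> 0" using M(2) K by (simp add: C_def)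
  moreover have "(L2_norm \<Omega> (\<lambda>x. w x - local_avg \<Q> w x))\<^sup>2 \<le> C * d"
    if Q: "mesh \<Omega> \<Q>" and d: "d > 0" "max_diameter \<Q> \<le> d" for \<Q> d
  proof -
    interpret mesh \<Omega> \<Q> by (rule Q)
    obtain c where c: "\<And>Q. \<bar>c Q\<bar> \<le> M" "\<And>x. x \<in> \<Omega> \<Longrightarrow> ennreal \<bar>W x - piecewise_const \<Q> c x\<bar>
      \<le> ennreal (2 ^ CARD('n)) * (\<integral>\<^sup>+y. ennreal \<bar>W (x + (2 * d) *\<^sub>R y) - W x\<bar> \<partial>unit_ball_measure)"
      using piecewise_const_approx[OF Wi d WM] by blast
    let ?\<mu> = "unit_ball_measure :: (real ^ 'n) measure"
    interpret \<mu>: sigma_finite_measure ?\<mu> by (rule sigma_finite_unit_measures)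
    interpret pair_sigma_finite ?\<mu> lborel ..
    have "(\<integral>\<^sup>+x. \<integral>\<^sup>+y. ennreal \<bar>W (x + (2 * d) *\<^sub>R y) - W x\<bar> \<partial>?\<mu> \<partial>lborel)
      = (\<integral>\<^sup>+y. \<integral>\<^sup>+x. ennreal \<bar>W (x + (2 * d) *\<^sub>R y) - W x\<bar> \<partial>lborel \<partial>?\<mu>)"
      by (rule Fubini') measurable
    also have "\<dots> \<le> (\<integral>\<^sup>+y. ennreal (K * (2 * d)) \<partial>?\<mu>)"
    proof (rule nn_integral_mono_AE)
      show "AE y in ?\<mu>. (\<integral>\<^sup>+x. ennreal \<bar>W (x + (2 * d) *\<^sub>R y) - W x\<bar> \<partial>lborel) \<le> ennreal (K * (2 * d))"
        using AE_unit_ball_measure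
      proof eventually_elim
        case (elim y)
        have "(\<integral>\<^sup>+x. ennreal \<bar>W (x + (2 * d) *\<^sub>R y) - W x\<bar> \<partial>lborel) \<le> ennreal (K * norm ((2 * d) *\<^sub>R y))"
          by (rule L1_translation_le[OF Wi K bound])
        also have "\<dots> \<le> ennreal (K * (2 * d))" using elim d K by (intro ennreal_leI mult_left_mono) auto
        finally show ?case .
      qed
    qed
    also have "\<dots> = ennreal (K * (2 * d))" by (simp only: nn_integral_const emeasure_unit_measures mult_1_right)
    finally have dbl: "(\<integral>\<^sup>+x. \<integral>\<^sup>+y. ennreal \<bar>W (x + (2 * d) *\<^sub>R y) - W x\<bar> \<partial>?\<mu> \<partial>lborel) \<le> ennreal (K * (2 * d))" .
    have "(\<integral>\<^sup>+x. ennreal \<bar>W x - piecewise_const \<Q> c x\<bar> \<partial>lebesgue_on \<Omega>)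
      \<le> (\<integral>\<^sup>+x. ennreal (2 ^ CARD('n)) * (\<integral>\<^sup>+y. ennreal \<bar>W (x + (2 * d) *\<^sub>R y) - W x\<bar> \<partial>?\<mu>) \<partial>lebesgue_on \<Omega>)"
      using c(2) by (intro nn_integral_mono) auto
    also have "\<dots> \<le> (\<integral>\<^sup>+x. ennreal (2 ^ CARD('n)) * (\<integral>\<^sup>+y. ennreal \<bar>W (x + (2 * d) *\<^sub>R y) - W x\<bar> \<partial>?\<mu>) \<partial>lborel)"
      by (rule nn_integral_lebesgue_on_le_lborel) simp
    also have "\<dots> = ennreal (2 ^ CARD('n)) * (\<integral>\<^sup>+x. \<integral>\<^sup>+y. ennreal \<bar>W (x + (2 * d) *\<^sub>R y) - W x\<bar> \<partial>?\<mu> \<partial>lborel)"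
      by (rule nn_integral_cmult) measurable
    also have "\<dots> \<le> ennreal (2 ^ CARD('n)) * ennreal (K * (2 * d))" by (intro mult_left_mono dbl) simp
    finally have L1: "(\<integral>\<^sup>+x. ennreal \<bar>W x - piecewise_const \<Q> c x\<bar> \<partial>lebesgue_on \<Omega>) \<le> ennreal (2 ^ CARD('n)) * ennreal (K * (2 * d))" .
    have "(\<integral>\<^sup>+x. (ennreal (norm (w x - piecewise_const \<Q> c x)))\<^sup>2 \<partial>lebesgue_on \<Omega>)
      \<le> (\<integral>\<^sup>+x. ennreal (2 * M) * ennreal \<bar>W x - piecewise_const \<Q> c x\<bar> \<partial>lebesgue_on \<Omega>)"
    proof (rule nn_integral_mono_AE)
      show "AE x in lebesgue_on \<Omega>. (ennreal (norm (w x - piecewise_const \<Q> c x)))\<^sup>2 \<le> ennreal (2 * M) * ennreal \<bar>W x - piecewise_const \<Q> c x\<bar>"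
        using Ww AE_space[of "lebesgue_on \<Omega>"]
      proof eventually_elim
        case (elim x)
        then obtain Q where Q: "piecewise_const \<Q> c x = c Q" using piecewise_const_cases[of x] by auto
        have "\<bar>W x - c Q\<bar> \<le> 2 * M" using WM[of x] c(1)[of Q] by linarith
        then have "\<bar>W x - c Q\<bar>\<^sup>2 \<le> 2 * M * \<bar>W x - c Q\<bar>" unfolding power2_eq_square by (rule mult_right_mono) simp
        then have "ennreal (\<bar>W x - c Q\<bar>\<^sup>2) \<le> ennreal (2 * M) * ennreal \<bar>W x - c Q\<bar>"
          using M(2) by (simp only: ennreal_mult[symmetric] abs_ge_zero mult_nonneg_nonneg zero_le_numeral) (rule ennreal_leI)
        then show ?case unfolding Q real_norm_def elim(1)[symmetric] by (simp only: ennreal_power[OF abs_ge_zero])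
      qed
    qed
    also have "\<dots> = ennreal (2 * M) * (\<integral>\<^sup>+x. ennreal \<bar>W x - piecewise_const \<Q> c x\<bar> \<partial>lebesgue_on \<Omega>)"
    proof (rule nn_integral_cmult)
      have [measurable]: "W \<in> borel_measurable (lebesgue_on \<Omega>)" by (rule measurable_lborel_lebesgue_on[OF Wm])
      show "(\<lambda>x. ennreal \<bar>W x - piecewise_const \<Q> c x\<bar>) \<in> borel_measurable (lebesgue_on \<Omega>)" by measurable
    qed
    also have "\<dots> \<le> ennreal (2 * M) * (ennreal (2 ^ CARD('n)) * ennreal (K * (2 * d)))"
      by (intro mult_left_mono L1) simp
    also have "\<dots> = ennreal ((sqrt (C * d))\<^sup>2)"
      using M(2) K d C by (simp add: C_def ennreal_mult[symmetric] mult_ac)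
    finally have "L2_norm \<Omega> (\<lambda>x. w x - piecewise_const \<Q> c x) \<le> sqrt (C * d)"
      using C d by (intro L2_norm_le_nn_integral L2_diff wL piecewise_const_L2) auto
    then have "L2_norm \<Omega> (\<lambda>x. w x - local_avg \<Q> w x) \<le> sqrt (C * d)"
      using local_avg_best_approx[OF wL, of c] by linarith
    then have "(L2_norm \<Omega> (\<lambda>x. w x - local_avg \<Q> w x))\<^sup>2 \<le> (sqrt (C * d))\<^sup>2" by (intro power_mono) auto
    then show ?thesis using C d by simp
  qed
  ultimately show ?thesis using that by blast
qed

end

subsection \<open>The error estimate\<close>

lemma L2_mult_bounded:
  fixes b f :: "real ^ 'n::finite \<Rightarrow> real"
  assumes "f \<in> L2 \<Omega>" "b \<in> borel_measurable (lebesgue_on \<Omega>)" "AE x in lebesgue_on \<Omega>. \<bar>b x\<bar> \<le> K" "K \<ge> 0"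
  shows "(\<lambda>x. b x * f x) \<in> L2 \<Omega>" "L2_norm \<Omega> (\<lambda>x. b x * f x) \<le> K * L2_norm \<Omega> f"
proof -
  have m: "(\<lambda>x. b x * f x) \<in> borel_measurable (lebesgue_on \<Omega>)"
    using assms(2) L2D(1)[OF assms(1)] by (rule borel_measurable_times)
  have ae: "AE x in lebesgue_on \<Omega>. norm (b x * f x) \<le> K * norm (f x)"
    using assms(3) by eventually_elim (auto simp: abs_mult intro!: mult_right_mono)
  show "(\<lambda>x. b x * f x) \<in> L2 \<Omega>" by (rule L2_bound[OF assms(1) m ae])
  show "L2_norm \<Omega> (\<lambda>x. b x * f x) \<le> K * L2_norm \<Omega> f" by (rule L2_norm_bound[OF assms(1) m assms(4) ae])
qed

context bounded_open
begin

text \<open>Permits testing with an explicitly known gradient in place of the chosen representative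
  \<open>weak_grad\<close>.\<close>

lemma solves_pde_pair:
  assumes A: "elliptic_coefficients \<Omega> A \<beta>" and u: "u \<in> H1_0 \<Omega>" and v: "H10_pair \<Omega> v V"
  shows "v \<in> H1_0 \<Omega>" "(LINT x|lebesgue_on \<Omega>. (A x *v weak_grad \<Omega> u x) \<bullet> weak_grad \<Omega> v x)
    = (LINT x|lebesgue_on \<Omega>. (A x *v weak_grad \<Omega> u x) \<bullet> V x)"
proof -
  note vv = H10_pair_H1_0[OF v]
  show "v \<in> H1_0 \<Omega>" by (rule vv)
  note L = H10_pairD(2)[OF H1_0_pair[OF u]] H10_pairD(2)[OF H1_0_pair[OF vv(1)]] H10_pairD(2)[OF v]
  note m = L2D(1)[OF elliptic_L2[OF A L(1)]] L2D(1)[OF L(2)] L2D(1)[OF L(3)]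
  show "(LINT x|lebesgue_on \<Omega>. (A x *v weak_grad \<Omega> u x) \<bullet> weak_grad \<Omega> v x)
    = (LINT x|lebesgue_on \<Omega>. (A x *v weak_grad \<Omega> u x) \<bullet> V x)"
    by (intro integral_cong_AE borel_measurable_inner m) (use vv(2) in \<open>auto elim!: eventually_mono\<close>)
qed

lemma poincare_pair:
  assumes "poincare_constant \<Omega> c" "H10_pair \<Omega> v V"
  shows "L2_norm \<Omega> v \<le> c * L2_norm \<Omega> V"
proof -
  note vv = H10_pair_H1_0[OF assms(2)]
  have "L2_norm \<Omega> (weak_grad \<Omega> v) = L2_norm \<Omega> V"
    using H10_pairD(2)[OF H1_0_pair[OF vv(1)]] H10_pairD(2)[OF assms(2)] vv(2)
    by (intro L2_norm_cong_AE L2D(1))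
  then show ?thesis using assms(1) vv(1) by (auto simp: poincare_constant_def)
qed

end

context mesh
begin

text \<open>A cell of diameter \<open>0\<close> would be a single point and hence a null
  set.\<close>

lemma max_diameter_bounds:
  assumes "\<Omega> \<noteq> {}"
  shows "0 < max_diameter \<Q>" "max_diameter \<Q> \<le> diameter \<Omega>"
proof -
  have ne: "\<Q> \<noteq> {}" using assms Union_cells by auto
  have "diameter Q \<le> diameter \<Omega>" if "Q \<in> \<Q>" for Q
    using cell_subset[OF that] bounded_\<Omega> by (rule diameter_subset)
  then show "max_diameter \<Q> \<le> diameter \<Omega>" unfolding max_diameter_def using ne by (subst Max_le_iff) auto
  obtain Q where Q: "Q \<in> \<Q>" using ne by auto
  obtain x where x: "x \<in> Q" using cell_nonempty[OF Q] by auto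
  show "0 < max_diameter \<Q>"
  proof (rule ccontr)
    assume "\<not> 0 < max_diameter \<Q>"
    have "y = x" if "y \<in> Q" for y
    proof -
      have "dist y x \<le> 0" using cell_diameter(2)[OF Q that x] \<open>\<not> 0 < max_diameter \<Q>\<close> by linarith
      then show ?thesis by simp
    qed
    then have "Q \<subseteq> {x}" by auto
    then have "Q = {x}" using x by auto
    then show False using cell_pos[OF Q] by simp
  qed
qed

text \<open>\<open>e\<close> is replaced by test functions, for which the product with
  \<open>u\<close> has a known gradient. Since \<open>u\<close> is bounded, these products converge
  to \<open>u e\<close> in \<open>L2\<close>, and the estimate for them depends only on norms that
  converge as well.\<close>

lemma product_avg_error:
  assumes u: "H10_pair \<Omega> u G" and M: "AE x in lebesgue_on \<Omega>. \<bar>u x\<bar> \<le> M" "M \<ge> 0"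
    and C: "C \<ge> 0" "\<And>\<phi> K. test_function \<Omega> \<phi> \<Longrightarrow> K > 0 \<Longrightarrow> (L2_norm \<Omega> \<phi>)\<^sup>2 \<le> K \<Longrightarrow> (L2_norm \<Omega> (grad \<phi>))\<^sup>2 \<le> K \<Longrightarrow>
      (L2_norm \<Omega> (\<lambda>x. \<phi> x *\<^sub>R G x))\<^sup>2 \<le> C * K"
    and e: "H10_pair \<Omega> e E" and d: "d > 0" "max_diameter \<Q> \<le> d"
  shows "L2_norm \<Omega> (\<lambda>x. u x * e x - local_avg \<Q> (\<lambda>x. u x * e x) x)
    \<le> 2 ^ CARD('a) * (2 * d) * (sqrt (C * ((L2_norm \<Omega> e)\<^sup>2 + (L2_norm \<Omega> E)\<^sup>2)) + M * L2_norm \<Omega> E)"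
proof -
  obtain \<phi> where \<phi>: "\<And>k. test_function \<Omega> (\<phi> k)" "L2_tendsto \<Omega> \<phi> e" "L2_tendsto \<Omega> (\<lambda>k. grad (\<phi> k)) E"
    using e by (auto simp: H10_pair_def)
  let ?k = "2 ^ CARD('a) * (2 * d)"
  note Lu = H10_pairD[OF u] and Le = H10_pairD[OF e] and L\<phi> = test_function_L2[OF \<phi>(1)]
  note um = L2D(1)[OF Lu(1)]
  \<comment> \<open>The summand \<open>1 / real (Suc k)\<close> makes \<open>K k\<close> positive,
    as hypothesis \<open>C\<close> demands, and disappears in the limit.\<close>
  define K where "K k = (L2_norm \<Omega> (\<phi> k))\<^sup>2 + (L2_norm \<Omega> (grad (\<phi> k)))\<^sup>2 + 1 / real (Suc k)" for k
  have K: "K k > 0" "(L2_norm \<Omega> (\<phi> k))\<^sup>2 \<le> K k" "(L2_norm \<Omega> (grad (\<phi> k)))\<^sup>2 \<le> K k" for k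
    by (auto simp: K_def intro!: add_nonneg_pos)
  have ue: "(\<lambda>x. u x * e x) \<in> L2 \<Omega>" by (rule L2_mult_bounded[OF Le(1) um M])
  have u\<phi>: "(\<lambda>x. u x * \<phi> k x) \<in> L2 \<Omega>" for k by (rule L2_mult_bounded[OF L\<phi>(1) um M])
  have "L2_tendsto \<Omega> (\<lambda>k x. u x *\<^sub>R \<phi> k x) (\<lambda>x. u x *\<^sub>R e x)" by (rule L2_tendsto_mult_bounded[OF \<phi>(2) um M(1)])
  then have lim: "(\<lambda>k. L2_norm \<Omega> (\<lambda>x. u x * \<phi> k x - u x * e x)) \<longlonglongrightarrow> 0" by (simp add: L2_tendsto_def)
  have le: "L2_norm \<Omega> (\<lambda>x. u x * e x - local_avg \<Q> (\<lambda>x. u x * e x) x)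
    \<le> ?k * (sqrt (C * K k) + M * L2_norm \<Omega> (grad (\<phi> k))) + L2_norm \<Omega> (\<lambda>x. u x * \<phi> k x - u x * e x)" for k
  proof -
    note tp = H10_pair_mult_test[OF u \<phi>(1)[of k]]
    have ug: "(\<lambda>x. u x *\<^sub>R grad (\<phi> k) x) \<in> L2 \<Omega>" "L2_norm \<Omega> (\<lambda>x. u x *\<^sub>R grad (\<phi> k) x) \<le> M * L2_norm \<Omega> (grad (\<phi> k))"
    proof -
      have m: "(\<lambda>x. u x *\<^sub>R grad (\<phi> k) x) \<in> borel_measurable (lebesgue_on \<Omega>)"
        using um L2D(1)[OF L\<phi>(2)] by (rule borel_measurable_scaleR)
      have ae: "AE x in lebesgue_on \<Omega>. norm (u x *\<^sub>R grad (\<phi> k) x) \<le> M * norm (grad (\<phi> k) x)"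
        using M(1) by eventually_elim (auto intro!: mult_right_mono)
      show "(\<lambda>x. u x *\<^sub>R grad (\<phi> k) x) \<in> L2 \<Omega>" by (rule L2_bound[OF L\<phi>(2) m ae])
      show "L2_norm \<Omega> (\<lambda>x. u x *\<^sub>R grad (\<phi> k) x) \<le> M * L2_norm \<Omega> (grad (\<phi> k))" by (rule L2_norm_bound[OF L\<phi>(2) m M(2) ae])
    qed
    have gG: "(\<lambda>x. \<phi> k x *\<^sub>R G x) \<in> L2 \<Omega>"
      using L2_diff[OF H10_pairD(2)[OF tp] ug(1)] by simp
    have "L2_norm \<Omega> (\<lambda>x. \<phi> k x *\<^sub>R G x) \<le> sqrt (C * K k)" by (rule real_le_rsqrt) (rule C(2)[OF \<phi>(1) K])
    then have g: "L2_norm \<Omega> (\<lambda>x. \<phi> k x *\<^sub>R G x + u x *\<^sub>R grad (\<phi> k) x) \<le> sqrt (C * K k) + M * L2_norm \<Omega> (grad (\<phi> k))"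
      using L2_norm_triangle[OF gG ug(1)] ug(2) by linarith
    have "(\<lambda>x. u x * e x - local_avg \<Q> (\<lambda>x. u x * e x) x) =
      (\<lambda>x. (u x * \<phi> k x - local_avg \<Q> (\<lambda>x. u x * \<phi> k x) x)
        - ((u x * \<phi> k x - u x * e x) - local_avg \<Q> (\<lambda>x. u x * \<phi> k x - u x * e x) x))"
      using local_avg_diff[OF u\<phi> ue] by auto
    then have "L2_norm \<Omega> (\<lambda>x. u x * e x - local_avg \<Q> (\<lambda>x. u x * e x) x) \<le>
      L2_norm \<Omega> (\<lambda>x. u x * \<phi> k x - local_avg \<Q> (\<lambda>x. u x * \<phi> k x) x)
      + L2_norm \<Omega> (\<lambda>x. (u x * \<phi> k x - u x * e x) - local_avg \<Q> (\<lambda>x. u x * \<phi> k x - u x * e x) x)"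
      by (simp only:) (intro L2_norm_triangle_diff L2_diff u\<phi> ue local_avg_L2)
    also have "\<dots> \<le> ?k * L2_norm \<Omega> (\<lambda>x. \<phi> k x *\<^sub>R G x + u x *\<^sub>R grad (\<phi> k) x) + L2_norm \<Omega> (\<lambda>x. u x * \<phi> k x - u x * e x)"
      by (intro add_mono local_avg_error[OF tp d] local_avg_contraction(1) L2_diff u\<phi> ue)
    also have "\<dots> \<le> ?k * (sqrt (C * K k) + M * L2_norm \<Omega> (grad (\<phi> k))) + L2_norm \<Omega> (\<lambda>x. u x * \<phi> k x - u x * e x)"
      using d by (intro add_right_mono mult_left_mono g) auto
    finally show ?thesis .
  qed
  have "(\<lambda>k. ?k * (sqrt (C * K k) + M * L2_norm \<Omega> (grad (\<phi> k))) + L2_norm \<Omega> (\<lambda>x. u x * \<phi> k x - u x * e x)) \<longlonglongrightarrow>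
    ?k * (sqrt (C * ((L2_norm \<Omega> e)\<^sup>2 + (L2_norm \<Omega> E)\<^sup>2 + 0)) + M * L2_norm \<Omega> E) + 0"
    unfolding K_def by (intro tendsto_intros L2_tendsto_norm \<phi> lim LIMSEQ_Suc[OF lim_1_over_n])
  from LIMSEQ_le_const[OF this] le show ?thesis by auto
qed

text \<open>Testing both equations with \<open>e\<close> and writing \<open>P\<close> for the averaging operator,
  \<open>u w - (P u\<^sub>h) (P w) = (w - P w) u + (P w) (u - P u) + (P w) (P e)\<close>; the last term is absorbed
  by the coercivity since \<open>\<integral>(P w) (P e) e = \<integral>(P w) (P e)\<^sup>2\<close>.\<close>

lemma energy_error:
  assumes A: "elliptic_coefficients \<Omega> A \<beta>" and P: "poincare_constant \<Omega> c" and c: "c > 0"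
    and w: "w \<in> L2 \<Omega>" "AE x in lebesgue_on \<Omega>. wl \<le> w x \<and> w x \<le> wu"
    and u: "solves_pde \<Omega> A f w u" and uh: "solves_averaged_pde \<Omega> A f \<Q> w uh"
    and e: "e = (\<lambda>x. u x - uh x)" and E: "E = (\<lambda>x. weak_grad \<Omega> u x - weak_grad \<Omega> uh x)"
  shows "(\<beta> + min (c\<^sup>2 * wl) 0) * (L2_norm \<Omega> E)\<^sup>2 \<le>
    \<bar>LINT x|lebesgue_on \<Omega>. (w x - local_avg \<Q> w x) * (u x * e x)\<bar>
    + \<bar>LINT x|lebesgue_on \<Omega>. local_avg \<Q> w x * (u x - local_avg \<Q> u x) * e x\<bar>"
proof -
  let ?P = "local_avg \<Q>"
  have uH: "u \<in> H1_0 \<Omega>" and uhH: "uh \<in> H1_0 \<Omega>" using u uh by (auto simp: solves_pde_def solves_averaged_pde_def)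
  note up = H1_0_pair[OF uH] and uhp = H1_0_pair[OF uhH]
  have eE: "H10_pair \<Omega> e E" unfolding e E by (rule H10_pair_diff[OF up uhp])
  note Lu = H10_pairD[OF up] and Luh = H10_pairD[OF uhp] and Le = H10_pairD[OF eE]
  define N where "N = max \<bar>wl\<bar> \<bar>wu\<bar>"
  have N: "N \<ge> 0" by (simp add: N_def)
  have wN: "AE x in lebesgue_on \<Omega>. \<bar>w x\<bar> \<le> N" using w(2) by eventually_elim (auto simp: N_def)
  have Pwb: "wl \<le> ?P w x \<and> ?P w x \<le> wu" if "x \<in> \<Omega>" for x by (rule local_avg_bounds[OF w that])
  have PwN: "AE x in lebesgue_on \<Omega>. \<bar>?P w x\<bar> \<le> N"
  proof (rule AE_I2)
    fix x assume "x \<in> space (lebesgue_on \<Omega>)"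
    then have "wl \<le> ?P w x" "?P w x \<le> wu" using Pwb[of x] by auto
    then show "\<bar>?P w x\<bar> \<le> N" unfolding N_def by linarith
  qed
  note wm = L2D(1)[OF w(1)] and Pwm = L2D(1)[OF local_avg_L2[of w]]
  have dN: "AE x in lebesgue_on \<Omega>. \<bar>w x - ?P w x\<bar> \<le> 2 * N" using wN PwN by eventually_elim linarith
  have dm: "(\<lambda>x. w x - ?P w x) \<in> borel_measurable (lebesgue_on \<Omega>)" using wm Pwm by (rule borel_measurable_diff)
  have e1: "(LINT x|lebesgue_on \<Omega>. (A x *v weak_grad \<Omega> u x) \<bullet> E x) + (LINT x|lebesgue_on \<Omega>. u x * w x * e x) = (LINT x|lebesgue_on \<Omega>. f x * e x)"
    using u solves_pde_pair[OF A uH eE] by (auto simp: solves_pde_def)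
  have e2: "(LINT x|lebesgue_on \<Omega>. (A x *v weak_grad \<Omega> uh x) \<bullet> E x) + (LINT x|lebesgue_on \<Omega>. ?P uh x * ?P w x * e x) = (LINT x|lebesgue_on \<Omega>. f x * e x)"
    using uh solves_pde_pair[OF A uhH eE] by (auto simp: solves_averaged_pde_def)
  have AE: "(LINT x|lebesgue_on \<Omega>. (A x *v E x) \<bullet> E x) =
    (LINT x|lebesgue_on \<Omega>. (A x *v weak_grad \<Omega> u x) \<bullet> E x) - (LINT x|lebesgue_on \<Omega>. (A x *v weak_grad \<Omega> uh x) \<bullet> E x)"
    using L2_inner_integrable[OF elliptic_L2[OF A Lu(2)] Le(2)] L2_inner_integrable[OF elliptic_L2[OF A Luh(2)] Le(2)]
    by (simp add: E matrix_vector_mult_diff_distrib inner_diff_left)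
  have PeL: "(\<lambda>x. ?P w x * ?P e x) \<in> L2 \<Omega>" by (rule L2_mult_bounded[OF local_avg_L2 Pwm PwN N])
  have wuL: "(\<lambda>x. (w x - ?P w x) * u x) \<in> L2 \<Omega>" using N by (intro L2_mult_bounded[OF Lu(1) dm dN]) simp
  have PuL: "(\<lambda>x. ?P w x * (u x - ?P u x)) \<in> L2 \<Omega>" by (intro L2_mult_bounded[OF L2_diff[OF Lu(1) local_avg_L2] Pwm PwN N])
  have i: "integrable (lebesgue_on \<Omega>) (\<lambda>x. (w x - ?P w x) * u x * e x)"
    "integrable (lebesgue_on \<Omega>) (\<lambda>x. ?P w x * (u x - ?P u x) * e x)"
    "integrable (lebesgue_on \<Omega>) (\<lambda>x. ?P w x * ?P e x * e x)"
    by (intro L2_mult_integrable wuL PuL PeL Le)+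
  have i': "integrable (lebesgue_on \<Omega>) (\<lambda>x. u x * w x * e x)"
    "integrable (lebesgue_on \<Omega>) (\<lambda>x. ?P uh x * ?P w x * e x)"
    using L2_mult_integrable[OF L2_mult_bounded(1)[OF Lu(1) wm wN N] Le(1)]
      L2_mult_integrable[OF L2_mult_bounded(1)[OF local_avg_L2[of uh] Pwm PwN N] Le(1)]
    by (simp_all add: mult.commute[of "w _"] mult.commute[of "?P w _"])
  have split: "(LINT x|lebesgue_on \<Omega>. u x * w x * e x) - (LINT x|lebesgue_on \<Omega>. ?P uh x * ?P w x * e x) =
    (LINT x|lebesgue_on \<Omega>. (w x - ?P w x) * u x * e x) + (LINT x|lebesgue_on \<Omega>. ?P w x * (u x - ?P u x) * e x)
     + (LINT x|lebesgue_on \<Omega>. ?P w x * ?P e x * e x)"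
  proof -
    have Pe: "?P e x = ?P u x - ?P uh x" for x unfolding e by (rule local_avg_diff[OF Lu(1) Luh(1)])
    have "(LINT x|lebesgue_on \<Omega>. u x * w x * e x) - (LINT x|lebesgue_on \<Omega>. ?P uh x * ?P w x * e x) =
      (LINT x|lebesgue_on \<Omega>. u x * w x * e x - ?P uh x * ?P w x * e x)" using i' by simp
    also have "\<dots> = (LINT x|lebesgue_on \<Omega>. (w x - ?P w x) * u x * e x + ?P w x * (u x - ?P u x) * e x + ?P w x * ?P e x * e x)"
      by (rule Bochner_Integration.integral_cong) (auto simp: Pe algebra_simps)
    also have "\<dots> = (LINT x|lebesgue_on \<Omega>. (w x - ?P w x) * u x * e x) + (LINT x|lebesgue_on \<Omega>. ?P w x * (u x - ?P u x) * e x)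
     + (LINT x|lebesgue_on \<Omega>. ?P w x * ?P e x * e x)" using i by simp
    finally show ?thesis .
  qed
  \<comment> \<open>Only negative values of \<open>P w\<close> lower the integral, and their effect
    is limited by \<open>\<parallel>P e\<parallel> \<le> \<parallel>e\<parallel> \<le> c
    \<parallel>E\<parallel>\<close>; hence the minimum with \<open>0\<close> in the
    constant.\<close>
  have low: "min (c\<^sup>2 * wl) 0 * (L2_norm \<Omega> E)\<^sup>2 \<le> (LINT x|lebesgue_on \<Omega>. ?P w x * ?P e x * e x)"
  proof -
    have pc: "?P w x * ?P e x = piecewise_const \<Q> (\<lambda>Q. cell_avg w Q * cell_avg e Q) x" if "x \<in> \<Omega>" for x
      unfolding local_avg_eq by (rule piecewise_const_mult[OF that])
    have "(LINT x|lebesgue_on \<Omega>. ?P w x * ?P e x * (e x - ?P e x)) =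
      (LINT x|lebesgue_on \<Omega>. piecewise_const \<Q> (\<lambda>Q. cell_avg w Q * cell_avg e Q) x * (e x - ?P e x))"
      by (rule Bochner_Integration.integral_cong) (auto simp: pc)
    then have 0: "(LINT x|lebesgue_on \<Omega>. ?P w x * ?P e x * (e x - ?P e x)) = 0"
      by (simp add: local_avg_orthogonal[OF Le(1)])
    have "(LINT x|lebesgue_on \<Omega>. ?P w x * ?P e x * e x) - (LINT x|lebesgue_on \<Omega>. ?P w x * ?P e x * ?P e x) = (LINT x|lebesgue_on \<Omega>. ?P w x * ?P e x * (e x - ?P e x))"
      using i(3) L2_mult_integrable[OF PeL local_avg_L2[of e]] by (simp add: right_diff_distrib)
    then have eq: "(LINT x|lebesgue_on \<Omega>. ?P w x * ?P e x * e x) = (LINT x|lebesgue_on \<Omega>. ?P w x * ?P e x * ?P e x)" using 0 by simp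
    have "L2_norm \<Omega> (?P e) \<le> c * L2_norm \<Omega> E"
      using local_avg_contraction(2)[OF Le(1)] poincare_pair[OF P eE] by linarith
    then have "(L2_norm \<Omega> (?P e))\<^sup>2 \<le> (c * L2_norm \<Omega> E)\<^sup>2" by (intro power_mono) auto
    then have "min wl 0 * (c * L2_norm \<Omega> E)\<^sup>2 \<le> min wl 0 * (L2_norm \<Omega> (?P e))\<^sup>2" by (intro mult_left_mono_neg) auto
    also have "\<dots> = (LINT x|lebesgue_on \<Omega>. min wl 0 * (norm (?P e x))\<^sup>2)" by (simp add: L2_norm_sq)
    also have "\<dots> \<le> (LINT x|lebesgue_on \<Omega>. ?P w x * ?P e x * ?P e x)"
    proof (rule integral_mono)
      show "integrable (lebesgue_on \<Omega>) (\<lambda>x. min wl 0 * (norm (?P e x))\<^sup>2)" by (intro integrable_mult_right L2D(2) local_avg_L2)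
      show "integrable (lebesgue_on \<Omega>) (\<lambda>x. ?P w x * ?P e x * ?P e x)" by (rule L2_mult_integrable[OF PeL local_avg_L2])
      fix x assume "x \<in> space (lebesgue_on \<Omega>)"
      then have "min wl 0 \<le> ?P w x" using Pwb[of x] by auto
      then have "min wl 0 * (?P e x)\<^sup>2 \<le> ?P w x * (?P e x)\<^sup>2" by (rule mult_right_mono) simp
      then show "min wl 0 * (norm (?P e x))\<^sup>2 \<le> ?P w x * ?P e x * ?P e x" by (simp add: power2_eq_square mult.assoc)
    qed
    finally have "min wl 0 * (c * L2_norm \<Omega> E)\<^sup>2 \<le> (LINT x|lebesgue_on \<Omega>. ?P w x * ?P e x * e x)" unfolding eq .
    moreover have "min (c\<^sup>2 * wl) 0 = c\<^sup>2 * min wl 0"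
      using min_mult_distrib_left[of "c\<^sup>2" wl 0] c by simp
    ultimately show ?thesis by (simp add: power_mult_distrib mult_ac)
  qed
  have "\<beta> * (L2_norm \<Omega> E)\<^sup>2 \<le> (LINT x|lebesgue_on \<Omega>. (A x *v E x) \<bullet> E x)" by (rule elliptic_coercive[OF A Le(2)])
  then have "\<beta> * (L2_norm \<Omega> E)\<^sup>2 + min (c\<^sup>2 * wl) 0 * (L2_norm \<Omega> E)\<^sup>2 \<le>
    - (LINT x|lebesgue_on \<Omega>. (w x - ?P w x) * u x * e x) - (LINT x|lebesgue_on \<Omega>. ?P w x * (u x - ?P u x) * e x)"
    using AE e1 e2 split low by linarith
  then show ?thesis by (simp add: distrib_right mult.assoc)
qed

end

context bounded_open
begin

text \<open>Testing with \<open>u\<close> itself; the part of \<open>w\<close> below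
  \<open>0\<close> is balanced against the ellipticity by Poincare's inequality, which leaves the
  positive constant of hypothesis \<open>pos\<close>.\<close>

lemma solution_energy_bound:
  assumes A: "elliptic_coefficients \<Omega> A \<beta>" and P: "poincare_constant \<Omega> c" and c: "c > 0" and f: "f \<in> L2 \<Omega>"
    and w: "w \<in> L2 \<Omega>" "AE x in lebesgue_on \<Omega>. wl \<le> w x \<and> w x \<le> wu"
    and pos: "\<beta> + min (c\<^sup>2 * wl) 0 > 0" and u: "solves_pde \<Omega> A f w u"
  shows "L2_norm \<Omega> (weak_grad \<Omega> u) \<le> c * L2_norm \<Omega> f / (\<beta> + min (c\<^sup>2 * wl) 0)"
    "weak_solution A u (weak_grad \<Omega> u) (\<lambda>x. f x - w x * u x)"
proof -
  have uH: "u \<in> H1_0 \<Omega>" using u by (auto simp: solves_pde_def)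
  note up = H1_0_pair[OF uH]
  note Lu = H10_pairD[OF up]
  let ?G = "weak_grad \<Omega> u"
  define N where "N = max \<bar>wl\<bar> \<bar>wu\<bar>"
  have N: "N \<ge> 0" by (simp add: N_def)
  have wN: "AE x in lebesgue_on \<Omega>. \<bar>w x\<bar> \<le> N" using w(2) by eventually_elim (auto simp: N_def)
  have wuL: "(\<lambda>x. w x * u x) \<in> L2 \<Omega>" by (rule L2_mult_bounded[OF Lu(1) L2D(1)[OF w(1)] wN N])
  have eq: "(LINT x|lebesgue_on \<Omega>. (A x *v ?G x) \<bullet> V x) = (LINT x|lebesgue_on \<Omega>. (f x - w x * u x) * v x)"
    if v: "H10_pair \<Omega> v V" for v V
  proof -
    have "(LINT x|lebesgue_on \<Omega>. (A x *v ?G x) \<bullet> V x) + (LINT x|lebesgue_on \<Omega>. u x * w x * v x) = (LINT x|lebesgue_on \<Omega>. f x * v x)"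
      using u solves_pde_pair[OF A uH v] by (auto simp: solves_pde_def)
    then show ?thesis
      using L2_mult_integrable[OF wuL H10_pairD(1)[OF v]] L2_mult_integrable[OF f H10_pairD(1)[OF v]]
      by (simp add: left_diff_distrib mult.commute[of "u _"])
  qed
  show "weak_solution A u ?G (\<lambda>x. f x - w x * u x)"
    unfolding weak_solution_def using up eq L2_diff[OF f wuL] by auto
  let ?a = "\<beta> + min (c\<^sup>2 * wl) 0"
  have P': "L2_norm \<Omega> u \<le> c * L2_norm \<Omega> ?G" by (rule poincare_pair[OF P up])
  have "min wl 0 * (c * L2_norm \<Omega> ?G)\<^sup>2 \<le> min wl 0 * (L2_norm \<Omega> u)\<^sup>2"
    using P' by (intro mult_left_mono_neg power_mono) auto
  also have "\<dots> = (LINT x|lebesgue_on \<Omega>. min wl 0 * (norm (u x))\<^sup>2)" by (simp add: L2_norm_sq)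
  also have "\<dots> \<le> (LINT x|lebesgue_on \<Omega>. w x * u x * u x)"
  proof (rule integral_mono_AE)
    show "integrable (lebesgue_on \<Omega>) (\<lambda>x. min wl 0 * (norm (u x))\<^sup>2)" by (intro integrable_mult_right L2D(2) Lu)
    show "integrable (lebesgue_on \<Omega>) (\<lambda>x. w x * u x * u x)" by (rule L2_mult_integrable[OF wuL Lu(1)])
    show "AE x in lebesgue_on \<Omega>. min wl 0 * (norm (u x))\<^sup>2 \<le> w x * u x * u x"
      using w(2)
    proof eventually_elim
      case (elim x)
      then have "min wl 0 * (u x)\<^sup>2 \<le> w x * (u x)\<^sup>2" by (intro mult_right_mono) auto
      then show ?case by (simp add: power2_eq_square mult.assoc)
    qed
  qed
  finally have low: "min wl 0 * (c * L2_norm \<Omega> ?G)\<^sup>2 \<le> (LINT x|lebesgue_on \<Omega>. w x * u x * u x)" .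
  have "\<beta> * (L2_norm \<Omega> ?G)\<^sup>2 \<le> (LINT x|lebesgue_on \<Omega>. (A x *v ?G x) \<bullet> ?G x)" by (rule elliptic_coercive[OF A Lu(2)])
  also have "\<dots> = (LINT x|lebesgue_on \<Omega>. f x * u x) - (LINT x|lebesgue_on \<Omega>. w x * u x * u x)"
    using eq[OF up] L2_mult_integrable[OF wuL Lu(1)] L2_mult_integrable[OF f Lu(1)] by (simp add: left_diff_distrib)
  finally have "\<beta> * (L2_norm \<Omega> ?G)\<^sup>2 + min wl 0 * (c * L2_norm \<Omega> ?G)\<^sup>2 \<le> L2_norm \<Omega> f * L2_norm \<Omega> u"
    using low L2_mult_le[OF f Lu(1)] by linarith
  also have "\<dots> \<le> L2_norm \<Omega> f * (c * L2_norm \<Omega> ?G)" by (intro mult_left_mono P') auto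
  also have "\<beta> * (L2_norm \<Omega> ?G)\<^sup>2 + min wl 0 * (c * L2_norm \<Omega> ?G)\<^sup>2 = ?a * L2_norm \<Omega> ?G * L2_norm \<Omega> ?G"
  proof -
    have "min (c\<^sup>2 * wl) 0 = c\<^sup>2 * min wl 0" using min_mult_distrib_left[of "c\<^sup>2" wl 0] c by simp
    then show ?thesis by (simp add: power_mult_distrib power2_eq_square algebra_simps)
  qed
  finally have "?a * L2_norm \<Omega> ?G * L2_norm \<Omega> ?G \<le> c * L2_norm \<Omega> f * L2_norm \<Omega> ?G" by (simp add: mult_ac)
  then have "?a * L2_norm \<Omega> ?G \<le> c * L2_norm \<Omega> f"
    using mult_right_le_imp_le[of "?a * L2_norm \<Omega> ?G" "L2_norm \<Omega> ?G" "c * L2_norm \<Omega> f"] c L2_norm_nonneg[of \<Omega> ?G]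
    by (cases "L2_norm \<Omega> ?G = 0") auto
  then show "L2_norm \<Omega> ?G \<le> c * L2_norm \<Omega> f / ?a" using pos by (simp add: pos_le_divide_eq mult.commute)
qed

end

context mesh
begin

text \<open>Orthogonality is used twice: \<open>w - P w\<close> annihilates \<open>P (u e)\<close>,
  and \<open>u - P u\<close> annihilates \<open>(P w) (P e)\<close>, because the product of two
  piecewise constant functions is piecewise constant. Each integrand thereby gains a second small
  factor.\<close>

lemma residual_bounds:
  assumes w: "w \<in> L2 \<Omega>" "AE x in lebesgue_on \<Omega>. wl \<le> w x \<and> w x \<le> wu"
    and u: "u \<in> L2 \<Omega>" and e: "e \<in> L2 \<Omega>" and ue: "(\<lambda>x. u x * e x) \<in> L2 \<Omega>"
  shows "\<bar>LINT x|lebesgue_on \<Omega>. (w x - local_avg \<Q> w x) * (u x * e x)\<bar>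
      \<le> L2_norm \<Omega> (\<lambda>x. w x - local_avg \<Q> w x) * L2_norm \<Omega> (\<lambda>x. u x * e x - local_avg \<Q> (\<lambda>x. u x * e x) x)"
    "\<bar>LINT x|lebesgue_on \<Omega>. local_avg \<Q> w x * (u x - local_avg \<Q> u x) * e x\<bar>
      \<le> max \<bar>wl\<bar> \<bar>wu\<bar> * L2_norm \<Omega> (\<lambda>x. u x - local_avg \<Q> u x) * L2_norm \<Omega> (\<lambda>x. e x - local_avg \<Q> e x)"
proof -
  let ?P = "local_avg \<Q>" and ?ue = "\<lambda>x. u x * e x" and ?N = "max \<bar>wl\<bar> \<bar>wu\<bar>"
  have dw: "(\<lambda>x. w x - ?P w x) \<in> L2 \<Omega>" and du: "(\<lambda>x. u x - ?P u x) \<in> L2 \<Omega>"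
    and de: "(\<lambda>x. e x - ?P e x) \<in> L2 \<Omega>" and due: "(\<lambda>x. ?ue x - ?P ?ue x) \<in> L2 \<Omega>"
    by (intro L2_diff local_avg_L2 w u e ue)+
  have "(LINT x|lebesgue_on \<Omega>. ?P ?ue x * (w x - ?P w x)) = 0"
    unfolding local_avg_eq[of ?ue] by (rule local_avg_orthogonal[OF w(1)])
  then have "(LINT x|lebesgue_on \<Omega>. (w x - ?P w x) * ?ue x) = (LINT x|lebesgue_on \<Omega>. (w x - ?P w x) * (?ue x - ?P ?ue x))"
    using L2_mult_integrable[OF dw ue] L2_mult_integrable[OF dw local_avg_L2[of ?ue]]
    by (simp add: right_diff_distrib[of "w _ - ?P w _"] mult.commute[of "?P ?ue _"])
  then show "\<bar>LINT x|lebesgue_on \<Omega>. (w x - ?P w x) * ?ue x\<bar>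
      \<le> L2_norm \<Omega> (\<lambda>x. w x - ?P w x) * L2_norm \<Omega> (\<lambda>x. ?ue x - ?P ?ue x)"
    using L2_mult_le[OF dw due] by simp
  have N: "AE x in lebesgue_on \<Omega>. \<bar>?P w x\<bar> \<le> ?N"
  proof (rule AE_I2)
    fix x assume "x \<in> space (lebesgue_on \<Omega>)"
    then have "wl \<le> ?P w x" "?P w x \<le> wu" using local_avg_bounds[OF w, of x] by auto
    then show "\<bar>?P w x\<bar> \<le> ?N" by linarith
  qed
  note Pwm = L2D(1)[OF local_avg_L2[of w]]
  have Pdu: "(\<lambda>x. ?P w x * (u x - ?P u x)) \<in> L2 \<Omega>"
    "L2_norm \<Omega> (\<lambda>x. ?P w x * (u x - ?P u x)) \<le> ?N * L2_norm \<Omega> (\<lambda>x. u x - ?P u x)"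
    by (rule L2_mult_bounded[OF du Pwm N]; simp)+
  have "(LINT x|lebesgue_on \<Omega>. ?P w x * (u x - ?P u x) * ?P e x) =
      (LINT x|lebesgue_on \<Omega>. piecewise_const \<Q> (\<lambda>Q. cell_avg w Q * cell_avg e Q) x * (u x - ?P u x))"
  proof (rule Bochner_Integration.integral_cong[OF refl])
    fix x assume "x \<in> space (lebesgue_on \<Omega>)"
    then have "?P w x * ?P e x = piecewise_const \<Q> (\<lambda>Q. cell_avg w Q * cell_avg e Q) x"
      unfolding local_avg_eq by (intro piecewise_const_mult) simp
    then show "?P w x * (u x - ?P u x) * ?P e x = piecewise_const \<Q> (\<lambda>Q. cell_avg w Q * cell_avg e Q) x * (u x - ?P u x)"
      by (simp add: mult_ac)
  qed
  then have "(LINT x|lebesgue_on \<Omega>. ?P w x * (u x - ?P u x) * ?P e x) = 0"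
    by (simp add: local_avg_orthogonal[OF u])
  then have "(LINT x|lebesgue_on \<Omega>. ?P w x * (u x - ?P u x) * e x) = (LINT x|lebesgue_on \<Omega>. ?P w x * (u x - ?P u x) * (e x - ?P e x))"
    using L2_mult_integrable[OF Pdu(1) e] L2_mult_integrable[OF Pdu(1) local_avg_L2[of e]]
    by (simp add: right_diff_distrib[of "?P w _ * (u _ - ?P u _)"])
  then have "\<bar>LINT x|lebesgue_on \<Omega>. ?P w x * (u x - ?P u x) * e x\<bar>
      \<le> L2_norm \<Omega> (\<lambda>x. ?P w x * (u x - ?P u x)) * L2_norm \<Omega> (\<lambda>x. e x - ?P e x)"
    using L2_mult_le[OF Pdu(1) de] by simp
  also have "\<dots> \<le> ?N * L2_norm \<Omega> (\<lambda>x. u x - ?P u x) * L2_norm \<Omega> (\<lambda>x. e x - ?P e x)"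
    by (intro mult_right_mono Pdu) simp
  finally show "\<bar>LINT x|lebesgue_on \<Omega>. ?P w x * (u x - ?P u x) * e x\<bar>
      \<le> ?N * L2_norm \<Omega> (\<lambda>x. u x - ?P u x) * L2_norm \<Omega> (\<lambda>x. e x - ?P e x)" .
qed

end

context bounded_open
begin

text \<open>Both bounds vanish with \<open>f\<close>, which makes the final constant vanish with \<open>f\<close>: the
  gradient estimate of the theorem has the factor \<open>L2_norm \<Omega> f\<close> on its right-hand side.\<close>

lemma solution_product_bounds:
  assumes n: "CARD('n) \<le> 3" and A: "elliptic_coefficients \<Omega> A \<beta>" and \<beta>: "\<beta> > 0"
    and P: "poincare_constant \<Omega> c" and c: "c > 0" and f: "f \<in> L2 \<Omega>"
    and w: "w \<in> L2 \<Omega>" "AE x in lebesgue_on \<Omega>. wl \<le> w x \<and> w x \<le> wu"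
    and pos: "\<beta> + min (c\<^sup>2 * wl) 0 > 0"
  obtains M C where "M \<ge> 0" "C \<ge> 0" "L2_norm \<Omega> f = 0 \<Longrightarrow> M = 0 \<and> C = 0"
    "\<And>u. solves_pde \<Omega> A f w u \<Longrightarrow> AE x in lebesgue_on \<Omega>. \<bar>u x\<bar> \<le> M"
    "\<And>u \<phi> K. solves_pde \<Omega> A f w u \<Longrightarrow> test_function \<Omega> \<phi> \<Longrightarrow> K > 0 \<Longrightarrow>
      (L2_norm \<Omega> \<phi>)\<^sup>2 \<le> K \<Longrightarrow> (L2_norm \<Omega> (grad \<phi>))\<^sup>2 \<le> K \<Longrightarrow>
      (L2_norm \<Omega> (\<lambda>x. \<phi> x *\<^sub>R weak_grad \<Omega> u x))\<^sup>2 \<le> C * K"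
proof -
  define U where "U = c * L2_norm \<Omega> f / (\<beta> + min (c\<^sup>2 * wl) 0)"
  \<comment> \<open>Bound for the data \<open>f - w u\<close> that results from the energy estimate
    and Poincare's inequality, uniform over all solutions.\<close>
  define N where "N = L2_norm \<Omega> f + max \<bar>wl\<bar> \<bar>wu\<bar> * (c * U)"
  obtain M0 where M0: "M0 \<ge> 0" "\<And>u G g. weak_solution A u G g \<Longrightarrow> L2_norm \<Omega> g \<le> N \<Longrightarrow> AE x in lebesgue_on \<Omega>. \<bar>u x\<bar> \<le> M0"
    by (rule weak_solution_bounded[OF n A \<beta>, of N]) blast
  obtain C0 where C0: "C0 \<ge> 0" "\<And>u G g \<phi> K. weak_solution A u G g \<Longrightarrow> L2_norm \<Omega> g \<le> N \<Longrightarrow>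
    (AE x in lebesgue_on \<Omega>. \<bar>u x\<bar> \<le> M0) \<Longrightarrow> test_function \<Omega> \<phi> \<Longrightarrow> K > 0 \<Longrightarrow>
    (L2_norm \<Omega> \<phi>)\<^sup>2 \<le> K \<Longrightarrow> (L2_norm \<Omega> (grad \<phi>))\<^sup>2 \<le> K \<Longrightarrow>
    (L2_norm \<Omega> (\<lambda>x. \<phi> x *\<^sub>R G x))\<^sup>2 \<le> C0 * K"
    by (rule product_gradient_bound[OF n A \<beta>, of N M0]) blast
  have data: "weak_solution A u (weak_grad \<Omega> u) (\<lambda>x. f x - w x * u x)" "L2_norm \<Omega> (weak_grad \<Omega> u) \<le> U"
    "L2_norm \<Omega> u \<le> c * U" "L2_norm \<Omega> (\<lambda>x. f x - w x * u x) \<le> N" "u \<in> L2 \<Omega>" "weak_grad \<Omega> u \<in> L2 \<Omega>"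
    if u: "solves_pde \<Omega> A f w u" for u
  proof -
    have uH: "u \<in> H1_0 \<Omega>" using u by (simp add: solves_pde_def)
    note up = H1_0_pair[OF uH]
    note L = H10_pairD[OF up]
    show L': "u \<in> L2 \<Omega>" "weak_grad \<Omega> u \<in> L2 \<Omega>" by (rule L)+
    note b = solution_energy_bound[OF A P c f w pos u]
    show "weak_solution A u (weak_grad \<Omega> u) (\<lambda>x. f x - w x * u x)" by (rule b(2))
    show g: "L2_norm \<Omega> (weak_grad \<Omega> u) \<le> U" unfolding U_def by (rule b(1))
    have "c * L2_norm \<Omega> (weak_grad \<Omega> u) \<le> c * U" using c by (intro mult_left_mono g) simp
    then show u0: "L2_norm \<Omega> u \<le> c * U" using poincare_pair[OF P up] by linarith
    have wN: "AE x in lebesgue_on \<Omega>. \<bar>w x\<bar> \<le> max \<bar>wl\<bar> \<bar>wu\<bar>" using w(2) by eventually_elim linarith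
    have "0 \<le> max \<bar>wl\<bar> \<bar>wu\<bar>" by simp
    note wu = L2_mult_bounded[OF L'(1) L2D(1)[OF w(1)] wN this]
    have "L2_norm \<Omega> (\<lambda>x. w x * u x) \<le> max \<bar>wl\<bar> \<bar>wu\<bar> * (c * U)"
      by (rule order_trans[OF wu(2) mult_left_mono[OF u0]]) simp
    then show "L2_norm \<Omega> (\<lambda>x. f x - w x * u x) \<le> N"
      using L2_norm_triangle_diff[OF f wu(1)] unfolding N_def by linarith
  qed
  show ?thesis
  proof (cases "L2_norm \<Omega> f = 0")
    case True
    have U0: "U = 0" by (simp add: U_def True)
    show ?thesis
    proof (rule that[of 0 0])
      fix u assume u: "solves_pde \<Omega> A f w u"
      have "L2_norm \<Omega> u = 0" using data(3)[OF u] L2_norm_nonneg[of \<Omega> u] U0 by simp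
      then show "AE x in lebesgue_on \<Omega>. \<bar>u x\<bar> \<le> 0" using L2_norm_eq_0_iff[OF data(5)[OF u]] by simp
      fix \<phi> K assume \<phi>: "test_function \<Omega> \<phi>"
      have "L2_norm \<Omega> (weak_grad \<Omega> u) = 0" using data(2)[OF u] L2_norm_nonneg[of \<Omega> "weak_grad \<Omega> u"] U0 by simp
      then have "AE x in lebesgue_on \<Omega>. weak_grad \<Omega> u x = 0" using L2_norm_eq_0_iff[OF data(6)[OF u]] by simp
      then have "AE x in lebesgue_on \<Omega>. norm (\<phi> x *\<^sub>R weak_grad \<Omega> u x) \<le> 0 * norm (\<phi> x)" by eventually_elim simp
      then have "L2_norm \<Omega> (\<lambda>x. \<phi> x *\<^sub>R weak_grad \<Omega> u x) \<le> 0 * L2_norm \<Omega> \<phi>"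
        using test_function_L2(1)[OF \<phi>] data(6)[OF u] by (intro L2_norm_bound borel_measurable_scaleR L2D(1)) auto
      then have "L2_norm \<Omega> (\<lambda>x. \<phi> x *\<^sub>R weak_grad \<Omega> u x) = 0" by (intro antisym) auto
      then show "(L2_norm \<Omega> (\<lambda>x. \<phi> x *\<^sub>R weak_grad \<Omega> u x))\<^sup>2 \<le> 0 * K" by simp
    qed simp_all
  next
    case False
    show ?thesis
    proof (rule that[of M0 C0])
      show b: "AE x in lebesgue_on \<Omega>. \<bar>u x\<bar> \<le> M0" if "solves_pde \<Omega> A f w u" for u
        by (rule M0(2)[OF data(1,4)[OF that]])
      show "(L2_norm \<Omega> (\<lambda>x. \<phi> x *\<^sub>R weak_grad \<Omega> u x))\<^sup>2 \<le> C0 * K"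
        if "solves_pde \<Omega> A f w u" "test_function \<Omega> \<phi>" "K > 0" "(L2_norm \<Omega> \<phi>)\<^sup>2 \<le> K" "(L2_norm \<Omega> (grad \<phi>))\<^sup>2 \<le> K" for u \<phi> K
        by (rule C0(2)[OF data(1,4)[OF that(1)] b[OF that(1)] that(2-5)])
    qed (use False M0(1) C0(1) in auto)
  qed
qed

text \<open>Both residuals are bounded by a power of \<open>d\<close> times the norm of the gradient
  error \<open>E\<close>, so one factor of that norm can be divided out of the coercive estimate; if
  the norm is \<open>0\<close>, there is nothing to show.\<close>

lemma gradient_error:
  assumes n: "CARD('n) \<le> 3" and ne: "\<Omega> \<noteq> {}" and poly: "polygonal_boundary \<Omega>"
    and A: "elliptic_coefficients \<Omega> A \<beta>" and \<beta>: "\<beta> > 0"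
    and P: "poincare_constant \<Omega> c" and c: "c > 0" and f: "f \<in> L2 \<Omega>"
    and w: "w \<in> BV \<Omega>" "AE x in lebesgue_on \<Omega>. wl \<le> w x \<and> w x \<le> wu"
    and pos: "\<beta> + min (c\<^sup>2 * wl) 0 > 0"
  obtains C where "C \<ge> 0" "L2_norm \<Omega> f = 0 \<Longrightarrow> C = 0"
    "\<And>\<Q> u uh. mesh \<Omega> \<Q> \<Longrightarrow> solves_pde \<Omega> A f w u \<Longrightarrow> solves_averaged_pde \<Omega> A f \<Q> w uh \<Longrightarrow>
      L2_norm \<Omega> (\<lambda>x. weak_grad \<Omega> u x - weak_grad \<Omega> uh x) \<le> C * max_diameter \<Q> powr (3 / 2)"
proof -
  let ?N = "max \<bar>wl\<bar> \<bar>wu\<bar>" and ?\<alpha> = "\<beta> + min (c\<^sup>2 * wl) 0" and ?k = "2 ^ CARD('n) * 2 :: real"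
  have wN: "AE x in lebesgue_on \<Omega>. \<bar>w x\<bar> \<le> ?N" using w(2) by eventually_elim linarith
  have wm: "w \<in> borel_measurable (lebesgue_on \<Omega>)" using w(1) by (auto simp: BV_def)
  have wL: "w \<in> L2 \<Omega>" using wN by (intro bounded_in_L2[OF wm]) simp
  have "0 \<le> ?N" by simp
  from BV_local_avg_error[OF w(1) wN this poly] obtain B where B: "B \<ge> 0"
    "\<And>\<Q> d. mesh \<Omega> \<Q> \<Longrightarrow> d > 0 \<Longrightarrow> max_diameter \<Q> \<le> d \<Longrightarrow> (L2_norm \<Omega> (\<lambda>x. w x - local_avg \<Q> w x))\<^sup>2 \<le> B * d"
    by blast
  obtain M K where MK: "M \<ge> 0" "K \<ge> 0" "L2_norm \<Omega> f = 0 \<Longrightarrow> M = 0 \<and> K = 0"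
    "\<And>u. solves_pde \<Omega> A f w u \<Longrightarrow> AE x in lebesgue_on \<Omega>. \<bar>u x\<bar> \<le> M"
    "\<And>u \<phi> t. solves_pde \<Omega> A f w u \<Longrightarrow> test_function \<Omega> \<phi> \<Longrightarrow> t > 0 \<Longrightarrow>
      (L2_norm \<Omega> \<phi>)\<^sup>2 \<le> t \<Longrightarrow> (L2_norm \<Omega> (grad \<phi>))\<^sup>2 \<le> t \<Longrightarrow>
      (L2_norm \<Omega> (\<lambda>x. \<phi> x *\<^sub>R weak_grad \<Omega> u x))\<^sup>2 \<le> K * t"
    by (rule solution_product_bounds[OF n A \<beta> P c f wL w(2) pos]) blast
  define U where "U = c * L2_norm \<Omega> f / ?\<alpha>"
  have U: "U \<ge> 0" using c pos by (auto simp: U_def)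
  \<comment> \<open>First summand: order \<open>1 / 2\<close> of \<open>w - P w\<close> times order
    \<open>1\<close> of the product \<open>u e\<close>. Second summand: order \<open>2\<close>,
    brought down to \<open>3 / 2\<close> with \<open>d \<le> diameter \<Omega>\<close>. The factors
    \<open>?k\<close> come from the local averaging error.\<close>
  define C where "C = (sqrt B * ?k * (sqrt (K * (c\<^sup>2 + 1)) + M) + ?N * ?k\<^sup>2 * U * sqrt (diameter \<Omega>)) / ?\<alpha>"
  show ?thesis
  proof (rule that[of C])
    show "C \<ge> 0" unfolding C_def using B(1) MK(1,2) U pos diameter_ge_0[OF bounded_\<Omega>]
      by (intro divide_nonneg_pos add_nonneg_nonneg mult_nonneg_nonneg) auto
    show "C = 0" if "L2_norm \<Omega> f = 0" using that MK(3) by (simp add: C_def U_def)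
    fix \<Q> u uh
    assume m: "mesh \<Omega> \<Q>" and u: "solves_pde \<Omega> A f w u" and uh: "solves_averaged_pde \<Omega> A f \<Q> w uh"
    interpret mesh \<Omega> \<Q> by (rule m)
    define d where "d = max_diameter \<Q>"
    define e where "e = (\<lambda>x. u x - uh x)"
    define E where "E = (\<lambda>x. weak_grad \<Omega> u x - weak_grad \<Omega> uh x)"
    have d: "d > 0" "max_diameter \<Q> \<le> d" "d \<le> diameter \<Omega>" using max_diameter_bounds[OF ne] by (auto simp: d_def)
    have uH: "u \<in> H1_0 \<Omega>" and uhH: "uh \<in> H1_0 \<Omega>" using u uh by (auto simp: solves_pde_def solves_averaged_pde_def)
    note up = H1_0_pair[OF uH]
    have eE: "H10_pair \<Omega> e E" unfolding e_def E_def by (rule H10_pair_diff[OF up H1_0_pair[OF uhH]])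
    note Lu = H10_pairD[OF up] and Le = H10_pairD[OF eE]
    let ?P = "local_avg \<Q>" and ?ue = "\<lambda>x. u x * e x" and ?E = "L2_norm \<Omega> E"
    have kd: "?k * d = 2 ^ CARD('n) * (2 * d)" by (rule mult.assoc)
    have ueL: "?ue \<in> L2 \<Omega>" by (rule L2_mult_bounded[OF Le(1) L2D(1)[OF Lu(1)] MK(4)[OF u] MK(1)])
    note res = residual_bounds[OF wL w(2) Lu(1) Le(1) ueL]
    have ew: "L2_norm \<Omega> (\<lambda>x. w x - ?P w x) \<le> sqrt B * sqrt d"
      using B(2)[OF m d(1,2)] by (simp add: real_le_rsqrt real_sqrt_mult[symmetric])
    have poin: "L2_norm \<Omega> e \<le> c * ?E" by (rule poincare_pair[OF P eE])
    have "(L2_norm \<Omega> e)\<^sup>2 \<le> (c * ?E)\<^sup>2" by (rule power_mono[OF poin]) simp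
    then have "K * ((L2_norm \<Omega> e)\<^sup>2 + ?E\<^sup>2) \<le> K * (c\<^sup>2 + 1) * ?E\<^sup>2"
      using MK(2) mult_left_mono[of "(L2_norm \<Omega> e)\<^sup>2 + ?E\<^sup>2" "(c\<^sup>2 + 1) * ?E\<^sup>2" K]
      by (simp add: power_mult_distrib algebra_simps)
    then have "sqrt (K * ((L2_norm \<Omega> e)\<^sup>2 + ?E\<^sup>2)) \<le> sqrt (K * (c\<^sup>2 + 1)) * ?E"
      using real_sqrt_le_mono[of "K * ((L2_norm \<Omega> e)\<^sup>2 + ?E\<^sup>2)" "K * (c\<^sup>2 + 1) * ?E\<^sup>2"]
      by (simp only: real_sqrt_mult real_sqrt_abs abs_of_nonneg[OF L2_norm_nonneg])
    then have "?k * d * (sqrt (K * ((L2_norm \<Omega> e)\<^sup>2 + ?E\<^sup>2)) + M * ?E) \<le> ?k * d * ((sqrt (K * (c\<^sup>2 + 1)) + M) * ?E)"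
      using d(1) by (intro mult_left_mono) (auto simp: distrib_right)
    moreover have "L2_norm \<Omega> (\<lambda>x. ?ue x - ?P ?ue x) \<le> ?k * d * (sqrt (K * ((L2_norm \<Omega> e)\<^sup>2 + ?E\<^sup>2)) + M * ?E)"
      unfolding kd by (rule product_avg_error[OF up MK(4)[OF u] MK(1,2) MK(5)[OF u] eE d(1,2)])
    ultimately have eue: "L2_norm \<Omega> (\<lambda>x. ?ue x - ?P ?ue x) \<le> ?k * d * ((sqrt (K * (c\<^sup>2 + 1)) + M) * ?E)" by linarith
    have "L2_norm \<Omega> (\<lambda>x. u x - ?P u x) \<le> ?k * d * L2_norm \<Omega> (weak_grad \<Omega> u)"
      unfolding kd by (rule local_avg_error[OF up d(1,2)])
    also have "\<dots> \<le> ?k * d * U"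
      using d(1) solution_energy_bound(1)[OF A P c f wL w(2) pos u] unfolding U_def by (intro mult_left_mono) auto
    finally have eu: "L2_norm \<Omega> (\<lambda>x. u x - ?P u x) \<le> ?k * d * U" .
    have ee: "L2_norm \<Omega> (\<lambda>x. e x - ?P e x) \<le> ?k * d * ?E"
      unfolding kd by (rule local_avg_error[OF eE d(1,2)])
    have dd: "d * sqrt d = d powr (3 / 2)"
      using d(1) powr_add[of d 1 "1 / 2"] by (simp add: powr_half_sqrt)
    have "d\<^sup>2 = d * sqrt d * sqrt d" using d(1) by (simp add: power2_eq_square)
    also have "\<dots> \<le> d * sqrt d * sqrt (diameter \<Omega>)" using d(1,3) by (intro mult_left_mono real_sqrt_le_mono) auto
    finally have d2: "d\<^sup>2 \<le> d powr (3 / 2) * sqrt (diameter \<Omega>)" unfolding dd .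
    have "L2_norm \<Omega> (\<lambda>x. w x - ?P w x) * L2_norm \<Omega> (\<lambda>x. ?ue x - ?P ?ue x) \<le>
      (sqrt B * sqrt d) * (?k * d * ((sqrt (K * (c\<^sup>2 + 1)) + M) * ?E))"
      using B(1) d(1) by (intro mult_mono ew eue) auto
    also have "\<dots> = sqrt B * ?k * (sqrt (K * (c\<^sup>2 + 1)) + M) * (d * sqrt d) * ?E" by (simp only: mult_ac)
    finally have 1: "L2_norm \<Omega> (\<lambda>x. w x - ?P w x) * L2_norm \<Omega> (\<lambda>x. ?ue x - ?P ?ue x) \<le>
      sqrt B * ?k * (sqrt (K * (c\<^sup>2 + 1)) + M) * d powr (3 / 2) * ?E" unfolding dd .
    have "?N * L2_norm \<Omega> (\<lambda>x. u x - ?P u x) * L2_norm \<Omega> (\<lambda>x. e x - ?P e x) \<le> ?N * (?k * d * U) * (?k * d * ?E)"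
      using d(1) U by (intro mult_mono eu ee mult_nonneg_nonneg) auto
    also have "\<dots> = ?N * ?k\<^sup>2 * U * d\<^sup>2 * ?E" by (simp only: power2_eq_square mult_ac)
    also have "\<dots> \<le> ?N * ?k\<^sup>2 * U * (d powr (3 / 2) * sqrt (diameter \<Omega>)) * ?E"
      using U by (intro mult_right_mono mult_left_mono d2) auto
    finally have 2: "?N * L2_norm \<Omega> (\<lambda>x. u x - ?P u x) * L2_norm \<Omega> (\<lambda>x. e x - ?P e x) \<le>
      ?N * ?k\<^sup>2 * U * (d powr (3 / 2) * sqrt (diameter \<Omega>)) * ?E" .
    have \<alpha>C: "?\<alpha> * C = sqrt B * ?k * (sqrt (K * (c\<^sup>2 + 1)) + M) + ?N * ?k\<^sup>2 * U * sqrt (diameter \<Omega>)"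
      unfolding C_def times_divide_eq_right
      by (rule nonzero_mult_div_cancel_left) (use pos in linarith)
    have "?\<alpha> * ?E\<^sup>2 \<le> sqrt B * ?k * (sqrt (K * (c\<^sup>2 + 1)) + M) * d powr (3 / 2) * ?E
      + ?N * ?k\<^sup>2 * U * (d powr (3 / 2) * sqrt (diameter \<Omega>)) * ?E"
      using energy_error[OF A P c wL w(2) u uh e_def E_def] res 1 2 by linarith
    also have "\<dots> = (sqrt B * ?k * (sqrt (K * (c\<^sup>2 + 1)) + M) + ?N * ?k\<^sup>2 * U * sqrt (diameter \<Omega>)) * d powr (3 / 2) * ?E"
      unfolding distrib_right by (simp only: mult_ac)
    also have "\<dots> = ?\<alpha> * C * d powr (3 / 2) * ?E" by (simp only: \<alpha>C)
    finally have "?\<alpha> * (?E * ?E) \<le> ?\<alpha> * (C * d powr (3 / 2) * ?E)" by (simp only: power2_eq_square mult.assoc)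
    then have le: "?E * ?E \<le> C * d powr (3 / 2) * ?E" using pos by (rule mult_left_le_imp_le)
    have "?E \<le> C * d powr (3 / 2)"
    proof (cases "?E = 0")
      case True
      then show ?thesis using \<open>C \<ge> 0\<close> by simp
    next
      case False
      then have "?E > 0" using L2_norm_nonneg[of \<Omega> E] by linarith
      from mult_right_le_imp_le[OF le this] show ?thesis .
    qed
    then show "L2_norm \<Omega> (\<lambda>x. weak_grad \<Omega> u x - weak_grad \<Omega> uh x) \<le> C * max_diameter \<Q> powr (3 / 2)"
      unfolding E_def d_def .
  qed
qed

end

text \<open>The nondegenerate ball around a cell has positive volume, and the eccentricity condition
  transfers this to the cell.\<close>

lemma mesh_if_bounded_eccentricity:
  fixes \<Omega> :: "(real ^ 'n::finite) set"
  assumes "bounded_open \<Omega>" "mesh_partition \<Omega> (\<Q> h)" "bounded_eccentricity H \<Q>" "h \<in> H"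
  shows "mesh \<Omega> (\<Q> h)"
proof -
  interpret bounded_open \<Omega> by fact
  obtain C where C: "C > 0" "\<And>Q. Q \<in> \<Q> h \<Longrightarrow> \<exists>x r. r > 0 \<and> Q \<subseteq> cball x r \<and>
        measure lebesgue (cball x r) \<le> C * measure lebesgue Q"
    using assms(3,4) unfolding bounded_eccentricity_def by blast
  have "measure lebesgue Q > 0" if Q: "Q \<in> \<Q> h" for Q
  proof -
    obtain x :: "real ^ 'n" and r where r: "r > 0" "measure lebesgue (cball x r) \<le> C * measure lebesgue Q" using C(2)[OF Q] by blast
    have "measure lebesgue (cball x r) > 0" using content_cball_pos[OF r(1), of x] by simp
    then have "C * measure lebesgue Q > 0" using r(2) by linarith
    then show ?thesis using C(1) by (simp add: zero_less_mult_iff)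
  qed
  then show ?thesis using assms(2) by unfold_locales auto
qed

theorem theorem4p4:
  fixes \<Omega> :: "(real ^ 'n::finite) set"
    and A :: "real ^ 'n \<Rightarrow> real ^ 'n ^ 'n"
    and f :: "real ^ 'n \<Rightarrow> real"
    and \<beta> c\<^sub>p w\<^sub>l w\<^sub>u :: real
    and H :: "real set"
    and \<Q> :: "real \<Rightarrow> (real ^ 'n) set set"
  assumes dim: "CARD('n) \<in> {1, 2, 3}"
    and domain: "bounded_polygonal_domain \<Omega>"
    and f: "f \<in> L2 \<Omega>"
    and \<beta>: "\<beta> > 0"
    and A: "elliptic_coefficients \<Omega> A \<beta>"
    and c\<^sub>p: "c\<^sub>p > 0" "poincare_constant \<Omega> c\<^sub>p"
    and bounds: "- (\<beta> / c\<^sub>p\<^sup>2) < w\<^sub>l" "w\<^sub>l < w\<^sub>u" "w\<^sub>u < \<beta> / c\<^sub>p\<^sup>2"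
    and mesh_sizes: "\<And>h. h \<in> H \<Longrightarrow> h > 0"
    and partitions: "\<And>h. h \<in> H \<Longrightarrow> mesh_partition \<Omega> (\<Q> h)"
    and eccentricity: "bounded_eccentricity H \<Q>"
  shows "\<exists>C\<^sub>b>0. \<forall>w \<in> BV \<Omega>.
           (AE x in lebesgue_on \<Omega>. w\<^sub>l \<le> w x \<and> w x \<le> w\<^sub>u) \<longrightarrow>
           (\<exists>C\<^sub>a>0. \<forall>u. solves_pde \<Omega> A f w u \<longrightarrow>
              (\<forall>h\<in>H. \<forall>u\<^sub>h. solves_averaged_pde \<Omega> A f (\<Q> h) w u\<^sub>h \<longrightarrow>
                 L2_norm \<Omega> (\<lambda>x. u x - u\<^sub>h x)
                   \<le> C\<^sub>a * max_diameter (\<Q> h) powr (3 / 2) + C\<^sub>b * (max_diameter (\<Q> h))\<^sup>2 \<and>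
                 (L2_norm \<Omega> (weak_grad \<Omega> (\<lambda>x. u x - u\<^sub>h x)))\<^sup>2
                   \<le> 1 / \<beta> * max (- w\<^sub>l) w\<^sub>u *
                     (c\<^sub>p / (\<beta> + min (c\<^sub>p\<^sup>2 * w\<^sub>l) 0) + c\<^sub>p / (\<beta> - max (- w\<^sub>l) w\<^sub>u * c\<^sub>p\<^sup>2)) *
                     L2_norm \<Omega> f *
                     (C\<^sub>a * max_diameter (\<Q> h) powr (3 / 2) + C\<^sub>b * (max_diameter (\<Q> h))\<^sup>2)))"
proof -
  have ne: "\<Omega> \<noteq> {}" and poly: "polygonal_boundary \<Omega>" and bo: "bounded_open \<Omega>"
    using domain by (auto simp: bounded_polygonal_domain_def intro: bounded_open.intro)
  interpret bounded_open \<Omega> by (rule bo)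
  have n: "CARD('n) \<le> 3" using dim by auto
  let ?\<alpha> = "\<beta> + min (c\<^sub>p\<^sup>2 * w\<^sub>l) 0" and ?m = "max (- w\<^sub>l) w\<^sub>u" and ?D = "diameter \<Omega>"
  let ?s = "c\<^sub>p / ?\<alpha> + c\<^sub>p / (\<beta> - ?m * c\<^sub>p\<^sup>2)"
  \<comment> \<open>The prefactor of the gradient estimate. Its other factors being positive, it
    vanishes exactly when \<open>f\<close> has norm \<open>0\<close>.\<close>
  let ?\<kappa> = "1 / \<beta> * ?m * ?s * L2_norm \<Omega> f"
  have wl: "- w\<^sub>l * c\<^sub>p\<^sup>2 < \<beta>" and wu: "w\<^sub>u * c\<^sub>p\<^sup>2 < \<beta>" using bounds(1,3) c\<^sub>p(1) by (simp_all add: field_simps)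
  then have pos: "?\<alpha> > 0" using \<beta> by (simp add: min_def mult.commute)
  have "?m * c\<^sub>p\<^sup>2 < \<beta>" using wl wu by (simp add: max_def)
  then have s: "?s > 0" by (intro add_pos_pos divide_pos_pos c\<^sub>p(1) pos) linarith
  \<comment> \<open>\<open>?m\<close> is an upper bound of \<open>- w\<^sub>l\<close> and of
    \<open>w\<^sub>u\<close>, whose sum is positive.\<close>
  have m: "?m > 0" using bounds(2) by linarith
  have \<kappa>: "?\<kappa> \<ge> 0" using \<beta> m s by (intro mult_nonneg_nonneg) auto
  show ?thesis
    \<comment> \<open>As \<open>d \<le> diameter \<Omega>\<close>, the quadratic term is absorbed into \<open>d powr (3 / 2)\<close>, so any \<open>C\<^sub>b\<close> will do.\<close>
  proof (rule exI[of _ 1], intro conjI ballI impI)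
    fix w assume w: "w \<in> BV \<Omega>" "AE x in lebesgue_on \<Omega>. w\<^sub>l \<le> w x \<and> w x \<le> w\<^sub>u"
    obtain C where C: "C \<ge> 0" "L2_norm \<Omega> f = 0 \<Longrightarrow> C = 0"
      "\<And>\<Q> u uh. mesh \<Omega> \<Q> \<Longrightarrow> solves_pde \<Omega> A f w u \<Longrightarrow> solves_averaged_pde \<Omega> A f \<Q> w uh \<Longrightarrow>
      L2_norm \<Omega> (\<lambda>x. weak_grad \<Omega> u x - weak_grad \<Omega> uh x) \<le> C * max_diameter \<Q> powr (3 / 2)"
      by (rule gradient_error[OF n ne poly A \<beta> c\<^sub>p(2,1) f w pos]) blast
    \<comment> \<open>The middle term secures the gradient estimate; it is \<open>0\<close>, by division by zero, when \<open>f\<close> vanishes,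
      but then \<open>C = 0\<close>.\<close>
    define C\<^sub>a where "C\<^sub>a = c\<^sub>p * C + C\<^sup>2 * ?D powr (3 / 2) / ?\<kappa> + 1"
    have t: "C\<^sup>2 * ?D powr (3 / 2) / ?\<kappa> \<ge> 0" using \<kappa> by (intro divide_nonneg_nonneg) auto
    have Ca: "C\<^sub>a > 0" "c\<^sub>p * C \<le> C\<^sub>a" using t C(1) c\<^sub>p(1) by (auto simp: C\<^sub>a_def intro!: add_nonneg_pos add_nonneg_nonneg)
    have C2: "C\<^sup>2 * ?D powr (3 / 2) \<le> ?\<kappa> * C\<^sub>a"
    proof (cases "L2_norm \<Omega> f = 0")
      case True
      then show ?thesis using C(2) by simp
    next
      case False
      then have "L2_norm \<Omega> f > 0" using L2_norm_nonneg[of \<Omega> f] by linarith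
      then have p: "?\<kappa> > 0" using \<beta> m s by (intro mult_pos_pos) auto
      have "C\<^sup>2 * ?D powr (3 / 2) / ?\<kappa> \<le> C\<^sub>a" using C(1) c\<^sub>p(1) by (simp add: C\<^sub>a_def)
      then show ?thesis using p by (simp only: pos_divide_le_eq mult.commute)
    qed
    show "\<exists>C\<^sub>a>0. \<forall>u. solves_pde \<Omega> A f w u \<longrightarrow>
              (\<forall>h\<in>H. \<forall>u\<^sub>h. solves_averaged_pde \<Omega> A f (\<Q> h) w u\<^sub>h \<longrightarrow>
                 L2_norm \<Omega> (\<lambda>x. u x - u\<^sub>h x)
                   \<le> C\<^sub>a * max_diameter (\<Q> h) powr (3 / 2) + 1 * (max_diameter (\<Q> h))\<^sup>2 \<and>
                 (L2_norm \<Omega> (weak_grad \<Omega> (\<lambda>x. u x - u\<^sub>h x)))\<^sup>2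
                   \<le> ?\<kappa> * (C\<^sub>a * max_diameter (\<Q> h) powr (3 / 2) + 1 * (max_diameter (\<Q> h))\<^sup>2))"
    proof (intro exI[of _ "C\<^sub>a"] conjI allI ballI impI)
      show "C\<^sub>a > 0" by (rule Ca)
      fix u h u\<^sub>h
      assume u: "solves_pde \<Omega> A f w u" and h: "h \<in> H" and uh: "solves_averaged_pde \<Omega> A f (\<Q> h) w u\<^sub>h"
      have mesh: "mesh \<Omega> (\<Q> h)" by (rule mesh_if_bounded_eccentricity[OF bo partitions[OF h] eccentricity h])
      interpret mesh \<Omega> "\<Q> h" by (rule mesh)
      let ?d = "max_diameter (\<Q> h)" and ?E = "\<lambda>x. weak_grad \<Omega> u x - weak_grad \<Omega> u\<^sub>h x"
      note d = max_diameter_bounds[OF ne]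
      have uH: "u \<in> H1_0 \<Omega>" and uhH: "u\<^sub>h \<in> H1_0 \<Omega>" using u uh by (auto simp: solves_pde_def solves_averaged_pde_def)
      have eE: "H10_pair \<Omega> (\<lambda>x. u x - u\<^sub>h x) ?E" by (rule H10_pair_diff[OF H1_0_pair[OF uH] H1_0_pair[OF uhH]])
      note E = C(3)[OF mesh u uh]
      have "L2_norm \<Omega> (\<lambda>x. u x - u\<^sub>h x) \<le> c\<^sub>p * L2_norm \<Omega> ?E" by (rule poincare_pair[OF c\<^sub>p(2) eE])
      also have "\<dots> \<le> c\<^sub>p * (C * ?d powr (3 / 2))" using c\<^sub>p(1) by (intro mult_left_mono E) simp
      also have "\<dots> \<le> C\<^sub>a * ?d powr (3 / 2)"
        using mult_right_mono[OF Ca(2), of "?d powr (3 / 2)"] by (simp add: mult.assoc)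
      finally show "L2_norm \<Omega> (\<lambda>x. u x - u\<^sub>h x) \<le> C\<^sub>a * ?d powr (3 / 2) + 1 * ?d\<^sup>2"
        using zero_le_power2[of ?d] by linarith
      have eq: "L2_norm \<Omega> (weak_grad \<Omega> (\<lambda>x. u x - u\<^sub>h x)) = L2_norm \<Omega> ?E"
        using H10_pair_H1_0[OF eE] H10_pairD(2)[OF H1_0_pair[OF H10_pair_H1_0(1)[OF eE]]] H10_pairD(2)[OF eE]
        by (intro L2_norm_cong_AE L2D(1))
      \<comment> \<open>The square is of order \<open>d powr 3\<close>; one of the two factors
        \<open>d powr (3 / 2)\<close> is bounded by the same power of the diameter of
        \<open>\<Omega>\<close> and goes into the constant.\<close>
      have "(L2_norm \<Omega> ?E)\<^sup>2 \<le> (C * ?d powr (3 / 2))\<^sup>2" using E by (intro power_mono) auto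
      also have "\<dots> = C\<^sup>2 * ?d powr (3 / 2) * ?d powr (3 / 2)" by (simp add: power2_eq_square mult_ac)
      also have "\<dots> \<le> C\<^sup>2 * ?D powr (3 / 2) * ?d powr (3 / 2)"
        using d by (intro mult_right_mono mult_left_mono powr_mono2) auto
      also have "\<dots> \<le> ?\<kappa> * C\<^sub>a * ?d powr (3 / 2)" using C2 by (rule mult_right_mono) simp
      also have "\<dots> \<le> ?\<kappa> * (C\<^sub>a * ?d powr (3 / 2) + 1 * ?d\<^sup>2)"
        using \<kappa> by (simp only: mult.assoc[of ?\<kappa>]) (intro mult_left_mono, auto)
      finally show "(L2_norm \<Omega> (weak_grad \<Omega> (\<lambda>x. u x - u\<^sub>h x)))\<^sup>2 \<le> ?\<kappa> * (C\<^sub>a * ?d powr (3 / 2) + 1 * ?d\<^sup>2)"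
        unfolding eq .
    qed
  qed simp
qed

end
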